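(* Let $\Phi:M\rightarrow\mathbb{S}^2\times\mathbb{S}^2$ be a connected orientable hypersurface. If $M$ is locally homogeneous, then $\Phi(M)$ is congruent to either an open subset of $\mathbb{S}^1(r)\times\mathbb{S}^2$ for some $r\in(0,1]$, or an open subset of $M_t$ for some $t\in(-1,1)$.
   Context: $\mathbb{S}^2\subset\mathbb{R}^3$ is the unit sphere and $\mathbb{S}^2\times\mathbb{S}^2$ carries the product metric. A hypersurface $\Phi:M\to\mathbb{S}^2\times\mathbb{S}^2$ is a smooth immersion of a 3-manifold $M$. The hypersurface is (extrinsically) locally homogeneous if for any points $p,q\in M$ there exist neighbourhoods $V$ of $p$ and $W$ of $q$ in $M$ and an isometry $F$ of $\mathbb{S}^2\times\mathbb{S}^2$ such that $F(\Phi(V))=\Phi(W)$ and $F(\Phi(p))=\Phi(q)$. Congruent means related by an isometry of $\mathbb{S}^2\times\mathbb{S}^2$. For $r\in(0,1]$, $\mathbb{S}^1(r)=\{(x,y,z)\in\mathbb{S}^2 : z=\sqrt{1-r^2}\}$. For $t\in(-1,1)$, $M_t=\{(p,q)\in\mathbb{S}^2\times\mathbb{S}^2 : \langle p,q\rangle=t\}$, where $\langle p,q\rangle$ is the inner product of $\mathbb{R}^3$. *)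

theory Defs
  imports "HOL-Analysis.Analysis"
begin

section \<open>Smooth maps between Euclidean spaces\<close>

primrec C_k_on :: "nat \<Rightarrow> 'a::euclidean_space set \<Rightarrow> ('a \<Rightarrow> 'b::euclidean_space) \<Rightarrow> bool" where
  "C_k_on 0 S f \<longleftrightarrow> continuous_on S f"
| "C_k_on (Suc k) S f \<longleftrightarrow>
     (\<forall>x\<in>S. f differentiable (at x)) \<and>
     (\<forall>v. C_k_on k S (\<lambda>x. frechet_derivative f (at x) v))"

text \<open>The derivatives in \<^const>\<open>C_k_on\<close> are full derivatives, so
  the following notion is meant for open \<open>S\<close> only; it depends only on the values of \<open>f\<close> on \<open>S\<close>.\<close>

definition smooth_on :: "'a::euclidean_space set \<Rightarrow> ('a \<Rightarrow> 'b::euclidean_space) \<Rightarrow> bool" where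
  "smooth_on S f \<longleftrightarrow> (\<forall>k. C_k_on k S f)"

text \<open>Smoothness on an embedded submanifold: local smooth extendability to the ambient space.\<close>

definition smooth_on_subset :: "'a::euclidean_space set \<Rightarrow> ('a \<Rightarrow> 'b::euclidean_space) \<Rightarrow> bool" where
  "smooth_on_subset S f \<longleftrightarrow>
     (\<forall>x\<in>S. \<exists>U g. open U \<and> x \<in> U \<and> smooth_on U g \<and> (\<forall>y\<in>S \<inter> U. g y = f y))"

section \<open>Abstract smooth manifolds\<close>

text \<open>A chart on \<open>M\<close> is a pair of its domain and its coordinate map; the coordinate map is
  irrelevant outside the domain.\<close>

type_synonym ('m, 'n) chart = "'m set \<times> ('m \<Rightarrow> real ^ 'n)"

definition is_chart :: "'m topology \<Rightarrow> ('m, 'n::finite) chart \<Rightarrow> bool" where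
  "is_chart M = (\<lambda>(U, \<phi>). openin M U \<and> open (\<phi> ` U) \<and>
     homeomorphic_map (subtopology M U) (top_of_set (\<phi> ` U)) \<phi>)"

definition transition :: "('m, 'n) chart \<Rightarrow> ('m, 'n) chart \<Rightarrow> real ^ 'n \<Rightarrow> real ^ 'n" where
  "transition c d = snd d \<circ> inv_into (fst c) (snd c)"

definition transition_domain :: "('m, 'n) chart \<Rightarrow> ('m, 'n) chart \<Rightarrow> (real ^ 'n) set" where
  "transition_domain c d = snd c ` (fst c \<inter> fst d)"

definition smooth_atlas :: "'m topology \<Rightarrow> ('m, 'n::finite) chart set \<Rightarrow> bool" where
  "smooth_atlas M A \<longleftrightarrow>
     (\<forall>c\<in>A. is_chart M c) \<and>
     (\<Union>c\<in>A. fst c) = topspace M \<and>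
     (\<forall>c\<in>A. \<forall>d\<in>A. smooth_on (transition_domain c d) (transition c d))"

text \<open>The dimension of the manifold is \<open>CARD('n)\<close>. The atlas need not be maximal.\<close>

definition smooth_manifold :: "'m topology \<Rightarrow> ('m, 'n::finite) chart set \<Rightarrow> bool" where
  "smooth_manifold M A \<longleftrightarrow> Hausdorff_space M \<and> second_countable M \<and> smooth_atlas M A"

definition orientable :: "'m topology \<Rightarrow> ('m, 'n::finite) chart set \<Rightarrow> bool" where
  "orientable M A \<longleftrightarrow>
     (\<exists>B. smooth_atlas M B \<and> smooth_atlas M (A \<union> B) \<and>
        (\<forall>c\<in>B. \<forall>d\<in>B. \<forall>x\<in>transition_domain c d. det (jacobian (transition c d) (at x)) > 0))"

definition smooth_immersion ::
  "('m, 'n::finite) chart set \<Rightarrow> ('m \<Rightarrow> 'e::euclidean_space) \<Rightarrow> bool" where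
  "smooth_immersion A \<Phi> \<longleftrightarrow>
     (\<forall>(U, \<phi>)\<in>A.
        smooth_on (\<phi> ` U) (\<Phi> \<circ> inv_into U \<phi>) \<and>
        (\<forall>x\<in>\<phi> ` U. inj (frechet_derivative (\<Phi> \<circ> inv_into U \<phi>) (at x))))"

section \<open>The product of two spheres\<close>

type_synonym R3xR3 = "(real ^ 3) \<times> (real ^ 3)"

definition S2 :: "(real ^ 3) set" where
  "S2 = sphere 0 1"

definition S2xS2 :: "R3xR3 set" where
  "S2xS2 = S2 \<times> S2"

definition tangent_space :: "R3xR3 \<Rightarrow> R3xR3 set" where
  "tangent_space = (\<lambda>(p, q). {(u, v). p \<bullet> u = 0 \<and> q \<bullet> v = 0})"

text \<open>Riemannian isometries. The product metric is the restriction to tangent spaces of the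
  inner product of \<^typ>\<open>R3xR3\<close>, which is the sum of those of the factors. The derivative within
  \<^const>\<open>S2xS2\<close> is uniquely determined on tangent vectors only.\<close>

definition isometry_S2xS2 :: "(R3xR3 \<Rightarrow> R3xR3) \<Rightarrow> bool" where
  "isometry_S2xS2 F \<longleftrightarrow>
     bij_betw F S2xS2 S2xS2 \<and>
     smooth_on_subset S2xS2 F \<and>
     smooth_on_subset S2xS2 (inv_into S2xS2 F) \<and>
     (\<forall>x\<in>S2xS2. \<exists>F'. (F has_derivative F') (at x within S2xS2) \<and>
        (\<forall>u\<in>tangent_space x. \<forall>v\<in>tangent_space x. F' u \<bullet> F' v = u \<bullet> v))"

definition congruent_S2xS2 :: "R3xR3 set \<Rightarrow> R3xR3 set \<Rightarrow> bool" where
  "congruent_S2xS2 X Y \<longleftrightarrow> (\<exists>F. isometry_S2xS2 F \<and> F ` X = Y)"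

definition S1 :: "real \<Rightarrow> (real ^ 3) set" where
  "S1 r = {p \<in> S2. p $ 3 = sqrt (1 - r\<^sup>2)}"

definition M_hyp :: "real \<Rightarrow> R3xR3 set" where
  "M_hyp t = {(p, q) \<in> S2xS2. p \<bullet> q = t}"

section \<open>Hypersurfaces\<close>

definition hypersurface ::
  "'m topology \<Rightarrow> ('m, 3) chart set \<Rightarrow> ('m \<Rightarrow> R3xR3) \<Rightarrow> bool" where
  "hypersurface M A \<Phi> \<longleftrightarrow>
     smooth_manifold M A \<and> \<Phi> ` topspace M \<subseteq> S2xS2 \<and> smooth_immersion A \<Phi>"

definition locally_homogeneous :: "'m topology \<Rightarrow> ('m \<Rightarrow> R3xR3) \<Rightarrow> bool" where
  "locally_homogeneous M \<Phi> \<longleftrightarrow>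
     (\<forall>p\<in>topspace M. \<forall>q\<in>topspace M. \<exists>V W F.
        openin M V \<and> p \<in> V \<and> openin M W \<and> q \<in> W \<and>
        isometry_S2xS2 F \<and> F ` \<Phi> ` V = \<Phi> ` W \<and> F (\<Phi> p) = \<Phi> q)"

end

theory Submission
  imports Defs
begin

text \<open>Local homogeneity supplies one isometry for each pair of points, with no group structure
  and no regularity in the points. The proof extracts infinitesimal symmetries by Baire category,
  reads off from them the shape of one small piece, and spreads this shape over M.

  An isometry of S2 x S2 preserves the Riemannian distance, hence the two spherical angles up to
  order, hence the inner product of R^3 x R^3. So it is a pair of orthogonal matrices, possibly
  followed by the exchange of the factors (\<open>isometry_form\<close>). M is covered by countably
  many C2 patches, to which their swapped copies are added. The pairs T that carry a fixed basic
  open piece of a patch into a fixed compact patch, called movers, form a compact set, and only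
  countably many such sets occur. Since the base point of a patch can be moved to every point of it,
  a single one of these sets already moves it over an open piece (\<open>transitive_movers\<close>).

  A limit of rescaled differences of movers is, after translation to the identity, an element of
  so(3) + so(3) = R^3 x R^3 whose Killing field is tangent to the piece
  (\<open>paratangent\<close>). The tangent Killing fields form a Lie algebra
  (\<open>killing_bracket\<close>). If its dimension were at most 2, movers would locally be
  Lipschitz functions of two real parameters, and the base point could not fill an open part of a
  3-manifold (\<open>movers_not_small\<close>).

  Let (n1, n2) be the normal. Where both components are nonzero, tangency confines this algebra to a
  hyperplane whose conormal has two nonzero components. A subalgebra of dimension at least 3 in such
  a hyperplane is the graph of a rotation f (\<open>subalgebra_rotation_graph\<close>); then f
  determines the normal and p . f(q) is constant (\<open>killing_graph_level\<close>), which is a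
  copy of M_t. If the two components are nowhere both nonzero, the case n2 = 0 suffices by symmetry.
  There p has rank one, and the first matrices of the movers are isolated unless some fixed vector a
  is orthogonal to all velocities of p (\<open>movers_first_isolated\<close>). Isolation and
  compactness would leave finitely many first matrices and make p or q constant on a ball, which is
  impossible. So a exists and p . a is constant (\<open>circle_direction\<close>,
  \<open>circle_level\<close>): a circle times a sphere.

  Translates of such a piece meet all points of all patches, and countably many models suffice, so
  models fill a dense union of balls in every patch (\<open>propagate\<close>). The normal
  determines the model up to finitely many choices of sign, and different choices cannot be locally
  constant at the same point (\<open>dense_constancy\<close>). Hence each patch lies in one model
  (\<open>model_rigid\<close>), and by connectedness all of M does (\<open>image_in_model\<close>).
  Invariance of domain makes the image open in the model
  (\<open>image_openin_model\<close>).\<close>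

section \<open>Calculus: C1 maps, symmetry of second derivatives, Baire category\<close>

abbreviation Dv :: "('a::euclidean_space \<Rightarrow> 'b::euclidean_space) \<Rightarrow> 'a \<Rightarrow> 'a \<Rightarrow> 'b" where
  "Dv f x \<equiv> frechet_derivative f (at x)"

text \<open>Continuity of the derivative is asked direction by direction, as in
  \<open>C_k_on\<close>. In finite dimension this is continuity in the operator norm, and
  derivatives stay ordinary functions.\<close>

definition C1_on :: "'a::euclidean_space set \<Rightarrow> ('a \<Rightarrow> 'b::euclidean_space) \<Rightarrow> bool" where
  "C1_on S f \<longleftrightarrow> (\<forall>x\<in>S. (f has_derivative Dv f x) (at x)) \<and>
     (\<forall>v. continuous_on S (\<lambda>x. Dv f x v))"

lemma C1_onI:
  assumes "\<And>x. x \<in> S \<Longrightarrow> (f has_derivative f' x) (at x)" and "\<And>v. continuous_on S (\<lambda>x. f' x v)"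
  shows "C1_on S f"
  unfolding C1_on_def
proof (intro conjI ballI allI)
  show "(f has_derivative Dv f x) (at x)" if "x \<in> S" for x
    using assms(1)[OF that] frechet_derivative_at by fastforce
  have "Dv f x = f' x" if "x \<in> S" for x
    using assms(1)[OF that] frechet_derivative_at by fastforce
  then show "continuous_on S (\<lambda>x. Dv f x v)" for v
    using assms(2)[of v] continuous_on_cong by fastforce
qed

lemma C1_onD: "C1_on S f \<Longrightarrow> x \<in> S \<Longrightarrow> (f has_derivative Dv f x) (at x)"
  and C1_on_cont_deriv: "C1_on S f \<Longrightarrow> continuous_on S (\<lambda>x. Dv f x v)"
  by (auto simp: C1_on_def)

lemma C1_on_linear: "C1_on S f \<Longrightarrow> x \<in> S \<Longrightarrow> linear (Dv f x)"
  using C1_onD has_derivative_linear by blast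

lemma C1_on_imp_continuous: "C1_on S f \<Longrightarrow> continuous_on S f"
  by (meson C1_onD continuous_at_imp_continuous_on has_derivative_continuous)

lemma C1_on_subset: "C1_on S f \<Longrightarrow> T \<subseteq> S \<Longrightarrow> C1_on T f"
  unfolding C1_on_def using continuous_on_subset by blast

lemma Dv_eqI: "(f has_derivative f') (at x) \<Longrightarrow> Dv f x = f'"
  using frechet_derivative_at by fastforce

lemma C1_on_blinear:
  assumes h: "bounded_linear h" and f: "C1_on S f"
  shows "C1_on S (\<lambda>x. h (f x))"
proof (rule C1_onI)
  show "((\<lambda>x. h (f x)) has_derivative (\<lambda>v. h (Dv f x v))) (at x)" if "x \<in> S" for x
    using bounded_linear.has_derivative[OF h C1_onD[OF f that]] .
  show "continuous_on S (\<lambda>x. h (Dv f x v))" for v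
    using bounded_linear.continuous_on[OF h C1_on_cont_deriv[OF f]] .
qed

lemma C1_on_const: "C1_on S (\<lambda>x. c)"
  by (rule C1_onI[where f'="\<lambda>_ _. 0"]) auto

lemma C1_on_add:
  assumes "C1_on S f" "C1_on S g"
  shows "C1_on S (\<lambda>x. f x + g x)"
  by (rule C1_onI[where f'="\<lambda>x v. Dv f x v + Dv g x v"])
     (auto intro!: has_derivative_add continuous_intros assms C1_onD C1_on_cont_deriv)

lemma C1_on_minus: "C1_on S f \<Longrightarrow> C1_on S (\<lambda>x. - f x)"
  using C1_on_blinear[of uminus] bounded_linear_minus[OF bounded_linear_ident] by blast

lemma C1_on_diff:
  assumes "C1_on S f" "C1_on S g"
  shows "C1_on S (\<lambda>x. f x - g x)"
  using C1_on_add[OF assms(1) C1_on_minus[OF assms(2)]] by simp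

lemma C1_on_bilinear:
  assumes h: "bounded_bilinear h" and f: "C1_on S f" and g: "C1_on S g"
  shows "C1_on S (\<lambda>x. h (f x) (g x))"
proof (rule C1_onI)
  show "((\<lambda>x. h (f x) (g x)) has_derivative (\<lambda>v. h (f x) (Dv g x v) + h (Dv f x v) (g x))) (at x)"
    if "x \<in> S" for x
    using bounded_bilinear.FDERIV[OF h C1_onD[OF f that] C1_onD[OF g that]] .
  show "continuous_on S (\<lambda>x. h (f x) (Dv g x v) + h (Dv f x v) (g x))" for v
    by (intro continuous_on_add bounded_bilinear.continuous_on[OF h]
        C1_on_cont_deriv f g C1_on_imp_continuous)
qed

lemma C1_on_real_comp:
  fixes f :: "'a::euclidean_space \<Rightarrow> real"
  assumes f: "C1_on S f" and g: "\<And>x. x \<in> S \<Longrightarrow> (g has_real_derivative g' (f x)) (at (f x))"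
    and g': "continuous_on (f ` S) g'"
  shows "C1_on S (\<lambda>x. g (f x))"
proof (rule C1_onI)
  show "((\<lambda>x. g (f x)) has_derivative (\<lambda>v. Dv f x v * g' (f x))) (at x)" if "x \<in> S" for x
    using has_derivative_compose[OF C1_onD[OF f that] g[OF that, unfolded has_field_derivative_def]]
    by (simp add: mult.commute)
  show "continuous_on S (\<lambda>x. Dv f x v * g' (f x))" for v
    by (intro continuous_on_mult C1_on_cont_deriv f continuous_on_compose2[OF g'] C1_on_imp_continuous) auto
qed

lemma C1_on_normalize:
  fixes f :: "'a::euclidean_space \<Rightarrow> 'b::euclidean_space"
  assumes f: "C1_on S f" and nz: "\<And>x. x \<in> S \<Longrightarrow> f x \<noteq> 0"
  shows "C1_on S (\<lambda>x. f x /\<^sub>R norm (f x))"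
proof -
  have "C1_on S (\<lambda>x. f x \<bullet> f x)"
    by (rule C1_on_bilinear[OF bounded_bilinear_inner f f])
  then have "C1_on S (\<lambda>x. inverse (sqrt (f x \<bullet> f x)))"
  proof (rule C1_on_real_comp[where g="\<lambda>y. inverse (sqrt y)" and g'="\<lambda>y. - (inverse (sqrt y) * (inverse (sqrt y) / 2) * inverse (sqrt y))"])
    fix x assume "x \<in> S"
    then have "f x \<bullet> f x > 0" using nz by (metis inner_gt_zero_iff)
    moreover have "((\<lambda>y. inverse (sqrt y)) has_real_derivative - (inverse (sqrt y) * (inverse (sqrt y) / 2) * inverse (sqrt y))) (at y)"
      if "y > 0" for y using that by (auto intro!: derivative_eq_intros)
    ultimately show "((\<lambda>y. inverse (sqrt y)) has_real_derivative - (inverse (sqrt (f x \<bullet> f x)) * (inverse (sqrt (f x \<bullet> f x)) / 2) * inverse (sqrt (f x \<bullet> f x)))) (at (f x \<bullet> f x))"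
      by blast
  next
    show "continuous_on ((\<lambda>x. f x \<bullet> f x) ` S) (\<lambda>y. - (inverse (sqrt y) * (inverse (sqrt y) / 2) * inverse (sqrt y)))"
      using nz by (intro continuous_intros) auto
  qed
  then have "C1_on S (\<lambda>x. inverse (norm (f x)))" by (simp add: norm_eq_sqrt_inner)
  from C1_on_bilinear[OF bounded_bilinear_scaleR this f] show ?thesis .
qed

text \<open>The operator norm of \<open>Dv f x - Dv f x0\<close> is at most the sum of the norms of
  its values on \<open>Basis\<close>, which is continuous in x and vanishes at x0. The mean value
  inequality for f minus its linear part then gives the bound. Both u and v may vary, as limits of
  secants with two moving end points require.\<close>

lemma C1_on_strict:
  assumes f: "C1_on S f" and S: "open S" and x0: "x0 \<in> S" and e: "e > 0"
  obtains d where "d > 0" "ball x0 d \<subseteq> S"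
    "\<And>u v. u \<in> ball x0 d \<Longrightarrow> v \<in> ball x0 d \<Longrightarrow>
      norm (f u - f v - Dv f x0 (u - v)) \<le> e * norm (u - v)"
proof -
  let ?K = "\<lambda>x. \<Sum>b\<in>Basis. norm (Dv f x b - Dv f x0 b)"
  have "continuous_on S ?K"
    by (intro continuous_intros C1_on_cont_deriv[OF f])
  then have "isCont ?K x0" using S x0 continuous_on_eq_continuous_at by blast
  then obtain d1 where d1: "d1 > 0" "\<And>x. dist x x0 < d1 \<Longrightarrow> dist (?K x) (?K x0) < e"
    using e unfolding continuous_at_eps_delta by blast
  obtain d2 where d2: "d2 > 0" "ball x0 d2 \<subseteq> S" using S x0 openE by blast
  define d where "d = min d1 d2"
  have d: "d > 0" "\<And>x. dist x x0 < d \<Longrightarrow> ?K x < e \<and> x \<in> S"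
    using d1(1) d2 d1(2) by (auto simp: d_def dist_real_def dist_commute subset_iff abs_less_iff)
  then have sub: "ball x0 d \<subseteq> S" by (auto simp: dist_commute)
  have lin: "linear (Dv f x)" if "x \<in> S" for x using C1_on_linear[OF f that] .
  show ?thesis
  proof (rule that[OF d(1) sub])
    fix u v assume uv: "u \<in> ball x0 d" "v \<in> ball x0 d"
    let ?g = "\<lambda>x. f x - Dv f x0 x"
    have "norm (?g u - ?g v) \<le> e * norm (u - v)"
    proof (rule differentiable_bound[OF convex_ball _ _ uv])
      fix x assume x: "x \<in> ball x0 d"
      then have xS: "x \<in> S" using sub by blast
      have bl: "bounded_linear (Dv f x0)" using C1_onD[OF f x0] has_derivative_bounded_linear by blast
      have "(?g has_derivative (\<lambda>v. Dv f x v - Dv f x0 v)) (at x)"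
        by (intro has_derivative_diff C1_onD[OF f xS] bounded_linear.has_derivative[OF bl has_derivative_ident])
      then show "(?g has_derivative (\<lambda>v. Dv f x v - Dv f x0 v)) (at x within ball x0 d)"
        by (rule has_derivative_at_withinI)
      show "onorm (\<lambda>v. Dv f x v - Dv f x0 v) \<le> e"
      proof (rule onorm_le)
        fix w :: 'a
        have L: "linear (\<lambda>v. Dv f x v - Dv f x0 v)"
          by (intro linear_compose_sub lin xS x0)
        have "(\<lambda>v. Dv f x v - Dv f x0 v) w = (\<lambda>v. Dv f x v - Dv f x0 v) (\<Sum>b\<in>Basis. (w \<bullet> b) *\<^sub>R b)"
          by (simp only: euclidean_representation)
        also have "\<dots> = (\<Sum>b\<in>Basis. (w \<bullet> b) *\<^sub>R (Dv f x b - Dv f x0 b))"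
          by (simp only: linear_sum[OF L] linear_scale[OF L])
        finally have "Dv f x w - Dv f x0 w = (\<Sum>b\<in>Basis. (w \<bullet> b) *\<^sub>R (Dv f x b - Dv f x0 b))" .
        then have "norm (Dv f x w - Dv f x0 w) \<le> (\<Sum>b\<in>Basis. norm ((w \<bullet> b) *\<^sub>R (Dv f x b - Dv f x0 b)))"
          by (metis norm_sum)
        also have "\<dots> \<le> (\<Sum>b\<in>Basis. norm w * norm (Dv f x b - Dv f x0 b))"
          by (intro sum_mono) (simp add: Basis_le_norm mult_right_mono)
        also have "\<dots> = norm w * ?K x" by (simp add: sum_distrib_left)
        also have "\<dots> \<le> norm w * e" using d(2)[of x] x by (intro mult_left_mono) (auto simp: dist_commute)
        finally show "norm (Dv f x w - Dv f x0 w) \<le> e * norm w" by (simp add: mult.commute)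
      qed
    qed
    moreover have "?g u - ?g v = f u - f v - Dv f x0 (u - v)"
      using lin[OF x0] by (simp add: linear_diff)
    ultimately show "norm (f u - f v - Dv f x0 (u - v)) \<le> e * norm (u - v)" by simp
  qed
qed

text \<open>The second difference is the increment over [0, t] of the function f(x + s v + t w) -
  f(x + s v) of s. Its s-derivative is a difference of two values of the partial derivative along v,
  which differentiability at x identifies with t H w up to o(t).\<close>

lemma second_difference_limit:
  fixes f :: "'a::euclidean_space \<Rightarrow> 'b::euclidean_space"
  assumes S: "open S" "x \<in> S" and f: "\<And>y. y \<in> S \<Longrightarrow> (f has_derivative Dv f y) (at y)"
    and H: "((\<lambda>y. Dv f y v) has_derivative H) (at x)" and e: "e > 0"
  obtains d where "d > 0" "\<And>t. 0 < t \<Longrightarrow> t < d \<Longrightarrow>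
     norm (f (x + t *\<^sub>R v + t *\<^sub>R w) - f (x + t *\<^sub>R v) - f (x + t *\<^sub>R w) + f x - (t * t) *\<^sub>R H w) \<le> e * (t * t)"
proof -
  let ?h = "\<lambda>y. Dv f y v"
  have linH: "linear H" using H has_derivative_linear by blast
  \<comment> \<open>The two points at which the partial derivative is evaluated have distances from
    x adding up to at most t (2 |v| + |w|). The added 1 keeps M positive if v and w vanish.\<close>
  define M where "M = 2 * norm v + norm w + 1"
  have M: "M > 0" by (simp add: M_def add_nonneg_pos)
  have "\<exists>d>0. \<forall>y. norm (y - x) < d \<longrightarrow> norm (?h y - ?h x - H (y - x)) \<le> e / M * norm (y - x)"
    using H e M unfolding has_derivative_at_alt by (meson divide_pos_pos)
  then obtain d1 where d1: "d1 > 0" "\<And>y. norm (y - x) < d1 \<Longrightarrow> norm (?h y - ?h x - H (y - x)) \<le> e / M * norm (y - x)"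
    by auto
  obtain d2 where d2: "d2 > 0" "ball x d2 \<subseteq> S" using S openE by blast
  define d where "d = min d1 d2 / M"
  have "d > 0" using d1 d2 M by (simp add: d_def)
  moreover have "norm (f (x + t *\<^sub>R v + t *\<^sub>R w) - f (x + t *\<^sub>R v) - f (x + t *\<^sub>R w) + f x - (t * t) *\<^sub>R H w) \<le> e * (t * t)"
    if t: "0 < t" "t < d" for t
  proof -
    define g where "g s = f (x + s *\<^sub>R v + t *\<^sub>R w) - f (x + s *\<^sub>R v) - s *\<^sub>R t *\<^sub>R H w" for s
    have tM: "t * M < min d1 d2" using t M by (simp add: d_def pos_less_divide_eq)
    have "norm (g t - g 0) \<le> e * t * norm (t - 0)"
    proof (rule differentiable_bound[of "{0..t}" g "\<lambda>s r. r *\<^sub>R (?h (x + s *\<^sub>R v + t *\<^sub>R w) - ?h (x + s *\<^sub>R v) - t *\<^sub>R H w)"])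
      fix s assume s: "s \<in> {0..t}"
      let ?a = "x + s *\<^sub>R v + t *\<^sub>R w" and ?b = "x + s *\<^sub>R v"
      have a1: "norm (?a - x) \<le> t * (norm v + norm w)"
      proof -
        have "norm (?a - x) \<le> norm (s *\<^sub>R v) + norm (t *\<^sub>R w)"
          by (metis (no_types, opaque_lifting) add.assoc add_diff_cancel_left' norm_triangle_ineq)
        also have "\<dots> \<le> t * norm v + t * norm w" using s t by (simp add: mult_right_mono)
        finally show ?thesis by (simp add: algebra_simps)
      qed
      have b1: "norm (?b - x) \<le> t * norm v" using s by (simp add: mult_right_mono)
      have "t * (norm v + norm w) + t * norm v \<le> t * M" using t by (simp add: M_def algebra_simps)
      then have ab: "norm (?a - x) + norm (?b - x) \<le> t * M" using a1 b1 by linarith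
      then have na: "norm (?a - x) < min d1 d2" and nb: "norm (?b - x) < min d1 d2"
        using tM norm_ge_zero[of "?a - x"] norm_ge_zero[of "?b - x"] by linarith+
      then have "?a \<in> ball x d2" "?b \<in> ball x d2"
        by (simp_all only: mem_ball dist_norm norm_minus_commute[of x] min_less_iff_conj)
      then have aS: "?a \<in> S" "?b \<in> S" using d2 by blast+
      have da: "((\<lambda>s. x + s *\<^sub>R v + t *\<^sub>R w) has_derivative (\<lambda>r. r *\<^sub>R v)) (at s)"
        by (auto intro!: derivative_eq_intros)
      have db: "((\<lambda>s. x + s *\<^sub>R v) has_derivative (\<lambda>r. r *\<^sub>R v)) (at s)"
        by (auto intro!: derivative_eq_intros)
      have la: "linear (Dv f ?a)" "linear (Dv f ?b)" using f aS has_derivative_linear by blast+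
      have "(g has_derivative (\<lambda>r. Dv f ?a (r *\<^sub>R v) - Dv f ?b (r *\<^sub>R v) - r *\<^sub>R t *\<^sub>R H w)) (at s)"
        unfolding g_def
        by (intro has_derivative_diff has_derivative_compose[OF da f[OF aS(1)]] has_derivative_compose[OF db f[OF aS(2)]])
           (auto intro!: derivative_eq_intros)
      then have "(g has_derivative (\<lambda>r. r *\<^sub>R (?h ?a - ?h ?b - t *\<^sub>R H w))) (at s)"
        by (simp add: linear_scale[OF la(1)] linear_scale[OF la(2)] scaleR_diff_right)
      then show "(g has_derivative (\<lambda>r. r *\<^sub>R (?h ?a - ?h ?b - t *\<^sub>R H w))) (at s within {0..t})"
        by (rule has_derivative_at_withinI)
      have "?h ?a - ?h ?b - t *\<^sub>R H w = (?h ?a - ?h x - H (?a - x)) - (?h ?b - ?h x - H (?b - x))"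
        by (simp add: linear_add[OF linH] linear_diff[OF linH] linear_scale[OF linH])
      then have "norm (?h ?a - ?h ?b - t *\<^sub>R H w) \<le> norm (?h ?a - ?h x - H (?a - x)) + norm (?h ?b - ?h x - H (?b - x))"
        by (metis norm_triangle_ineq4)
      also have "\<dots> \<le> e / M * norm (?a - x) + e / M * norm (?b - x)"
        using na nb by (intro add_mono d1(2)) (simp_all only: min_less_iff_conj)
      also have "\<dots> = e / M * (norm (?a - x) + norm (?b - x))" by (simp add: algebra_simps)
      also have "\<dots> \<le> e / M * (t * M)" using ab e M by (intro mult_left_mono) auto
      also have "\<dots> = e * t" using M by simp
      finally have *: "norm (?h ?a - ?h ?b - t *\<^sub>R H w) \<le> e * t" .
      show "onorm (\<lambda>r. r *\<^sub>R (?h ?a - ?h ?b - t *\<^sub>R H w)) \<le> e * t"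
        by (rule onorm_le) (use * in \<open>auto simp: mult.commute mult_left_mono\<close>)
    qed (use t in auto)
    then show ?thesis using t by (simp add: g_def algebra_simps)
  qed
  ultimately show ?thesis using that by blast
qed

text \<open>The second difference is symmetric in v and w, and divided by the square of t it tends
  to both sides.\<close>

lemma second_derivative_symmetric:
  fixes f :: "'a::euclidean_space \<Rightarrow> 'b::euclidean_space"
  assumes S: "open S" "x \<in> S" and f: "\<And>y. y \<in> S \<Longrightarrow> (f has_derivative Dv f y) (at y)"
    and H: "((\<lambda>y. Dv f y v) has_derivative H) (at x)"
    and H': "((\<lambda>y. Dv f y w) has_derivative H') (at x)"
  shows "H w = H' v"
proof (rule ccontr)
  assume "H w \<noteq> H' v"
  then have e: "norm (H w - H' v) / 4 > 0" (is "?e > 0") by simp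
  let ?P = "\<lambda>t. f (x + t *\<^sub>R v + t *\<^sub>R w) - f (x + t *\<^sub>R v) - f (x + t *\<^sub>R w) + f x"
  obtain d where d: "d > 0" "\<And>t. 0 < t \<Longrightarrow> t < d \<Longrightarrow> norm (?P t - (t * t) *\<^sub>R H w) \<le> ?e * (t * t)"
    using second_difference_limit[OF S f H e, of w] by blast
  obtain d' where d': "d' > 0" "\<And>t. 0 < t \<Longrightarrow> t < d' \<Longrightarrow>
      norm (f (x + t *\<^sub>R w + t *\<^sub>R v) - f (x + t *\<^sub>R w) - f (x + t *\<^sub>R v) + f x - (t * t) *\<^sub>R H' v) \<le> ?e * (t * t)"
    using second_difference_limit[OF S f H' e, of v] by blast
  define t where "t = min d d' / 2"
  have t: "0 < t" "t < d" "t < d'" using d(1) d'(1) by (auto simp: t_def)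
  have 1: "norm (?P t - (t * t) *\<^sub>R H w) \<le> ?e * (t * t)" using d(2) t by blast
  have 2: "norm (?P t - (t * t) *\<^sub>R H' v) \<le> ?e * (t * t)"
    using d'(2)[OF t(1,3)] by (simp add: algebra_simps)
  have "(t * t) *\<^sub>R (H w - H' v) = (?P t - (t * t) *\<^sub>R H' v) - (?P t - (t * t) *\<^sub>R H w)"
    by (simp add: scaleR_diff_right)
  then have "norm ((t * t) *\<^sub>R (H w - H' v)) \<le> norm (?P t - (t * t) *\<^sub>R H' v) + norm (?P t - (t * t) *\<^sub>R H w)"
    by (simp only: norm_triangle_ineq4)
  moreover have "norm ((t * t) *\<^sub>R (H w - H' v)) = (t * t) * norm (H w - H' v)"
    by simp
  ultimately have "(t * t) * norm (H w - H' v) \<le> 2 * (?e * (t * t))" using 1 2 by linarith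
  moreover have "(t * t) * norm (H w - H' v) > 0" using t e by simp
  moreover have "2 * (?e * (t * t)) = (t * t) * norm (H w - H' v) / 2" by simp
  ultimately show False by linarith
qed

text \<open>If no \<open>C i\<close> had interior points in U, the complements would be relatively
  open and dense in the closure of U, and some point of U would avoid all \<open>C i\<close>. This
  is how choices made point by point become uniform on a ball.\<close>

lemma Baire_union:
  fixes U :: "'a::euclidean_space set"
  assumes U: "open U" "U \<noteq> {}" and cI: "countable I" and cl: "\<And>i. i \<in> I \<Longrightarrow> closed (C i)"
    and cov: "U \<subseteq> (\<Union>i\<in>I. C i)"
  obtains i c r where "i \<in> I" "r > 0" "ball c r \<subseteq> U" "ball c r \<subseteq> C i"
proof -
  have "\<exists>i\<in>I. interior (C i) \<inter> U \<noteq> {}"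
  proof (rule ccontr)
    assume neg: "\<not> (\<exists>i\<in>I. interior (C i) \<inter> U \<noteq> {})"
    have "closure U \<subseteq> closure (\<Inter>i\<in>I. closure U - C i)"
    proof (rule Baire)
      fix T assume "T \<in> (\<lambda>i. closure U - C i) ` I"
      then obtain i where i: "i \<in> I" "T = closure U - C i" by blast
      have "openin (top_of_set (closure U)) T"
        using i cl by (metis Diff_eq openin_open_Int open_Compl)
      moreover have "U \<subseteq> closure T"
      proof
        fix x assume x: "x \<in> U"
        show "x \<in> closure T"
        proof (rule ccontr)
          assume "x \<notin> closure T"
          then have "open (U - closure T)" "x \<in> U - closure T" using x U by auto
          moreover have "U - closure T \<subseteq> C i"
            using i closure_subset[of U] closure_subset[of T] by auto
          ultimately have "x \<in> interior (C i)" by (meson interior_maximal subsetD)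
          then show False using neg i x by blast
        qed
      qed
      ultimately show "openin (top_of_set (closure U)) T \<and> closure U \<subseteq> closure T"
        by (simp add: closure_minimal)
    qed (use cI in auto)
    then obtain y where y: "y \<in> (\<Inter>i\<in>I. closure U - C i) \<inter> U"
      using U by (metis (no_types, lifting) closure_subset disjoint_iff ex_in_conv inf.orderE inf_commute open_Int_closure_eq_empty subset_iff)
    then obtain i where "i \<in> I" "y \<in> C i" using cov by blast
    then show False using y by blast
  qed
  then obtain i x where i: "i \<in> I" "x \<in> interior (C i) \<inter> U" by blast
  moreover have "open (interior (C i) \<inter> U)" using U by auto
  ultimately obtain r where "r > 0" "ball x r \<subseteq> interior (C i) \<inter> U" using open_contains_ball by metis
  then show ?thesis using that[OF i(1), of r x] interior_subset by blast
qed

section \<open>Cross product identities\<close>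

lemma bounded_bilinear_cross3: "bounded_bilinear cross3"
  using bilinear_cross bilinear_conv_bounded_bilinear by blast

text \<open>Cramer's rule, multiplied by the determinant so that degenerate triples are
  included.\<close>

lemma cross_expand: "(x \<bullet> cross3 y w) *\<^sub>R q = (q \<bullet> cross3 y w) *\<^sub>R x + (q \<bullet> cross3 w x) *\<^sub>R y + (q \<bullet> cross3 x y) *\<^sub>R w"
  by (simp add: cross3_simps forall_3)

lemma cross_dot_swap: "cross3 a b \<bullet> c = a \<bullet> cross3 b c" for a b c :: "real^3"
  by (simp add: cross3_simps)

lemma cross_cross_left: "cross3 a (cross3 b c) = (a \<bullet> c) *\<^sub>R b - (a \<bullet> b) *\<^sub>R c"
  by (simp add: cross3_simps forall_3)

lemma cross_cross_right: "cross3 (cross3 a b) c = (a \<bullet> c) *\<^sub>R b - (b \<bullet> c) *\<^sub>R a"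
  by (simp add: cross3_simps forall_3)

text \<open>Vectors orthogonal to a nonzero q have determinant zero, so Cramer's rule turns into a
  linear relation between them. Its coefficients later serve as the components of a kernel vector of
  the derivative of one factor (\<open>dir1\<close>, \<open>dir2\<close>).\<close>

lemma coplanar_relation:
  fixes q y1 y2 y3 :: "real^3"
  assumes "q \<noteq> 0" "q \<bullet> y1 = 0" "q \<bullet> y2 = 0" "q \<bullet> y3 = 0"
  shows "(q \<bullet> cross3 y2 y3) *\<^sub>R y1 + (q \<bullet> cross3 y3 y1) *\<^sub>R y2 + (q \<bullet> cross3 y1 y2) *\<^sub>R y3 = 0"
proof -
  have e: "(y1 \<bullet> cross3 y2 y3) *\<^sub>R q = (q \<bullet> cross3 y2 y3) *\<^sub>R y1 + (q \<bullet> cross3 y3 y1) *\<^sub>R y2 + (q \<bullet> cross3 y1 y2) *\<^sub>R y3"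
    by (rule cross_expand)
  then have "q \<bullet> ((y1 \<bullet> cross3 y2 y3) *\<^sub>R q) = 0"
    using assms by (simp add: inner_add_right)
  then have "y1 \<bullet> cross3 y2 y3 = 0" using assms(1) by simp
  then show ?thesis using e by simp
qed

lemma linear_axis_expand:
  fixes f :: "real^3 \<Rightarrow> 'b::real_vector"
  assumes "linear f"
  shows "f \<xi> = (\<xi> $ 1) *\<^sub>R f (axis 1 1) + (\<xi> $ 2) *\<^sub>R f (axis 2 1) + (\<xi> $ 3) *\<^sub>R f (axis 3 1)"
proof -
  have "\<xi> = (\<xi> $ 1) *\<^sub>R axis 1 1 + (\<xi> $ 2) *\<^sub>R axis 2 1 + (\<xi> $ 3) *\<^sub>R axis 3 1"
    by (simp add: vec_eq_iff forall_3 axis_def)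
  then have "f \<xi> = f ((\<xi> $ 1) *\<^sub>R axis 1 1 + (\<xi> $ 2) *\<^sub>R axis 2 1 + (\<xi> $ 3) *\<^sub>R axis 3 1)"
    by simp
  then show ?thesis by (simp only: linear_add[OF assms] linear_scale[OF assms])
qed

lemma linear_axis_combine:
  fixes f :: "real^3 \<Rightarrow> 'b::real_vector"
  assumes "linear f"
  shows "f (vector [a, b, c]) = a *\<^sub>R f (axis 1 1) + b *\<^sub>R f (axis 2 1) + c *\<^sub>R f (axis 3 1)"
  using linear_axis_expand[OF assms, of "vector [a, b, c]"] by (simp add: vector_3)

lemma parallel_image_span:
  fixes f :: "'a \<Rightarrow> real^3"
  assumes "\<And>x y. cross3 (f x) (f y) = 0"
  obtains v where "range f \<subseteq> span {v}"
proof (cases "\<forall>x. f x = 0")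
  case True
  then show ?thesis using that[of 0] by auto
next
  case False
  then obtain x where x: "f x \<noteq> 0" by blast
  have "f y \<in> span {f x}" for y
  proof -
    have "collinear {0, f x, f y}" using assms cross_eq_0 by blast
    then obtain c where "f y = c *\<^sub>R f x" using x unfolding collinear_lemma by auto
    then show ?thesis by (simp add: span_base span_mul)
  qed
  then show ?thesis using that by blast
qed

text \<open>The product of two vectors orthogonal to q is a multiple of q; being orthogonal to q as
  well, it vanishes.\<close>

lemma orthogonal_parallel_zero:
  fixes q a b :: "real^3"
  assumes "q \<noteq> 0" "q \<bullet> a = 0" "q \<bullet> b = 0" "q \<bullet> cross3 a b = 0"
  shows "cross3 a b = 0"
proof -
  have "cross3 q (cross3 a b) = 0" using assms by (simp add: cross_cross_left)
  then show ?thesis using norm_and_cross_eq_0 assms(1,4)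
    by (metis (no_types) mult_eq_0_iff norm_cross_dot norm_eq_zero power2_eq_square add.right_neutral)
qed

section \<open>Patches of a hypersurface and their normal\<close>

text \<open>The lower bound c makes \<Psi> injective on the closed ball with Lipschitz inverse, so
  sequences in the image can be pulled back to the parameters. The closed ball has a compact image,
  as the Baire arguments need, and S leaves room for derivatives on its boundary.\<close>

locale patch =
  fixes \<Psi> :: "real^3 \<Rightarrow> R3xR3" and z :: "real^3" and r :: real and S :: "(real^3) set" and c :: real
  assumes r: "r > 0" and c: "c > 0" and S: "open S" "cball z r \<subseteq> S"
    and C1: "C1_on S \<Psi>" and C2: "\<And>v. C1_on S (\<lambda>u. Dv \<Psi> u v)"
    and sph: "\<Psi> ` S \<subseteq> S2xS2" and inj: "\<And>u. u \<in> S \<Longrightarrow> inj (Dv \<Psi> u)"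
    and low: "\<And>u v. u \<in> cball z r \<Longrightarrow> v \<in> cball z r \<Longrightarrow> c * norm (u - v) \<le> norm (\<Psi> u - \<Psi> v)"
begin

definition "p u = fst (\<Psi> u)"
definition "q u = snd (\<Psi> u)"
definition "dp u v = fst (Dv \<Psi> u v)"
definition "dq u v = snd (Dv \<Psi> u v)"

text \<open>The coefficients are the components of a parameter direction \<xi> with
  \<open>dq u \<xi> = 0\<close>, and \<alpha> is \<open>dp u \<xi>\<close>. So (\<alpha>, 0) is a
  tangent vector along the first factor, and symmetrically (0, \<beta>) along the second. Being
  polynomial in first derivatives, both are again C1.\<close>

definition "\<alpha> u = (q u \<bullet> cross3 (dq u (axis 2 1)) (dq u (axis 3 1))) *\<^sub>R dp u (axis 1 1)
  + (q u \<bullet> cross3 (dq u (axis 3 1)) (dq u (axis 1 1))) *\<^sub>R dp u (axis 2 1)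
  + (q u \<bullet> cross3 (dq u (axis 1 1)) (dq u (axis 2 1))) *\<^sub>R dp u (axis 3 1)"
definition "\<beta> u = (p u \<bullet> cross3 (dp u (axis 2 1)) (dp u (axis 3 1))) *\<^sub>R dq u (axis 1 1)
  + (p u \<bullet> cross3 (dp u (axis 3 1)) (dp u (axis 1 1))) *\<^sub>R dq u (axis 2 1)
  + (p u \<bullet> cross3 (dp u (axis 1 1)) (dp u (axis 2 1))) *\<^sub>R dq u (axis 3 1)"
text \<open>Turning \<alpha> and \<beta> by a right angle in the tangent planes of the two spheres
  gives a normal of the patch. It is not normalized, but the pair never vanishes
  (\<open>normal_nz\<close>).\<close>

definition "n1 u = cross3 (p u) (\<alpha> u)"
definition "n2 u = cross3 (q u) (\<beta> u)"

lemma \<Psi>_eq: "\<Psi> u = (p u, q u)" and D_eq: "Dv \<Psi> u v = (dp u v, dq u v)"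
  by (simp_all add: p_def q_def dp_def dq_def)

lemma ball_sub: "ball z r \<subseteq> S" using S(2) ball_subset_cball by blast

lemma C1_p: "C1_on S p" and C1_q: "C1_on S q"
  and C1_dp: "C1_on S (\<lambda>u. dp u v)" and C1_dq: "C1_on S (\<lambda>u. dq u v)"
  using C1_on_blinear[OF bounded_linear_fst C1] C1_on_blinear[OF bounded_linear_snd C1]
    C1_on_blinear[OF bounded_linear_fst C2] C1_on_blinear[OF bounded_linear_snd C2]
  by (auto simp: p_def[abs_def] q_def[abs_def] dp_def dq_def)

lemma Dp: "u \<in> S \<Longrightarrow> (p has_derivative dp u) (at u)" and Dq: "u \<in> S \<Longrightarrow> (q has_derivative dq u) (at u)"
  unfolding p_def q_def dp_def dq_def
  by (auto intro!: derivative_eq_intros C1_onD[OF C1])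

lemma lin_D: "u \<in> S \<Longrightarrow> linear (Dv \<Psi> u)" by (rule C1_on_linear[OF C1])
lemma lin_dp: "u \<in> S \<Longrightarrow> linear (dp u)" using Dp has_derivative_linear by blast
lemma lin_dq: "u \<in> S \<Longrightarrow> linear (dq u)" using Dq has_derivative_linear by blast

lemma unit: "u \<in> S \<Longrightarrow> p u \<bullet> p u = 1" "u \<in> S \<Longrightarrow> q u \<bullet> q u = 1"
  using sph by (force simp: S2xS2_def S2_def p_def q_def norm_eq_1)+

lemma tangent: assumes u: "u \<in> S" shows "p u \<bullet> dp u v = 0" "q u \<bullet> dq u v = 0"
proof -
  have "((\<lambda>u. p u \<bullet> p u) has_derivative (\<lambda>v. p u \<bullet> dp u v + dp u v \<bullet> p u)) (at u)"
    by (intro has_derivative_inner Dp u)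
  moreover have "((\<lambda>u. p u \<bullet> p u) has_derivative (\<lambda>v. 0)) (at u)"
    by (rule has_derivative_transform_within_open[OF has_derivative_const[of 1] S(1) u]) (simp add: unit)
  ultimately have "(\<lambda>v. p u \<bullet> dp u v + dp u v \<bullet> p u) = (\<lambda>v. 0)" by (rule has_derivative_unique)
  from fun_cong[OF this, of v] show "p u \<bullet> dp u v = 0" by (simp add: inner_commute)
  have "((\<lambda>u. q u \<bullet> q u) has_derivative (\<lambda>v. q u \<bullet> dq u v + dq u v \<bullet> q u)) (at u)"
    by (intro has_derivative_inner Dq u)
  moreover have "((\<lambda>u. q u \<bullet> q u) has_derivative (\<lambda>v. 0)) (at u)"
    by (rule has_derivative_transform_within_open[OF has_derivative_const[of 1] S(1) u]) (simp add: unit)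
  ultimately have "(\<lambda>v. q u \<bullet> dq u v + dq u v \<bullet> q u) = (\<lambda>v. 0)" by (rule has_derivative_unique)
  from fun_cong[OF this, of v] show "q u \<bullet> dq u v = 0" by (simp add: inner_commute)
qed

lemma pq_nz: "u \<in> S \<Longrightarrow> p u \<noteq> 0" "u \<in> S \<Longrightarrow> q u \<noteq> 0" using unit by fastforce+

lemma dir1: assumes u: "u \<in> S" obtains \<xi> where "dp u \<xi> = \<alpha> u" "dq u \<xi> = 0"
    "\<xi> = vector [q u \<bullet> cross3 (dq u (axis 2 1)) (dq u (axis 3 1)), q u \<bullet> cross3 (dq u (axis 3 1)) (dq u (axis 1 1)), q u \<bullet> cross3 (dq u (axis 1 1)) (dq u (axis 2 1))]"
proof -
  let ?\<xi> = "vector [q u \<bullet> cross3 (dq u (axis 2 1)) (dq u (axis 3 1)), q u \<bullet> cross3 (dq u (axis 3 1)) (dq u (axis 1 1)), q u \<bullet> cross3 (dq u (axis 1 1)) (dq u (axis 2 1))] :: real^3"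
  have "dp u ?\<xi> = \<alpha> u"
    by (simp add: linear_axis_combine[OF lin_dp[OF u]] \<alpha>_def)
  moreover have "dq u ?\<xi> = 0"
    unfolding linear_axis_combine[OF lin_dq[OF u]]
    by (rule coplanar_relation) (simp_all add: tangent u pq_nz)
  ultimately show ?thesis using that by blast
qed

lemma dir2: assumes u: "u \<in> S" obtains \<xi> where "dp u \<xi> = 0" "dq u \<xi> = \<beta> u"
    "\<xi> = vector [p u \<bullet> cross3 (dp u (axis 2 1)) (dp u (axis 3 1)), p u \<bullet> cross3 (dp u (axis 3 1)) (dp u (axis 1 1)), p u \<bullet> cross3 (dp u (axis 1 1)) (dp u (axis 2 1))]"
proof -
  let ?\<xi> = "vector [p u \<bullet> cross3 (dp u (axis 2 1)) (dp u (axis 3 1)), p u \<bullet> cross3 (dp u (axis 3 1)) (dp u (axis 1 1)), p u \<bullet> cross3 (dp u (axis 1 1)) (dp u (axis 2 1))] :: real^3"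
  have "dq u ?\<xi> = \<beta> u"
    by (simp add: linear_axis_combine[OF lin_dq[OF u]] \<beta>_def)
  moreover have "dp u ?\<xi> = 0"
    unfolding linear_axis_combine[OF lin_dp[OF u]]
    by (rule coplanar_relation) (simp_all add: tangent u pq_nz)
  ultimately show ?thesis using that by blast
qed

lemma \<alpha>_tan: "u \<in> S \<Longrightarrow> p u \<bullet> \<alpha> u = 0" and \<beta>_tan: "u \<in> S \<Longrightarrow> q u \<bullet> \<beta> u = 0"
  by (metis dir1 tangent(1)) (metis dir2 tangent(2))

lemma n_tan: "p u \<bullet> n1 u = 0" "q u \<bullet> n2 u = 0" "n1 u \<bullet> p u = 0" "n2 u \<bullet> q u = 0"
  by (simp_all add: n1_def n2_def dot_cross_self)

lemma cross_n: assumes "u \<in> S" shows "cross3 (p u) (n1 u) = - \<alpha> u" "cross3 (q u) (n2 u) = - \<beta> u"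
  using assms by (simp_all add: n1_def n2_def cross_cross_left \<alpha>_tan \<beta>_tan unit)

text \<open>On basis vectors both summands are sums of products of a minor of dp with a minor of dq,
  and they cancel by antisymmetry of the triple product.\<close>

lemma normal: assumes u: "u \<in> S" shows "n1 u \<bullet> dp u \<xi> + n2 u \<bullet> dq u \<xi> = 0"
proof -
  have key: "n1 u \<bullet> dp u (axis i 1) + n2 u \<bullet> dq u (axis i 1) = 0" for i
  proof -
    define x1 x2 x3 y1 y2 y3 where xy: "x1 = dp u (axis 1 1)" "x2 = dp u (axis 2 1)" "x3 = dp u (axis 3 1)"
      "y1 = dq u (axis 1 1)" "y2 = dq u (axis 2 1)" "y3 = dq u (axis 3 1)"
    have sk: "cross3 a b \<bullet> a = 0" "p u \<bullet> cross3 a a = 0" for a b :: "real^3" by (simp_all add: dot_cross_self)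
    have c: "cross3 x2 x1 = - cross3 x1 x2" "cross3 x3 x2 = - cross3 x2 x3" "cross3 x1 x3 = - cross3 x3 x1"
      "cross3 y2 y1 = - cross3 y1 y2" "cross3 y3 y2 = - cross3 y2 y3" "cross3 y1 y3 = - cross3 y3 y1"
      by (rule cross_skew)+
    have "i = 1 \<or> i = 2 \<or> i = 3" by (rule exhaust_3)
    then show ?thesis
      unfolding n1_def n2_def \<alpha>_def \<beta>_def
      by (auto simp flip: xy simp: cross_add_right cross_mult_right inner_add_left cross_dot_swap c algebra_simps)
  qed
  have "n1 u \<bullet> dp u \<xi> + n2 u \<bullet> dq u \<xi> = (\<xi>$1) * (n1 u \<bullet> dp u (axis 1 1) + n2 u \<bullet> dq u (axis 1 1))
     + (\<xi>$2) * (n1 u \<bullet> dp u (axis 2 1) + n2 u \<bullet> dq u (axis 2 1)) + (\<xi>$3) * (n1 u \<bullet> dp u (axis 3 1) + n2 u \<bullet> dq u (axis 3 1))"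
    by (subst linear_axis_expand[OF lin_dp[OF u]], subst linear_axis_expand[OF lin_dq[OF u]])
       (simp add: inner_add_right algebra_simps)
  then show ?thesis by (simp add: key)
qed

lemma inj_zero: "u \<in> S \<Longrightarrow> dp u \<xi> = 0 \<Longrightarrow> dq u \<xi> = 0 \<Longrightarrow> \<xi> = 0"
  using inj[of u] lin_D[of u] by (metis D_eq injD linear_0 zero_prod_def)

lemma dim_range: assumes u: "u \<in> S" shows "dim (range (Dv \<Psi> u)) = 3"
  using dim_image_eq[OF lin_D[OF u], of UNIV] inj[OF u] by (simp add: dim_UNIV)

text \<open>If \<alpha> and \<beta> vanish, the two kernel directions are killed by the whole
  injective derivative, so they are zero and with them all the minors. Then dp and dq have rank at
  most one, and the tangent space would have dimension at most 2 instead of 3.\<close>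

lemma normal_nz: assumes u: "u \<in> S" shows "n1 u \<noteq> 0 \<or> n2 u \<noteq> 0"
proof (rule ccontr)
  assume "\<not> (n1 u \<noteq> 0 \<or> n2 u \<noteq> 0)"
  then have ab: "\<alpha> u = 0" "\<beta> u = 0" using cross_n[OF u] by auto
  obtain \<xi> where x: "dp u \<xi> = \<alpha> u" "dq u \<xi> = 0" and xe: "\<xi> = vector [q u \<bullet> cross3 (dq u (axis 2 1)) (dq u (axis 3 1)), q u \<bullet> cross3 (dq u (axis 3 1)) (dq u (axis 1 1)), q u \<bullet> cross3 (dq u (axis 1 1)) (dq u (axis 2 1))]"
    using dir1[OF u] by blast
  have "\<xi> = 0" using inj_zero[OF u] x ab by simp
  then have A: "q u \<bullet> cross3 (dq u (axis 2 1)) (dq u (axis 3 1)) = 0" "q u \<bullet> cross3 (dq u (axis 3 1)) (dq u (axis 1 1)) = 0"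
     "q u \<bullet> cross3 (dq u (axis 1 1)) (dq u (axis 2 1)) = 0"
    using xe by (metis vector_3 zero_index)+
  obtain \<eta> where y: "dp u \<eta> = 0" "dq u \<eta> = \<beta> u" and ye: "\<eta> = vector [p u \<bullet> cross3 (dp u (axis 2 1)) (dp u (axis 3 1)), p u \<bullet> cross3 (dp u (axis 3 1)) (dp u (axis 1 1)), p u \<bullet> cross3 (dp u (axis 1 1)) (dp u (axis 2 1))]"
    using dir2[OF u] by blast
  have "\<eta> = 0" using inj_zero[OF u] y ab by simp
  then have B: "p u \<bullet> cross3 (dp u (axis 2 1)) (dp u (axis 3 1)) = 0" "p u \<bullet> cross3 (dp u (axis 3 1)) (dp u (axis 1 1)) = 0"
     "p u \<bullet> cross3 (dp u (axis 1 1)) (dp u (axis 2 1)) = 0"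
    using ye by (metis vector_3 zero_index)+
  have par: "cross3 (f a) (f b) = 0"
    if f: "linear f" and "cross3 (f (axis 2 1)) (f (axis 3 1)) = 0" "cross3 (f (axis 3 1)) (f (axis 1 1)) = 0" "cross3 (f (axis 1 1)) (f (axis 2 1)) = 0"
    for f :: "real^3 \<Rightarrow> real^3" and a b
  proof -
    have s: "cross3 (f (axis 3 1)) (f (axis 2 1)) = 0" "cross3 (f (axis 1 1)) (f (axis 3 1)) = 0" "cross3 (f (axis 2 1)) (f (axis 1 1)) = 0"
      using that cross_skew by (metis neg_equal_0_iff_equal)+
    show ?thesis
      by (subst linear_axis_expand[OF f, of a], subst linear_axis_expand[OF f, of b])
         (simp add: cross_add_left cross_add_right cross_mult_left cross_mult_right that s)
  qed
  have "cross3 (dq u a) (dq u b) = 0" for a b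
    by (rule par[OF lin_dq[OF u]]; rule orthogonal_parallel_zero[OF pq_nz(2)[OF u] tangent(2)[OF u] tangent(2)[OF u]]; fact A)
  then obtain w where w: "range (dq u) \<subseteq> span {w}" using parallel_image_span by metis
  have "cross3 (dp u a) (dp u b) = 0" for a b
    by (rule par[OF lin_dp[OF u]]; rule orthogonal_parallel_zero[OF pq_nz(1)[OF u] tangent(1)[OF u] tangent(1)[OF u]]; fact B)
  then obtain v where v: "range (dp u) \<subseteq> span {v}" using parallel_image_span by metis
  have "Dv \<Psi> u \<xi> \<in> span {(v, 0), (0, w)}" for \<xi>
  proof -
    obtain k l where "dp u \<xi> = k *\<^sub>R v" "dq u \<xi> = l *\<^sub>R w" using v w unfolding span_singleton by blast
    then have "Dv \<Psi> u \<xi> = k *\<^sub>R (v, 0) + l *\<^sub>R (0, w)" by (simp add: D_eq)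
    then show ?thesis by (simp only:) (intro span_add span_mul span_base; simp)
  qed
  then have "range (Dv \<Psi> u) \<subseteq> span {(v, 0), (0, w)}" by blast
  then have "dim (range (Dv \<Psi> u)) \<le> card {(v, 0), (0, w)}" by (rule dim_le_card) simp
  also have "\<dots> \<le> 2" by (simp add: card_insert_if)
  finally show False using dim_range[OF u] by simp
qed

text \<open>The vectors (p, 0), (0, q), (n1, n2) are orthogonal and nonzero in a space of dimension
  6. Their orthogonal complement has dimension 3 and contains the tangent space, hence equals
  it.\<close>

lemma in_rangeI:
  assumes u: "u \<in> S" and w: "p u \<bullet> w1 = 0" "q u \<bullet> w2 = 0" "n1 u \<bullet> w1 + n2 u \<bullet> w2 = 0"
  obtains \<xi> where "dp u \<xi> = w1" "dq u \<xi> = w2"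
proof -
  let ?B = "{(p u, 0), (0, q u), (n1 u, n2 u)}"
  let ?V = "{y. \<forall>x\<in>span ?B. orthogonal x y}"
  have "pairwise orthogonal ?B" by (auto simp: pairwise_def orthogonal_def n_tan)
  then have ind: "independent ?B"
    using pq_nz[OF u] normal_nz[OF u] by (intro pairwise_orthogonal_independent) (auto simp: zero_prod_def)
  have "card ?B = 3" using pq_nz[OF u] n_tan[of u] unit[OF u]
    by (auto simp: card_insert_if)
  then have dB: "dim (span ?B) = 3" using ind by (simp add: dim_eq_card_independent)
  have "dim {y\<in>UNIV. \<forall>x\<in>span ?B. orthogonal x y} + dim (span ?B) = dim (UNIV::R3xR3 set)"
    by (rule dim_subspace_orthogonal_to_vectors) auto
  then have dV: "dim ?V = 3" using dB by (simp add: dim_UNIV)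
  have sV: "subspace ?V" by (auto simp: subspace_def orthogonal_def inner_add_right)
  have mem: "y \<in> ?V \<longleftrightarrow> p u \<bullet> fst y = 0 \<and> q u \<bullet> snd y = 0 \<and> n1 u \<bullet> fst y + n2 u \<bullet> snd y = 0" (is "_ = ?R y") for y
  proof
    show "?R y" if "y \<in> ?V"
      using that span_base[of _ ?B] by (cases y) (force simp: orthogonal_def)
    assume R: "?R y"
    have "orthogonal x y" if "x \<in> span ?B" for x
    proof -
      have "orthogonal y x" by (rule orthogonal_to_span[OF that]) (use R in \<open>cases y; auto simp: orthogonal_def inner_commute\<close>)
      then show ?thesis by (simp add: orthogonal_commute)
    qed
    then show "y \<in> ?V" by blast
  qed
  have "range (Dv \<Psi> u) \<subseteq> ?V"
    using mem tangent[OF u] normal[OF u] by (auto simp: D_eq)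
  then have "range (Dv \<Psi> u) = ?V"
    using subspace_dim_equal[of "range (Dv \<Psi> u)" ?V] sV dV dim_range[OF u]
      linear_subspace_image[OF lin_D[OF u] subspace_UNIV] by simp
  moreover have "(w1, w2) \<in> ?V" unfolding mem using w by simp
  ultimately obtain \<xi> where "(w1, w2) = Dv \<Psi> u \<xi>" by blast
  then show ?thesis using that[of \<xi>] by (simp add: D_eq)
qed

text \<open>After subtraction of the component along (n1, n2) the remainder is tangent by
  \<open>in_rangeI\<close> and orthogonal to all tangent vectors, hence zero.\<close>

lemma normal_unique:
  assumes u: "u \<in> S" and w: "p u \<bullet> w1 = 0" "q u \<bullet> w2 = 0" "\<And>\<xi>. w1 \<bullet> dp u \<xi> + w2 \<bullet> dq u \<xi> = 0"
  obtains l where "w1 = l *\<^sub>R n1 u" "w2 = l *\<^sub>R n2 u"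
proof -
  define l where "l = (n1 u \<bullet> w1 + n2 u \<bullet> w2) / (n1 u \<bullet> n1 u + n2 u \<bullet> n2 u)"
  have nn: "n1 u \<bullet> n1 u + n2 u \<bullet> n2 u \<noteq> 0"
    using normal_nz[OF u] by (metis add_nonneg_eq_0_iff inner_eq_zero_iff inner_ge_zero)
  have "n1 u \<bullet> (w1 - l *\<^sub>R n1 u) + n2 u \<bullet> (w2 - l *\<^sub>R n2 u) = (n1 u \<bullet> w1 + n2 u \<bullet> w2) - l * (n1 u \<bullet> n1 u + n2 u \<bullet> n2 u)"
    by (simp add: inner_diff_right algebra_simps)
  also have "\<dots> = 0" using nn by (simp add: l_def)
  finally have z: "n1 u \<bullet> (w1 - l *\<^sub>R n1 u) + n2 u \<bullet> (w2 - l *\<^sub>R n2 u) = 0" .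
  obtain \<xi> where x: "dp u \<xi> = w1 - l *\<^sub>R n1 u" "dq u \<xi> = w2 - l *\<^sub>R n2 u"
    using in_rangeI[OF u _ _ z] w n_tan by (auto simp: inner_diff_right)
  have "(w1 - l *\<^sub>R n1 u) \<bullet> (w1 - l *\<^sub>R n1 u) + (w2 - l *\<^sub>R n2 u) \<bullet> (w2 - l *\<^sub>R n2 u)
     = (w1 \<bullet> dp u \<xi> + w2 \<bullet> dq u \<xi>) - l * (n1 u \<bullet> dp u \<xi> + n2 u \<bullet> dq u \<xi>)"
    by (simp only: x) (simp add: inner_diff_left algebra_simps)
  also have "\<dots> = 0" by (simp only: w(3) normal[OF u])
  finally have "w1 - l *\<^sub>R n1 u = 0 \<and> w2 - l *\<^sub>R n2 u = 0"
    by (metis add_nonneg_eq_0_iff inner_eq_zero_iff inner_ge_zero)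
  then show ?thesis using that[of l] by simp
qed

lemma C1_n1: "C1_on S n1" and C1_n2: "C1_on S n2" and C1_\<alpha>: "C1_on S \<alpha>" and C1_\<beta>: "C1_on S \<beta>"
proof -
  show a: "C1_on S \<alpha>" unfolding \<alpha>_def
    by (intro C1_on_add C1_on_bilinear[OF bounded_bilinear_scaleR] C1_on_bilinear[OF bounded_bilinear_inner]
        C1_on_bilinear[OF bounded_bilinear_cross3] C1_q C1_dq C1_dp)
  show b: "C1_on S \<beta>" unfolding \<beta>_def
    by (intro C1_on_add C1_on_bilinear[OF bounded_bilinear_scaleR] C1_on_bilinear[OF bounded_bilinear_inner]
        C1_on_bilinear[OF bounded_bilinear_cross3] C1_p C1_dq C1_dp)
  show "C1_on S n1" "C1_on S n2" unfolding n1_def n2_def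
    by (intro C1_on_bilinear[OF bounded_bilinear_cross3] C1_p C1_q a b)+
qed

section \<open>Limits of secants and transport of tangent spaces\<close>

text \<open>The lower bound \<open>low\<close> turns boundedness of the rescaled secants of the
  image into boundedness of the rescaled parameter differences \<open>w k\<close>, so a subsequence
  converges to some \<eta>. Strict differentiability replaces the rescaled secant by the derivative
  applied to \<open>w k\<close>.\<close>

lemma tangent_limit:
  assumes u0: "u0 \<in> cball z r" and uk: "\<And>k. u k \<in> cball z r" "\<And>k. u' k \<in> cball z r"
    and lim: "(\<lambda>k. \<Psi> (u k)) \<longlonglongrightarrow> \<Psi> u0" "(\<lambda>k. \<Psi> (u' k)) \<longlonglongrightarrow> \<Psi> u0"
    and Y: "(\<lambda>k. t k *\<^sub>R (\<Psi> (u k) - \<Psi> (u' k))) \<longlonglongrightarrow> Y"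
  obtains \<eta> where "Y = Dv \<Psi> u0 \<eta>"
proof -
  have conv: "v \<longlonglongrightarrow> u0" if v: "\<And>k. v k \<in> cball z r" and l: "(\<lambda>k. \<Psi> (v k)) \<longlonglongrightarrow> \<Psi> u0" for v
  proof -
    have "(\<lambda>k. v k - u0) \<longlonglongrightarrow> 0"
    proof (rule Lim_null_comparison)
      show "\<forall>\<^sub>F k in sequentially. norm (v k - u0) \<le> norm (\<Psi> (v k) - \<Psi> u0) / c"
        using low[OF v u0] c by (intro always_eventually) (simp add: pos_le_divide_eq mult.commute)
      show "(\<lambda>k. norm (\<Psi> (v k) - \<Psi> u0) / c) \<longlonglongrightarrow> 0"
        using tendsto_divide[OF tendsto_norm[OF l[THEN LIM_zero]] tendsto_const[of c]] c by simp
    qed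
    then show ?thesis by (rule LIM_zero_cancel)
  qed
  have cu: "u \<longlonglongrightarrow> u0" "u' \<longlonglongrightarrow> u0" using conv uk lim by blast+
  define w where "w k = t k *\<^sub>R (u k - u' k)" for k
  obtain K where K: "K > 0" "\<And>k. norm (t k *\<^sub>R (\<Psi> (u k) - \<Psi> (u' k))) \<le> K"
    using convergent_imp_Bseq[OF convergentI[OF Y]] by (auto elim!: BseqE)
  have wb: "norm (w k) \<le> K / c" for k
  proof -
    have "c * norm (w k) = \<bar>t k\<bar> * (c * norm (u k - u' k))" by (simp add: w_def)
    also have "\<dots> \<le> \<bar>t k\<bar> * norm (\<Psi> (u k) - \<Psi> (u' k))"
      by (intro mult_left_mono low uk) auto
    also have "\<dots> \<le> K" using K(2)[of k] by simp
    finally show ?thesis using c by (simp add: pos_le_divide_eq mult.commute)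
  qed
  then have "\<And>k. w k \<in> cball 0 (K / c)" by simp
  then obtain \<eta> s where s: "strict_mono s" "(w \<circ> s) \<longlonglongrightarrow> \<eta>"
    using compact_cball[of "0::real^3" "K / c"] unfolding compact_def by metis
  have u0S: "u0 \<in> S" using u0 S(2) by blast
  have "(\<lambda>k. t k *\<^sub>R (\<Psi> (u k) - \<Psi> (u' k)) - Dv \<Psi> u0 (w k)) \<longlonglongrightarrow> 0"
    unfolding LIMSEQ_iff
  proof (intro allI impI)
    fix e :: real assume e: "e > 0"
    \<comment> \<open>\<open>K / c\<close> bounds the norms of all \<open>w k\<close>, so this
      choice leaves an error of at most e/2.\<close>
    define e' where "e' = e / (2 * (K / c))"
    have e': "e' > 0" using e K c by (simp add: e'_def)
    obtain d where d: "d > 0" "\<And>x y. x \<in> ball u0 d \<Longrightarrow> y \<in> ball u0 d \<Longrightarrow>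
      norm (\<Psi> x - \<Psi> y - Dv \<Psi> u0 (x - y)) \<le> e' * norm (x - y)"
      using C1_on_strict[OF C1 S(1) u0S e'] by metis
    obtain n where n: "\<And>k. k \<ge> n \<Longrightarrow> u k \<in> ball u0 d \<and> u' k \<in> ball u0 d"
      using cu d(1) unfolding lim_sequentially mem_ball by (metis dist_commute le_trans nat_le_linear)
    have "norm (t k *\<^sub>R (\<Psi> (u k) - \<Psi> (u' k)) - Dv \<Psi> u0 (w k)) < e" if "k \<ge> n" for k
    proof -
      have "t k *\<^sub>R (\<Psi> (u k) - \<Psi> (u' k)) - Dv \<Psi> u0 (w k) = t k *\<^sub>R (\<Psi> (u k) - \<Psi> (u' k) - Dv \<Psi> u0 (u k - u' k))"
        unfolding w_def linear_scale[OF lin_D[OF u0S]] by (simp only: scaleR_diff_right)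
      then have "norm (t k *\<^sub>R (\<Psi> (u k) - \<Psi> (u' k)) - Dv \<Psi> u0 (w k)) \<le> \<bar>t k\<bar> * (e' * norm (u k - u' k))"
        using d(2) n[OF that] by (simp add: mult_left_mono)
      also have "\<dots> = e' * norm (w k)" by (simp add: w_def)
      also have "\<dots> \<le> e' * (K / c)" using wb e' by (intro mult_left_mono) auto
      also have "\<dots> < e" using e K c by (simp add: e'_def)
      finally show ?thesis .
    qed
    then show "\<exists>no. \<forall>n\<ge>no. norm (t n *\<^sub>R (\<Psi> (u n) - \<Psi> (u' n)) - Dv \<Psi> u0 (w n) - 0) < e" by auto
  qed
  from tendsto_diff[OF Y this] have "(\<lambda>k. Dv \<Psi> u0 (w k)) \<longlonglongrightarrow> Y" by simp
  then have "(\<lambda>k. Dv \<Psi> u0 (w (s k))) \<longlonglongrightarrow> Y" using s(1) LIMSEQ_subseq_LIMSEQ[unfolded o_def] by blast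
  moreover have "(\<lambda>k. Dv \<Psi> u0 (w (s k))) \<longlonglongrightarrow> Dv \<Psi> u0 \<eta>"
    using bounded_linear.tendsto[OF linear_conv_bounded_linear[THEN iffD1, OF lin_D[OF u0S]] s(2)]
    by (simp add: o_def)
  ultimately have "Y = Dv \<Psi> u0 \<eta>" using LIMSEQ_unique by blast
  then show ?thesis using that by blast
qed

end

lemma derivative_sequence:
  assumes f: "(f has_derivative f') (at x)" and s: "s \<longlonglongrightarrow> (0::real)" "\<And>k. s k \<noteq> 0"
  shows "(\<lambda>k. (1 / s k) *\<^sub>R (f (x + s k *\<^sub>R v) - f x)) \<longlonglongrightarrow> f' v"
proof -
  have lin: "linear f'" using f has_derivative_linear by blast
  have "((\<lambda>t. x + t *\<^sub>R v) has_derivative (\<lambda>t. t *\<^sub>R v)) (at 0)"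
    by (auto intro!: derivative_eq_intros)
  then have "((\<lambda>t. f (x + t *\<^sub>R v)) has_derivative (\<lambda>t. f' (t *\<^sub>R v))) (at 0)"
    using has_derivative_compose[of "\<lambda>t. x + t *\<^sub>R v" _ 0 UNIV f f'] f by simp
  then have "(\<lambda>h. norm (f (x + h *\<^sub>R v) - f x - h *\<^sub>R f' v) / norm h) \<midarrow>0\<rightarrow> 0"
    unfolding has_derivative_at by (simp add: linear_scale[OF lin])
  moreover have "filterlim s (at 0) sequentially"
    using s by (simp add: filterlim_at)
  ultimately have "(\<lambda>k. norm (f (x + s k *\<^sub>R v) - f x - s k *\<^sub>R f' v) / norm (s k)) \<longlonglongrightarrow> 0"
    by (rule filterlim_compose)
  moreover have "norm (f (x + s k *\<^sub>R v) - f x - s k *\<^sub>R f' v) / norm (s k)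
     = norm ((1 / s k) *\<^sub>R (f (x + s k *\<^sub>R v) - f x) - f' v)" for k
  proof -
    have "(1 / s k) *\<^sub>R (f (x + s k *\<^sub>R v) - f x) - f' v = (1 / s k) *\<^sub>R (f (x + s k *\<^sub>R v) - f x - s k *\<^sub>R f' v)"
      using s(2)[of k] by (simp add: scaleR_diff_right)
    then show ?thesis by (simp add: divide_inverse mult.commute)
  qed
  ultimately have "(\<lambda>k. norm ((1 / s k) *\<^sub>R (f (x + s k *\<^sub>R v) - f x) - f' v)) \<longlonglongrightarrow> 0" by simp
  then show ?thesis using tendsto_norm_zero_iff LIM_zero_cancel by blast
qed

context patch begin

text \<open>L sends secants through \<Psi> u to secants of the second patch, and their limits are
  tangent there by \<open>tangent_limit\<close>. This gives one inclusion, and both spaces have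
  dimension 3.\<close>

lemma tangent_transfer:
  assumes P: "patch \<Psi>' z' r' S' c'" and L: "linear L" "inj L"
    and B: "open B" "u \<in> B" "u \<in> S" and im: "\<And>w. w \<in> B \<Longrightarrow> L (\<Psi> w) \<in> \<Psi>' ` cball z' r'"
    and u': "u' \<in> cball z' r'" "\<Psi>' u' = L (\<Psi> u)"
  shows "range (Dv \<Psi>' u') = L ` range (Dv \<Psi> u)"
proof -
  interpret P: patch \<Psi>' z' r' S' c' by fact
  have bl: "bounded_linear L" using L(1) linear_conv_bounded_linear by blast
  have sub: "L (Dv \<Psi> u \<xi>) \<in> range (Dv \<Psi>' u')" for \<xi>
  proof -
    obtain e where e: "e > 0" "ball u e \<subseteq> B" using B open_contains_ball by metis
    \<comment> \<open>Dividing by \<open>norm \<xi> + 1\<close> keeps all points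
      \<open>u + s k *\<^sub>R \<xi>\<close> inside the ball of radius e, also for \<xi> =
      0.\<close>
    define s where "s k = e / (norm \<xi> + 1) / real (Suc k)" for k
    have npos: "norm \<xi> + 1 > 0" by (simp add: add_nonneg_pos)
    have s0: "s k > 0" for k using e npos by (simp add: s_def)
    have sl: "s \<longlonglongrightarrow> 0" unfolding s_def
      using LIMSEQ_Suc[OF lim_const_over_n[of "e / (norm \<xi> + 1)"]] by (simp add: )
    have wB: "u + s k *\<^sub>R \<xi> \<in> B" for k
    proof -
      have "norm (s k *\<^sub>R \<xi>) = s k * norm \<xi>" using s0[of k] by simp
      also have "\<dots> < e"
      proof -
        have "s k \<le> e / (norm \<xi> + 1)" using e npos by (simp add: s_def divide_le_eq mult_le_cancel_left1)
        then have "s k * norm \<xi> \<le> e / (norm \<xi> + 1) * norm \<xi>" by (rule mult_right_mono) simp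
        also have "\<dots> < e" using e npos by (simp add: field_simps)
        finally show ?thesis .
      qed
      finally show ?thesis using e(2) by (auto simp: dist_norm)
    qed
    have "\<forall>k. \<exists>y. y \<in> cball z' r' \<and> \<Psi>' y = L (\<Psi> (u + s k *\<^sub>R \<xi>))"
    proof
      fix k
      obtain y where "L (\<Psi> (u + s k *\<^sub>R \<xi>)) = \<Psi>' y" "y \<in> cball z' r'"
        using im[OF wB[of k]] by (rule imageE)
      then show "\<exists>y. y \<in> cball z' r' \<and> \<Psi>' y = L (\<Psi> (u + s k *\<^sub>R \<xi>))" by (intro exI[of _ y]) simp
    qed
    then obtain v where v': "\<forall>k. v k \<in> cball z' r' \<and> \<Psi>' (v k) = L (\<Psi> (u + s k *\<^sub>R \<xi>))"
      by (rule choice[THEN exE])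
    then have v: "\<And>k. v k \<in> cball z' r'" "\<And>k. \<Psi>' (v k) = L (\<Psi> (u + s k *\<^sub>R \<xi>))" by blast+
    have d: "(\<lambda>k. (1 / s k) *\<^sub>R (\<Psi> (u + s k *\<^sub>R \<xi>) - \<Psi> u)) \<longlonglongrightarrow> Dv \<Psi> u \<xi>"
      by (rule derivative_sequence[OF C1_onD[OF C1 B(3)] sl]) (use s0 in \<open>metis less_irrefl\<close>)
    have d2: "(\<lambda>k. s k *\<^sub>R ((1 / s k) *\<^sub>R (\<Psi> (u + s k *\<^sub>R \<xi>) - \<Psi> u))) \<longlonglongrightarrow> 0 *\<^sub>R Dv \<Psi> u \<xi>"
      by (rule tendsto_scaleR[OF sl d])
    have "s k *\<^sub>R ((1 / s k) *\<^sub>R (\<Psi> (u + s k *\<^sub>R \<xi>) - \<Psi> u)) = \<Psi> (u + s k *\<^sub>R \<xi>) - \<Psi> u" for k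
      using s0[of k] by simp
    then have "(\<lambda>k. \<Psi> (u + s k *\<^sub>R \<xi>) - \<Psi> u) \<longlonglongrightarrow> 0" using d2 by simp
    then have d3: "(\<lambda>k. \<Psi> (u + s k *\<^sub>R \<xi>)) \<longlonglongrightarrow> \<Psi> u" by (rule LIM_zero_cancel)
    have a: "(\<lambda>k. \<Psi>' (v k)) \<longlonglongrightarrow> \<Psi>' u'"
      using bounded_linear.tendsto[OF bl d3] by (simp add: v(2) u'(2))
    have b: "(\<lambda>k. (1 / s k) *\<^sub>R (\<Psi>' (v k) - \<Psi>' u')) \<longlonglongrightarrow> L (Dv \<Psi> u \<xi>)"
      using bounded_linear.tendsto[OF bl d] by (simp add: v(2) u'(2) linear_scale[OF L(1)] linear_diff[OF L(1)])
    obtain \<eta> where "L (Dv \<Psi> u \<xi>) = Dv \<Psi>' u' \<eta>"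
      using P.tangent_limit[OF u'(1) v(1) u'(1) a tendsto_const b] .
    then show ?thesis by blast
  qed
  have u'S: "u' \<in> S'" using u' P.S by blast
  have "L ` range (Dv \<Psi> u) = range (Dv \<Psi>' u')"
  proof (rule subspace_dim_equal)
    show "subspace (L ` range (Dv \<Psi> u))"
      by (intro linear_subspace_image L lin_D B subspace_UNIV)
    show "subspace (range (Dv \<Psi>' u'))"
      by (intro linear_subspace_image P.lin_D u'S subspace_UNIV)
    show "L ` range (Dv \<Psi> u) \<subseteq> range (Dv \<Psi>' u')" using sub by blast
    have "dim (L ` range (Dv \<Psi> u)) = dim (range (Dv \<Psi> u))"
      using L(2) inj_on_subset by (intro dim_image_eq L(1)) blast
    then show "dim (range (Dv \<Psi>' u')) \<le> dim (L ` range (Dv \<Psi> u))"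
      by (simp add: dim_range[OF B(3)] P.dim_range[OF u'S])
  qed
  then show ?thesis by simp
qed

lemma subpatch:
  assumes "r' > 0" "cball z' r' \<subseteq> cball z r"
  shows "patch \<Psi> z' r' S c"
proof
  show "c * norm (u - v) \<le> norm (\<Psi> u - \<Psi> v)" if "u \<in> cball z' r'" "v \<in> cball z' r'" for u v
    using low that assms by blast
qed (use assms c S C1 C2 sph inj in auto)

text \<open>Exchanging the factors exchanges the roles of \<open>n1\<close> and \<open>n2\<close>
  (\<open>swap_normal\<close>), so results for n2 = 0 also serve for n1 = 0.\<close>

lemma swap_patch: "patch (prod.swap \<circ> \<Psi>) z r S c"
proof
  have bl: "bounded_linear (prod.swap :: R3xR3 \<Rightarrow> R3xR3)"
    unfolding prod.swap_def by (intro bounded_linear_Pair bounded_linear_snd bounded_linear_fst)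
  have D: "Dv (prod.swap \<circ> \<Psi>) u = (\<lambda>v. prod.swap (Dv \<Psi> u v))" if "u \<in> S" for u
    unfolding o_def by (rule Dv_eqI bounded_linear.has_derivative[OF bl] C1_onD[OF C1] that)+
  show "C1_on S (prod.swap \<circ> \<Psi>)" unfolding o_def by (rule C1_on_blinear[OF bl C1])
  show "C1_on S (\<lambda>u. Dv (prod.swap \<circ> \<Psi>) u v)" for v
  proof (rule C1_onI)
    note * = C1_on_blinear[OF bl C2, of v]
    show "((\<lambda>u. Dv (prod.swap \<circ> \<Psi>) u v) has_derivative Dv (\<lambda>u. prod.swap (Dv \<Psi> u v)) x) (at x)" if "x \<in> S" for x
      by (rule has_derivative_transform_within_open[OF C1_onD[OF * that] S(1) that]) (simp add: D)
    show "continuous_on S (\<lambda>x. Dv (\<lambda>u. prod.swap (Dv \<Psi> u v)) x w)" for w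
      by (rule C1_on_cont_deriv[OF *])
  qed
  show "inj (Dv (prod.swap \<circ> \<Psi>) u)" if "u \<in> S" for u
    using inj[OF that] unfolding D[OF that] inj_def by (metis swap_swap)
  show "c * norm (u - v) \<le> norm ((prod.swap \<circ> \<Psi>) u - (prod.swap \<circ> \<Psi>) v)" if "u \<in> cball z r" "v \<in> cball z r" for u v
    using low[OF that] by (cases "\<Psi> u"; cases "\<Psi> v") (simp add: norm_Pair add.commute)
  show "(prod.swap \<circ> \<Psi>) ` S \<subseteq> S2xS2"
    using sph by (force simp: S2xS2_def)
qed (use r c S in auto)

lemma swap_normal: assumes "u \<in> S"
  shows "patch.n1 (prod.swap \<circ> \<Psi>) u = n2 u" "patch.n2 (prod.swap \<circ> \<Psi>) u = n1 u"
proof -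
  interpret Q: patch "prod.swap \<circ> \<Psi>" z r S c by (rule swap_patch)
  have bl: "bounded_linear (prod.swap :: R3xR3 \<Rightarrow> R3xR3)"
    unfolding prod.swap_def by (intro bounded_linear_Pair bounded_linear_snd bounded_linear_fst)
  have D: "Dv (prod.swap \<circ> \<Psi>) u = (\<lambda>v. prod.swap (Dv \<Psi> u v))"
    unfolding o_def by (rule Dv_eqI bounded_linear.has_derivative[OF bl] C1_onD[OF C1] assms)+
  have e: "Q.p u = q u" "Q.q u = p u" "Q.dp u v = dq u v" "Q.dq u v = dp u v" for v
    by (simp_all add: Q.p_def Q.q_def Q.dp_def Q.dq_def p_def q_def dp_def dq_def D)
  show "Q.n1 u = n2 u" "Q.n2 u = n1 u"
    by (simp_all add: Q.n1_def Q.n2_def n1_def n2_def Q.\<alpha>_def Q.\<beta>_def \<alpha>_def \<beta>_def e)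
qed

end

text \<open>The injective derivative at u0 is bounded below by some b; strict differentiability with
  error b/2 leaves the lower bound b/2 for \<Psi> on a small ball.\<close>

lemma patch_exists:
  assumes S: "open S" "u0 \<in> S" and C1: "C1_on S \<Psi>" and C2: "\<And>v. C1_on S (\<lambda>u. Dv \<Psi> u v)"
    and sph: "\<Psi> ` S \<subseteq> S2xS2" and inj: "\<And>u. u \<in> S \<Longrightarrow> inj (Dv \<Psi> u)"
  obtains r c where "patch \<Psi> u0 r S c"
proof -
  have lin: "linear (Dv \<Psi> u0)" using C1_on_linear C1 S by blast
  obtain b where b: "b > 0" "\<And>x. b * norm x \<le> norm (Dv \<Psi> u0 x)"
    using linear_inj_bounded_below_pos[OF lin inj[OF S(2)]] by blast
  obtain d where d: "d > 0" "ball u0 d \<subseteq> S" "\<And>u v. u \<in> ball u0 d \<Longrightarrow> v \<in> ball u0 d \<Longrightarrow>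
      norm (\<Psi> u - \<Psi> v - Dv \<Psi> u0 (u - v)) \<le> b / 2 * norm (u - v)"
    using C1_on_strict[OF C1 S, of "b / 2"] b by auto
  have cb: "cball u0 (d / 2) \<subseteq> ball u0 d" using d(1) by auto
  have "patch \<Psi> u0 (d / 2) S (b / 2)"
  proof
    fix u v assume "u \<in> cball u0 (d / 2)" "v \<in> cball u0 (d / 2)"
    then have 1: "norm (\<Psi> u - \<Psi> v - Dv \<Psi> u0 (u - v)) \<le> b / 2 * norm (u - v)" using d(3) cb by blast
    have "norm (Dv \<Psi> u0 (u - v)) \<le> norm (\<Psi> u - \<Psi> v) + norm (\<Psi> u - \<Psi> v - Dv \<Psi> u0 (u - v))"
      by (metis add_diff_cancel_left' diff_add_cancel norm_triangle_ineq4)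
    then show "b / 2 * norm (u - v) \<le> norm (\<Psi> u - \<Psi> v)" using 1 b(2)[of "u - v"] by (simp add: )
  qed (use S C1 C2 sph inj d b cb in auto)
  then show ?thesis using that by blast
qed

lemma patch_small:
  assumes "patch \<Psi> z r S c" "u0 \<in> ball z r" "e > 0"
  obtains r' where "r' > 0" "r' < e" "cball u0 r' \<subseteq> ball z r" "patch \<Psi> u0 r' S c"
proof -
  obtain d where d: "d > 0" "ball u0 d \<subseteq> ball z r" using assms(2) open_ball open_contains_ball by metis
  define r' where "r' = min d e / 2"
  have r': "r' > 0" "r' < d" "r' < e" using d assms(3) by (auto simp: r'_def min_def)
  have "cball u0 r' \<subseteq> ball u0 d" using r' by auto
  then have 1: "cball u0 r' \<subseteq> ball z r" using d(2) by blast
  then have "patch \<Psi> u0 r' S c" using patch.subpatch[OF assms(1) r'(1)] ball_subset_cball by blast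
  then show ?thesis using that r' 1 by blast
qed

section \<open>Pairs of orthogonal matrices and their infinitesimal generators\<close>

definition act :: "(real^3^3) \<times> (real^3^3) \<Rightarrow> R3xR3 \<Rightarrow> R3xR3" where
  "act T x = (fst T *v fst x, snd T *v snd x)"

text \<open>The group O(3) x O(3) of isometries that keep the two factors apart. Exchanges of
  factors are handled separately, by swapping patches.\<close>

definition orth_pairs :: "((real^3^3) \<times> (real^3^3)) set" where
  "orth_pairs = {T. orthogonal_matrix (fst T) \<and> orthogonal_matrix (snd T)}"

lemma act_linear: "linear (act T)"
  by (rule linearI) (simp_all add: act_def matrix_vector_right_distrib matrix_vector_mult_scaleR)

lemma orthogonal_matrix_inner: "orthogonal_matrix A \<Longrightarrow> (A *v x) \<bullet> (A *v y) = x \<bullet> y" for A :: "real^'n^'n"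
  by (metis orthogonal_transformation_def orthogonal_transformation_matrix matrix_of_matrix_vector_mul matrix_vector_mul_linear)

lemma act_inner: "T \<in> orth_pairs \<Longrightarrow> act T x \<bullet> act T y = x \<bullet> y"
  by (cases x; cases y) (simp add: act_def orth_pairs_def orthogonal_matrix_inner)

lemma act_norm: "T \<in> orth_pairs \<Longrightarrow> norm (act T x) = norm x"
  by (simp add: norm_eq_sqrt_inner act_inner)

lemma act_inj: "T \<in> orth_pairs \<Longrightarrow> inj (act T)"
  by (metis act_linear act_norm linear_injective_0 norm_eq_zero)

lemma act_S2xS2: "T \<in> orth_pairs \<Longrightarrow> x \<in> S2xS2 \<Longrightarrow> act T x \<in> S2xS2"
  by (auto simp: S2xS2_def S2_def act_def orth_pairs_def orthogonal_matrix_inner norm_eq_sqrt_inner)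

lemma act_diff_left: "act T x - act T' x = act (T - T') x"
  by (simp add: act_def matrix_vector_mult_diff_rdistrib)

lemma act_scale_left: "c *\<^sub>R act T x = act (c *\<^sub>R T) x"
  by (simp add: act_def scaleR_matrix_vector_assoc)

lemma bounded_bilinear_matrix_vector: "bounded_bilinear ((*v) :: real^3^3 \<Rightarrow> real^3 \<Rightarrow> real^3)"
  unfolding bilinear_conv_bounded_bilinear[symmetric] bilinear_def
  by (auto intro!: linearI simp: matrix_vector_mult_add_rdistrib matrix_vector_right_distrib scaleR_matrix_vector_assoc matrix_vector_mult_scaleR)

lemma tendsto_act:
  assumes "(f \<longlongrightarrow> T) F" "(g \<longlongrightarrow> x) F"
  shows "((\<lambda>k. act (f k) (g k)) \<longlongrightarrow> act T x) F"
  unfolding act_def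
  by (intro tendsto_Pair bounded_bilinear.tendsto[OF bounded_bilinear_matrix_vector] tendsto_fst tendsto_snd assms)

lemma tendsto_transpose:
  fixes f :: "'k \<Rightarrow> real^3^3"
  assumes "(f \<longlongrightarrow> T) F" shows "((\<lambda>k. transpose (f k)) \<longlongrightarrow> transpose T) F"
  unfolding transpose_def by (intro tendsto_vec_lambda tendsto_vec_nth assms)

lemma tendsto_matrix_mult:
  fixes f g :: "'k \<Rightarrow> real^3^3"
  assumes "(f \<longlongrightarrow> A) F" "(g \<longlongrightarrow> B) F" shows "((\<lambda>k. f k ** g k) \<longlongrightarrow> A ** B) F"
  unfolding matrix_matrix_mult_def
  by (intro tendsto_vec_lambda tendsto_sum tendsto_mult tendsto_vec_nth assms)

lemma closed_orth_pairs: "closed orth_pairs"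
  unfolding closed_sequential_limits
proof (intro allI impI, elim conjE)
  fix f and T :: "(real^3^3) \<times> (real^3^3)"
  assume f: "\<forall>n. f n \<in> orth_pairs" and l: "f \<longlonglongrightarrow> T"
  have "(\<lambda>n. transpose (fst (f n)) ** fst (f n)) \<longlonglongrightarrow> transpose (fst T) ** fst T"
    "(\<lambda>n. transpose (snd (f n)) ** snd (f n)) \<longlonglongrightarrow> transpose (snd T) ** snd T"
    by (intro tendsto_matrix_mult tendsto_transpose tendsto_fst tendsto_snd l)+
  then show "T \<in> orth_pairs" using f
    by (simp add: orth_pairs_def orthogonal_matrix LIMSEQ_const_iff)
qed

lemma orthogonal_matrix_bound:
  fixes A :: "real^3^3" assumes "orthogonal_matrix A" shows "norm A \<le> 9"
proof -
  have "norm (A $ i) = 1" for i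
    using assms orthogonal_matrix_orthonormal_rows[of A] by (simp add: row_def)
  then have "(\<Sum>i\<in>UNIV. norm (A $ i)) \<le> 3" by (simp add: )
  moreover have "norm A \<le> (\<Sum>i\<in>UNIV. norm (A $ i))"
    unfolding norm_vec_def by (rule L2_set_le_sum) simp
  ultimately show ?thesis by simp
qed

lemma compact_orth_pairs: "compact orth_pairs"
proof -
  have "norm T \<le> 18" if "T \<in> orth_pairs" for T
    using that norm_Pair_le[of "fst T" "snd T"] orthogonal_matrix_bound[of "fst T"] orthogonal_matrix_bound[of "snd T"]
    by (simp add: orth_pairs_def)
  then have "bounded orth_pairs" unfolding bounded_iff by blast
  then show ?thesis using closed_orth_pairs compact_eq_bounded_closed by blast
qed

text \<open>The usual identification of so(3) with R^3: a skew matrix acts as the cross product with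
  its axial vector (\<open>skew_eq_cross\<close>). It is given on all matrices so that it is linear
  on the whole matrix space.\<close>

definition axial :: "real^3^3 \<Rightarrow> real^3" where
  "axial Z = vector [Z$3$2, Z$1$3, Z$2$1]"

lemma axial_linear: "linear axial"
  by (rule linearI) (simp_all add: axial_def vec_eq_iff forall_3 vector_3)

lemma skew_eq_cross:
  assumes "transpose Z + Z = 0"
  shows "Z *v x = cross3 (axial Z) x"
proof -
  have e: "Z $ j $ i + Z $ i $ j = 0" for i j
    using arg_cong[OF assms, of "\<lambda>M. M $ i $ j"] by (simp add: transpose_def)
  have d: "Z$1$1 = 0" "Z$2$2 = 0" "Z$3$3 = 0" using e[of 1 1] e[of 2 2] e[of 3 3] by simp_all
  have o: "Z$1$2 = - Z$2$1" "Z$2$3 = - Z$3$2" "Z$3$1 = - Z$1$3"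
    using e[of 1 2] e[of 2 3] e[of 3 1] by simp_all
  show ?thesis
    by (simp add: vec_eq_iff forall_3 matrix_vector_mult_def sum_3 axial_def cross3_def vector_3 d o)
qed

lemma skew_axial_zero:
  assumes "transpose Z + Z = 0" "axial Z = 0" shows "Z = 0"
  using skew_eq_cross[OF assms(1)] assms(2) by (simp add: matrix_eq)

lemma orthogonal_matrix_cancel:
  fixes A Y :: "real^3^3"
  assumes "orthogonal_matrix A" "transpose A ** Y = 0" shows "Y = 0"
proof -
  have "Y = A ** (transpose A ** Y)" using assms(1) by (simp add: matrix_mul_assoc orthogonal_matrix_def)
  also have "\<dots> = 0" unfolding assms(2) by (simp add: vec_eq_iff matrix_matrix_mult_def)
  finally show ?thesis .
qed

text \<open>Subtracting \<open>transpose (X k) ** X k = mat 1\<close> for the two sequences and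
  factoring the difference gives an identity that survives rescaling and the limit. It says that Y
  is tangent to the orthogonal group at A, even though both end points of the difference quotient
  move.\<close>

lemma orthogonal_difference_skew:
  fixes X X' :: "nat \<Rightarrow> real^3^3"
  assumes o: "\<And>k. orthogonal_matrix (X k)" "\<And>k. orthogonal_matrix (X' k)"
    and l: "X \<longlonglongrightarrow> A" "X' \<longlonglongrightarrow> A" and Y: "(\<lambda>k. t k *\<^sub>R (X k - X' k)) \<longlonglongrightarrow> Y"
  shows "transpose (transpose A ** Y) + transpose A ** Y = 0"
proof -
  have "(\<lambda>k. transpose (t k *\<^sub>R (X k - X' k)) ** X k + transpose (X' k) ** (t k *\<^sub>R (X k - X' k)))
     \<longlonglongrightarrow> transpose Y ** A + transpose A ** Y"
    by (intro tendsto_add tendsto_matrix_mult tendsto_transpose Y l)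
  moreover have "transpose (t k *\<^sub>R (X k - X' k)) ** X k + transpose (X' k) ** (t k *\<^sub>R (X k - X' k)) = 0" for k
  proof -
    have "transpose (X k - X' k) ** X k + transpose (X' k) ** (X k - X' k) = transpose (X k) ** X k - transpose (X' k) ** X' k"
      by (simp add: vec_eq_iff matrix_matrix_mult_def transpose_def sum_3 algebra_simps)
    also have "\<dots> = 0" using o by (simp add: orthogonal_matrix)
    finally have "t k *\<^sub>R (transpose (X k - X' k) ** X k + transpose (X' k) ** (X k - X' k)) = 0" by simp
    then show ?thesis
      by (simp add: vec_eq_iff matrix_matrix_mult_def transpose_def sum_3 algebra_simps)
  qed
  ultimately have "transpose Y ** A + transpose A ** Y = 0" by (simp add: LIMSEQ_const_iff)
  then show ?thesis by (simp add: matrix_transpose_mul)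
qed

lemma norm_fst_snd_le: "norm (fst x) \<le> norm x" "norm (snd x) \<le> norm x"
  by (cases x, simp add: norm_fst_le norm_snd_le)+

text \<open>The Lie algebra element of a tangent vector Y at A, after left translation to the
  identity. It is also evaluated on mere differences of movers, where it serves as a linear
  coordinate.\<close>

definition pair_axial :: "(real^3^3) \<times> (real^3^3) \<Rightarrow> (real^3^3) \<times> (real^3^3) \<Rightarrow> R3xR3" where
  "pair_axial A Y = (axial (transpose (fst A) ** fst Y), axial (transpose (snd A) ** snd Y))"

lemma linear_pair_axial: "linear (pair_axial A)"
proof -
  have lin_mult: "linear (\<lambda>Y. (M :: real^3^3) ** Y)" for M
    by (rule linearI) (simp_all add: vec_eq_iff matrix_matrix_mult_def sum_3 algebra_simps)
  have linf: "linear (\<lambda>Y::(real^3^3)\<times>(real^3^3). axial (transpose (fst A) ** fst Y))"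
    using linear_compose[OF linear_compose[OF linear_fst lin_mult] axial_linear] by (simp add: o_def)
  have lins: "linear (\<lambda>Y::(real^3^3)\<times>(real^3^3). axial (transpose (snd A) ** snd Y))"
    using linear_compose[OF linear_compose[OF linear_snd lin_mult] axial_linear] by (simp add: o_def)
  show ?thesis unfolding pair_axial_def
    using linear_add[OF linf] linear_add[OF lins] linear_scale[OF linf] linear_scale[OF lins]
    by (intro linearI) simp_all
qed

lemma act_bound: obtains K where "K > 0" "\<And>T x. norm (act T x) \<le> K * norm T * norm x"
proof -
  obtain K where K: "K > 0" "\<And>(A::real^3^3) (x::real^3). norm (A *v x) \<le> norm A * norm x * K"
    using bounded_bilinear.pos_bounded[OF bounded_bilinear_matrix_vector] by blast
  have "norm (act T x) \<le> (2 * K) * norm T * norm x" for T x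
  proof -
    have "norm (act T x) \<le> norm (fst T *v fst x) + norm (snd T *v snd x)"
      unfolding act_def by (rule norm_Pair_le)
    also have "\<dots> \<le> norm (fst T) * norm (fst x) * K + norm (snd T) * norm (snd x) * K"
      by (intro add_mono K)
    also have "\<dots> \<le> norm T * norm x * K + norm T * norm x * K"
      by (intro add_mono mult_right_mono mult_mono norm_fst_snd_le) (use K in auto)
    finally show ?thesis by (simp add: algebra_simps)
  qed
  then show ?thesis using that[of "2 * K"] K by simp
qed

definition inv_pair :: "(real^3^3) \<times> (real^3^3) \<Rightarrow> (real^3^3) \<times> (real^3^3)" where
  "inv_pair T = (transpose (fst T), transpose (snd T))"

lemma inv_pair_orth: "T \<in> orth_pairs \<Longrightarrow> inv_pair T \<in> orth_pairs"
  by (simp add: orth_pairs_def inv_pair_def)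

lemma act_inv_pair: assumes "T \<in> orth_pairs"
  shows "act (inv_pair T) (act T x) = x" "act T (act (inv_pair T) x) = x"
  using assms by (simp_all add: act_def inv_pair_def orth_pairs_def orthogonal_matrix_def matrix_vector_mul_assoc
    del: transpose_matrix_vector vector_transpose_matrix)

section \<open>Movers and their limiting directions\<close>

text \<open>The piece is kept fixed and the target K is a closed set, usually the image of a closed
  ball under another patch. Both make this set of isometries compact
  (\<open>compact_movers\<close>).\<close>

definition movers :: "(real^3 \<Rightarrow> R3xR3) \<Rightarrow> (real^3) set \<Rightarrow> R3xR3 set \<Rightarrow> ((real^3^3) \<times> (real^3^3)) set" where
  "movers \<Psi> B K = {T \<in> orth_pairs. \<forall>u\<in>B. act T (\<Psi> u) \<in> K}"

lemma moversD: "T \<in> movers \<Psi> B K \<Longrightarrow> T \<in> orth_pairs" "T \<in> movers \<Psi> B K \<Longrightarrow> u \<in> B \<Longrightarrow> act T (\<Psi> u) \<in> K"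
  by (auto simp: movers_def)

lemma compact_movers: assumes "closed K" shows "compact (movers \<Psi> B K)"
proof -
  have "closed {T. \<forall>u\<in>B. act T (\<Psi> u) \<in> K}"
    unfolding closed_sequential_limits
  proof (intro allI impI, elim conjE, simp, intro ballI)
    fix f T u assume f: "\<forall>n. \<forall>u\<in>B. act (f n) (\<Psi> u) \<in> K" and l: "f \<longlonglongrightarrow> T" and u: "u \<in> B"
    have lim: "(\<lambda>n. act (f n) (\<Psi> u)) \<longlonglongrightarrow> act T (\<Psi> u)" by (intro tendsto_act l tendsto_const)
    show "act T (\<Psi> u) \<in> K" by (rule closed_sequentially[OF assms _ lim]) (use f u in auto)
  qed
  moreover have "movers \<Psi> B K = orth_pairs \<inter> {T. \<forall>u\<in>B. act T (\<Psi> u) \<in> K}" by (auto simp: movers_def)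
  ultimately show ?thesis using compact_orth_pairs by (simp add: compact_Int_closed)
qed

context patch begin

lemma cont: "continuous_on (cball z r) \<Psi>"
  using C1_on_imp_continuous[OF C1] S(2) continuous_on_subset by blast

lemma compact_image: "compact (\<Psi> ` cball z r)"
  using compact_continuous_image[OF cont compact_cball] .

text \<open>Applied to \<Psi> u, the movers \<open>X k\<close> and \<open>X' k\<close> give two
  sequences on the target patch that converge to A \<Psi>(u). The limit Y \<Psi>(u) of the rescaled
  secants is tangent there, and \<open>tangent_transfer\<close> carries it back by the inverse of A.
  The result is the Killing field of \<open>pair_axial A Y\<close> at \<Psi> u, now tangent to the
  original patch and so orthogonal to its normal.\<close>

lemma paratangent:
  assumes P: "patch \<Psi>' z' r' S' c'" and B: "open B" "B \<subseteq> S" "u \<in> B"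
    and T: "\<And>k. X k \<in> movers \<Psi> B (\<Psi>' ` cball z' r')" "\<And>k. X' k \<in> movers \<Psi> B (\<Psi>' ` cball z' r')"
      "A \<in> movers \<Psi> B (\<Psi>' ` cball z' r')"
    and l: "X \<longlonglongrightarrow> A" "X' \<longlonglongrightarrow> A" and Y: "(\<lambda>k. t k *\<^sub>R (X k - X' k)) \<longlonglongrightarrow> Y"
  shows "n1 u \<bullet> cross3 (axial (transpose (fst A) ** fst Y)) (p u) + n2 u \<bullet> cross3 (axial (transpose (snd A) ** snd Y)) (q u) = 0"
proof -
  interpret P: patch \<Psi>' z' r' S' c' by fact
  have A: "A \<in> orth_pairs" using T(3) moversD by blast
  have o: "orthogonal_matrix (fst (X k))" "orthogonal_matrix (fst (X' k))"
       "orthogonal_matrix (snd (X k))" "orthogonal_matrix (snd (X' k))" for k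
    using moversD(1)[OF T(1)[of k]] moversD(1)[OF T(2)[of k]] by (simp_all add: orth_pairs_def)
  have sk: "transpose (transpose (fst A) ** fst Y) + transpose (fst A) ** fst Y = 0"
    by (rule orthogonal_difference_skew[OF o(1,2) tendsto_fst[OF l(1)] tendsto_fst[OF l(2)]])
       (use tendsto_fst[OF Y] in simp)
  have sk2: "transpose (transpose (snd A) ** snd Y) + transpose (snd A) ** snd Y = 0"
    by (rule orthogonal_difference_skew[OF o(3,4) tendsto_snd[OF l(1)] tendsto_snd[OF l(2)]])
       (use tendsto_snd[OF Y] in simp)
  have uS: "u \<in> S" using B by blast
  have ex: "\<exists>f. \<forall>k. f k \<in> cball z' r' \<and> \<Psi>' (f k) = act (G k) (\<Psi> u)" if G: "\<And>k. G k \<in> movers \<Psi> B (\<Psi>' ` cball z' r')" for G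
  proof (rule choice, rule allI)
    fix k
    obtain y where "act (G k) (\<Psi> u) = \<Psi>' y" "y \<in> cball z' r'"
      using moversD(2)[OF G B(3)] by (rule imageE)
    then show "\<exists>y. y \<in> cball z' r' \<and> \<Psi>' y = act (G k) (\<Psi> u)" by (intro exI[of _ y]) simp
  qed
  obtain f where f: "\<And>k. f k \<in> cball z' r'" "\<And>k. \<Psi>' (f k) = act (X k) (\<Psi> u)" using ex[of X, OF T(1)] by blast
  obtain f' where f': "\<And>k. f' k \<in> cball z' r'" "\<And>k. \<Psi>' (f' k) = act (X' k) (\<Psi> u)" using ex[of X', OF T(2)] by blast
  obtain u' where "act A (\<Psi> u) = \<Psi>' u'" and u'1: "u' \<in> cball z' r'"
    using moversD(2)[OF T(3) B(3)] by (rule imageE)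
  then have u': "u' \<in> cball z' r'" "\<Psi>' u' = act A (\<Psi> u)" by simp_all
  have 1: "(\<lambda>k. \<Psi>' (f k)) \<longlonglongrightarrow> \<Psi>' u'" "(\<lambda>k. \<Psi>' (f' k)) \<longlonglongrightarrow> \<Psi>' u'"
    unfolding f f' u' by (intro tendsto_act l tendsto_const)+
  have "(\<lambda>k. act (t k *\<^sub>R (X k - X' k)) (\<Psi> u)) \<longlonglongrightarrow> act Y (\<Psi> u)"
    by (intro tendsto_act Y tendsto_const)
  then have 2: "(\<lambda>k. t k *\<^sub>R (\<Psi>' (f k) - \<Psi>' (f' k))) \<longlonglongrightarrow> act Y (\<Psi> u)"
    by (simp only: f f' act_diff_left act_scale_left)
  obtain \<eta> where "act Y (\<Psi> u) = Dv \<Psi>' u' \<eta>" using P.tangent_limit[OF u'(1) f(1) f'(1) 1 2] .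
  moreover have "range (Dv \<Psi>' u') = act A ` range (Dv \<Psi> u)"
    by (rule tangent_transfer[OF P act_linear act_inj[OF A] B(1,3) uS _ u'])
       (use T(3) moversD(2) in blast)
  ultimately obtain \<xi> where "act Y (\<Psi> u) = act A (Dv \<Psi> u \<xi>)" by blast
  then have "act (inv_pair A) (act Y (\<Psi> u)) = Dv \<Psi> u \<xi>" using act_inv_pair[OF A] by simp
  then have "dp u \<xi> = (transpose (fst A) ** fst Y) *v p u" "dq u \<xi> = (transpose (snd A) ** snd Y) *v q u"
    by (simp_all add: act_def inv_pair_def D_eq \<Psi>_eq matrix_vector_mul_assoc
        del: transpose_matrix_vector vector_transpose_matrix)
  then show ?thesis using normal[OF uS, of \<xi>] skew_eq_cross[OF sk] skew_eq_cross[OF sk2] by simp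
qed

text \<open>A pair w stands for an infinitesimal isometry whose vector field at (p, q) is the pair
  of cross products of \<open>fst w\<close> with p and of \<open>snd w\<close> with q. The condition
  says that this field is tangent to the patch along B.\<close>

definition killing :: "(real^3) set \<Rightarrow> R3xR3 set" where
  "killing B = {w. \<forall>u\<in>B. n1 u \<bullet> cross3 (fst w) (p u) + n2 u \<bullet> cross3 (snd w) (q u) = 0}"

text \<open>Were this false, there would be differences of movers tending to A whose b1- and
  b2-coordinates are negligible against their norms. After normalization they converge to a unit Y0
  whose generator lies in \<open>killing B\<close>, hence in the span of b1 and b2, and is
  orthogonal to both. So the generator vanishes and then Y0 does, since Y0 is tangent to the
  group.\<close>

lemma movers_local_embedding:
  assumes P: "patch \<Psi>' z' r' S' c'" and B: "open B" "B \<subseteq> S" "B \<noteq> {}"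
    and A: "A \<in> movers \<Psi> B (\<Psi>' ` cball z' r')" and h: "killing B \<subseteq> span {b1, b2}"
  obtains e K where "e > 0" "K > 0"
    "\<And>T T'. T \<in> movers \<Psi> B (\<Psi>' ` cball z' r') \<Longrightarrow> T' \<in> movers \<Psi> B (\<Psi>' ` cball z' r') \<Longrightarrow>
      T \<in> ball A e \<Longrightarrow> T' \<in> ball A e \<Longrightarrow> 
      norm (T - T') \<le> K * (norm (pair_axial A (T - T') \<bullet> b1) + norm (pair_axial A (T - T') \<bullet> b2))"
proof -
  let ?M = "movers \<Psi> B (\<Psi>' ` cball z' r')"
  let ?w = "pair_axial A"
  define g where "g Y = norm (?w Y \<bullet> b1) + norm (?w Y \<bullet> b2)" for Y
  note linw = linear_pair_axial[of A]
  have "\<exists>e>0. \<exists>K>0. \<forall>T\<in>?M \<inter> ball A e. \<forall>T'\<in>?M \<inter> ball A e. norm (T - T') \<le> K * g (T - T')"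
  proof (rule ccontr)
    assume neg: "\<not> ?thesis"
    have "\<exists>T T'. T \<in> ?M \<inter> ball A (1 / Suc n) \<and> T' \<in> ?M \<inter> ball A (1 / Suc n) \<and> norm (T - T') > Suc n * g (T - T')" for n
    proof -
      have "(1::real) / Suc n > 0" "real (Suc n) > 0" by simp_all
      then show ?thesis using neg unfolding not_ex not_all de_Morgan_conj not_imp by (metis not_le linorder_not_less)
    qed
    then obtain X X' where X: "\<And>n. X n \<in> ?M \<inter> ball A (1 / Suc n)" "\<And>n. X' n \<in> ?M \<inter> ball A (1 / Suc n)"
      "\<And>n. norm (X n - X' n) > Suc n * g (X n - X' n)" by metis
    have gnn: "g Y \<ge> 0" for Y by (simp add: g_def)
    have np: "norm (X n - X' n) > 0" for n
      by (rule le_less_trans[OF _ X(3)]) (simp add: gnn)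
    have tA: "V \<longlonglongrightarrow> A" if "\<And>n. V n \<in> ?M \<inter> ball A (1 / Suc n)" for V
    proof -
      have "(\<lambda>n. dist (V n) A) \<longlonglongrightarrow> 0"
      proof (rule Lim_null_comparison[OF _ LIMSEQ_Suc[OF lim_const_over_n[of 1]]])
        show "\<forall>\<^sub>F n in sequentially. norm (dist (V n) A) \<le> 1 / real (Suc n)"
          using that by (intro always_eventually) (auto simp: dist_commute less_imp_le)
      qed
      then show ?thesis using tendsto_dist_iff by blast
    qed
    have XA: "X \<longlonglongrightarrow> A" "X' \<longlonglongrightarrow> A" using tA X by blast+
    define Y where "Y n = (1 / norm (X n - X' n)) *\<^sub>R (X n - X' n)" for n
    have "Y n \<in> sphere 0 1" for n using np[of n] by (simp add: Y_def)
    then obtain Y0 s where Y0: "Y0 \<in> sphere 0 1" "strict_mono s" "(Y \<circ> s) \<longlonglongrightarrow> Y0"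
      using compact_sphere[of 0 1] unfolding compact_def by metis
    have gY: "g (Y n) \<le> 1 / Suc n" for n
    proof -
      have "g (Y n) = (1 / norm (X n - X' n)) * g (X n - X' n)"
        unfolding Y_def g_def by (simp add: linear_scale[OF linw] add_divide_distrib)
      also have "\<dots> \<le> 1 / Suc n" using X(3)[of n] np[of n]
        by (simp add: pos_divide_le_eq pos_le_divide_eq field_simps less_imp_le)
      finally show ?thesis .
    qed
    have "(\<lambda>n. ?w ((Y \<circ> s) n)) \<longlonglongrightarrow> ?w Y0"
      using linw Y0(3) linear_conv_bounded_linear bounded_linear.tendsto by blast
    then have "(\<lambda>n. g ((Y \<circ> s) n)) \<longlonglongrightarrow> g Y0"
      unfolding g_def by (intro tendsto_add tendsto_norm tendsto_inner tendsto_const)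
    moreover have "(\<lambda>n. g ((Y \<circ> s) n)) \<longlonglongrightarrow> 0"
    proof (rule Lim_null_comparison[OF _ LIMSEQ_subseq_LIMSEQ[OF LIMSEQ_Suc[OF lim_const_over_n[of 1]] Y0(2)]])
      show "\<forall>\<^sub>F n in sequentially. norm (g ((Y \<circ> s) n)) \<le> ((\<lambda>n. 1 / real (Suc n)) \<circ> s) n"
        using gY gnn by (intro always_eventually) (simp add: )
    qed
    ultimately have "g Y0 = 0" using LIMSEQ_unique by blast
    then have g0: "?w Y0 \<bullet> b1 = 0" "?w Y0 \<bullet> b2 = 0" by (auto simp: g_def)
    have lim: "(\<lambda>k. (1 / norm (X (s k) - X' (s k))) *\<^sub>R (X (s k) - X' (s k))) \<longlonglongrightarrow> Y0"
      using Y0(3) by (simp add: Y_def o_def)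
    have Xs: "(\<lambda>k. X (s k)) \<longlonglongrightarrow> A" "(\<lambda>k. X' (s k)) \<longlonglongrightarrow> A"
      using XA LIMSEQ_subseq_LIMSEQ[OF _ Y0(2)] by (auto simp: o_def)
    have mem: "X (s k) \<in> ?M" "X' (s k) \<in> ?M" for k using X by blast+
    have "?w Y0 \<in> killing B"
      unfolding killing_def pair_axial_def using paratangent[OF P B(1,2) _ mem A Xs lim] by simp
    then have "?w Y0 \<in> span {b1, b2}" using h by blast
    then have "orthogonal (?w Y0) (?w Y0)"
      by (rule orthogonal_to_span) (use g0 in \<open>auto simp: orthogonal_def\<close>)
    then have w0: "?w Y0 = 0" by (simp add: orthogonal_def)
    have ax: "axial (transpose (fst A) ** fst Y0) = 0" "axial (transpose (snd A) ** snd Y0) = 0"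
      using w0 by (simp_all add: pair_axial_def zero_prod_def)
    have oA: "orthogonal_matrix (fst A)" "orthogonal_matrix (snd A)" using moversD(1)[OF A] by (simp_all add: orth_pairs_def)
    have o: "orthogonal_matrix (fst (X (s k)))" "orthogonal_matrix (fst (X' (s k)))"
       "orthogonal_matrix (snd (X (s k)))" "orthogonal_matrix (snd (X' (s k)))" for k
      using moversD(1)[OF mem(1)[of k]] moversD(1)[OF mem(2)[of k]] by (simp_all add: orth_pairs_def)
    have sk1: "transpose (transpose (fst A) ** fst Y0) + transpose (fst A) ** fst Y0 = 0"
      by (rule orthogonal_difference_skew[OF o(1,2) tendsto_fst[OF Xs(1)] tendsto_fst[OF Xs(2)]])
         (use tendsto_fst[OF lim] in simp)
    have f0: "fst Y0 = 0" by (rule orthogonal_matrix_cancel[OF oA(1) skew_axial_zero[OF sk1 ax(1)]])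
    have sk2: "transpose (transpose (snd A) ** snd Y0) + transpose (snd A) ** snd Y0 = 0"
      by (rule orthogonal_difference_skew[OF o(3,4) tendsto_snd[OF Xs(1)] tendsto_snd[OF Xs(2)]])
         (use tendsto_snd[OF lim] in simp)
    have "snd Y0 = 0" by (rule orthogonal_matrix_cancel[OF oA(2) skew_axial_zero[OF sk2 ax(2)]])
    then have "Y0 = 0" using f0 by (simp add: prod_eq_iff)
    then show False using Y0(1) by simp
  qed
  then show ?thesis using that unfolding g_def by blast
qed

end

section \<open>Tangent Killing fields: dimension and bracket\<close>

context patch begin

text \<open>With at most two independent tangent Killing fields, movers near a fixed one are
  Lipschitz functions of two real numbers, and u depends in a Lipschitz way on the mover that brings
  x0 to \<Psi> u. So a 3-dimensional ball would be a Lipschitz image of a subset of a plane, which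
  has measure zero.\<close>

lemma movers_not_small:
  assumes P: "patch \<Psi>' z' r' S' c'" and B: "open B" "B \<subseteq> S" "B \<noteq> {}"
    and h: "killing B \<subseteq> span {b1, b2}" and U: "open U" "U \<noteq> {}" "U \<subseteq> ball z r"
    and L: "\<And>x y. norm (L x - L y) = norm (x - y :: R3xR3)"
    and cov: "\<And>u. u \<in> U \<Longrightarrow> \<exists>T\<in>movers \<Psi> B (\<Psi>' ` cball z' r'). \<Psi> u = L (act T x0)"
  shows False
proof -
  interpret P: patch \<Psi>' z' r' S' c' by fact
  let ?M = "movers \<Psi> B (\<Psi>' ` cball z' r')"
  have cM: "compact ?M" by (rule compact_movers[OF compact_imp_closed[OF P.compact_image]])
  have "\<forall>A\<in>?M. \<exists>e K. e > 0 \<and> K > 0 \<and> (\<forall>T\<in>?M \<inter> ball A e. \<forall>T'\<in>?M \<inter> ball A e.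
      norm (T - T') \<le> K * (norm (pair_axial A (T - T') \<bullet> b1) + norm (pair_axial A (T - T') \<bullet> b2)))"
  proof
    fix A assume A: "A \<in> ?M"
    obtain e K where eK: "e > 0" "K > 0" "\<And>T T'. T \<in> ?M \<Longrightarrow> T' \<in> ?M \<Longrightarrow> T \<in> ball A e \<Longrightarrow> T' \<in> ball A e \<Longrightarrow>
      norm (T - T') \<le> K * (norm (pair_axial A (T - T') \<bullet> b1) + norm (pair_axial A (T - T') \<bullet> b2))"
      using movers_local_embedding[OF P B A h] by blast
    then show "\<exists>e K. e > 0 \<and> K > 0 \<and> (\<forall>T\<in>?M \<inter> ball A e. \<forall>T'\<in>?M \<inter> ball A e.
      norm (T - T') \<le> K * (norm (pair_axial A (T - T') \<bullet> b1) + norm (pair_axial A (T - T') \<bullet> b2)))" by blast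
  qed
  then obtain e K where eK: "\<And>A. A \<in> ?M \<Longrightarrow> e A > 0" "\<And>A. A \<in> ?M \<Longrightarrow> K A > 0"
    "\<And>A T T'. A \<in> ?M \<Longrightarrow> T \<in> ?M \<inter> ball A (e A) \<Longrightarrow> T' \<in> ?M \<inter> ball A (e A) \<Longrightarrow> 
      norm (T - T') \<le> K A * (norm (pair_axial A (T - T') \<bullet> b1) + norm (pair_axial A (T - T') \<bullet> b2))"
    unfolding bchoice_iff by blast
  \<comment> \<open>Closed balls of half the radius give closed sets \<open>C A\<close> for the
    Baire argument and stay inside the balls on which the Lipschitz estimate holds.\<close>
  have "?M \<subseteq> (\<Union>A\<in>?M. ball A (e A / 2))"
    using eK(1) by force
  then obtain M0 where M0: "M0 \<subseteq> ?M" "finite M0" "?M \<subseteq> (\<Union>A\<in>M0. ball A (e A / 2))"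
    using compactE_image[OF cM, of ?M "\<lambda>A. ball A (e A / 2)"] by auto
  obtain c0 \<rho> where c0: "\<rho> > 0" "cball c0 \<rho> \<subseteq> U" using U open_contains_cball by blast
  define C where "C A = {u \<in> cball c0 \<rho>. \<exists>T\<in>?M \<inter> cball A (e A / 2). \<Psi> u = L (act T x0)}" for A
  have contL: "continuous_on X L" for X
  proof (rule continuous_onI)
    fix x e assume "(0::real) < e" "x \<in> X"
    then show "\<exists>d>0. \<forall>x'\<in>X. dist x' x < d \<longrightarrow> dist (L x') (L x) \<le> e"
      by (intro exI[of _ e]) (simp add: dist_norm L)
  qed
  have contact: "continuous_on X (\<lambda>T. act T x0)" for X
    unfolding continuous_on_def by (intro ballI tendsto_act tendsto_const tendsto_ident_at)
  have contLact: "continuous_on X (\<lambda>T. L (act T x0))" for X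
    by (rule continuous_on_compose2[OF contL[of UNIV] contact]) simp
  have clC: "closed (C A)" for A
  proof -
    have "compact ((\<lambda>T. L (act T x0)) ` (?M \<inter> cball A (e A / 2)))"
      by (intro compact_continuous_image contLact compact_Int cM compact_cball)
    then have "closed (cball c0 \<rho> \<inter> \<Psi> -` ((\<lambda>T. L (act T x0)) ` (?M \<inter> cball A (e A / 2))))"
      using c0 U(3) ball_subset_cball
      by (intro continuous_closed_preimage closed_cball compact_imp_closed continuous_on_subset[OF cont]) auto
    moreover have "C A = cball c0 \<rho> \<inter> \<Psi> -` ((\<lambda>T. L (act T x0)) ` (?M \<inter> cball A (e A / 2)))"
      by (auto simp: C_def)
    ultimately show ?thesis by simp
  qed
  have covC: "ball c0 \<rho> \<subseteq> (\<Union>A\<in>M0. C A)"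
  proof
    fix u assume u: "u \<in> ball c0 \<rho>"
    then have "u \<in> U" using c0 ball_subset_cball by blast
    then obtain T where T: "T \<in> ?M" "\<Psi> u = L (act T x0)" using cov by blast
    then obtain A where A: "A \<in> M0" "T \<in> ball A (e A / 2)" using M0(3) by blast
    then have "T \<in> cball A (e A / 2)" "u \<in> cball c0 \<rho>" using u by auto
    then have "u \<in> C A" unfolding C_def using T by blast
    then show "u \<in> (\<Union>A\<in>M0. C A)" using A by blast
  qed
  have neC: "ball c0 \<rho> \<noteq> {}" using c0 by simp
  obtain A c1 \<sigma> where A: "A \<in> M0" "\<sigma> > 0" "ball c1 \<sigma> \<subseteq> ball c0 \<rho>" "ball c1 \<sigma> \<subseteq> C A"
    by (rule Baire_union[OF open_ball neC countable_finite[OF M0(2)] clC covC])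
  have AM: "A \<in> ?M" using A M0 by blast
  have "\<forall>u\<in>ball c1 \<sigma>. \<exists>T. T \<in> ?M \<inter> ball A (e A) \<and> \<Psi> u = L (act T x0)"
  proof
    fix u assume "u \<in> ball c1 \<sigma>"
    then have "u \<in> C A" using A by blast
    then obtain T where T: "T \<in> ?M" "T \<in> cball A (e A / 2)" "\<Psi> u = L (act T x0)" by (auto simp: C_def)
    have "T \<in> ball A (e A)" using T(2) eK(1)[OF AM] by simp
    then show "\<exists>T. T \<in> ?M \<inter> ball A (e A) \<and> \<Psi> u = L (act T x0)" using T by blast
  qed
  then obtain T where T: "\<And>u. u \<in> ball c1 \<sigma> \<Longrightarrow> T u \<in> ?M \<inter> ball A (e A)" "\<And>u. u \<in> ball c1 \<sigma> \<Longrightarrow> \<Psi> u = L (act (T u) x0)"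
    unfolding bchoice_iff by blast
  obtain K1 where K1: "K1 > 0" "\<And>T x. norm (act T x) \<le> K1 * norm T * norm x" using act_bound by blast
  \<comment> \<open>The third coordinate 0 places the two parameters in a null plane of the same
    space R^3 that contains the ball.\<close>
  define \<theta> :: "real^3 \<Rightarrow> real^3" where "\<theta> u = vector [pair_axial A (T u) \<bullet> b1, pair_axial A (T u) \<bullet> b2, 0]" for u
  define K2 where "K2 = K1 * (K A * 2) * norm x0 / c"
  have sub: "ball c1 \<sigma> \<subseteq> cball z r" using A(3) c0 U(3) ball_subset_cball by blast
  have lip: "norm (u - v) \<le> K2 * norm (\<theta> u - \<theta> v)" if u: "u \<in> ball c1 \<sigma>" and v: "v \<in> ball c1 \<sigma>" for u v
  proof -
    have comp: "norm (pair_axial A (T u - T v) \<bullet> b1) \<le> norm (\<theta> u - \<theta> v)" "norm (pair_axial A (T u - T v) \<bullet> b2) \<le> norm (\<theta> u - \<theta> v)"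
      using component_le_norm_cart[of "\<theta> u - \<theta> v" 1] component_le_norm_cart[of "\<theta> u - \<theta> v" 2]
      by (simp_all add: \<theta>_def vector_3 linear_diff[OF linear_pair_axial] inner_diff_left)
    have "c * norm (u - v) \<le> norm (\<Psi> u - \<Psi> v)" using low u v sub by blast
    also have "\<dots> = norm (act (T u - T v) x0)" by (simp add: T(2)[OF u] T(2)[OF v] L act_diff_left)
    also have "\<dots> \<le> K1 * norm (T u - T v) * norm x0" by (rule K1)
    also have "\<dots> \<le> K1 * (K A * (norm (\<theta> u - \<theta> v) + norm (\<theta> u - \<theta> v))) * norm x0"
    proof (intro mult_right_mono mult_left_mono)
      have "norm (T u - T v) \<le> K A * (norm (pair_axial A (T u - T v) \<bullet> b1) + norm (pair_axial A (T u - T v) \<bullet> b2))"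
        by (rule eK(3)[OF AM T(1)[OF u] T(1)[OF v]])
      also have "\<dots> \<le> K A * (norm (\<theta> u - \<theta> v) + norm (\<theta> u - \<theta> v))"
        using eK(2)[OF AM] comp by (intro mult_left_mono add_mono) auto
      finally show "norm (T u - T v) \<le> K A * (norm (\<theta> u - \<theta> v) + norm (\<theta> u - \<theta> v))" .
    qed (use K1 in auto)
    finally show ?thesis using c by (simp add: K2_def field_simps)
  qed
  \<comment> \<open>By the estimate \<open>lip\<close>, \<theta> is injective on the ball; g is its
    inverse there and is Lipschitz with constant \<open>K2\<close>.\<close>
  define g where "g y = (SOME u. u \<in> ball c1 \<sigma> \<and> \<theta> u = y)" for y
  have gth: "g (\<theta> u) = u" if "u \<in> ball c1 \<sigma>" for u
  proof -
    have "g (\<theta> u) \<in> ball c1 \<sigma> \<and> \<theta> (g (\<theta> u)) = \<theta> u" unfolding g_def by (rule someI[of _ u]) (use that in simp)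
    then have "norm (g (\<theta> u) - u) \<le> 0" using lip[of "g (\<theta> u)" u] that by simp
    then show ?thesis by simp
  qed
  have "negligible {x::real^3. x \<bullet> axis 3 1 = 0}"
    by (rule negligible_standard_hyperplane) simp
  then have "negligible (\<theta> ` ball c1 \<sigma>)"
    by (rule negligible_subset) (auto simp: \<theta>_def inner_axis vector_3)
  then have "negligible (g ` \<theta> ` ball c1 \<sigma>)"
  proof (rule negligible_locally_Lipschitz_image[OF order_refl])
    fix x assume "x \<in> \<theta> ` ball c1 \<sigma>"
    then show "\<exists>T B. open T \<and> x \<in> T \<and> (\<forall>y\<in>\<theta> ` ball c1 \<sigma> \<inter> T. norm (g y - g x) \<le> B * norm (y - x))"
      by (intro exI[of _ UNIV] exI[of _ K2]) (auto simp: gth intro!: lip)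
  qed
  moreover have "g ` \<theta> ` ball c1 \<sigma> = ball c1 \<sigma>" using gth by force
  ultimately show False using open_not_negligible[of "ball c1 \<sigma>"] A(2) by simp
qed

text \<open>Brackets of fields tangent to a submanifold are tangent. Here the bracket is the
  commutator of two linear fields, so it is enough that the two iterated applications of w and w'
  have the same normal component. Both equal the normal part of a second derivative of \<Psi>, which
  is symmetric; the Jacobi identity turns their difference into the field of the bracket.\<close>

lemma killing_bracket:
  assumes B: "open B" "B \<subseteq> S" and w: "w \<in> killing B" and w': "w' \<in> killing B"
  shows "(cross3 (fst w) (fst w'), cross3 (snd w) (snd w')) \<in> killing B"
  unfolding killing_def
proof (rule CollectI, rule ballI)
  fix u assume u: "u \<in> B"
  then have uS: "u \<in> S" using B by blast
  have tan: "p u \<bullet> cross3 a (p u) = 0" "q u \<bullet> cross3 a (q u) = 0" for a by (simp_all add: dot_cross_self)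
  have ex: "\<exists>\<xi>. dp u \<xi> = cross3 (fst x) (p u) \<and> dq u \<xi> = cross3 (snd x) (q u)" if "x \<in> killing B" for x
    using in_rangeI[OF uS tan] that u unfolding killing_def by blast
  obtain \<xi> where x: "dp u \<xi> = cross3 (fst w) (p u)" "dq u \<xi> = cross3 (snd w) (q u)" using ex[OF w] by blast
  obtain \<xi>' where x': "dp u \<xi>' = cross3 (fst w') (p u)" "dq u \<xi>' = cross3 (snd w') (q u)" using ex[OF w'] by blast
  define E where "E a = Dv (\<lambda>u. Dv \<Psi> u a) u" for a
  have E: "((\<lambda>u. Dv \<Psi> u a) has_derivative E a) (at u)" for a
    unfolding E_def by (rule C1_onD[OF C2 uS])
  have Ep: "((\<lambda>u. dp u a) has_derivative (\<lambda>v. fst (E a v))) (at u)" and Eq: "((\<lambda>u. dq u a) has_derivative (\<lambda>v. snd (E a v))) (at u)" for a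
    unfolding dp_def dq_def by (intro has_derivative_fst has_derivative_snd E)+
  have sym: "E a b = E b a" for a b
    by (rule second_derivative_symmetric[OF S(1) uS C1_onD[OF C1] E E])
  note D1 = C1_onD[OF C1_n1 uS] note D2 = C1_onD[OF C1_n2 uS]
  \<comment> \<open>Two expressions vanish identically: the normal paired with the Killing field of
    v, and the normal paired with the derivative of \<Psi> along a. At u the direction a reproduces
    that Killing field, so the derivatives of the normal contribute equally to both and drop
    out.\<close>
  have key: "n1 u \<bullet> cross3 (fst v) (dp u b) + n2 u \<bullet> cross3 (snd v) (dq u b) = n1 u \<bullet> fst (E a b) + n2 u \<bullet> snd (E a b)"
    if v: "v \<in> killing B" and a: "dp u a = cross3 (fst v) (p u)" "dq u a = cross3 (snd v) (q u)" for v a b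
  proof -
    have "((\<lambda>u. n1 u \<bullet> cross3 (fst v) (p u) + n2 u \<bullet> cross3 (snd v) (q u)) has_derivative
      (\<lambda>b. (n1 u \<bullet> cross3 (fst v) (dp u b) + Dv n1 u b \<bullet> cross3 (fst v) (p u)) + (n2 u \<bullet> cross3 (snd v) (dq u b) + Dv n2 u b \<bullet> cross3 (snd v) (q u)))) (at u)"
      by (intro has_derivative_add has_derivative_inner D1 D2 
          bounded_linear.has_derivative[OF bounded_bilinear.bounded_linear_right[OF bounded_bilinear_cross3]] Dp Dq uS)
    moreover have "((\<lambda>u. n1 u \<bullet> cross3 (fst v) (p u) + n2 u \<bullet> cross3 (snd v) (q u)) has_derivative (\<lambda>b. 0)) (at u)"
      by (rule has_derivative_transform_within_open[OF has_derivative_const[of 0] B(1) u]) (use v in \<open>simp add: killing_def\<close>)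
    ultimately have "(\<lambda>b. (n1 u \<bullet> cross3 (fst v) (dp u b) + Dv n1 u b \<bullet> cross3 (fst v) (p u)) + (n2 u \<bullet> cross3 (snd v) (dq u b) + Dv n2 u b \<bullet> cross3 (snd v) (q u))) = (\<lambda>b. 0)"
      by (rule has_derivative_unique)
    from fun_cong[OF this, of b] have 1: "(n1 u \<bullet> cross3 (fst v) (dp u b) + Dv n1 u b \<bullet> cross3 (fst v) (p u)) + (n2 u \<bullet> cross3 (snd v) (dq u b) + Dv n2 u b \<bullet> cross3 (snd v) (q u)) = 0" .
    have "((\<lambda>u. n1 u \<bullet> dp u a + n2 u \<bullet> dq u a) has_derivative
      (\<lambda>b. (n1 u \<bullet> fst (E a b) + Dv n1 u b \<bullet> dp u a) + (n2 u \<bullet> snd (E a b) + Dv n2 u b \<bullet> dq u a))) (at u)"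
      by (intro has_derivative_add has_derivative_inner D1 D2 Ep Eq)
    moreover have "((\<lambda>u. n1 u \<bullet> dp u a + n2 u \<bullet> dq u a) has_derivative (\<lambda>b. 0)) (at u)"
      by (rule has_derivative_transform_within_open[OF has_derivative_const[of 0] S(1) uS]) (simp add: normal)
    ultimately have "(\<lambda>b. (n1 u \<bullet> fst (E a b) + Dv n1 u b \<bullet> dp u a) + (n2 u \<bullet> snd (E a b) + Dv n2 u b \<bullet> dq u a)) = (\<lambda>b. 0)"
      by (rule has_derivative_unique)
    from fun_cong[OF this, of b] show ?thesis using 1 a by simp
  qed
  have "n1 u \<bullet> cross3 (fst w) (cross3 (fst w') (p u)) + n2 u \<bullet> cross3 (snd w) (cross3 (snd w') (q u)) =
    n1 u \<bullet> cross3 (fst w') (cross3 (fst w) (p u)) + n2 u \<bullet> cross3 (snd w') (cross3 (snd w) (q u))"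
    using key[OF w x, of \<xi>'] key[OF w' x', of \<xi>] sym[of \<xi> \<xi>'] by (simp add: x x')
  moreover have jac: "cross3 (cross3 a b) x = cross3 a (cross3 b x) - cross3 b (cross3 a x)" for a b x :: "real^3"
    by (simp add: cross3_simps forall_3)
  ultimately show "n1 u \<bullet> cross3 (fst (cross3 (fst w) (fst w'), cross3 (snd w) (snd w'))) (p u) +
    n2 u \<bullet> cross3 (snd (cross3 (fst w) (fst w'), cross3 (snd w) (snd w'))) (q u) = 0"
    by (simp add: jac inner_diff_right)
qed

lemma subspace_killing: "subspace (killing B)"
  unfolding killing_def subspace_def
  by (auto simp: cross_add_left cross_mult_left inner_add_right algebra_simps) (metis add.commute add.left_commute add_0 mult_zero_right distrib_left)+

end

section \<open>Subalgebras of so(3) + so(3) contained in a hyperplane\<close>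

lemma orthogonal_triple_zero:
  fixes b d e :: "real^3"
  assumes "b \<noteq> 0" "d \<noteq> 0" "b \<bullet> d = 0" "e \<bullet> b = 0" "e \<bullet> d = 0" "e \<bullet> cross3 b d = 0"
  shows "e = 0"
proof -
  have 1: "cross3 (cross3 b d) e = 0" using assms by (simp add: cross_cross_right inner_commute)
  have "(norm (cross3 b d))\<^sup>2 = (norm b * norm d)\<^sup>2" using norm_cross_dot[of b d] assms(3) by simp
  then have 2: "cross3 b d \<noteq> 0" using assms(1,2) by auto
  have "(norm (cross3 b d) * norm e)\<^sup>2 = 0"
    using norm_cross_dot[of "cross3 b d" e] 1 assms(6) by (simp add: inner_commute)
  then show ?thesis using 2 by simp
qed

lemma small_span:
  fixes h :: "'a::euclidean_space set"
  assumes "subspace h" "dim h \<le> 2" obtains x y where "h \<subseteq> span {x, y}"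
proof -
  obtain B where B: "B \<subseteq> h" "independent B" "h \<subseteq> span B" "card B = dim h" using basis_exists by blast
  have fin: "finite B" using B(2) independent_imp_finite by blast
  have "\<exists>x y. B \<subseteq> {x, y}"
  proof -
    consider "card B = 0" | "card B = 1" | "card B = 2" using B(4) assms(2) by linarith
    then show ?thesis
    proof cases
      case 1 then show ?thesis using fin by simp
    next
      case 2 then show ?thesis by (auto simp: card_1_singleton_iff)
    next
      case 3 then show ?thesis by (auto simp: card_2_iff)
    qed
  qed
  then obtain x y where "B \<subseteq> {x, y}" by blast
  then have "span B \<subseteq> span {x, y}" by (rule span_mono)
  then show ?thesis using that B(3) by blast
qed

text \<open>Suppose b is nonzero. If some w in h has a second component not parallel to b,
  bracketing (0, b) with w and then with the result yields an orthogonal basis of 0 x R^3 inside h,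
  so e2 = 0. Otherwise h splits into a part in R^3 x 0 and the line through (0, b). Not being
  contained in the span of two vectors, h then contains two independent vectors of R^3 x 0, whose
  brackets yield an orthogonal basis of that factor, so e1 = 0.\<close>

lemma subalgebra_kernel_trivial:
  fixes h :: "R3xR3 set"
  assumes h: "subspace h" and br: "\<And>w w'. w \<in> h \<Longrightarrow> w' \<in> h \<Longrightarrow> (cross3 (fst w) (fst w'), cross3 (snd w) (snd w')) \<in> h"
    and big: "\<And>x y. \<not> h \<subseteq> span {x, y}"
    and e: "\<And>w. w \<in> h \<Longrightarrow> e1 \<bullet> fst w + e2 \<bullet> snd w = 0" "e1 \<noteq> 0" "e2 \<noteq> 0"
    and b: "(0, b) \<in> h"
  shows "b = 0"
proof (rule ccontr)
  assume b0: "b \<noteq> 0"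
  show False
  proof (cases "\<exists>w\<in>h. cross3 b (snd w) \<noteq> 0")
    case True
    then obtain w where w: "w \<in> h" "cross3 b (snd w) \<noteq> 0" by blast
    define d where "d = cross3 b (snd w)"
    have d: "(0, d) \<in> h" using br[OF b w(1)] by (simp add: d_def)
    have "(0, cross3 b d) \<in> h" using br[OF b d] by simp
    then have "e2 = 0" using e(1)[OF b] e(1)[OF d] e(1) b0 w(2)
      by (intro orthogonal_triple_zero[of b d]) (force simp: d_def dot_cross_self)+
    then show False using e by simp
  next
    case False
    have red: "(fst w, 0) \<in> h" "\<exists>l. w = (fst w, 0) + l *\<^sub>R (0, b)" if w: "w \<in> h" for w
    proof -
      have "collinear {0, b, snd w}" using False w cross_eq_0 by blast
      then obtain l where l: "snd w = l *\<^sub>R b" using b0 unfolding collinear_lemma by (metis scale_zero_left)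
      have "w - l *\<^sub>R (0, b) \<in> h" using h w b subspace_diff subspace_scale by blast
      moreover have "w - l *\<^sub>R (0, b) = (fst w, 0)" using l by (simp add: prod_eq_iff)
      ultimately show "(fst w, 0) \<in> h" by simp
      show "\<exists>l. w = (fst w, 0) + l *\<^sub>R (0, b)" using l by (intro exI[of _ l]) (simp add: prod_eq_iff)
    qed
    \<comment> \<open>With the vector repeated, \<open>big\<close> excludes that h is contained in
      the line through (0, b); below it excludes the plane spanned by that line and (a1, 0).\<close>
    obtain w1 where w1: "w1 \<in> h" "w1 \<notin> span {(0, b), (0, b)}" using big by blast
    define a1 where "a1 = fst w1"
    have a1: "(a1, 0) \<in> h" "a1 \<noteq> 0"
    proof -
      show "(a1, 0) \<in> h" using red w1 by (simp add: a1_def)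
      obtain l where "w1 = (a1, 0) + l *\<^sub>R (0, b)" using red(2)[OF w1(1)] a1_def by blast
      then show "a1 \<noteq> 0" using w1(2) by (metis add_0 insert_absorb2 insertI1 span_base span_mul zero_prod_def)
    qed
    obtain w2 where w2: "w2 \<in> h" "w2 \<notin> span {(0, b), (a1, 0)}" using big by blast
    define a2 where "a2 = fst w2"
    have a2: "(a2, 0) \<in> h" using red w2 by (simp add: a2_def)
    define d where "d = cross3 a1 a2"
    have "d \<noteq> 0"
    proof
      assume "d = 0"
      then have "collinear {0, a1, a2}" using d_def cross_eq_0[of a1 a2] by simp
      then obtain k where k: "a2 = k *\<^sub>R a1" using a1(2) unfolding collinear_lemma by (metis scale_zero_left)
      obtain l where "w2 = (a2, 0) + l *\<^sub>R (0, b)" using red(2)[OF w2(1)] a2_def by blast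
      then have "w2 = k *\<^sub>R (a1, 0) + l *\<^sub>R (0, b)" using k by simp
      then have "w2 \<in> span {(0, b), (a1, 0)}" by (simp only:) (intro span_add span_mul span_base; simp)
      then show False using w2 by blast
    qed
    have d: "(d, 0) \<in> h" using br[OF a1(1) a2] by (simp add: d_def)
    have "(cross3 a1 d, 0) \<in> h" using br[OF a1(1) d] by simp
    then have "e1 = 0" using e(1)[OF a1(1)] e(1)[OF d] e(1) a1(2) \<open>d \<noteq> 0\<close>
      by (intro orthogonal_triple_zero[of a1 d]) (force simp: d_def dot_cross_self)+
    then show False using e by simp
  qed
qed

text \<open>For y orthogonal to x, multiplying y twice by x gives minus |x| squared times y.
  Applying f and using injectivity yields a relation between x and y, and pairing it with y forces f
  to preserve the norm of x.\<close>

lemma cross_hom_orthogonal: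
  fixes f :: "real^3 \<Rightarrow> real^3"
  assumes f: "linear f" "inj f" and cr: "\<And>x y. f (cross3 x y) = cross3 (f x) (f y)"
  shows "orthogonal_transformation f"
  unfolding orthogonal_transformation
proof (intro conjI f allI)
  fix x
  show "norm (f x) = norm x"
  proof (cases "x = 0")
    case True then show ?thesis by (simp add: linear_0[OF f(1)])
  next
    case False
    obtain y where y: "y \<noteq> 0" "orthogonal x y" using orthogonal_to_vector_exists[of x] by auto
    have "f (cross3 x (cross3 x y)) = f ((- (x \<bullet> x)) *\<^sub>R y)" using y(2) by (simp add: cross_cross_left orthogonal_def)
    moreover have "f (cross3 x (cross3 x y)) = (f x \<bullet> f y) *\<^sub>R f x - (f x \<bullet> f x) *\<^sub>R f y"
      unfolding cr by (rule cross_cross_left)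
    ultimately have "(f x \<bullet> f y) *\<^sub>R f x - (f x \<bullet> f x) *\<^sub>R f y = (- (x \<bullet> x)) *\<^sub>R f y"
      by (simp only: linear_scale[OF f(1)])
    then have "(f x \<bullet> f y) *\<^sub>R f x = (f x \<bullet> f x - x \<bullet> x) *\<^sub>R f y" by (simp add: scaleR_diff_left algebra_simps)
    then have "f ((f x \<bullet> f y) *\<^sub>R x) = f ((f x \<bullet> f x - x \<bullet> x) *\<^sub>R y)" by (simp add: linear_scale[OF f(1)])
    then have "(f x \<bullet> f y) *\<^sub>R x = (f x \<bullet> f x - x \<bullet> x) *\<^sub>R y" using f(2) by (simp add: inj_eq)
    then have "y \<bullet> ((f x \<bullet> f y) *\<^sub>R x) = y \<bullet> ((f x \<bullet> f x - x \<bullet> x) *\<^sub>R y)" by simp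
    then have "(f x \<bullet> f x - x \<bullet> x) * (y \<bullet> y) = 0" using y(2) by (simp add: orthogonal_def inner_commute)
    then show ?thesis using y(1) by (simp add: norm_eq_sqrt_inner)
  qed
qed

text \<open>By \<open>subalgebra_kernel_trivial\<close>, used for h and for its swap, h meets both
  factors only in 0. Since its dimension is at least 3, the second projection is bijective and h is
  the graph of a linear injective map. Closure under brackets makes this map a homomorphism for the
  cross product, hence orthogonal.\<close>

lemma subalgebra_rotation_graph:
  fixes h :: "R3xR3 set"
  assumes h: "subspace h" and br: "\<And>w w'. w \<in> h \<Longrightarrow> w' \<in> h \<Longrightarrow> (cross3 (fst w) (fst w'), cross3 (snd w) (snd w')) \<in> h"
    and big: "dim h \<ge> 3"
    and e: "\<And>w. w \<in> h \<Longrightarrow> e1 \<bullet> fst w + e2 \<bullet> snd w = 0" "e1 \<noteq> 0" "e2 \<noteq> 0"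
  obtains f where "orthogonal_transformation f" "\<And>x y. f (cross3 x y) = cross3 (f x) (f y)" "\<And>b. (f b, b) \<in> h"
proof -
  have big': "\<not> h \<subseteq> span {x, y}" for x y
  proof
    assume "h \<subseteq> span {x, y}"
    then have "dim h \<le> card {x, y}" by (rule dim_le_card) simp
    also have "\<dots> \<le> 2" by (simp add: card_insert_if)
    finally show False using big by simp
  qed
  have k2: "b = 0" if "(0, b) \<in> h" for b
    by (rule subalgebra_kernel_trivial[OF h br big' e that])
  have k1: "a = 0" if a: "(a, 0) \<in> h" for a
  proof -
    have ls: "linear (prod.swap :: R3xR3 \<Rightarrow> R3xR3)" by (rule linearI) auto
    have m: "w \<in> prod.swap ` h \<longleftrightarrow> prod.swap w \<in> h" for w by (metis image_iff swap_swap)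
    show ?thesis
    proof (rule subalgebra_kernel_trivial[of "prod.swap ` h" e2 e1 a])
      show "subspace (prod.swap ` h)" by (rule linear_subspace_image[OF ls h])
      show "(cross3 (fst w) (fst w'), cross3 (snd w) (snd w')) \<in> prod.swap ` h"
        if "w \<in> prod.swap ` h" "w' \<in> prod.swap ` h" for w w'
        using that br[of "prod.swap w" "prod.swap w'"] unfolding m by simp
      show "\<not> prod.swap ` h \<subseteq> span {x, y}" for x y
      proof
        assume "prod.swap ` h \<subseteq> span {x, y}"
        then have "prod.swap ` (prod.swap ` h) \<subseteq> prod.swap ` span {x, y}" by (rule image_mono)
        then have "h \<subseteq> span {prod.swap x, prod.swap y}"
          by (simp add: image_image linear_span_image[OF ls, symmetric])
        then show False using big' by blast
      qed
      show "e2 \<bullet> fst w + e1 \<bullet> snd w = 0" if "w \<in> prod.swap ` h" for w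
        using that e(1)[of "prod.swap w"] unfolding m by simp
      show "(0, a) \<in> prod.swap ` h" unfolding m using a by simp
    qed (use e in auto)
  qed
  have inj_snd: "inj_on snd h"
  proof (rule inj_onI)
    fix w w' assume w: "w \<in> h" "w' \<in> h" "snd w = snd w'"
    then have "(fst w - fst w', 0) \<in> h" using subspace_diff[OF h w(1,2)] by (simp add: minus_prod_def)
    then show "w = w'" using k1 w(3) by (fastforce simp: prod_eq_iff)
  qed
  have "dim (snd ` h) = dim h"
    by (rule dim_image_eq[OF linear_snd]) (use inj_snd h in \<open>simp add: span_eq_iff[THEN iffD2]\<close>)
  then have "dim (snd ` h) \<ge> dim (UNIV :: (real^3) set)" using big by (simp add: dim_UNIV)
  then have sU: "snd ` h = UNIV"
    using subspace_dim_equal[OF linear_subspace_image[OF linear_snd h] subspace_UNIV] by simp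
  have "\<forall>b. \<exists>a. (a, b) \<in> h"
  proof
    fix b
    have "b \<in> snd ` h" using sU by simp
    then show "\<exists>a. (a, b) \<in> h" by (metis imageE prod.collapse)
  qed
  then obtain f where f: "\<And>b. (f b, b) \<in> h" by metis
  have uniq: "a = f b" if "(a, b) \<in> h" for a b
    using inj_onD[OF inj_snd _ that f[of b]] by simp
  have lin: "linear f"
  proof (rule linearI)
    show "f (x + y) = f x + f y" for x y using uniq subspace_add[OF h f[of x] f[of y]] by simp
    show "f (k *\<^sub>R x) = k *\<^sub>R f x" for k x using uniq subspace_scale[OF h f[of x], of k] by simp
  qed
  have cr: "f (cross3 x y) = cross3 (f x) (f y)" for x y using uniq br[OF f[of x] f[of y]] by simp
  have "inj f" unfolding linear_injective_0[OF lin] using f k2 by metis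
  then show ?thesis using that cross_hom_orthogonal[OF lin _ cr] cr f by blast
qed

text \<open>Unless p and Q are parallel, a is a multiple of their cross product, and expanding the
  triple products turns the hypothesis n into the conclusion. If they are parallel, each summand
  vanishes. It is used with Q = f(q): a vector orthogonal to the normal does not change p .
  f(q).\<close>

lemma parallel_cross_tangent:
  fixes p Q a v w :: "real^3"
  assumes p: "p \<bullet> p = 1" "Q \<bullet> Q = 1" and a: "a \<noteq> 0" "a \<bullet> p = 0" "a \<bullet> Q = 0" and v: "v \<bullet> p = 0" "w \<bullet> Q = 0"
    and n: "v \<bullet> cross3 p a - w \<bullet> cross3 Q a = 0"
  shows "v \<bullet> Q + w \<bullet> p = 0"
proof (cases "cross3 p Q = 0")
  case True
  then have "collinear {0, p, Q}" using cross_eq_0 by blast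
  then obtain k where k: "Q = k *\<^sub>R p" using p unfolding collinear_lemma by auto
  have "w \<bullet> p = 0" using v(2) k p(2) by (cases "k = 0") auto
  then show ?thesis using v k by simp
next
  case False
  have "cross3 (cross3 p Q) a = 0" using a by (simp add: cross_cross_right inner_commute)
  then have "collinear {0, cross3 p Q, a}" using cross_eq_0 by blast
  then obtain k where k: "a = k *\<^sub>R cross3 p Q" using False a unfolding collinear_lemma by auto
  then have "k \<noteq> 0" using a by auto
  have "v \<bullet> cross3 p a - w \<bullet> cross3 Q a = - k * (v \<bullet> Q + w \<bullet> p)"
    using p v by (simp add: k cross_mult_right cross_cross_left inner_diff_right inner_commute algebra_simps)
  then show ?thesis using n \<open>k \<noteq> 0\<close> by simp
qed

section \<open>Both normal components nonzero: level sets of p . f(q)\<close>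

context patch begin

text \<open>Tangency of all Killing fields (f b, b) forces \<alpha> = - f(\<beta>), so that the
  normal is made of p and f(q) as in \<open>parallel_cross_tangent\<close>, and the derivative of p
  . f(q) vanishes.\<close>

lemma killing_graph_level:
  assumes B: "open B" "B \<subseteq> S" "ball c0 \<rho> \<subseteq> B" "\<rho> > 0" and n: "\<And>u. u \<in> B \<Longrightarrow> n1 u \<noteq> 0" "\<And>u. u \<in> B \<Longrightarrow> n2 u \<noteq> 0"
    and big: "dim (killing B) \<ge> 3"
  obtains R t where "orthogonal_matrix R" "\<bar>t\<bar> < 1" "\<And>u. u \<in> ball c0 \<rho> \<Longrightarrow> p u \<bullet> (R *v q u) = t"
proof -
  have c0: "c0 \<in> B" using B by auto
  have ab0: "\<alpha> u \<noteq> 0" "\<beta> u \<noteq> 0" if "u \<in> B" for u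
    using cross_n[of u] n[OF that] by (auto simp: n1_def n2_def)
  \<comment> \<open>Moving the cross product from the generator to the normal turns tangency into
    orthogonality to (\<alpha>, \<beta>). This puts the algebra into a hyperplane with both conormal
    components nonzero.\<close>
  have perp: "\<alpha> u \<bullet> fst w + \<beta> u \<bullet> snd w = 0" if w: "w \<in> killing B" and u: "u \<in> B" for u w
  proof -
    have "n1 u \<bullet> cross3 (fst w) (p u) + n2 u \<bullet> cross3 (snd w) (q u) = 0" using w u unfolding killing_def by blast
    moreover have "n1 u \<bullet> cross3 (fst w) (p u) = fst w \<bullet> cross3 (p u) (n1 u)" "n2 u \<bullet> cross3 (snd w) (q u) = snd w \<bullet> cross3 (q u) (n2 u)"
      by (simp_all add: cross3_simps)
    ultimately show ?thesis using cross_n[of u] u B by (simp add: inner_commute subset_iff)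
  qed
  obtain f where f: "orthogonal_transformation f" "\<And>x y. f (cross3 x y) = cross3 (f x) (f y)" "\<And>b. (f b, b) \<in> killing B"
    using subalgebra_rotation_graph[OF subspace_killing killing_bracket[OF B(1,2)] big perp[OF _ c0] ab0[OF c0]]
    by blast
  have lf: "linear f" using f(1) orthogonal_transformation_linear by blast
  have bf: "bounded_linear f" using lf linear_conv_bounded_linear by blast
  have fi: "f x \<bullet> f y = x \<bullet> y" for x y using f(1) by (simp add: orthogonal_transformation_def)
  have ae: "\<alpha> u = - f (\<beta> u)" if u: "u \<in> B" for u
  proof -
    have "(\<alpha> u + f (\<beta> u)) \<bullet> f b = 0" for b using perp[OF f(3) u, of b] by (simp add: inner_add_left fi)
    then have "(\<alpha> u + f (\<beta> u)) \<bullet> x = 0" for x using orthogonal_transformation_surj[OF f(1)] by (metis surjD)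
    then have "\<alpha> u + f (\<beta> u) = 0" using inner_eq_zero_iff by blast
    then show ?thesis by (simp add: eq_neg_iff_add_eq_0)
  qed
  have dzero: "dp u \<xi> \<bullet> f (q u) + p u \<bullet> f (dq u \<xi>) = 0" if u: "u \<in> B" for u \<xi>
  proof -
    have uS: "u \<in> S" using u B by blast
    have 1: "f (n2 u) = - cross3 (f (q u)) (\<alpha> u)" by (simp add: n2_def f(2) ae[OF u])
    have 2: "dq u \<xi> \<bullet> n2 u = f (dq u \<xi>) \<bullet> f (n2 u)" by (simp add: fi)
    have "dp u \<xi> \<bullet> cross3 (p u) (\<alpha> u) - f (dq u \<xi>) \<bullet> cross3 (f (q u)) (\<alpha> u) = 0"
      using normal[OF uS, of \<xi>] 2 by (simp add: 1 n1_def inner_commute)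
    moreover have "\<alpha> u \<bullet> f (q u) = 0" using \<beta>_tan[OF uS] by (simp add: ae[OF u] fi inner_commute)
    ultimately have "dp u \<xi> \<bullet> f (q u) + f (dq u \<xi>) \<bullet> p u = 0"
      by (intro parallel_cross_tangent[of "p u" "f (q u)" "\<alpha> u"])
         (use unit[OF uS] ab0[OF u] \<alpha>_tan[OF uS] tangent[OF uS] in \<open>simp_all add: fi inner_commute\<close>)
    then show ?thesis by (simp add: inner_commute)
  qed
  have "\<exists>t. \<forall>u\<in>ball c0 \<rho>. p u \<bullet> f (q u) = t"
  proof (rule has_derivative_zero_constant[OF convex_ball])
    fix u assume "u \<in> ball c0 \<rho>"
    then have u: "u \<in> B" "u \<in> S" using B by blast+
    have "((\<lambda>u. p u \<bullet> f (q u)) has_derivative (\<lambda>v. p u \<bullet> f (dq u v) + dp u v \<bullet> f (q u))) (at u)"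
      by (intro has_derivative_inner Dp bounded_linear.has_derivative[OF bf] Dq u)
    then have "((\<lambda>u. p u \<bullet> f (q u)) has_derivative (\<lambda>v. 0)) (at u)"
      using dzero[OF u(1)] by (simp add: add.commute)
    then show "((\<lambda>u. p u \<bullet> f (q u)) has_derivative (\<lambda>v. 0)) (at u within ball c0 \<rho>)"
      by (rule has_derivative_at_withinI)
  qed
  then obtain t where t: "\<And>u. u \<in> ball c0 \<rho> \<Longrightarrow> p u \<bullet> f (q u) = t" by blast
  have cS: "c0 \<in> S" using c0 B by blast
  have np: "norm (p u) = 1" "norm (f (q u)) = 1" if "u \<in> S" for u
    using unit[OF that] by (simp_all add: norm_eq_sqrt_inner fi)
  have "\<bar>t\<bar> \<le> 1" using Cauchy_Schwarz_ineq2[of "p c0" "f (q c0)"] t[of c0] B np[OF cS] by simp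
  \<comment> \<open>For |t| = 1 one has p = t f(q) on the ball, so dp vanishes wherever dq does, and
    the direction from \<open>dir1\<close> would give \<alpha> = 0.\<close>
  moreover have "\<bar>t\<bar> \<noteq> 1"
  proof
    assume t1: "\<bar>t\<bar> = 1"
    have eq: "p u = t *\<^sub>R f (q u)" if u: "u \<in> ball c0 \<rho>" for u
    proof -
      have uS: "u \<in> S" using u B by blast
      have "(p u - t *\<^sub>R f (q u)) \<bullet> (p u - t *\<^sub>R f (q u)) = p u \<bullet> p u - 2 * t * (p u \<bullet> f (q u)) + t\<^sup>2 * (q u \<bullet> q u)"
        by (simp add: inner_diff_left inner_diff_right fi inner_commute power2_eq_square algebra_simps)
      also have "\<dots> = 1 - t\<^sup>2" using unit[OF uS] t[OF u] by (simp add: power2_eq_square)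
      also have "\<dots> = 0" using t1 by (metis diff_self one_power2 power2_abs)
      finally show ?thesis by simp
    qed
    obtain \<xi> where x: "dp c0 \<xi> = \<alpha> c0" "dq c0 \<xi> = 0" using dir1[OF cS] by blast
    have "((\<lambda>u. t *\<^sub>R f (q u)) has_derivative (\<lambda>v. t *\<^sub>R f (dq c0 v))) (at c0)"
      by (intro has_derivative_scaleR_right bounded_linear.has_derivative[OF bf] Dq cS)
    then have "(p has_derivative (\<lambda>v. t *\<^sub>R f (dq c0 v))) (at c0)"
      by (rule has_derivative_transform_within_open[OF _ open_ball[of c0 \<rho>]]) (use B eq in auto)
    then have "dp c0 = (\<lambda>v. t *\<^sub>R f (dq c0 v))" using Dp[OF cS] has_derivative_unique by blast
    then have "\<alpha> c0 = 0" using x linear_0[OF lf] by (metis scaleR_zero_right)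
    then show False using ab0[OF c0] by blast
  qed
  ultimately have "\<bar>t\<bar> < 1" by simp
  moreover have "orthogonal_matrix (matrix f)" using f(1) orthogonal_transformation_matrix by blast
  moreover have "matrix f *v x = f x" for x using fun_cong[OF matrix_vector_mul(2)[OF lf]] .
  ultimately show ?thesis using that[of "matrix f" t] t by simp
qed

end

section \<open>One normal component zero: p of rank one\<close>

context patch begin

text \<open>The inverse of the target patch is Lipschitz on the image of its closed ball, so the
  transition map g between the parameters is continuous and injective. Invariance of domain makes
  its image open, hence contained in the open ball.\<close>

lemma transfer_open:
  assumes P: "patch \<Psi>' z' r' S' c'" and L: "linear L" "inj L"
    and B: "open B" "B \<subseteq> cball z r" and im: "\<And>w. w \<in> B \<Longrightarrow> L (\<Psi> w) \<in> \<Psi>' ` cball z' r'"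
  obtains g where "open (g ` B)" "g ` B \<subseteq> ball z' r'" "\<And>w. w \<in> B \<Longrightarrow> \<Psi>' (g w) = L (\<Psi> w)"
proof -
  interpret P: patch \<Psi>' z' r' S' c' by fact
  have "\<forall>w\<in>B. \<exists>y. y \<in> cball z' r' \<and> \<Psi>' y = L (\<Psi> w)"
  proof
    fix w assume "w \<in> B"
    obtain y where "L (\<Psi> w) = \<Psi>' y" "y \<in> cball z' r'" using im[OF \<open>w \<in> B\<close>] by (rule imageE)
    then show "\<exists>y. y \<in> cball z' r' \<and> \<Psi>' y = L (\<Psi> w)" by (intro exI[of _ y]) simp
  qed
  then obtain g where g': "\<forall>w\<in>B. g w \<in> cball z' r' \<and> \<Psi>' (g w) = L (\<Psi> w)" unfolding bchoice_iff by blast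
  then have g: "\<And>w. w \<in> B \<Longrightarrow> g w \<in> cball z' r'" "\<And>w. w \<in> B \<Longrightarrow> \<Psi>' (g w) = L (\<Psi> w)" by blast+
  have inj: "inj_on g B"
  proof (rule inj_onI)
    fix u v assume uv: "u \<in> B" "v \<in> B" "g u = g v"
    then have "\<Psi> u = \<Psi> v" using g(2) L(2) by (metis inj_eq)
    moreover have "u \<in> cball z r" "v \<in> cball z r" using uv B by blast+
    ultimately have "c * norm (u - v) \<le> 0" using low[of u v] by simp
    then show "u = v" using c by (simp add: mult_le_0_iff)
  qed
  have "continuous_on B g"
  proof -
    have "continuous_on B (\<lambda>w. L (\<Psi> w))"
      by (rule bounded_linear.continuous_on[OF linear_conv_bounded_linear[THEN iffD1, OF L(1)] continuous_on_subset[OF cont B(2)]])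
    then have c: "\<And>x e. x \<in> B \<Longrightarrow> e > 0 \<Longrightarrow> \<exists>d>0. \<forall>y\<in>B. dist y x < d \<longrightarrow> dist (L (\<Psi> y)) (L (\<Psi> x)) < e"
      unfolding continuous_on_iff by blast
    show ?thesis unfolding continuous_on_iff
    proof (intro ballI allI impI)
      fix x e assume x: "x \<in> B" and e: "(0::real) < e"
      obtain d where d: "d > 0" "\<And>y. y \<in> B \<Longrightarrow> dist y x < d \<Longrightarrow> dist (L (\<Psi> y)) (L (\<Psi> x)) < c' * e"
        using c[OF x, of "c' * e"] P.c e by auto
      have "dist (g y) (g x) < e" if "y \<in> B" "dist y x < d" for y
      proof -
        have "c' * dist (g y) (g x) \<le> dist (L (\<Psi> y)) (L (\<Psi> x))"
          using P.low[OF g(1)[OF that(1)] g(1)[OF x]] by (simp add: dist_norm g(2) that(1) x)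
        also have "\<dots> < c' * e" by (rule d(2)[OF that])
        finally show ?thesis using P.c by simp
      qed
      then show "\<exists>d>0. \<forall>y\<in>B. dist y x < d \<longrightarrow> dist (g y) (g x) < e" using d(1) by blast
    qed
  qed
  then have op: "open (g ` B)" using inj B(1) invariance_of_domain by blast
  then have "g ` B \<subseteq> interior (cball z' r')" using g(1) interior_maximal[of "g ` B"] by blast
  then show ?thesis using that[OF op] g(2) by (simp add: interior_cball)
qed

lemma dp_parallel:
  assumes u: "u \<in> S" "n2 u = 0"
  obtains k where "dp u \<xi> = k *\<^sub>R \<alpha> u"
proof -
  have n1: "n1 u \<noteq> 0" using normal_nz u by blast
  have a0: "\<alpha> u \<noteq> 0" using n1 by (auto simp: n1_def)
  have "n1 u \<bullet> dp u \<xi> = 0" using normal[OF u(1), of \<xi>] u(2) by simp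
  then have "cross3 (cross3 (p u) (n1 u)) (dp u \<xi>) = 0"
    using tangent(1)[OF u(1)] by (simp add: cross_cross_right)
  then have "cross3 (\<alpha> u) (dp u \<xi>) = 0" by (simp add: cross_n[OF u(1)])
  then have "collinear {0, \<alpha> u, dp u \<xi>}" using cross_eq_0 by blast
  then show ?thesis using that a0 unfolding collinear_lemma by (metis scale_zero_left)
qed

text \<open>Since dp is everywhere a multiple of \<alpha>, near u0 the image of p is a regular C1
  curve, and its chords make a small angle with the tangent line. The bound is relative to the chord
  of p and not to |u - u0|; differentiability at u0 alone would not give this, because p is constant
  in two directions.\<close>

lemma constant_rank:
  assumes V: "open V" "V \<subseteq> S" "u0 \<in> V" and n2: "\<And>u. u \<in> V \<Longrightarrow> n2 u = 0"
    and n: "\<And>\<xi>. n \<bullet> dp u0 \<xi> = 0" and e: "e > 0"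
  obtains d where "d > 0" "\<And>u. u \<in> ball u0 d \<Longrightarrow> \<bar>n \<bullet> (p u - p u0)\<bar> \<le> e * norm (p u - p u0)"
proof -
  have u0S: "u0 \<in> S" using V by blast
  define T0 where "T0 = \<alpha> u0"
  have "n1 u0 \<noteq> 0" using normal_nz[OF u0S] n2 V by blast
  then have T0: "T0 \<noteq> 0" by (auto simp: T0_def n1_def)
  define m where "m = T0 \<bullet> T0"
  have m: "m > 0" using T0 by (metis m_def inner_gt_zero_iff)
  obtain \<xi>1 where x1: "dp u0 \<xi>1 = T0" using dir1[OF u0S] T0_def by metis
  define l where "l \<xi> = T0 \<bullet> dp u0 \<xi>" for \<xi>
  have ll: "linear l" unfolding l_def
    by (rule linearI) (simp_all add: linear_add[OF lin_dp[OF u0S]] linear_scale[OF lin_dp[OF u0S]] inner_add_right)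
  have lx1: "l \<xi>1 = m" by (simp add: l_def x1 m_def)
  \<comment> \<open>A change of coordinates in which the linear form l becomes T0 . p, where T0 is
    the velocity \<alpha> at u0. Its derivative at u0 is the identity because l is the differential
    of T0 . p there.\<close>
  define \<phi> where "\<phi> u = u + ((T0 \<bullet> p u - l u) / m) *\<^sub>R \<xi>1" for u
  define \<phi>' where "\<phi>' u \<xi> = \<xi> + ((T0 \<bullet> dp u \<xi> - l \<xi>) / m) *\<^sub>R \<xi>1" for u \<xi>
  have l\<phi>: "l (\<phi> u) = T0 \<bullet> p u" for u
    using m by (simp add: \<phi>_def linear_add[OF ll] linear_scale[OF ll] lx1)
  have l\<phi>': "l (\<phi>' u \<xi>) = T0 \<bullet> dp u \<xi>" for u \<xi>
    using m by (simp add: \<phi>'_def linear_add[OF ll] linear_scale[OF ll] lx1)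
  have bll: "bounded_linear l" using ll linear_conv_bounded_linear by blast
  have Dl: "(l has_derivative l) (at u)" for u by (rule bounded_linear.has_derivative[OF bll has_derivative_ident])
  have D\<phi>: "(\<phi> has_derivative \<phi>' u) (at u)" if "u \<in> S" for u
    unfolding \<phi>_def \<phi>'_def
    by (auto intro!: derivative_eq_intros Dp[OF that] Dl simp: divide_inverse)
  \<comment> \<open>Where T0 . \<alpha> is positive, a multiple of \<alpha> with no T0 component is
    zero.\<close>
  define W where "W = {u \<in> V. T0 \<bullet> \<alpha> u > 0}"
  have cW: "continuous_on V (\<lambda>u. T0 \<bullet> \<alpha> u)"
    by (intro continuous_on_inner continuous_on_const continuous_on_subset[OF C1_on_imp_continuous[OF C1_\<alpha>] V(2)])
  have W: "open W" "W \<subseteq> V" "u0 \<in> W"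
  proof -
    have "open (V \<inter> (\<lambda>u. T0 \<bullet> \<alpha> u) -` {0<..})"
      by (rule continuous_open_preimage[OF cW V(1)]) simp
    moreover have "W = V \<inter> (\<lambda>u. T0 \<bullet> \<alpha> u) -` {0<..}" by (auto simp: W_def)
    ultimately show "open W" by simp
    show "W \<subseteq> V" by (auto simp: W_def)
    show "u0 \<in> W" using V(3) m by (simp add: W_def m_def T0_def)
  qed
  have WS: "W \<subseteq> S" using W V by blast
  have bl\<phi>': "bounded_linear (\<phi>' u)" if "u \<in> S" for u using D\<phi>[OF that] has_derivative_bounded_linear by blast
  have app: "blinfun_apply (Blinfun (\<phi>' u)) = \<phi>' u" if "u \<in> S" for u
    by (rule bounded_linear_Blinfun_apply[OF bl\<phi>'[OF that]])
  have d0: "\<phi>' u0 = id" by (auto simp: \<phi>'_def l_def)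
  have contB: "continuous_on W (\<lambda>u. Blinfun (\<phi>' u))"
  proof (rule continuous_on_blinfun_componentwise)
    fix i :: "real^3" assume "i \<in> Basis"
    have "continuous_on W (\<lambda>u. \<phi>' u i)" unfolding \<phi>'_def divide_inverse
      by (intro continuous_intros continuous_on_subset[OF C1_on_imp_continuous[OF C1_dp] WS])
    then show "continuous_on W (\<lambda>u. blinfun_apply (Blinfun (\<phi>' u)) i)"
      by (rule continuous_on_eq) (use app WS in \<open>simp add: subset_iff\<close>)
  qed
  have invB: "id_blinfun o\<^sub>L Blinfun (\<phi>' u0) = id_blinfun"
    by (rule blinfun_eqI) (simp add: app[OF u0S, unfolded d0] d0)
  obtain U' V' g g' where IF: "open U'" "U' \<subseteq> W" "u0 \<in> U'" "open V'" "\<phi> u0 \<in> V'" "homeomorphism U' V' \<phi> g"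
    "\<And>y. y \<in> V' \<Longrightarrow> (g has_derivative (g' y)) (at y)"
    "\<And>y. y \<in> V' \<Longrightarrow> g' y = inv (blinfun_apply (Blinfun (\<phi>' (g y))))"
    "\<And>y. y \<in> V' \<Longrightarrow> bij (blinfun_apply (Blinfun (\<phi>' (g y))))"
  proof (rule inverse_function_theorem[OF W(1) _ contB W(3) invB])
    show "(\<phi> has_derivative blinfun_apply (Blinfun (\<phi>' u))) (at u)" if "u \<in> W" for u
      using D\<phi> app WS that by (simp add: subset_iff)
  qed blast
  have gU: "g y \<in> U'" "\<phi> (g y) = y" if "y \<in> V'" for y
    using IF(6) that by (auto simp: homeomorphism_def)
  have g\<phi>: "g (\<phi> u) = u" "\<phi> u \<in> V'" if "u \<in> U'" for u
    using IF(6) that by (auto simp: homeomorphism_def)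
  define y0 where "y0 = \<phi> u0"
  have y0: "y0 \<in> V'" "g y0 = u0" using IF g\<phi> y0_def by auto
  define h where "h y = p (g y)" for y
  have gS: "g y \<in> S" if "y \<in> V'" for y using gU[OF that] IF(2) WS by blast
  have Dh: "(h has_derivative (\<lambda>v. dp (g y) (g' y v))) (at y)" if "y \<in> V'" for y
    unfolding h_def by (rule has_derivative_compose[OF IF(7)[OF that] Dp[OF gS[OF that]]])
  \<comment> \<open>In the new coordinates a direction in the kernel of l does not change T0 . p.
    The derivative of p in that direction is a multiple of \<alpha>, so it vanishes: locally p
    factors through l.\<close>
  have flat: "dp (g y) (g' y \<eta>) = 0" if y: "y \<in> V'" and \<eta>: "l \<eta> = 0" for y \<eta>
  proof -
    have "\<phi>' (g y) (g' y \<eta>) = \<eta>"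
      using IF(8,9)[OF y] by (simp add: app[OF gS[OF y]] bij_is_surj surj_f_inv_f)
    then have z: "T0 \<bullet> dp (g y) (g' y \<eta>) = 0" using l\<phi>'[of "g y" "g' y \<eta>"] \<eta> by simp
    have gW: "g y \<in> W" using gU[OF y] IF(2) by blast
    obtain k where k: "dp (g y) (g' y \<eta>) = k *\<^sub>R \<alpha> (g y)"
      using dp_parallel[OF gS[OF y]] n2 gW W(2) by blast
    then have "k * (T0 \<bullet> \<alpha> (g y)) = 0" using z by simp
    then show ?thesis using k gW by (simp add: W_def)
  qed
  have g'0: "g' y0 = id" using IF(8)[OF y0(1)] by (simp add: y0 app[OF u0S, unfolded d0] d0)
  obtain \<delta> where \<delta>: "\<delta> > 0" "ball y0 \<delta> \<subseteq> V'" using IF(4) y0(1) open_contains_ball by blast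
  obtain Kl where Kl: "Kl > 0" "\<And>x. \<bar>l x\<bar> \<le> Kl * norm x"
    using bounded_linear.pos_bounded[OF bll] by (auto simp: mult.commute)
  define N where "N = norm n + 1"
  \<comment> \<open>Chosen so that an error \<open>e' * norm (y' - y0)\<close>, multiplied by |n|,
    is at most e |\<sigma>| |T0|, and the chord is at least |\<sigma>| |T0|.\<close>
  define e' where "e' = e * norm T0 / ((norm n + 1) * (norm \<xi>1 + 1))"
  have npos: "norm n + 1 > 0" "norm \<xi>1 + 1 > 0" by (simp_all add: add_nonneg_pos)
  have e': "e' > 0" using e T0 npos by (simp add: e'_def)
  have "\<exists>d>0. \<forall>y. norm (y - y0) < d \<longrightarrow> norm (h y - h y0 - dp (g y0) (g' y0 (y - y0))) \<le> e' * norm (y - y0)"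
    using Dh[OF y0(1)] e' unfolding has_derivative_at_alt by blast
  then obtain d1 where d1: "d1 > 0" "\<And>y. norm (y - y0) < d1 \<Longrightarrow> norm (h y - h y0 - dp u0 (y - y0)) \<le> e' * norm (y - y0)"
    by (auto simp: y0 g'0)
  \<comment> \<open>The point y' below is at most C times as far from y0 as y is, so dividing the
    radius by C keeps it in the ball.\<close>
  define C where "C = Kl / m * norm \<xi>1 + 1"
  have C: "C \<ge> 1" using Kl m by (simp add: C_def)
  define d2 where "d2 = min \<delta> d1 / C"
  have "min \<delta> d1 > 0" using \<delta> d1 by simp
  moreover from this have "min \<delta> d1 * 1 \<le> min \<delta> d1 * C" using C by (intro mult_left_mono) auto
  ultimately have d2: "d2 > 0" "d2 \<le> min \<delta> d1" unfolding d2_def using C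
    by (simp_all only: divide_le_eq) simp_all
  have main: "\<bar>n \<bullet> (h y - h y0)\<bar> \<le> e * norm (h y - h y0)" if y: "y \<in> ball y0 d2" for y
  proof -
    \<comment> \<open>On the line through y0 in the direction \<xi>1, y' is the point with the same
      value of l as y. By \<open>flat\<close> the segment from y to y' has constant image, so y can
      be replaced by y'.\<close>
    define \<sigma> where "\<sigma> = l (y - y0) / m"
    define y' where "y' = y0 + \<sigma> *\<^sub>R \<xi>1"
    have ny: "norm (y - y0) < d2" using y by (simp add: dist_norm norm_minus_commute)
    have "norm (y' - y0) = \<bar>l (y - y0)\<bar> / m * norm \<xi>1" using m by (simp add: y'_def \<sigma>_def)
    also have "\<dots> \<le> (Kl * norm (y - y0)) / m * norm \<xi>1"
      using Kl m by (intro mult_right_mono divide_right_mono) auto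
    also have "\<dots> \<le> C * norm (y - y0)" by (simp add: C_def algebra_simps)
    also have "\<dots> < min \<delta> d1" using ny C by (simp add: d2_def pos_less_divide_eq mult.commute)
    finally have ny': "norm (y' - y0) < min \<delta> d1" .
    have yb: "y \<in> ball y0 \<delta>" "y' \<in> ball y0 \<delta>" using ny d2 ny' by (simp_all add: dist_norm norm_minus_commute)
    have seg: "y + t *\<^sub>R (y' - y) \<in> V'" if t: "t \<in> {0..1}" for t
    proof -
      have "(1 - t) *\<^sub>R y + t *\<^sub>R y' \<in> ball y0 \<delta>" using convexD_alt[OF convex_ball yb] t by simp
      then show ?thesis using \<delta>(2) by (auto simp: algebra_simps)
    qed
    have lz: "l (y' - y) = 0" using m
      by (simp add: y'_def linear_add[OF ll] linear_diff[OF ll] linear_scale[OF ll] lx1 \<sigma>_def)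
    have "\<exists>k. \<forall>t\<in>{0..1::real}. h (y + t *\<^sub>R (y' - y)) = k"
    proof (rule has_derivative_zero_constant)
      fix t :: real assume t: "t \<in> {0..1}"
      have "((\<lambda>t. y + t *\<^sub>R (y' - y)) has_derivative (\<lambda>s. s *\<^sub>R (y' - y))) (at t)"
        by (auto intro!: derivative_eq_intros)
      from has_derivative_compose[OF this Dh[OF seg[OF t]]]
      have "((\<lambda>t. h (y + t *\<^sub>R (y' - y))) has_derivative (\<lambda>s. dp (g (y + t *\<^sub>R (y' - y))) (g' (y + t *\<^sub>R (y' - y)) (s *\<^sub>R (y' - y))))) (at t)" .
      then have "((\<lambda>t. h (y + t *\<^sub>R (y' - y))) has_derivative (\<lambda>s. 0)) (at t)"
        using flat[OF seg[OF t]] lz by (simp add: linear_scale[OF ll])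
      then show "((\<lambda>t. h (y + t *\<^sub>R (y' - y))) has_derivative (\<lambda>s. 0)) (at t within {0..1})"
        by (rule has_derivative_at_withinI)
    qed simp
    then obtain k where k: "\<And>t. t \<in> {0..1::real} \<Longrightarrow> h (y + t *\<^sub>R (y' - y)) = k" by blast
    have hy: "h y = h y'" using k[of 0] k[of 1] by simp
    have y'V: "y' \<in> V'" using yb \<delta> by blast
    \<comment> \<open>The T0 component of the chord is known exactly and bounds the chord from
      below.\<close>
    have "T0 \<bullet> (h y' - h y0) = l y' - l y0"
      unfolding h_def inner_diff_right l\<phi>[symmetric] using gU(2)[OF y'V] gU(2)[OF y0(1)] by simp
    also have "\<dots> = \<sigma> * m" by (simp add: y'_def linear_add[OF ll] linear_scale[OF ll] lx1)
    finally have "\<bar>\<sigma>\<bar> * m = \<bar>T0 \<bullet> (h y' - h y0)\<bar>" using m by (simp add: abs_mult)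
    also have "\<dots> \<le> norm T0 * norm (h y' - h y0)" by (rule Cauchy_Schwarz_ineq2)
    finally have "\<bar>\<sigma>\<bar> * (norm T0 * norm T0) \<le> norm T0 * norm (h y' - h y0)"
      by (simp add: m_def power2_norm_eq_inner[symmetric] power2_eq_square)
    then have low': "\<bar>\<sigma>\<bar> * norm T0 \<le> norm (h y' - h y0)" using T0 by simp
    have "n \<bullet> (h y' - h y0) = n \<bullet> (h y' - h y0 - dp u0 (y' - y0))" by (simp add: inner_diff_right n)
    then have "\<bar>n \<bullet> (h y' - h y0)\<bar> \<le> norm n * norm (h y' - h y0 - dp u0 (y' - y0))"
      by (simp only: Cauchy_Schwarz_ineq2)
    also have "\<dots> \<le> norm n * (e' * norm (y' - y0))" using d1(2) ny' by (intro mult_left_mono) auto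
    also have "\<dots> = (norm n * norm \<xi>1) * (e' * \<bar>\<sigma>\<bar>)" by (simp add: y'_def)
    also have "\<dots> \<le> ((norm n + 1) * (norm \<xi>1 + 1)) * (e' * \<bar>\<sigma>\<bar>)"
      using e' by (intro mult_right_mono mult_mono) auto
    also have "\<dots> = e * (\<bar>\<sigma>\<bar> * norm T0)" using npos by (simp add: e'_def)
    also have "\<dots> \<le> e * norm (h y' - h y0)" using low' e by (intro mult_left_mono) auto
    finally show ?thesis by (simp add: hy)
  qed
  have "open (U' \<inter> \<phi> -` ball y0 d2)"
  proof (rule continuous_open_preimage[OF _ IF(1) open_ball])
    show "continuous_on U' \<phi>" using IF(6) by (simp add: homeomorphism_def)
  qed
  moreover have "u0 \<in> U' \<inter> \<phi> -` ball y0 d2" using IF(3) d2 y0_def by simp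
  ultimately obtain d where d: "d > 0" "ball u0 d \<subseteq> U' \<inter> \<phi> -` ball y0 d2" using open_contains_ball by blast
  have "\<bar>n \<bullet> (p u - p u0)\<bar> \<le> e * norm (p u - p u0)" if "u \<in> ball u0 d" for u
  proof -
    have u: "u \<in> U'" "\<phi> u \<in> ball y0 d2" using that d by auto
    have "h (\<phi> u) = p u" "h y0 = p u0" using g\<phi>[OF u(1)] y0 by (simp_all add: h_def)
    then show ?thesis using main[OF u(2)] by simp
  qed
  then show ?thesis using that d by blast
qed

end

context patch begin

text \<open>Otherwise normalized differences of first matrices converge to a unit Y0, with generator
  a. At every u in B the first components of the moved points run along the curve traced by the
  target patch, so by \<open>constant_rank\<close> the limit Y0 p(u) has no component normal to that
  curve. This says that a is orthogonal to \<alpha> u, so a = 0 by \<open>no\<close> and Y0 =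
  0.\<close>

lemma movers_first_isolated:
  assumes P: "patch \<Psi>' z' r' S' c'" and B: "open B" "B \<subseteq> ball z r" and n2: "\<And>u. u \<in> B \<Longrightarrow> n2 u = 0"
    and dich: "\<And>u. u \<in> ball z' r' \<Longrightarrow> patch.n1 \<Psi>' u = 0 \<or> patch.n2 \<Psi>' u = 0"
    and A: "A \<in> movers \<Psi> B (\<Psi>' ` cball z' r')" and no: "\<And>a. (\<And>u. u \<in> B \<Longrightarrow> a \<bullet> \<alpha> u = 0) \<Longrightarrow> a = 0"
  obtains e where "e > 0" "\<And>T. T \<in> movers \<Psi> B (\<Psi>' ` cball z' r') \<Longrightarrow> T \<in> ball A e \<Longrightarrow> fst T = fst A"
proof (rule ccontr)
  interpret P: patch \<Psi>' z' r' S' c' by fact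
  let ?M = "movers \<Psi> B (\<Psi>' ` cball z' r')"
  assume "\<not> thesis"
  then have neg: "\<And>e. e > 0 \<Longrightarrow> \<exists>T\<in>?M \<inter> ball A e. fst T \<noteq> fst A" using that by blast
  have "\<forall>n. \<exists>T. T \<in> ?M \<inter> ball A (1 / Suc n) \<and> fst T \<noteq> fst A"
  proof
    fix n
    have "(1::real) / Suc n > 0" by simp
    from neg[OF this] show "\<exists>T. T \<in> ?M \<inter> ball A (1 / Suc n) \<and> fst T \<noteq> fst A" by blast
  qed
  then obtain X where X': "\<forall>n. X n \<in> ?M \<inter> ball A (1 / Suc n) \<and> fst (X n) \<noteq> fst A" by (rule choice[THEN exE])
  then have X: "\<And>n. X n \<in> ?M" "\<And>n. X n \<in> ball A (1 / Suc n)" "\<And>n. fst (X n) \<noteq> fst A" by blast+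
  have XA: "X \<longlonglongrightarrow> A"
  proof -
    have "(\<lambda>n. dist (X n) A) \<longlonglongrightarrow> 0"
    proof (rule Lim_null_comparison[OF _ LIMSEQ_Suc[OF lim_const_over_n[of 1]]])
      show "\<forall>\<^sub>F n in sequentially. norm (dist (X n) A) \<le> 1 / real (Suc n)"
        using X(2) by (intro always_eventually) (auto simp: dist_commute less_imp_le)
    qed
    then show ?thesis using tendsto_dist_iff by blast
  qed
  define Y where "Y n = (1 / norm (fst (X n) - fst A)) *\<^sub>R (fst (X n) - fst A)" for n
  have Y1: "norm (Y n) = 1" for n using X(3)[of n] by (simp add: Y_def)
  have "\<And>n. Y n \<in> sphere 0 1" using Y1 by simp
  then obtain Y0 s where Y0: "Y0 \<in> sphere 0 1" "strict_mono s" "(Y \<circ> s) \<longlonglongrightarrow> Y0"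
    using compact_sphere[of 0 1] unfolding compact_def by metis
  have oA: "orthogonal_matrix (fst A)" using moversD(1)[OF A] by (simp add: orth_pairs_def)
  have oX: "orthogonal_matrix (fst (X n))" for n using moversD(1)[OF X(1)] by (simp add: orth_pairs_def)
  have Xs: "(\<lambda>k. X (s k)) \<longlonglongrightarrow> A" using LIMSEQ_subseq_LIMSEQ[OF XA Y0(2)] by (simp add: o_def)
  have Ys: "(\<lambda>k. Y (s k)) \<longlonglongrightarrow> Y0" using Y0(3) by (simp add: o_def)
  have sk: "transpose (transpose (fst A) ** Y0) + transpose (fst A) ** Y0 = 0"
    by (rule orthogonal_difference_skew[OF oX oA tendsto_fst[OF Xs] tendsto_const])
       (use Ys in \<open>simp add: Y_def\<close>)
  define a where "a = axial (transpose (fst A) ** Y0)"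
  obtain g where g: "open (g ` B)" "g ` B \<subseteq> ball z' r'" "\<And>w. w \<in> B \<Longrightarrow> \<Psi>' (g w) = act A (\<Psi> w)"
    using transfer_open[OF P act_linear act_inj[OF moversD(1)[OF A]] B(1) order_trans[OF B(2) ball_subset_cball] moversD(2)[OF A]]
    by blast
  have "a \<bullet> \<alpha> u = 0" if u: "u \<in> B" for u
  proof -
    have uS: "u \<in> S" using u B ball_sub by blast
    have n1: "n1 u \<noteq> 0" using normal_nz[OF uS] n2[OF u] by blast
    define u' where "u' = g u"
    have u'b: "u' \<in> ball z' r'" using g u by (auto simp: u'_def)
    then have u'c: "u' \<in> cball z' r'" and u'S: "u' \<in> S'" using P.ball_sub by auto
    have pu': "P.p u' = fst A *v p u" using g(3)[OF u] by (simp add: P.\<Psi>_eq \<Psi>_eq act_def u'_def)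
    define n where "n = fst A *v n1 u"
    have tr: "range (Dv \<Psi>' u') = act A ` range (Dv \<Psi> u)"
      by (rule tangent_transfer[OF P act_linear act_inj[OF moversD(1)[OF A]] B(1) u uS moversD(2)[OF A] u'c])
         (use g(3)[OF u] in \<open>simp_all add: u'_def\<close>)
    have nperp: "n \<bullet> P.dp u' \<xi> = 0" for \<xi>
    proof -
      obtain \<eta> where "Dv \<Psi>' u' \<xi> = act A (Dv \<Psi> u \<eta>)" using tr by blast
      then have "P.dp u' \<xi> = fst A *v dp u \<eta>" by (simp add: P.D_eq D_eq act_def)
      then have "n \<bullet> P.dp u' \<xi> = n1 u \<bullet> dp u \<eta>" by (simp add: n_def orthogonal_matrix_inner[OF oA])
      then show ?thesis using normal[OF uS, of \<eta>] n2[OF u] by simp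
    qed
    have n0: "n \<noteq> 0" using n1 orthogonal_matrix_inner[OF oA, of "n1 u" "n1 u"] by (metis n_def inner_eq_zero_iff)
    have "P.p u' \<bullet> n = 0" by (simp add: pu' n_def orthogonal_matrix_inner[OF oA] n_tan)
    \<comment> \<open>The normal (n1, 0), moved by A, is a multiple of the normal of the target
      patch at u'. So the first normal component of the target is nonzero near u', and
      \<open>dich\<close> makes the second one vanish on V.\<close>
    then obtain l where l: "n = l *\<^sub>R P.n1 u'" "0 = l *\<^sub>R P.n2 u'"
      using P.normal_unique[OF u'S, of n 0] nperp by auto
    then have n1': "P.n1 u' \<noteq> 0" using n0 by auto
    define V where "V = {w \<in> ball z' r'. P.n1 w \<noteq> 0}"
    have oV: "open V"
    proof -
      have "open (ball z' r' \<inter> P.n1 -` (- {0}))"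
        by (rule continuous_open_preimage[OF continuous_on_subset[OF C1_on_imp_continuous[OF P.C1_n1] P.ball_sub]]) auto
      moreover have "V = ball z' r' \<inter> P.n1 -` (- {0})" by (auto simp: V_def)
      ultimately show ?thesis by simp
    qed
    have V: "V \<subseteq> S'" "u' \<in> V" "\<And>w. w \<in> V \<Longrightarrow> P.n2 w = 0"
      using P.ball_sub u'b n1' dich by (auto simp: V_def)
    obtain K where K: "K > 0" "\<And>(M::real^3^3) (x::real^3). norm (M *v x) \<le> norm M * norm x * K"
      using bounded_bilinear.pos_bounded[OF bounded_bilinear_matrix_vector] by blast
    have ex: "\<forall>k. \<exists>w. w \<in> cball z' r' \<and> \<Psi>' w = act (X (s k)) (\<Psi> u)"
    proof
      fix k
      obtain w where "act (X (s k)) (\<Psi> u) = \<Psi>' w" "w \<in> cball z' r'" using moversD(2)[OF X(1) u] by (rule imageE)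
      then show "\<exists>w. w \<in> cball z' r' \<and> \<Psi>' w = act (X (s k)) (\<Psi> u)" by (intro exI[of _ w]) simp
    qed
    then obtain v where v': "\<forall>k. v k \<in> cball z' r' \<and> \<Psi>' (v k) = act (X (s k)) (\<Psi> u)" by (rule choice[THEN exE])
    then have v: "\<And>k. v k \<in> cball z' r'" "\<And>k. \<Psi>' (v k) = act (X (s k)) (\<Psi> u)" by blast+
    have vl: "v \<longlonglongrightarrow> u'"
    proof -
      have l1: "(\<lambda>k. \<Psi>' (v k) - \<Psi>' u') \<longlonglongrightarrow> 0"
        unfolding v(2) u'_def g(3)[OF u] by (rule LIM_zero[OF tendsto_act[OF Xs tendsto_const]])
      have "(\<lambda>k. v k - u') \<longlonglongrightarrow> 0"
      proof (rule Lim_null_comparison)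
        show "\<forall>\<^sub>F k in sequentially. norm (v k - u') \<le> norm (\<Psi>' (v k) - \<Psi>' u') / c'"
          using P.low[OF v(1) u'c] P.c by (intro always_eventually) (simp add: pos_le_divide_eq mult.commute)
        show "(\<lambda>k. norm (\<Psi>' (v k) - \<Psi>' u') / c') \<longlonglongrightarrow> 0"
          using tendsto_divide[OF tendsto_norm[OF l1] tendsto_const[of c']] P.c by simp
      qed
      then show ?thesis by (rule LIM_zero_cancel)
    qed
    have pv: "P.p (v k) = fst (X (s k)) *v p u" for k using v(2)[of k] by (simp add: P.\<Psi>_eq \<Psi>_eq act_def)
    have "(\<lambda>k. n \<bullet> (Y (s k) *v p u)) \<longlonglongrightarrow> n \<bullet> (Y0 *v p u)"
      by (intro tendsto_inner tendsto_const bounded_bilinear.tendsto[OF bounded_bilinear_matrix_vector Ys])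
    moreover have "(\<lambda>k. n \<bullet> (Y (s k) *v p u)) \<longlonglongrightarrow> 0"
      unfolding lim_sequentially
    proof (intro allI impI)
      fix e :: real assume e: "e > 0"
      have e2: "e / (2 * K) > 0" using e K by simp
      obtain d where d: "d > 0" "\<And>w. w \<in> ball u' d \<Longrightarrow> \<bar>n \<bullet> (P.p w - P.p u')\<bar> \<le> e / (2 * K) * norm (P.p w - P.p u')"
        using P.constant_rank[OF oV V(1,2,3) nperp e2] by blast
      obtain N where N: "\<And>k. k \<ge> N \<Longrightarrow> dist (v k) u' < d" using vl d(1) unfolding lim_sequentially by blast
      have "dist (n \<bullet> (Y (s k) *v p u)) 0 < e" if "k \<ge> N" for k
      proof -
        let ?m = "norm (fst (X (s k)) - fst A)"
        have m: "?m > 0" using X(3) by simp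
        have vk: "v k \<in> ball u' d" using N[OF that] by (simp add: dist_commute)
        have eq: "Y (s k) *v p u = (1 / ?m) *\<^sub>R (P.p (v k) - P.p u')"
          by (simp add: Y_def pv pu' matrix_vector_mult_diff_rdistrib scaleR_matrix_vector_assoc[symmetric])
        have "\<bar>n \<bullet> (Y (s k) *v p u)\<bar> = (1 / ?m) * \<bar>n \<bullet> (P.p (v k) - P.p u')\<bar>"
          unfolding eq using m by (simp add: abs_mult)
        also have "\<dots> \<le> (1 / ?m) * (e / (2 * K) * norm (P.p (v k) - P.p u'))"
          using d(2)[OF vk] m by (intro mult_left_mono) auto
        also have "\<dots> = e / (2 * K) * norm (Y (s k) *v p u)" unfolding eq using m by simp
        also have "\<dots> \<le> e / (2 * K) * (norm (Y (s k)) * norm (p u) * K)" using e2 K(2) by (intro mult_left_mono) auto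
        also have "\<dots> = e / 2" using K(1) Y1 unit(1)[OF uS] by (simp add: norm_eq_sqrt_inner)
        finally show ?thesis using e by (simp add: dist_real_def)
      qed
      then show "\<exists>no. \<forall>k\<ge>no. dist (n \<bullet> (Y (s k) *v p u)) 0 < e" by blast
    qed
    ultimately have "n \<bullet> (Y0 *v p u) = 0" using LIMSEQ_unique by blast
    moreover have "Y0 *v p u = fst A *v ((transpose (fst A) ** Y0) *v p u)"
      using oA by (simp add: matrix_vector_mul_assoc matrix_mul_assoc orthogonal_matrix_def)
    ultimately have "n1 u \<bullet> cross3 a (p u) = 0"
      by (simp add: n_def orthogonal_matrix_inner[OF oA] skew_eq_cross[OF sk] a_def)
    moreover have "n1 u \<bullet> cross3 a (p u) = a \<bullet> cross3 (p u) (n1 u)" by (simp add: cross3_simps)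
    ultimately show "a \<bullet> \<alpha> u = 0" by (simp add: cross_n[OF uS])
  qed
  then have "a = 0" by (rule no)
  then have "Y0 = 0" using orthogonal_matrix_cancel[OF oA skew_axial_zero[OF sk]] by (simp add: a_def)
  then show False using Y0(1) by simp
qed

text \<open>If no such a existed, every mover would have a neighbourhood in which the first matrix
  is constant, and by compactness only finitely many first matrices would occur. Then p, or q when L
  is the swap, takes finitely many values on U and is constant on a ball. Since \<alpha> is linear
  in dp and quadratic in dq, it would vanish there, against n1 being nonzero.\<close>

lemma circle_direction:
  assumes P: "patch \<Psi>' z' r' S' c'" and B: "open B" "B \<subseteq> ball z r" and n2: "\<And>u. u \<in> ball z r \<Longrightarrow> n2 u = 0"
    and dich: "\<And>u. u \<in> ball z' r' \<Longrightarrow> patch.n1 \<Psi>' u = 0 \<or> patch.n2 \<Psi>' u = 0"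
    and U: "open U" "U \<noteq> {}" "U \<subseteq> ball z r"
    and L: "L = (\<lambda>x. x) \<or> L = prod.swap"
    and cov: "\<And>u. u \<in> U \<Longrightarrow> \<exists>T\<in>movers \<Psi> B (\<Psi>' ` cball z' r'). \<Psi> u = L (act T x0)"
  obtains a where "a \<noteq> 0" "\<And>u. u \<in> B \<Longrightarrow> a \<bullet> \<alpha> u = 0"
proof (rule ccontr)
  interpret P: patch \<Psi>' z' r' S' c' by fact
  let ?M = "movers \<Psi> B (\<Psi>' ` cball z' r')"
  assume "\<not> thesis"
  then have no: "\<And>a. (\<And>u. u \<in> B \<Longrightarrow> a \<bullet> \<alpha> u = 0) \<Longrightarrow> a = 0" using that by blast
  have cM: "compact ?M" by (rule compact_movers[OF compact_imp_closed[OF P.compact_image]])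
  have n2B: "\<And>u. u \<in> B \<Longrightarrow> n2 u = 0" using n2 B by blast
  have "\<forall>A\<in>?M. \<exists>e>0. \<forall>T\<in>?M \<inter> ball A e. fst T = fst A"
  proof
    fix A assume A: "A \<in> ?M"
    show "\<exists>e>0. \<forall>T\<in>?M \<inter> ball A e. fst T = fst A"
      using movers_first_isolated[OF P B n2B dich A no] by (metis IntE)
  qed
  then obtain e where e: "\<And>A. A \<in> ?M \<Longrightarrow> e A > 0" "\<And>A T. A \<in> ?M \<Longrightarrow> T \<in> ?M \<inter> ball A (e A) \<Longrightarrow> fst T = fst A"
    unfolding bchoice_iff by blast
  have "?M \<subseteq> (\<Union>A\<in>?M. ball A (e A))" using e(1) by force
  then obtain M0 where M0: "M0 \<subseteq> ?M" "finite M0" "?M \<subseteq> (\<Union>A\<in>M0. ball A (e A))"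
    using compactE_image[OF cM, of ?M "\<lambda>A. ball A (e A)"] by auto
  have "fst ` ?M \<subseteq> fst ` M0"
  proof
    fix X assume "X \<in> fst ` ?M"
    then obtain T where T: "T \<in> ?M" "X = fst T" by blast
    then obtain A where A: "A \<in> M0" "T \<in> ball A (e A)" using M0(3) by blast
    then have "fst T = fst A" using e(2) M0(1) T(1) by blast
    then show "X \<in> fst ` M0" using A T by blast
  qed
  then have fin: "finite (fst ` ?M)" using M0(2) finite_surj by blast
  define F where "F = (\<lambda>X. X *v fst x0) ` fst ` ?M"
  have finF: "finite F" using fin by (simp add: F_def)
  obtain c0 \<rho> where c0: "\<rho> > 0" "ball c0 \<rho> \<subseteq> U" using U open_contains_ball by blast
  have sub: "ball c0 \<rho> \<subseteq> S" using c0 U ball_sub by blast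
  have "c0 \<in> ball c0 \<rho>" using c0 by simp
  then have cS: "c0 \<in> S" "c0 \<in> ball z r" using sub c0 U by blast+
  have n1: "n1 c0 \<noteq> 0" using normal_nz[OF cS(1)] n2[OF cS(2)] by blast
  have const: "\<exists>k. \<forall>u\<in>ball c0 \<rho>. f u = k" if f: "continuous_on S f" "\<And>u. u \<in> U \<Longrightarrow> f u \<in> F" for f
  proof -
    have "connected (f ` ball c0 \<rho>)"
      using f(1) sub by (intro connected_continuous_image continuous_on_subset[OF f(1) sub] connected_ball)
    moreover have "f ` ball c0 \<rho> \<subseteq> F" using f(2) c0 by blast
    then have "finite (f ` ball c0 \<rho>)" using finF finite_subset by blast
    ultimately have "f ` ball c0 \<rho> = {} \<or> (\<exists>k. f ` ball c0 \<rho> = {k})"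
      using connected_finite_iff_sing by blast
    then show ?thesis by blast
  qed
  have dz: "f' = (\<lambda>v. 0)" if "(f has_derivative f') (at c0)" "\<exists>k. \<forall>u\<in>ball c0 \<rho>. f u = k" for f :: "real^3 \<Rightarrow> real^3" and f'
  proof -
    obtain k where k: "\<And>u. u \<in> ball c0 \<rho> \<Longrightarrow> f u = k" using \<open>\<exists>k. _\<close> by blast
    have "(f has_derivative (\<lambda>v. 0)) (at c0)"
      by (rule has_derivative_transform_within_open[OF has_derivative_const[of k] open_ball[of c0 \<rho>]]) (use c0 k in auto)
    then show ?thesis using that(1) has_derivative_unique by blast
  qed
  have "dp c0 = (\<lambda>v. 0) \<or> dq c0 = (\<lambda>v. 0)"
    using L
  proof
    assume L: "L = (\<lambda>x. x)"
    have "p u \<in> F" if u: "u \<in> U" for u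
    proof -
      obtain T where "T \<in> ?M" "\<Psi> u = act T x0" using cov[OF u] L by blast
      then show ?thesis by (auto simp: F_def \<Psi>_eq act_def)
    qed
    then show ?thesis using dz[OF Dp[OF cS(1)] const[OF C1_on_imp_continuous[OF C1_p]]] by blast
  next
    assume L: "L = prod.swap"
    have "q u \<in> F" if u: "u \<in> U" for u
    proof -
      obtain T where "T \<in> ?M" "\<Psi> u = prod.swap (act T x0)" using cov[OF u] L by blast
      then show ?thesis by (auto simp: F_def \<Psi>_eq act_def)
    qed
    then show ?thesis using dz[OF Dq[OF cS(1)] const[OF C1_on_imp_continuous[OF C1_q]]] by blast
  qed
  then have "\<alpha> c0 = 0" by (auto simp: \<alpha>_def)
  then show False using n1 by (simp add: n1_def)
qed

text \<open>All derivatives of p are multiples of \<alpha>, which is orthogonal to a, so p . b is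
  constant for the normalized b. If |t| = 1, then p itself would be constant and the normal would
  vanish.\<close>

lemma circle_level:
  assumes B: "ball c0 \<rho> \<subseteq> ball z r" "\<rho> > 0" and n2: "\<And>u. u \<in> ball z r \<Longrightarrow> n2 u = 0"
    and a: "a \<noteq> 0" "\<And>u. u \<in> ball c0 \<rho> \<Longrightarrow> a \<bullet> \<alpha> u = 0"
  obtains b t where "norm b = 1" "\<bar>t\<bar> < 1" "\<And>u. u \<in> ball c0 \<rho> \<Longrightarrow> p u \<bullet> b = t"
proof -
  define b where "b = a /\<^sub>R norm a"
  have nb: "norm b = 1" using a by (simp add: b_def)
  have sub: "ball c0 \<rho> \<subseteq> S" using B ball_sub by blast
  have "\<exists>t. \<forall>u\<in>ball c0 \<rho>. p u \<bullet> b = t"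
  proof (rule has_derivative_zero_constant[OF convex_ball])
    fix u assume u: "u \<in> ball c0 \<rho>"
    then have uS: "u \<in> S" and n: "n2 u = 0" using sub B n2 by blast+
    have "((\<lambda>u. p u \<bullet> b) has_derivative (\<lambda>v. dp u v \<bullet> b)) (at u)"
      by (intro has_derivative_inner_left Dp uS)
    moreover have "dp u v \<bullet> b = 0" for v
    proof -
      obtain k where "dp u v = k *\<^sub>R \<alpha> u" using dp_parallel[OF uS n] by blast
      then show ?thesis using a(2)[OF u] by (simp add: b_def inner_commute)
    qed
    ultimately show "((\<lambda>u. p u \<bullet> b) has_derivative (\<lambda>v. 0)) (at u within ball c0 \<rho>)"
      by (simp add: has_derivative_at_withinI)
  qed
  then obtain t where t: "\<And>u. u \<in> ball c0 \<rho> \<Longrightarrow> p u \<bullet> b = t" by blast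
  have c0: "c0 \<in> ball c0 \<rho>" using B by simp
  have cS: "c0 \<in> S" using c0 sub by blast
  have np: "norm (p u) = 1" if "u \<in> S" for u using unit(1)[OF that] by (simp add: norm_eq_sqrt_inner)
  have "\<bar>t\<bar> \<le> 1" using Cauchy_Schwarz_ineq2[of "p c0" b] t[OF c0] np[OF cS] nb by simp
  moreover have "\<bar>t\<bar> \<noteq> 1"
  proof
    assume t1: "\<bar>t\<bar> = 1"
    have eq: "p u = t *\<^sub>R b" if u: "u \<in> ball c0 \<rho>" for u
    proof -
      have uS: "u \<in> S" using u sub by blast
      have "(p u - t *\<^sub>R b) \<bullet> (p u - t *\<^sub>R b) = p u \<bullet> p u - 2 * t * (p u \<bullet> b) + t\<^sup>2 * (b \<bullet> b)"
        by (simp add: inner_diff_left inner_diff_right inner_commute power2_eq_square algebra_simps)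
      also have "\<dots> = 1 - t\<^sup>2" using unit[OF uS] t[OF u] nb by (simp add: power2_eq_square norm_eq_1)
      also have "\<dots> = 0" using t1 by (metis diff_self one_power2 power2_abs)
      finally show ?thesis by simp
    qed
    have "(p has_derivative (\<lambda>v. 0)) (at c0)"
      by (rule has_derivative_transform_within_open[OF has_derivative_const[of "t *\<^sub>R b"] open_ball[of c0 \<rho>]]) (use c0 eq in auto)
    then have "dp c0 = (\<lambda>v. 0)" using Dp[OF cS] has_derivative_unique by blast
    then have "\<alpha> c0 = 0" by (simp add: \<alpha>_def)
    moreover have "n1 c0 \<noteq> 0" using normal_nz[OF cS] n2 c0 B by blast
    ultimately show False by (simp add: n1_def)
  qed
  ultimately show ?thesis using that[OF nb] t by force
qed

end

section \<open>Model hypersurfaces and their reconstruction from the normal\<close>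

text \<open>The sets where the derivative of a given \<rho> j vanishes are closed, finitely many and
  pairwise disjoint. Their union is closed and dense, hence the whole ball, and by connectedness a
  single one of them is the ball. This excludes that different \<rho> j are constant on different
  parts of it.\<close>

lemma dense_constancy:
  fixes \<rho> :: "'j \<Rightarrow> 'a::euclidean_space \<Rightarrow> 'b::euclidean_space"
  assumes r: "r > 0" and J: "finite J" and C: "\<And>j. j \<in> J \<Longrightarrow> C1_on (ball z r) (\<rho> j)"
    and dense: "\<And>c e. e > 0 \<Longrightarrow> ball c e \<subseteq> ball z r \<Longrightarrow> \<exists>j\<in>J. \<exists>c' e' v. e' > 0 \<and> ball c' e' \<subseteq> ball c e \<and> (\<forall>u\<in>ball c' e'. \<rho> j u = v)"
    and disj: "\<And>u j j'. u \<in> ball z r \<Longrightarrow> j \<in> J \<Longrightarrow> j' \<in> J \<Longrightarrow> (\<And>v. Dv (\<rho> j) u v = 0) \<Longrightarrow> (\<And>v. Dv (\<rho> j') u v = 0) \<Longrightarrow> j = j'"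
  obtains j v where "j \<in> J" "\<And>u. u \<in> ball z r \<Longrightarrow> \<rho> j u = v" "\<And>u v. u \<in> ball z r \<Longrightarrow> Dv (\<rho> j) u v = 0"
proof -
  define Z where "Z j = {u \<in> ball z r. \<forall>v. Dv (\<rho> j) u v = 0}" for j
  have cl: "closedin (top_of_set (ball z r)) (Z j)" if j: "j \<in> J" for j
  proof -
    have eq: "Z j = (\<Inter>v. ball z r \<inter> (\<lambda>u. Dv (\<rho> j) u v) -` {0})" by (auto simp: Z_def)
    have "closedin (top_of_set (ball z r)) (ball z r \<inter> (\<lambda>u. Dv (\<rho> j) u v) -` {0})" for v
      by (rule continuous_closedin_preimage[OF C1_on_cont_deriv[OF C[OF j]]]) simp
    then show ?thesis unfolding eq by (intro closedin_Inter) auto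
  qed
  have cov: "ball z r \<subseteq> (\<Union>j\<in>J. Z j)"
  proof (rule ccontr)
    assume "\<not> ?thesis"
    then obtain u where u: "u \<in> ball z r - (\<Union>j\<in>J. Z j)" by blast
    have "closedin (top_of_set (ball z r)) (\<Union>j\<in>J. Z j)" using J cl by (intro closedin_Union) auto
    then have "openin (top_of_set (ball z r)) (ball z r - (\<Union>j\<in>J. Z j))" by (simp add: openin_diff)
    then have "open (ball z r - (\<Union>j\<in>J. Z j))" using openin_open_trans open_ball by blast
    then obtain e where e: "e > 0" "ball u e \<subseteq> ball z r - (\<Union>j\<in>J. Z j)" using u open_contains_ball by metis
    have sub: "ball u e \<subseteq> ball z r" using e by blast
    obtain j c' e' v where j: "j \<in> J" "e' > 0" "ball c' e' \<subseteq> ball u e" "\<And>w. w \<in> ball c' e' \<Longrightarrow> \<rho> j w = v"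
      using dense[OF e(1) sub] by blast
    have c': "c' \<in> ball c' e'" using j by simp
    have "(\<rho> j has_derivative (\<lambda>w. 0)) (at c')"
      by (rule has_derivative_transform_within_open[OF has_derivative_const[of v] open_ball c']) (use j in simp)
    then have "Dv (\<rho> j) c' = (\<lambda>w. 0)" by (rule Dv_eqI)
    moreover have "c' \<in> ball z r" using c' j(3) sub by blast
    ultimately have "c' \<in> Z j" by (simp add: Z_def)
    then show False using c' j e(2) by blast
  qed
  have "z \<in> ball z r" using r by simp
  then obtain j where j: "j \<in> J" "z \<in> Z j" using cov by blast
  have eq: "ball z r - (\<Union>i\<in>J - {j}. Z i) = Z j"
  proof
    show "ball z r - (\<Union>i\<in>J - {j}. Z i) \<subseteq> Z j" using cov j by blast
    show "Z j \<subseteq> ball z r - (\<Union>i\<in>J - {j}. Z i)"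
    proof
      fix u assume u: "u \<in> Z j"
      have "u \<notin> Z i" if "i \<in> J - {j}" for i
      proof
        assume "u \<in> Z i"
        then have "i = j" using disj[of u i j] u j(1) that by (auto simp: Z_def)
        then show False using that by blast
      qed
      then show "u \<in> ball z r - (\<Union>i\<in>J - {j}. Z i)" using u by (auto simp: Z_def)
    qed
  qed
  have "closedin (top_of_set (ball z r)) (\<Union>i\<in>J - {j}. Z i)" using J cl by (intro closedin_Union) auto
  then have "openin (top_of_set (ball z r)) (Z j)" using eq by (metis openin_diff openin_subtopology_self)
  then have "Z j = {} \<or> Z j = ball z r"
    using connected_clopen[of "ball z r"] cl[OF j(1)] by auto
  then have Zj: "Z j = ball z r" using j by blast
  have "\<exists>v. \<forall>u\<in>ball z r. \<rho> j u = v"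
  proof (rule has_derivative_zero_constant[OF convex_ball])
    fix u assume u: "u \<in> ball z r"
    then have "u \<in> Z j" using Zj by blast
    then have "Dv (\<rho> j) u = (\<lambda>v. 0)" by (auto simp: Z_def)
    then show "(\<rho> j has_derivative (\<lambda>v. 0)) (at u within ball z r)"
      using C1_onD[OF C[OF j(1)] u] has_derivative_at_withinI by metis
  qed
  moreover have "Dv (\<rho> j) u v = 0" if "u \<in> ball z r" for u v using that Zj by (auto simp: Z_def)
  ultimately show ?thesis using that j(1) by blast
qed

lemma constant_on_subball:
  fixes \<rho> :: "'j \<Rightarrow> 'a::euclidean_space \<Rightarrow> 'b::euclidean_space"
  assumes e: "e > 0" and I: "finite I" and cont: "\<And>i. i \<in> I \<Longrightarrow> continuous_on (ball c e) (\<rho> i)"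
    and cov: "\<And>u. u \<in> ball c e \<Longrightarrow> \<exists>i\<in>I. \<rho> i u = val i"
  obtains i c' e' where "i \<in> I" "e' > 0" "ball c' e' \<subseteq> ball c e" "\<And>u. u \<in> ball c' e' \<Longrightarrow> \<rho> i u = val i"
proof -
  have sub: "cball c (e/2) \<subseteq> ball c e" using e by auto
  have ne: "ball c (e/2) \<noteq> {}" using e by simp
  have cl: "closed (cball c (e/2) \<inter> \<rho> i -` {val i})" if "i \<in> I" for i
    by (rule continuous_closed_preimage[OF continuous_on_subset[OF cont[OF that] sub] closed_cball]) simp
  have covI: "ball c (e/2) \<subseteq> (\<Union>i\<in>I. cball c (e/2) \<inter> \<rho> i -` {val i})"
  proof
    fix u assume "u \<in> ball c (e/2)"
    then have u: "u \<in> cball c (e/2)" "u \<in> ball c e" using e by auto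
    obtain i where "i \<in> I" "\<rho> i u = val i" using cov[OF u(2)] by blast
    then show "u \<in> (\<Union>i\<in>I. cball c (e/2) \<inter> \<rho> i -` {val i})" using u by blast
  qed
  obtain i e' c' where i: "i \<in> I" "e' > 0" "ball c' e' \<subseteq> ball c (e/2)" "ball c' e' \<subseteq> cball c (e/2) \<inter> \<rho> i -` {val i}"
    by (rule Baire_union[OF open_ball ne countable_finite[OF I] cl covI])
  then have "ball c' e' \<subseteq> ball c e" using sub ball_subset_cball by blast
  then show ?thesis using that i by blast
qed

text \<open>The copies of M_t under pairs of orthogonal matrices; \<open>circ1\<close> and
  \<open>circ2\<close> below are the products of a circle with a sphere, with the circle in the
  first or the second factor.\<close>

definition rotK :: "real^3^3 \<Rightarrow> real \<Rightarrow> R3xR3 set" where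
  "rotK R t = {x \<in> S2xS2. fst x \<bullet> (R *v snd x) = t}"

definition circ1 :: "real^3 \<Rightarrow> real \<Rightarrow> R3xR3 set" where
  "circ1 a t = {x \<in> S2xS2. fst x \<bullet> a = t}"

definition circ2 :: "real^3 \<Rightarrow> real \<Rightarrow> R3xR3 set" where
  "circ2 a t = {x \<in> S2xS2. snd x \<bullet> a = t}"

definition outer :: "real^3 \<Rightarrow> real^3 \<Rightarrow> real^3^3" where
  "outer a b = (\<chi> i j. a $ i * b $ j)"

lemma outer_mult: "outer a b *v x = (b \<bullet> x) *\<^sub>R a"
  by (simp add: outer_def vec_eq_iff matrix_vector_mult_def inner_vec_def sum_3 algebra_simps)

lemma bounded_bilinear_outer: "bounded_bilinear outer"
  unfolding bilinear_conv_bounded_bilinear[symmetric] bilinear_def outer_def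
  by (auto intro!: linearI simp: vec_eq_iff algebra_simps)

lemma orthonormal_expand:
  fixes q v x :: "real^3"
  assumes "q \<bullet> q = 1" "v \<bullet> v = 1" "q \<bullet> v = 0"
  shows "x = (q \<bullet> x) *\<^sub>R q + (v \<bullet> x) *\<^sub>R v + (cross3 q v \<bullet> x) *\<^sub>R cross3 q v"
proof -
  let ?w = "cross3 q v"
  have w1: "?w \<bullet> ?w = 1" using norm_cross_dot[of q v] assms by (simp add: norm_eq_sqrt_inner)
  have w2: "q \<bullet> ?w = 0" "v \<bullet> ?w = 0" "?w \<bullet> q = 0" "?w \<bullet> v = 0" by (simp_all add: dot_cross_self)
  have "x - ((q \<bullet> x) *\<^sub>R q + (v \<bullet> x) *\<^sub>R v + (?w \<bullet> x) *\<^sub>R ?w) = 0" (is "?e = 0")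
  proof (rule orthogonal_triple_zero[of q v])
    show "q \<noteq> 0" "v \<noteq> 0" using assms by auto
    show "?e \<bullet> q = 0" "?e \<bullet> v = 0" "?e \<bullet> ?w = 0"
      using assms w1 w2 by (simp_all add: inner_diff_left inner_add_left inner_diff_right inner_add_right inner_commute)
  qed (rule assms)
  then show ?thesis by simp
qed

text \<open>The linear map that sends the frame q, \<nu>2, q x \<nu>2 to \<tau> p + s \<nu>1, s p -
  \<tau> \<nu>1 and -\<kappa> times p x \<nu>1. For s = sqrt(1 - t^2) and suitable signs of \<tau> =
  t or -t and of \<kappa>, it recovers R up to sign from a point of \<open>rotK R t\<close> and its
  unit normals.\<close>

definition frame_map :: "real \<Rightarrow> real \<Rightarrow> real \<Rightarrow> real^3 \<Rightarrow> real^3 \<Rightarrow> real^3 \<Rightarrow> real^3 \<Rightarrow> real^3^3" where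
  "frame_map s \<tau> \<kappa> p \<nu>1 q \<nu>2 = outer (\<tau> *\<^sub>R p + s *\<^sub>R \<nu>1) q + outer (s *\<^sub>R p - \<tau> *\<^sub>R \<nu>1) \<nu>2 - \<kappa> *\<^sub>R outer (cross3 p \<nu>1) (cross3 q \<nu>2)"

lemma frame_map_mult:
  "frame_map s \<tau> \<kappa> p \<nu>1 q \<nu>2 *v x = (q \<bullet> x) *\<^sub>R (\<tau> *\<^sub>R p + s *\<^sub>R \<nu>1) + (\<nu>2 \<bullet> x) *\<^sub>R (s *\<^sub>R p - \<tau> *\<^sub>R \<nu>1)
     - (\<kappa> * (cross3 q \<nu>2 \<bullet> x)) *\<^sub>R cross3 p \<nu>1"
  by (simp add: frame_map_def matrix_vector_mult_add_rdistrib matrix_vector_mult_diff_rdistrib outer_mult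
      scaleR_matrix_vector_assoc[symmetric])

text \<open>The vectors in l are the tangential gradient of p . R q, and both have length s. So R q,
  R \<nu>2 and R (q x \<nu>2) can be expressed by p and \<nu>1. What remains open is the sign of the
  factor l, as the normal has no preferred orientation, and the determinant of R.\<close>

lemma rotation_level_frame:
  fixes R :: "real^3^3"
  assumes R: "orthogonal_matrix R" and t: "\<bar>t\<bar> < 1" and pq: "p \<bullet> p = 1" "q \<bullet> q = 1" "p \<bullet> (R *v q) = t"
    and l: "R *v q - t *\<^sub>R p = l *\<^sub>R N1" "transpose R *v p - t *\<^sub>R q = l *\<^sub>R N2"
  shows "N1 \<noteq> 0" "N2 \<noteq> 0" "norm N1 = norm N2"
    "\<exists>\<delta>\<in>{1, -1}. \<exists>\<kappa>\<in>{1, -1}. frame_map (sqrt (1 - t\<^sup>2)) (\<delta> * t) \<kappa> p (N1 /\<^sub>R norm N1) q (N2 /\<^sub>R norm N2) = \<delta> *\<^sub>R R"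
proof -
  define s where "s = sqrt (1 - t\<^sup>2)"
  have t2: "t\<^sup>2 < 1" using t by (simp add: abs_square_less_1)
  have s: "s > 0" "s\<^sup>2 = 1 - t\<^sup>2" using t2 by (simp_all add: s_def)
  have Ri: "(R *v x) \<bullet> (R *v y) = x \<bullet> y" for x y by (rule orthogonal_matrix_inner[OF R])
  have oT: "orthogonal_matrix (transpose R)" using R by simp
  have Ti: "(transpose R *v x) \<bullet> (transpose R *v y) = x \<bullet> y" for x y by (rule orthogonal_matrix_inner[OF oT])
  have RT: "R *v (transpose R *v x) = x" for x
    using R by (simp add: orthogonal_matrix_def matrix_vector_mul_assoc del: transpose_matrix_vector vector_transpose_matrix)
  have adj: "x \<bullet> (R *v y) = (transpose R *v x) \<bullet> y" for x y using Ri[of "transpose R *v x" y] by (simp only: RT)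
  have a1: "(R *v q - t *\<^sub>R p) \<bullet> (R *v q - t *\<^sub>R p) = s\<^sup>2"
    using pq s(2) by (simp add: inner_diff_left inner_diff_right Ri inner_commute power2_eq_square)
  have pT: "q \<bullet> (transpose R *v p) = t" using pq(3) adj[of p q] by (simp only: inner_commute)
  have a2: "(transpose R *v p - t *\<^sub>R q) \<bullet> (transpose R *v p - t *\<^sub>R q) = s\<^sup>2"
    using pq s(2) pT Ti[of p p]
    by (simp add: inner_diff_left inner_diff_right inner_commute power2_eq_square del: transpose_matrix_vector vector_transpose_matrix)
  have b1: "\<bar>l\<bar> * norm N1 = s"
  proof -
    have "(\<bar>l\<bar> * norm N1)\<^sup>2 = s\<^sup>2" using a1 unfolding l
      by (simp add: power_mult_distrib power2_norm_eq_inner power2_eq_square[of l] algebra_simps)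
    then show ?thesis using s(1) by (simp add: power2_eq_iff_nonneg)
  qed
  have b2: "\<bar>l\<bar> * norm N2 = s"
  proof -
    have "(\<bar>l\<bar> * norm N2)\<^sup>2 = s\<^sup>2" using a2 unfolding l
      by (simp add: power_mult_distrib power2_norm_eq_inner power2_eq_square[of l] algebra_simps)
    then show ?thesis using s(1) by (simp add: power2_eq_iff_nonneg)
  qed
  have l0: "l \<noteq> 0" using b1 s by auto
  show N1: "N1 \<noteq> 0" and N2: "N2 \<noteq> 0" using b1 b2 s by auto
  show "norm N1 = norm N2" using b1 b2 l0 by (metis mult_left_cancel abs_eq_0)
  define \<nu>1 \<nu>2 where "\<nu>1 = N1 /\<^sub>R norm N1" and "\<nu>2 = N2 /\<^sub>R norm N2"
  define \<delta> where "\<delta> = sgn l"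
  have \<delta>: "\<delta> \<in> {1, -1}" "\<delta> * \<delta> = 1" "\<delta> * l = \<bar>l\<bar>" using l0 by (auto simp: \<delta>_def sgn_if)
  have d1: "\<delta> *\<^sub>R (R *v q) = (\<delta> * t) *\<^sub>R p + s *\<^sub>R \<nu>1"
  proof -
    have "\<delta> *\<^sub>R (R *v q) = (\<delta> * t) *\<^sub>R p + \<delta> *\<^sub>R (R *v q - t *\<^sub>R p)" by (simp add: scaleR_diff_right)
    also have "\<delta> *\<^sub>R (R *v q - t *\<^sub>R p) = \<bar>l\<bar> *\<^sub>R N1" by (simp add: l \<delta>(3))
    also have "\<dots> = s *\<^sub>R \<nu>1" using N1 by (simp add: \<nu>1_def b1[symmetric])
    finally show ?thesis .
  qed
  have d2: "\<delta> *\<^sub>R (transpose R *v p) = (\<delta> * t) *\<^sub>R q + s *\<^sub>R \<nu>2"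
  proof -
    have "\<delta> *\<^sub>R (transpose R *v p) = (\<delta> * t) *\<^sub>R q + \<delta> *\<^sub>R (transpose R *v p - t *\<^sub>R q)" by (simp only: scaleR_diff_right) simp
    also have "\<delta> *\<^sub>R (transpose R *v p - t *\<^sub>R q) = \<bar>l\<bar> *\<^sub>R N2" by (simp only: l(2)) (simp add: \<delta>(3))
    also have "\<dots> = s *\<^sub>R \<nu>2" using N2 by (simp add: \<nu>2_def b2[symmetric])
    finally show ?thesis .
  qed
  have "R *v (\<delta> *\<^sub>R (transpose R *v p)) = \<delta> *\<^sub>R p" by (simp only: matrix_vector_mult_scaleR RT)
  then have "(\<delta> * t) *\<^sub>R (R *v q) + s *\<^sub>R (R *v \<nu>2) = \<delta> *\<^sub>R p"
    unfolding d2 by (simp add: matrix_vector_right_distrib matrix_vector_mult_scaleR)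
  then have "s *\<^sub>R (R *v \<nu>2) = \<delta> *\<^sub>R p - t *\<^sub>R (\<delta> *\<^sub>R (R *v q))" by (simp add: algebra_simps)
  also have "\<dots> = \<delta> *\<^sub>R p - t *\<^sub>R ((\<delta> * t) *\<^sub>R p + s *\<^sub>R \<nu>1)" by (simp only: d1)
  finally have "s *\<^sub>R (\<delta> *\<^sub>R (R *v \<nu>2)) = \<delta> *\<^sub>R (\<delta> *\<^sub>R p - t *\<^sub>R ((\<delta> * t) *\<^sub>R p + s *\<^sub>R \<nu>1))"
    by (metis scaleR_left_commute)
  also have "\<dots> = ((\<delta> * \<delta>) * (1 - t\<^sup>2)) *\<^sub>R p - (s * (\<delta> * t)) *\<^sub>R \<nu>1"
    by (simp add: scaleR_diff_right scaleR_add_right scaleR_diff_left power2_eq_square algebra_simps)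
  also have "\<dots> = s *\<^sub>R (s *\<^sub>R p - (\<delta> * t) *\<^sub>R \<nu>1)"
    using s(2) by (simp add: \<delta>(2) scaleR_diff_right power2_eq_square)
  finally have sd3: "s *\<^sub>R (\<delta> *\<^sub>R (R *v \<nu>2)) = s *\<^sub>R (s *\<^sub>R p - (\<delta> * t) *\<^sub>R \<nu>1)" .
  have d3: "\<delta> *\<^sub>R (R *v \<nu>2) = s *\<^sub>R p - (\<delta> * t) *\<^sub>R \<nu>1"
    by (rule scaleR_left_imp_eq[OF _ sd3]) (use s in simp)
  have u1: "\<nu>1 \<bullet> \<nu>1 = 1" "\<nu>2 \<bullet> \<nu>2 = 1" 
  proof -
    have "norm \<nu>1 = 1" "norm \<nu>2 = 1" using N1 N2 by (simp_all add: \<nu>1_def \<nu>2_def)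
    then show "\<nu>1 \<bullet> \<nu>1 = 1" "\<nu>2 \<bullet> \<nu>2 = 1" by (simp_all add: norm_eq_1)
  qed
  have p1: "p \<bullet> \<nu>1 = 0" "q \<bullet> \<nu>2 = 0"
  proof -
    have "p \<bullet> (l *\<^sub>R N1) = 0" unfolding l[symmetric] using pq by (simp add: inner_diff_right)
    then show "p \<bullet> \<nu>1 = 0" using l0 by (simp add: \<nu>1_def)
    have "q \<bullet> (l *\<^sub>R N2) = 0" unfolding l[symmetric] inner_diff_right pT using pq by simp
    then show "q \<bullet> \<nu>2 = 0" using l0 by (simp add: \<nu>2_def)
  qed
  define \<kappa> where "\<kappa> = det R"
  have \<kappa>: "\<kappa> \<in> {1, -1}" using det_orthogonal_matrix[OF R] by (auto simp: \<kappa>_def)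
  \<comment> \<open>R multiplies cross products by its determinant, and passing from R to \<delta> R
    contributes another sign.\<close>
  define \<kappa>' where "\<kappa>' = \<delta> * \<kappa>"
  have \<kappa>': "\<kappa>' \<in> {1, -1}" using \<kappa> \<delta>(1) by (auto simp: \<kappa>'_def)
  have kk: "\<kappa> * \<kappa> = 1" using \<kappa> by auto
  have "cross3 (\<delta> *\<^sub>R (R *v q)) (\<delta> *\<^sub>R (R *v \<nu>2)) = \<kappa> *\<^sub>R (R *v cross3 q \<nu>2)"
    using cross_orthogonal_matrix[OF R, of q \<nu>2] \<delta>(2) by (simp add: cross_mult_left cross_mult_right \<kappa>_def)
  moreover have "cross3 (\<delta> *\<^sub>R (R *v q)) (\<delta> *\<^sub>R (R *v \<nu>2)) = - cross3 p \<nu>1"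
  proof -
    have "cross3 (\<delta> *\<^sub>R (R *v q)) (\<delta> *\<^sub>R (R *v \<nu>2)) = - (((\<delta> * t) * (\<delta> * t) + s * s) *\<^sub>R cross3 p \<nu>1)"
      unfolding d1 d3
      by (simp add: cross_add_left cross_mult_left cross_mult_right right_diff_distrib cross_skew[of \<nu>1 p] Cross3.right_diff_distrib scaleR_add_left algebra_simps)
    also have "(\<delta> * t) * (\<delta> * t) + s * s = 1" using s(2) \<delta>(2) by (simp add: power2_eq_square)
    finally show ?thesis by simp
  qed
  ultimately have "\<kappa> *\<^sub>R (R *v cross3 q \<nu>2) = - cross3 p \<nu>1" by simp
  then have "\<kappa> *\<^sub>R (\<kappa> *\<^sub>R (R *v cross3 q \<nu>2)) = \<kappa> *\<^sub>R (- cross3 p \<nu>1)" by (rule arg_cong)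
  then have d4: "R *v cross3 q \<nu>2 = - (\<kappa> *\<^sub>R cross3 p \<nu>1)" by (simp add: kk)
  have "frame_map s (\<delta> * t) \<kappa>' p \<nu>1 q \<nu>2 *v x = (\<delta> *\<^sub>R R) *v x" for x
  proof -
    have "(\<delta> *\<^sub>R R) *v x = \<delta> *\<^sub>R (R *v ((q \<bullet> x) *\<^sub>R q + (\<nu>2 \<bullet> x) *\<^sub>R \<nu>2 + (cross3 q \<nu>2 \<bullet> x) *\<^sub>R cross3 q \<nu>2))"
      using orthonormal_expand[OF pq(2) u1(2) p1(2), of x] by (simp add: scaleR_matrix_vector_assoc)
    also have "\<dots> = (q \<bullet> x) *\<^sub>R (\<delta> *\<^sub>R (R *v q)) + (\<nu>2 \<bullet> x) *\<^sub>R (\<delta> *\<^sub>R (R *v \<nu>2)) + (\<delta> * (cross3 q \<nu>2 \<bullet> x)) *\<^sub>R (R *v cross3 q \<nu>2)"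
      by (simp add: matrix_vector_right_distrib matrix_vector_mult_scaleR scaleR_add_right scaleR_left_commute algebra_simps)
    also have "\<dots> = frame_map s (\<delta> * t) \<kappa>' p \<nu>1 q \<nu>2 *v x"
      unfolding d1 d3 d4 frame_map_mult by (simp add: \<kappa>'_def algebra_simps)
    finally show ?thesis by simp
  qed
  then have "frame_map s (\<delta> * t) \<kappa>' p \<nu>1 q \<nu>2 = \<delta> *\<^sub>R R" by (simp add: matrix_eq)
  then show "\<exists>\<delta>\<in>{1, -1}. \<exists>\<kappa>\<in>{1, -1}. frame_map (sqrt (1 - t\<^sup>2)) (\<delta> * t) \<kappa> p (N1 /\<^sub>R norm N1) q (N2 /\<^sub>R norm N2) = \<delta> *\<^sub>R R"
    using \<delta>(1) \<kappa>' unfolding s_def \<nu>1_def \<nu>2_def by blast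
qed

definition rot_class :: "real \<Rightarrow> R3xR3 set set" where
  "rot_class t = {rotK R t | R. orthogonal_matrix R}"

definition circ_class :: "real \<Rightarrow> R3xR3 set set" where
  "circ_class t = {circ1 a t | a. norm a = 1} \<union> {circ2 a t | a. norm a = 1}"

lemma rotK_sign: "\<delta> \<in> {1, -1} \<Longrightarrow> rotK (\<delta> *\<^sub>R R) (\<delta> * t) = rotK R t"
  by (auto simp: rotK_def scaleR_matrix_vector_assoc[symmetric])

lemma circ1_sign: "\<delta> \<in> {1, -1} \<Longrightarrow> circ1 (\<delta> *\<^sub>R a) (\<delta> * t) = circ1 a t"
  by (auto simp: circ1_def)

lemma C1_bilinear_vec: "C1_on S f \<Longrightarrow> C1_on S g \<Longrightarrow> C1_on S (\<lambda>x. outer (f x) (g x))"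
  by (rule C1_on_bilinear[OF bounded_bilinear_outer])

lemma C1_on_scale: "C1_on S f \<Longrightarrow> C1_on S (\<lambda>x. k *\<^sub>R f x)"
  by (rule C1_on_blinear[OF bounded_linear_scaleR_right])

section \<open>Rigidity of the copies of M_t\<close>

context patch begin

definition "nu1 u = n1 u /\<^sub>R norm (n1 u)"
definition "nu2 u = n2 u /\<^sub>R norm (n2 u)"
definition "rot_frame t \<tau> \<kappa> u = frame_map (sqrt (1 - t\<^sup>2)) \<tau> \<kappa> (p u) (nu1 u) (q u) (nu2 u)"
text \<open>The analogue of \<open>rot_frame\<close> for circles: at a point of
  \<open>circ1 a t\<close> it equals a or -a for \<tau> = t or -t, according to the orientation of
  the normal (\<open>circ1_point\<close>).\<close>

definition "circ_axis t \<tau> u = \<tau> *\<^sub>R p u + sqrt (1 - t\<^sup>2) *\<^sub>R nu1 u"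

lemma C1_nu: assumes "W \<subseteq> S"
  shows "(\<And>u. u \<in> W \<Longrightarrow> n1 u \<noteq> 0) \<Longrightarrow> C1_on W nu1" "(\<And>u. u \<in> W \<Longrightarrow> n2 u \<noteq> 0) \<Longrightarrow> C1_on W nu2"
  unfolding nu1_def nu2_def
  by (rule C1_on_normalize[OF C1_on_subset[OF C1_n1 assms]], blast)
     (rule C1_on_normalize[OF C1_on_subset[OF C1_n2 assms]], blast)

lemma C1_rot_frame:
  assumes W: "W \<subseteq> S" and n: "\<And>u. u \<in> W \<Longrightarrow> n1 u \<noteq> 0" "\<And>u. u \<in> W \<Longrightarrow> n2 u \<noteq> 0"
  shows "C1_on W (rot_frame t \<tau> \<kappa>)"
  unfolding rot_frame_def frame_map_def
  by (intro C1_on_diff C1_on_add C1_bilinear_vec C1_on_scale C1_on_bilinear[OF bounded_bilinear_cross3]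
      C1_nu[OF W] n C1_on_subset[OF C1_p W] C1_on_subset[OF C1_q W])

lemma C1_circ_axis:
  assumes W: "W \<subseteq> S" and n: "\<And>u. u \<in> W \<Longrightarrow> n1 u \<noteq> 0"
  shows "C1_on W (circ_axis t \<tau>)"
  unfolding circ_axis_def
  by (intro C1_on_add C1_on_scale C1_nu[OF W] n C1_on_subset[OF C1_p W])

lemma nu_unit: "n1 u \<noteq> 0 \<Longrightarrow> nu1 u \<bullet> nu1 u = 1" "n2 u \<noteq> 0 \<Longrightarrow> nu2 u \<bullet> nu2 u = 1"
  unfolding norm_eq_1[symmetric] by (simp_all add: nu1_def nu2_def)

lemma nu_perp: "p u \<bullet> nu1 u = 0" "q u \<bullet> nu2 u = 0"
  by (simp_all add: nu1_def nu2_def n_tan)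

lemma level_derivative_zero:
  fixes f :: "real^3 \<Rightarrow> real"
  assumes "open W" "u \<in> W" "\<And>w. w \<in> W \<Longrightarrow> f w = t" "(f has_derivative f') (at u)"
  shows "f' v = 0"
proof -
  have "(f has_derivative (\<lambda>v. 0)) (at u)"
    by (rule has_derivative_transform_within_open[OF has_derivative_const[of t] assms(1,2)]) (simp add: assms(3))
  then have "f' = (\<lambda>v. 0)" using assms(4) has_derivative_unique by blast
  then show ?thesis by simp
qed

text \<open>Differentiating p . R q = t shows that its tangential gradient is normal to the patch,
  so \<open>normal_unique\<close> applies.\<close>

lemma rotK_normal:
  assumes W: "open W" "W \<subseteq> S" "u \<in> W" and K: "\<Psi> ` W \<subseteq> rotK R t" and R: "orthogonal_matrix R"
  obtains l where "R *v q u - t *\<^sub>R p u = l *\<^sub>R n1 u" "transpose R *v p u - t *\<^sub>R q u = l *\<^sub>R n2 u"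
proof -
  have uS: "u \<in> S" using W by blast
  have lev: "p w \<bullet> (R *v q w) = t" if "w \<in> W" for w
    using K that by (auto simp: rotK_def p_def q_def)
  have adj: "x \<bullet> (R *v y) = (transpose R *v x) \<bullet> y" for x y
    by (simp add: dot_lmul_matrix)
  have d: "dp u \<xi> \<bullet> (R *v q u) + p u \<bullet> (R *v dq u \<xi>) = 0" for \<xi>
  proof -
    have "((\<lambda>w. p w \<bullet> (R *v q w)) has_derivative (\<lambda>v. p u \<bullet> (R *v dq u v) + dp u v \<bullet> (R *v q u))) (at u)"
      by (intro has_derivative_inner Dp uS bounded_linear.has_derivative[OF matrix_vector_mul_bounded_linear] Dq)
    from level_derivative_zero[OF W(1,3) lev this] show ?thesis by (simp add: add.commute)
  qed
  show ?thesis
  proof (rule normal_unique[OF uS, of "R *v q u - t *\<^sub>R p u" "transpose R *v p u - t *\<^sub>R q u"])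
    show "p u \<bullet> (R *v q u - t *\<^sub>R p u) = 0" using lev[OF W(3)] unit[OF uS] by (simp add: inner_diff_right)
    show "q u \<bullet> (transpose R *v p u - t *\<^sub>R q u) = 0"
      using lev[OF W(3)] unit[OF uS] adj[of "p u" "q u"] unfolding inner_diff_right by (simp only: inner_commute) simp
    show "(R *v q u - t *\<^sub>R p u) \<bullet> dp u \<xi> + (transpose R *v p u - t *\<^sub>R q u) \<bullet> dq u \<xi> = 0" for \<xi>
      using d[of \<xi>] tangent[OF uS, of \<xi>] adj[of "p u" "dq u \<xi>"]
      by (simp add: inner_diff_left inner_diff_right inner_commute)
  qed (rule that)
qed

lemma rotK_point:
  assumes W: "open W" "W \<subseteq> S" "u \<in> W" and K: "\<Psi> ` W \<subseteq> rotK R t" and R: "orthogonal_matrix R" and t: "\<bar>t\<bar> < 1"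
  shows "n1 u \<noteq> 0" "n2 u \<noteq> 0" "norm (n1 u) = norm (n2 u)"
    "\<exists>\<delta>\<in>{1, -1}. \<exists>\<kappa>\<in>{1, -1}. rot_frame t (\<delta> * t) \<kappa> u = \<delta> *\<^sub>R R"
proof -
  have uS: "u \<in> S" using W by blast
  have lev: "p u \<bullet> (R *v q u) = t" using K W(3) by (auto simp: rotK_def p_def q_def)
  obtain l where l: "R *v q u - t *\<^sub>R p u = l *\<^sub>R n1 u" "transpose R *v p u - t *\<^sub>R q u = l *\<^sub>R n2 u"
    by (rule rotK_normal[OF W K R])
  note * = rotation_level_frame[OF R t unit[OF uS] lev l]
  show "n1 u \<noteq> 0" "n2 u \<noteq> 0" "norm (n1 u) = norm (n2 u)"
    "\<exists>\<delta>\<in>{1, -1}. \<exists>\<kappa>\<in>{1, -1}. rot_frame t (\<delta> * t) \<kappa> u = \<delta> *\<^sub>R R"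
    using * by (simp_all add: rot_frame_def nu1_def nu2_def)
qed

text \<open>Differentiation of the stationary frame along the direction with dq = 0 and dp =
  \<alpha>, applied to q and to \<nu>2, gives two equations. The first determines \<tau> from the
  derivative of \<nu>1, the second determines \<kappa> from the derivative of \<nu>2, because
  \<alpha> is nonzero.\<close>

lemma rot_frame_separated:
  assumes W: "open W" "W \<subseteq> S" "u \<in> W" and n: "\<And>u. u \<in> W \<Longrightarrow> n1 u \<noteq> 0" "\<And>u. u \<in> W \<Longrightarrow> n2 u \<noteq> 0"
    and t: "\<bar>t\<bar> < 1" "\<tau>\<^sup>2 = t\<^sup>2" "\<tau>'\<^sup>2 = t\<^sup>2"
    and z: "\<And>v. Dv (rot_frame t \<tau> \<kappa>) u v = 0" "\<And>v. Dv (rot_frame t \<tau>' \<kappa>') u v = 0"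
  shows "\<tau> = \<tau>' \<and> \<kappa> = \<kappa>'"
proof -
  have uS: "u \<in> S" using W by blast
  define s where "s = sqrt (1 - t\<^sup>2)"
  have "t\<^sup>2 < 1" using t by (simp add: abs_square_less_1)
  then have s: "s > 0" "s\<^sup>2 = 1 - t\<^sup>2" by (simp_all add: s_def)
  obtain \<xi> where x: "dp u \<xi> = \<alpha> u" "dq u \<xi> = 0" using dir1[OF uS] by blast
  have a0: "\<alpha> u \<noteq> 0" using n(1)[OF W(3)] by (auto simp: n1_def)
  note Dn1 = C1_onD[OF C1_nu(1)[OF W(2) n(1)] W(3)]
  note Dn2 = C1_onD[OF C1_nu(2)[OF W(2) n(2)] W(3)]
  define d1 d2 where "d1 = Dv nu1 u \<xi>" and "d2 = Dv nu2 u \<xi>"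
  have qd2: "q u \<bullet> d2 = 0"
  proof -
    have "((\<lambda>w. q w \<bullet> nu2 w) has_derivative (\<lambda>v. q u \<bullet> Dv nu2 u v + dq u v \<bullet> nu2 u)) (at u)"
      by (intro has_derivative_inner Dq uS Dn2)
    from level_derivative_zero[OF W(1,3) nu_perp(2) this, of \<xi>] show ?thesis by (simp add: d2_def x)
  qed
  have nd2: "nu2 u \<bullet> d2 = 0"
  proof -
    have "((\<lambda>w. nu2 w \<bullet> nu2 w) has_derivative (\<lambda>v. nu2 u \<bullet> Dv nu2 u v + Dv nu2 u v \<bullet> nu2 u)) (at u)"
      by (intro has_derivative_inner Dn2)
    from level_derivative_zero[OF W(1,3) nu_unit(2)[OF n(2)] this, of \<xi>] show ?thesis by (simp add: d2_def inner_commute)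
  qed
  have main: "\<tau> *\<^sub>R \<alpha> u + s *\<^sub>R d1 = 0 \<and> - (s * \<kappa> * (cross3 (q u) (nu2 u) \<bullet> d2)) *\<^sub>R cross3 (p u) (nu1 u) = \<alpha> u"
    if tau: "\<tau>\<^sup>2 = t\<^sup>2" and z: "\<And>v. Dv (rot_frame t \<tau> \<kappa>) u v = 0" for \<tau> \<kappa>
  proof -
    let ?F = "rot_frame t \<tau> \<kappa>"
    have DF: "(?F has_derivative (\<lambda>v. 0)) (at u)"
      using C1_onD[OF C1_rot_frame[OF W(2) n] W(3)] z by (metis (no_types, lifting) ext)
    have val: "?F w *v q w = \<tau> *\<^sub>R p w + s *\<^sub>R nu1 w" "?F w *v nu2 w = s *\<^sub>R p w - \<tau> *\<^sub>R nu1 w" if w: "w \<in> W" for w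
      using unit[of w] nu_unit(2)[OF n(2)[OF w]] nu_perp[of w] w W
      by (auto simp: rot_frame_def s_def frame_map_mult dot_cross_self inner_commute)
    have e1: "?F u *v dq u v + 0 *v q u = \<tau> *\<^sub>R dp u v + s *\<^sub>R Dv nu1 u v" for v
    proof -
      have A: "((\<lambda>w. ?F w *v q w) has_derivative (\<lambda>v. ?F u *v dq u v + 0 *v q u)) (at u)"
        by (rule bounded_bilinear.FDERIV[OF bounded_bilinear_matrix_vector DF Dq[OF uS]])
      have B: "((\<lambda>w. ?F w *v q w) has_derivative (\<lambda>v. \<tau> *\<^sub>R dp u v + s *\<^sub>R Dv nu1 u v)) (at u)"
        by (rule has_derivative_transform_within_open[where f="\<lambda>w. \<tau> *\<^sub>R p w + s *\<^sub>R nu1 w", OF _ W(1,3)])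
           (auto intro!: has_derivative_add has_derivative_scaleR_right Dp uS Dn1 simp: val)
      from fun_cong[OF has_derivative_unique[OF A B], of v] show ?thesis .
    qed
    have e2: "?F u *v Dv nu2 u v + 0 *v nu2 u = s *\<^sub>R dp u v - \<tau> *\<^sub>R Dv nu1 u v" for v
    proof -
      have A: "((\<lambda>w. ?F w *v nu2 w) has_derivative (\<lambda>v. ?F u *v Dv nu2 u v + 0 *v nu2 u)) (at u)"
        by (rule bounded_bilinear.FDERIV[OF bounded_bilinear_matrix_vector DF Dn2])
      have B: "((\<lambda>w. ?F w *v nu2 w) has_derivative (\<lambda>v. s *\<^sub>R dp u v - \<tau> *\<^sub>R Dv nu1 u v)) (at u)"
        by (rule has_derivative_transform_within_open[where f="\<lambda>w. s *\<^sub>R p w - \<tau> *\<^sub>R nu1 w", OF _ W(1,3)])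
           (auto intro!: has_derivative_diff has_derivative_scaleR_right Dp uS Dn1 simp: val)
      from fun_cong[OF has_derivative_unique[OF A B], of v] show ?thesis .
    qed
    have 1: "\<tau> *\<^sub>R \<alpha> u + s *\<^sub>R d1 = 0" using e1[of \<xi>] by (simp add: x d1_def)
    have 2: "?F u *v d2 = s *\<^sub>R \<alpha> u - \<tau> *\<^sub>R d1" using e2[of \<xi>] by (simp add: x d1_def d2_def)
    have "s *\<^sub>R (?F u *v d2) = (s * s) *\<^sub>R \<alpha> u - \<tau> *\<^sub>R (s *\<^sub>R d1)" unfolding 2 by (simp add: scaleR_diff_right)
    also have "s *\<^sub>R d1 = - (\<tau> *\<^sub>R \<alpha> u)" using 1 by (simp add: add_eq_0_iff)
    also have "(s * s) *\<^sub>R \<alpha> u - \<tau> *\<^sub>R (- (\<tau> *\<^sub>R \<alpha> u)) = (s\<^sup>2 + \<tau>\<^sup>2) *\<^sub>R \<alpha> u" by (simp add: power2_eq_square scaleR_add_left)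
    also have "\<dots> = \<alpha> u" by (simp add: s tau)
    finally have "s *\<^sub>R (?F u *v d2) = \<alpha> u" .
    moreover have "?F u *v d2 = - (\<kappa> * (cross3 (q u) (nu2 u) \<bullet> d2)) *\<^sub>R cross3 (p u) (nu1 u)"
      unfolding rot_frame_def frame_map_mult using qd2 nd2 by simp
    ultimately show ?thesis using 1 by (simp add: mult.assoc)
  qed
  have m1: "\<tau> *\<^sub>R \<alpha> u + s *\<^sub>R d1 = 0" "- (s * \<kappa> * (cross3 (q u) (nu2 u) \<bullet> d2)) *\<^sub>R cross3 (p u) (nu1 u) = \<alpha> u"
    using main[OF t(2) z(1)] by blast+
  have m2: "\<tau>' *\<^sub>R \<alpha> u + s *\<^sub>R d1 = 0" "- (s * \<kappa>' * (cross3 (q u) (nu2 u) \<bullet> d2)) *\<^sub>R cross3 (p u) (nu1 u) = \<alpha> u"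
    using main[OF t(3) z(2)] by blast+
  have "\<tau> *\<^sub>R \<alpha> u = \<tau>' *\<^sub>R \<alpha> u" using m1(1) m2(1) by (metis add_right_cancel)
  then have "\<tau> = \<tau>'" using a0 by simp
  moreover have "(- (s * \<kappa> * (cross3 (q u) (nu2 u) \<bullet> d2))) *\<^sub>R cross3 (p u) (nu1 u) = (- (s * \<kappa>' * (cross3 (q u) (nu2 u) \<bullet> d2))) *\<^sub>R cross3 (p u) (nu1 u)"
    using m1(2) m2(2) by simp
  then have "\<kappa> = \<kappa>'" using m1(2) a0 s by auto
  ultimately show ?thesis by blast
qed

lemma rotK_subball:
  assumes e: "e > 0" "ball c0 e \<subseteq> S" and K: "\<Psi> ` ball c0 e \<subseteq> rotK R t" and R: "orthogonal_matrix R" and t: "\<bar>t\<bar> < 1"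
  obtains \<delta> \<kappa> c' e' where "\<delta> \<in> {1, -1}" "\<kappa> \<in> {1, -1}" "e' > 0" "ball c' e' \<subseteq> ball c0 e"
    "\<And>u. u \<in> ball c' e' \<Longrightarrow> rot_frame t (\<delta> * t) \<kappa> u = \<delta> *\<^sub>R R"
proof -
  note pt = rotK_point[OF open_ball e(2) _ K R t]
  have cov: "\<exists>i\<in>{1, -1} \<times> {1, -1}. rot_frame t (fst i * t) (snd i) u = fst i *\<^sub>R R" if "u \<in> ball c0 e" for u
    using pt(4)[OF that] by force
  have fin: "finite ({1, -1} \<times> {1, -1} :: (real \<times> real) set)" by simp
  have contF: "continuous_on (ball c0 e) (rot_frame t (fst i * t) (snd i))" for i
    by (rule C1_on_imp_continuous[OF C1_rot_frame[OF e(2) pt(1,2)]])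
  obtain i c' e' where "i \<in> {1, -1} \<times> {1, -1 :: real}" "e' > 0" "ball c' e' \<subseteq> ball c0 e" "\<And>u. u \<in> ball c' e' \<Longrightarrow> rot_frame t (fst i * t) (snd i) u = fst i *\<^sub>R R"
    by (rule constant_on_subball[OF e(1) fin contF cov]) (assumption | rule that, assumption+)+
  then show ?thesis using that[of "fst i" "snd i"] by (auto simp: mem_Times_iff)
qed

text \<open>On a common subball one frame is constantly R up to sign and one is constantly R' up to
  sign. Both are stationary, so by \<open>rot_frame_separated\<close> it is the same frame; a common
  sign of R and t does not change the level set.\<close>

lemma rotK_unique:
  assumes e: "e > 0" "ball c0 e \<subseteq> S" and t: "\<bar>t\<bar> < 1"
    and K: "\<Psi> ` ball c0 e \<subseteq> rotK R t" "orthogonal_matrix R" and K': "\<Psi> ` ball c0 e \<subseteq> rotK R' t" "orthogonal_matrix R'"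
  shows "rotK R t = rotK R' t"
proof -
  obtain \<delta> \<kappa> c1 e1 where 1: "\<delta> \<in> {1, -1}" "\<kappa> \<in> {1, -1}" "e1 > 0" "ball c1 e1 \<subseteq> ball c0 e"
    "\<And>u. u \<in> ball c1 e1 \<Longrightarrow> rot_frame t (\<delta> * t) \<kappa> u = \<delta> *\<^sub>R R"
    by (rule rotK_subball[OF e K t]) (assumption | rule that, assumption+)+
  have sub1: "ball c1 e1 \<subseteq> S" "\<Psi> ` ball c1 e1 \<subseteq> rotK R' t" using 1(4) e K' by blast+
  obtain \<delta>' \<kappa>' c2 e2 where 2: "\<delta>' \<in> {1, -1}" "\<kappa>' \<in> {1, -1}" "e2 > 0" "ball c2 e2 \<subseteq> ball c1 e1"
    "\<And>u. u \<in> ball c2 e2 \<Longrightarrow> rot_frame t (\<delta>' * t) \<kappa>' u = \<delta>' *\<^sub>R R'"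
    by (rule rotK_subball[OF 1(3) sub1(1) sub1(2) K'(2) t]) (assumption | rule that, assumption+)+
  have "c2 \<in> ball c2 e2" using 2(3) by simp
  then have c2: "c2 \<in> ball c2 e2" "c2 \<in> ball c1 e1" "c2 \<in> ball c0 e" using 2(4) 1(4) by blast+
  have z: "Dv f c2 v = 0" if "\<And>u. u \<in> ball c2 e2 \<Longrightarrow> f u = k" for f :: "real^3 \<Rightarrow> real^3^3" and k v
  proof -
    have "(f has_derivative (\<lambda>v. 0)) (at c2)"
      by (rule has_derivative_transform_within_open[OF has_derivative_const[of k] open_ball c2(1)]) (simp add: that)
    then show ?thesis using Dv_eqI by metis
  qed
  have "\<delta> * t = \<delta>' * t \<and> \<kappa> = \<kappa>'"
  proof (rule rot_frame_separated[OF open_ball e(2) c2(3) _ _ t])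
    show "n1 u \<noteq> 0" "n2 u \<noteq> 0" if "u \<in> ball c0 e" for u
      using rotK_point[OF open_ball e(2) that K t] by blast+
    show "Dv (rot_frame t (\<delta> * t) \<kappa>) c2 v = 0" for v using z 1(5) 2(4) by blast
    show "Dv (rot_frame t (\<delta>' * t) \<kappa>') c2 v = 0" for v using z 2(5) by blast
  qed (use 1 2 in auto)
  then have tt: "\<delta> * t = \<delta>' * t" "\<kappa> = \<kappa>'" by blast+
  have "\<delta> *\<^sub>R R = rot_frame t (\<delta> * t) \<kappa> c2" using 1(5)[OF c2(2)] by (rule sym)
  also have "\<dots> = rot_frame t (\<delta>' * t) \<kappa>' c2" by (simp only: tt)
  also have "\<dots> = \<delta>' *\<^sub>R R'" by (rule 2(5)[OF c2(1)])
  finally have RR: "\<delta> *\<^sub>R R = \<delta>' *\<^sub>R R'" .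
  have "rotK R t = rotK (\<delta> *\<^sub>R R) (\<delta> * t)" using rotK_sign[OF 1(1)] by (rule sym)
  also have "\<dots> = rotK (\<delta>' *\<^sub>R R') (\<delta>' * t)" by (simp only: tt RR)
  also have "\<dots> = rotK R' t" by (rule rotK_sign[OF 2(1)])
  finally show ?thesis .
qed

text \<open>\<open>dense_constancy\<close> applied to the candidate frames shows that one of them is
  constant on the whole ball. Its value on q already contains the equation p . R q = t.\<close>

lemma rotK_rigid:
  assumes t: "\<bar>t\<bar> < 1"
    and dense: "\<And>c0 e. e > 0 \<Longrightarrow> ball c0 e \<subseteq> ball z r \<Longrightarrow> \<exists>K\<in>rot_class t. \<exists>c' e'. e' > 0 \<and> ball c' e' \<subseteq> ball c0 e \<and> \<Psi> ` ball c' e' \<subseteq> K"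
  shows "\<exists>K\<in>rot_class t. \<Psi> ` ball z r \<subseteq> K"
proof -
  have dense': "\<exists>R c' e'. orthogonal_matrix R \<and> e' > 0 \<and> ball c' e' \<subseteq> ball c0 e \<and> \<Psi> ` ball c' e' \<subseteq> rotK R t"
    if "e > 0" "ball c0 e \<subseteq> ball z r" for c0 e
    using dense[OF that] unfolding rot_class_def by blast
  \<comment> \<open>At points of a model both normal components have the same length. This closed
    condition holds on a dense set, hence everywhere, so neither component vanishes and all frames
    are C1 on the whole ball.\<close>
  define Q where "Q = {u \<in> ball z r. norm (n1 u) = norm (n2 u)}"
  have Q: "Q = ball z r"
  proof (rule ccontr)
    assume "Q \<noteq> ball z r"
    have "closedin (top_of_set (ball z r)) (ball z r \<inter> (\<lambda>u. norm (n1 u) - norm (n2 u)) -` {0})"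
      by (rule continuous_closedin_preimage)
         (auto intro!: continuous_intros continuous_on_subset[OF C1_on_imp_continuous[OF C1_n1] ball_sub] continuous_on_subset[OF C1_on_imp_continuous[OF C1_n2] ball_sub])
    moreover have "Q = ball z r \<inter> (\<lambda>u. norm (n1 u) - norm (n2 u)) -` {0}" by (auto simp: Q_def)
    ultimately have "openin (top_of_set (ball z r)) (ball z r - Q)" by (simp add: openin_diff)
    then have "open (ball z r - Q)" using openin_open_trans open_ball by blast
    moreover obtain u where "u \<in> ball z r - Q" using \<open>Q \<noteq> ball z r\<close> Q_def by blast
    ultimately obtain e where e: "e > 0" "ball u e \<subseteq> ball z r - Q" using open_contains_ball by metis
    then have "ball u e \<subseteq> ball z r" by blast
    from dense'[OF e(1) this] obtain R c' e' where R: "orthogonal_matrix R" "e' > 0" "ball c' e' \<subseteq> ball u e" "\<Psi> ` ball c' e' \<subseteq> rotK R t"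
      by blast
    have "c' \<in> ball c' e'" using R(2) by simp
    then have c': "c' \<in> ball c' e'" "ball c' e' \<subseteq> S" using R e ball_sub by blast+
    have "norm (n1 c') = norm (n2 c')" by (rule rotK_point(3)[OF open_ball c'(2,1) R(4,1) t])
    moreover have cb: "c' \<in> ball z r - Q" using c' R e by blast
    ultimately show False unfolding Q_def by blast
  qed
  have n: "n1 u \<noteq> 0" "n2 u \<noteq> 0" if "u \<in> ball z r" for u
  proof -
    have "u \<in> Q" using that by (simp only: Q)
    then have "norm (n1 u) = norm (n2 u)" unfolding Q_def by blast
    moreover have "u \<in> S" using that ball_sub by blast
    ultimately show "n1 u \<noteq> 0" "n2 u \<noteq> 0" using normal_nz[of u] by auto
  qed
  \<comment> \<open>The index set consists of values of \<tau> rather than of signs, so that for t =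
    0 no frame is listed twice and the indices remain separated.\<close>
  define J where "J = {t, -t} \<times> {1, -1 :: real}"
  have fin: "finite J" by (simp add: J_def)
  have C: "C1_on (ball z r) (rot_frame t (fst j) (snd j))" for j
    by (rule C1_rot_frame[OF ball_sub n])
  have sq: "(fst j)\<^sup>2 = t\<^sup>2" if "j \<in> J" for j using that by (auto simp: J_def)
  have sep: "j = j'" if "u \<in> ball z r" "j \<in> J" "j' \<in> J" "\<And>v. Dv (rot_frame t (fst j) (snd j)) u v = 0" "\<And>v. Dv (rot_frame t (fst j') (snd j')) u v = 0" for u j j'
    using rot_frame_separated[OF open_ball ball_sub that(1) n t sq[OF that(2)] sq[OF that(3)] that(4,5)] by (simp add: prod_eq_iff)
  have loc: "\<exists>j\<in>J. \<exists>R c' e'. orthogonal_matrix R \<and> e' > 0 \<and> ball c' e' \<subseteq> ball c0 e \<and> (\<exists>\<delta>\<in>{1,-1}. fst j = \<delta> * t \<and> (\<forall>u\<in>ball c' e'. rot_frame t (fst j) (snd j) u = \<delta> *\<^sub>R R))"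
    if e: "e > 0" "ball c0 e \<subseteq> ball z r" for c0 e
  proof -
    obtain R c1 e1 where R: "orthogonal_matrix R" "e1 > 0" "ball c1 e1 \<subseteq> ball c0 e" "\<Psi> ` ball c1 e1 \<subseteq> rotK R t"
      using dense'[OF e] by blast
    have sub: "ball c1 e1 \<subseteq> S" using R e ball_sub by blast
    obtain \<delta> \<kappa> c' e' where d: "\<delta> \<in> {1, -1}" "\<kappa> \<in> {1, -1}" "e' > 0" "ball c' e' \<subseteq> ball c1 e1"
      "\<And>u. u \<in> ball c' e' \<Longrightarrow> rot_frame t (\<delta> * t) \<kappa> u = \<delta> *\<^sub>R R"
      by (rule rotK_subball[OF R(2) sub R(4,1) t]) (assumption | rule that, assumption+)+
    show ?thesis
    proof (intro bexI[of _ "(\<delta> * t, \<kappa>)"] exI[of _ R] exI[of _ c'] exI[of _ e'] conjI bexI[of _ \<delta>])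
      show "ball c' e' \<subseteq> ball c0 e" using d R by blast
      show "(\<delta> * t, \<kappa>) \<in> J" using d by (auto simp: J_def)
    qed (use d R in auto)
  qed
  obtain j v where j: "j \<in> J" "\<And>u. u \<in> ball z r \<Longrightarrow> rot_frame t (fst j) (snd j) u = v" "\<And>u v. u \<in> ball z r \<Longrightarrow> Dv (rot_frame t (fst j) (snd j)) u v = 0"
  proof (rule dense_constancy[OF r fin C _ sep])
    show "\<exists>j\<in>J. \<exists>c' e' v. e' > 0 \<and> ball c' e' \<subseteq> ball c0 e \<and> (\<forall>u\<in>ball c' e'. rot_frame t (fst j) (snd j) u = v)"
      if "e > 0" "ball c0 e \<subseteq> ball z r" for c0 e
      using loc[OF that] by blast
  qed (assumption | rule that, assumption+)+
  obtain j' R c' e' \<delta> where l: "j' \<in> J" "orthogonal_matrix R" "e' > 0" "ball c' e' \<subseteq> ball z r" "\<delta> \<in> {1, -1}" "fst j' = \<delta> * t"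
    "\<And>u. u \<in> ball c' e' \<Longrightarrow> rot_frame t (fst j') (snd j') u = \<delta> *\<^sub>R R"
    using loc[OF r order_refl] by blast
  have "c' \<in> ball c' e'" using l(3) by simp
  then have c': "c' \<in> ball c' e'" "c' \<in> ball z r" using l(4) by blast+
  have "(rot_frame t (fst j') (snd j') has_derivative (\<lambda>v. 0)) (at c')"
    by (rule has_derivative_transform_within_open[OF has_derivative_const[of "\<delta> *\<^sub>R R"] open_ball c'(1)]) (rule sym, rule l(7))
  then have "Dv (rot_frame t (fst j') (snd j')) c' = (\<lambda>v. 0)" by (rule Dv_eqI)
  then have jj: "j = j'" using sep[OF c'(2) j(1) l(1) j(3)[OF c'(2)]] by simp
  have v: "v = \<delta> *\<^sub>R R" using j(2)[OF c'(2)] l(7)[OF c'(1)] jj by simp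
  have "\<Psi> u \<in> rotK R t" if u: "u \<in> ball z r" for u
  proof -
    have uS: "u \<in> S" using u ball_sub by blast
    have "(\<delta> *\<^sub>R R) *v q u = rot_frame t (fst j) (snd j) u *v q u" using j(2)[OF u] v by simp
    also have "\<dots> = (\<delta> * t) *\<^sub>R p u + sqrt (1 - t\<^sup>2) *\<^sub>R nu1 u"
      using unit[OF uS] nu_perp[of u] by (simp add: rot_frame_def frame_map_mult dot_cross_self inner_commute jj l(6))
    finally have "p u \<bullet> ((\<delta> *\<^sub>R R) *v q u) = \<delta> * t" using unit[OF uS] nu_perp[of u] by (simp add: inner_add_right)
    then have "\<Psi> u \<in> rotK (\<delta> *\<^sub>R R) (\<delta> * t)" using sph uS by (auto simp: rotK_def p_def q_def)
    then show ?thesis using rotK_sign[OF l(5)] by simp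
  qed
  then show ?thesis using l(2) unfolding rot_class_def by blast
qed

end

section \<open>Rigidity of circles times spheres\<close>

context patch begin

lemma circ1_normal:
  assumes W: "open W" "W \<subseteq> S" "u \<in> W" and K: "\<Psi> ` W \<subseteq> circ1 a t"
  obtains l where "a - t *\<^sub>R p u = l *\<^sub>R n1 u" "0 = l *\<^sub>R n2 u"
proof -
  have uS: "u \<in> S" using W by blast
  have lev: "p w \<bullet> a = t" if "w \<in> W" for w using K that by (auto simp: circ1_def p_def)
  have d: "dp u \<xi> \<bullet> a = 0" for \<xi>
  proof -
    have "((\<lambda>w. p w \<bullet> a) has_derivative (\<lambda>v. dp u v \<bullet> a)) (at u)"
      by (intro has_derivative_inner_left Dp uS)
    from level_derivative_zero[OF W(1,3) lev this] show ?thesis .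
  qed
  show ?thesis
  proof (rule normal_unique[OF uS, of "a - t *\<^sub>R p u" 0])
    show "p u \<bullet> (a - t *\<^sub>R p u) = 0" using lev[OF W(3)] unit[OF uS] by (simp add: inner_diff_right)
    show "(a - t *\<^sub>R p u) \<bullet> dp u \<xi> + 0 \<bullet> dq u \<xi> = 0" for \<xi>
      using d[of \<xi>] tangent[OF uS, of \<xi>] by (simp add: inner_diff_left inner_diff_right inner_commute)
    show "q u \<bullet> 0 = 0" by simp
  qed (rule that)
qed

lemma circ1_point:
  assumes W: "open W" "W \<subseteq> S" "u \<in> W" and K: "\<Psi> ` W \<subseteq> circ1 a t" and a: "norm a = 1" and t: "\<bar>t\<bar> < 1"
  shows "n2 u = 0" "n1 u \<noteq> 0" "\<exists>\<delta>\<in>{1, -1}. circ_axis t (\<delta> * t) u = \<delta> *\<^sub>R a"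
proof -
  have uS: "u \<in> S" using W by blast
  have lev: "p u \<bullet> a = t" using K W(3) by (auto simp: circ1_def p_def)
  obtain l where l: "a - t *\<^sub>R p u = l *\<^sub>R n1 u" "0 = l *\<^sub>R n2 u" by (rule circ1_normal[OF W K])
  define s where "s = sqrt (1 - t\<^sup>2)"
  have "t\<^sup>2 < 1" using t by (simp add: abs_square_less_1)
  then have s: "s > 0" "s\<^sup>2 = 1 - t\<^sup>2" by (simp_all add: s_def)
  have aa: "a \<bullet> a = 1" using a by (simp add: norm_eq_1)
  have "(a - t *\<^sub>R p u) \<bullet> (a - t *\<^sub>R p u) = s\<^sup>2"
    using lev unit(1)[OF uS] aa s(2) by (simp add: inner_diff_left inner_diff_right inner_commute power2_eq_square)
  then have "(\<bar>l\<bar> * norm (n1 u))\<^sup>2 = s\<^sup>2" unfolding l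
    by (simp add: power_mult_distrib power2_norm_eq_inner power2_eq_square[of l] algebra_simps)
  then have b: "\<bar>l\<bar> * norm (n1 u) = s" using s(1) by (simp add: power2_eq_iff_nonneg)
  then have l0: "l \<noteq> 0" using s by auto
  show "n2 u = 0" using l(2) l0 by simp
  show n1: "n1 u \<noteq> 0" using b s by auto
  define \<delta> where "\<delta> = sgn l"
  have \<delta>: "\<delta> \<in> {1, -1}" "\<delta> * l = \<bar>l\<bar>" using l0 by (auto simp: \<delta>_def sgn_if)
  have "\<delta> *\<^sub>R a = (\<delta> * t) *\<^sub>R p u + \<delta> *\<^sub>R (a - t *\<^sub>R p u)" by (simp add: scaleR_diff_right)
  also have "\<delta> *\<^sub>R (a - t *\<^sub>R p u) = \<bar>l\<bar> *\<^sub>R n1 u" by (simp add: l(1) \<delta>(2))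
  also have "\<dots> = s *\<^sub>R nu1 u" using n1 by (simp add: nu1_def b[symmetric])
  finally have "circ_axis t (\<delta> * t) u = \<delta> *\<^sub>R a" by (simp add: circ_axis_def s_def)
  then show "\<exists>\<delta>\<in>{1, -1}. circ_axis t (\<delta> * t) u = \<delta> *\<^sub>R a" using \<delta>(1) by blast
qed

text \<open>Along the direction with dp = \<alpha> the derivatives of the two axes differ by (\<tau>
  - \<tau>') \<alpha>, and \<alpha> is nonzero.\<close>

lemma circ_axis_separated:
  assumes W: "W \<subseteq> S" "u \<in> W" and n: "\<And>u. u \<in> W \<Longrightarrow> n1 u \<noteq> 0"
    and z: "\<And>v. Dv (circ_axis t \<tau>) u v = 0" "\<And>v. Dv (circ_axis t \<tau>') u v = 0"
  shows "\<tau> = \<tau>'"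
proof -
  have uS: "u \<in> S" using W by blast
  have D: "Dv (circ_axis t \<sigma>) u = (\<lambda>v. \<sigma> *\<^sub>R dp u v + sqrt (1 - t\<^sup>2) *\<^sub>R Dv nu1 u v)" for \<sigma>
    unfolding circ_axis_def
    by (rule Dv_eqI) (intro has_derivative_add has_derivative_scaleR_right Dp uS C1_onD[OF C1_nu(1)[OF W(1) n] W(2)])
  obtain \<xi> where x: "dp u \<xi> = \<alpha> u" using dir1[OF uS] by blast
  have a0: "\<alpha> u \<noteq> 0" using n[OF W(2)] by (auto simp: n1_def)
  have "\<tau> *\<^sub>R \<alpha> u + sqrt (1 - t\<^sup>2) *\<^sub>R Dv nu1 u \<xi> = \<tau>' *\<^sub>R \<alpha> u + sqrt (1 - t\<^sup>2) *\<^sub>R Dv nu1 u \<xi>"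
    using z(1)[of \<xi>] z(2)[of \<xi>] unfolding D x by simp
  then have "\<tau> *\<^sub>R \<alpha> u = \<tau>' *\<^sub>R \<alpha> u" by simp
  then show ?thesis using a0 by simp
qed

lemma circ1_subball:
  assumes e: "e > 0" "ball c0 e \<subseteq> S" and K: "\<Psi> ` ball c0 e \<subseteq> circ1 a t" and a: "norm a = 1" and t: "\<bar>t\<bar> < 1"
  obtains \<delta> c' e' where "\<delta> \<in> {1, -1}" "e' > 0" "ball c' e' \<subseteq> ball c0 e"
    "\<And>u. u \<in> ball c' e' \<Longrightarrow> circ_axis t (\<delta> * t) u = \<delta> *\<^sub>R a"
proof -
  note pt = circ1_point[OF open_ball e(2) _ K a t]
  have cov: "\<exists>i\<in>{1, -1}. circ_axis t (i * t) u = i *\<^sub>R a" if "u \<in> ball c0 e" for u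
    using pt(3)[OF that] .
  have fin: "finite ({1, -1} :: real set)" by simp
  have contF: "continuous_on (ball c0 e) (circ_axis t (i * t))" for i
    by (rule C1_on_imp_continuous[OF C1_circ_axis[OF e(2) pt(2)]])
  show ?thesis
    by (rule constant_on_subball[OF e(1) fin contF cov]) (assumption | rule that, assumption+)+
qed

lemma constant_Dv_zero:
  fixes f :: "real^3 \<Rightarrow> 'b::euclidean_space"
  assumes "open W" "x \<in> W" "\<And>u. u \<in> W \<Longrightarrow> f u = k"
  shows "Dv f x v = 0"
proof -
  have "(f has_derivative (\<lambda>v. 0)) (at x)"
    by (rule has_derivative_transform_within_open[OF has_derivative_const[of k] assms(1,2)]) (simp add: assms(3))
  then show ?thesis by (simp add: Dv_eqI)
qed

lemma circ1_unique:
  assumes e: "e > 0" "ball c0 e \<subseteq> S" and t: "\<bar>t\<bar> < 1"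
    and K: "\<Psi> ` ball c0 e \<subseteq> circ1 a t" "norm a = 1" and K': "\<Psi> ` ball c0 e \<subseteq> circ1 b t" "norm b = 1"
  shows "circ1 a t = circ1 b t"
proof -
  obtain \<delta> c1 e1 where 1: "\<delta> \<in> {1, -1}" "e1 > 0" "ball c1 e1 \<subseteq> ball c0 e"
    "\<And>u. u \<in> ball c1 e1 \<Longrightarrow> circ_axis t (\<delta> * t) u = \<delta> *\<^sub>R a"
    by (rule circ1_subball[OF e K t]) (assumption | rule that, assumption+)+
  have sub1: "ball c1 e1 \<subseteq> S" "\<Psi> ` ball c1 e1 \<subseteq> circ1 b t" using 1(3) e K' by blast+
  obtain \<delta>' c2 e2 where 2: "\<delta>' \<in> {1, -1}" "e2 > 0" "ball c2 e2 \<subseteq> ball c1 e1"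
    "\<And>u. u \<in> ball c2 e2 \<Longrightarrow> circ_axis t (\<delta>' * t) u = \<delta>' *\<^sub>R b"
    by (rule circ1_subball[OF 1(2) sub1(1) sub1(2) K'(2) t]) (assumption | rule that, assumption+)+
  have "c2 \<in> ball c2 e2" using 2(2) by simp
  then have c2: "c2 \<in> ball c2 e2" "c2 \<in> ball c1 e1" "c2 \<in> ball c0 e" using 2(3) 1(3) by blast+
  have tt: "\<delta> * t = \<delta>' * t"
    by (rule circ_axis_separated[OF e(2) c2(3) circ1_point(2)[OF open_ball e(2) _ K t]
       constant_Dv_zero[OF open_ball c2(2) 1(4)] constant_Dv_zero[OF open_ball c2(1) 2(4)]])
  have "\<delta> *\<^sub>R a = circ_axis t (\<delta> * t) c2" using 1(4)[OF c2(2)] by (rule sym)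
  also have "\<dots> = circ_axis t (\<delta>' * t) c2" by (simp only: tt)
  also have "\<dots> = \<delta>' *\<^sub>R b" by (rule 2(4)[OF c2(1)])
  finally have RR: "\<delta> *\<^sub>R a = \<delta>' *\<^sub>R b" .
  have "circ1 a t = circ1 (\<delta> *\<^sub>R a) (\<delta> * t)" using circ1_sign[OF 1(1)] by (rule sym)
  also have "\<dots> = circ1 (\<delta>' *\<^sub>R b) (\<delta>' * t)" by (simp only: tt RR)
  also have "\<dots> = circ1 b t" by (rule circ1_sign[OF 2(1)])
  finally show ?thesis .
qed

lemma circ1_rigid:
  assumes t: "\<bar>t\<bar> < 1" and n2: "\<And>u. u \<in> ball z r \<Longrightarrow> n2 u = 0"
    and dense: "\<And>c0 e. e > 0 \<Longrightarrow> ball c0 e \<subseteq> ball z r \<Longrightarrow> \<exists>a c' e'. norm a = 1 \<and> e' > 0 \<and> ball c' e' \<subseteq> ball c0 e \<and> \<Psi> ` ball c' e' \<subseteq> circ1 a t"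
  shows "\<exists>a. norm a = 1 \<and> \<Psi> ` ball z r \<subseteq> circ1 a t"
proof -
  have n: "n1 u \<noteq> 0" if "u \<in> ball z r" for u
  proof -
    have "u \<in> S" using that ball_sub by blast
    then show ?thesis using normal_nz[of u] n2[OF that] by blast
  qed
  define J where "J = {t, -t}"
  have fin: "finite J" by (simp add: J_def)
  have C: "C1_on (ball z r) (circ_axis t j)" for j by (rule C1_circ_axis[OF ball_sub n])
  have sep: "j = j'" if "u \<in> ball z r" "j \<in> J" "j' \<in> J" "\<And>v. Dv (circ_axis t j) u v = 0" "\<And>v. Dv (circ_axis t j') u v = 0" for u j j'
    by (rule circ_axis_separated[OF ball_sub that(1) n that(4,5)])
  have loc: "\<exists>j\<in>J. \<exists>a c' e'. norm a = 1 \<and> e' > 0 \<and> ball c' e' \<subseteq> ball c0 e \<and> (\<exists>\<delta>\<in>{1,-1}. j = \<delta> * t \<and> (\<forall>u\<in>ball c' e'. circ_axis t j u = \<delta> *\<^sub>R a))"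
    if e: "e > 0" "ball c0 e \<subseteq> ball z r" for c0 e
  proof -
    obtain a c1 e1 where a: "norm a = 1" "e1 > 0" "ball c1 e1 \<subseteq> ball c0 e" "\<Psi> ` ball c1 e1 \<subseteq> circ1 a t"
      using dense[OF e] by blast
    have sub: "ball c1 e1 \<subseteq> S" using a e ball_sub by blast
    obtain \<delta> c' e' where d: "\<delta> \<in> {1, -1}" "e' > 0" "ball c' e' \<subseteq> ball c1 e1"
      "\<And>u. u \<in> ball c' e' \<Longrightarrow> circ_axis t (\<delta> * t) u = \<delta> *\<^sub>R a"
      by (rule circ1_subball[OF a(2) sub a(4,1) t]) (assumption | rule that, assumption+)+
    show ?thesis
    proof (rule bexI[of _ "\<delta> * t"], rule exI[of _ a], rule exI[of _ c'], rule exI[of _ e'], intro conjI)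
      show "ball c' e' \<subseteq> ball c0 e" using d a by blast
      show "\<exists>\<delta>'\<in>{1, -1}. \<delta> * t = \<delta>' * t \<and> (\<forall>u\<in>ball c' e'. circ_axis t (\<delta> * t) u = \<delta>' *\<^sub>R a)"
        using d by blast
      show "\<delta> * t \<in> J" using d by (auto simp: J_def)
    qed (use d a in auto)
  qed
  obtain j v where j: "j \<in> J" "\<And>u. u \<in> ball z r \<Longrightarrow> circ_axis t j u = v" "\<And>u v. u \<in> ball z r \<Longrightarrow> Dv (circ_axis t j) u v = 0"
  proof (rule dense_constancy[OF r fin C _ sep])
    show "\<exists>j\<in>J. \<exists>c' e' v. e' > 0 \<and> ball c' e' \<subseteq> ball c0 e \<and> (\<forall>u\<in>ball c' e'. circ_axis t j u = v)"
      if "e > 0" "ball c0 e \<subseteq> ball z r" for c0 e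
      using loc[OF that] by blast
  qed (assumption | rule that, assumption+)+
  obtain j' a c' e' \<delta> where l: "j' \<in> J" "norm a = 1" "e' > 0" "ball c' e' \<subseteq> ball z r" "\<delta> \<in> {1, -1}" "j' = \<delta> * t"
    "\<And>u. u \<in> ball c' e' \<Longrightarrow> circ_axis t j' u = \<delta> *\<^sub>R a"
    using loc[OF r order_refl] by blast
  have "c' \<in> ball c' e'" using l(3) by simp
  then have c': "c' \<in> ball c' e'" "c' \<in> ball z r" using l(4) by blast+
  have jj: "j = j'" by (rule sep[OF c'(2) j(1) l(1) j(3)[OF c'(2)] constant_Dv_zero[OF open_ball c'(1) l(7)]])
  have v: "v = \<delta> *\<^sub>R a" using j(2)[OF c'(2)] l(7)[OF c'(1)] jj by simp
  have "\<Psi> u \<in> circ1 a t" if u: "u \<in> ball z r" for u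
  proof -
    have uS: "u \<in> S" using u ball_sub by blast
    have "\<delta> *\<^sub>R a = circ_axis t j u" using j(2)[OF u] v by simp
    also have "\<dots> = (\<delta> * t) *\<^sub>R p u + sqrt (1 - t\<^sup>2) *\<^sub>R nu1 u" by (simp add: circ_axis_def jj l(6))
    finally have "p u \<bullet> (\<delta> *\<^sub>R a) = \<delta> * t" using unit[OF uS] nu_perp[of u] by (simp add: inner_add_right)
    then have "\<Psi> u \<in> circ1 (\<delta> *\<^sub>R a) (\<delta> * t)" using sph uS by (auto simp: circ1_def p_def)
    then show ?thesis using circ1_sign[OF l(5)] by simp
  qed
  then show ?thesis using l(2) by blast
qed

lemma swap_circ: "(prod.swap \<circ> \<Psi>) ` W \<subseteq> circ1 a t \<longleftrightarrow> \<Psi> ` W \<subseteq> circ2 a t"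
  "(prod.swap \<circ> \<Psi>) ` W \<subseteq> circ2 a t \<longleftrightarrow> \<Psi> ` W \<subseteq> circ1 a t"
  unfolding image_subset_iff o_def circ1_def circ2_def by (auto simp: S2xS2_def mem_Times_iff)

lemma circ2_point:
  assumes W: "open W" "W \<subseteq> S" "u \<in> W" and K: "\<Psi> ` W \<subseteq> circ2 a t" and a: "norm a = 1" and t: "\<bar>t\<bar> < 1"
  shows "n1 u = 0" "n2 u \<noteq> 0"
proof -
  have uS: "u \<in> S" using W by blast
  show "n1 u = 0" "n2 u \<noteq> 0"
    using patch.circ1_point(1,2)[OF swap_patch W swap_circ(1)[THEN iffD2, OF K] a t] swap_normal[OF uS] by simp_all
qed

lemma circ_unique:
  assumes e: "e > 0" "ball c0 e \<subseteq> S" and t: "\<bar>t\<bar> < 1"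
    and K: "\<Psi> ` ball c0 e \<subseteq> K" "K \<in> circ_class t" and K': "\<Psi> ` ball c0 e \<subseteq> K'" "K' \<in> circ_class t"
  shows "K = K'"
proof -
  have c0: "c0 \<in> ball c0 e" using e by simp
  have mixed: False if "\<Psi> ` ball c0 e \<subseteq> circ1 a t" "norm a = 1" "\<Psi> ` ball c0 e \<subseteq> circ2 b t" "norm b = 1" for a b
    using circ1_point(1,2)[OF open_ball e(2) c0 that(1,2) t] circ2_point[OF open_ball e(2) c0 that(3,4) t] by simp
  have sw: "circ2 a t = circ2 b t" if "circ1 a t = circ1 b t" for a b
  proof -
    have "x \<in> circ2 a' t \<longleftrightarrow> prod.swap x \<in> circ1 a' t" for x a' by (auto simp: circ1_def circ2_def S2xS2_def mem_Times_iff)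
    then show ?thesis using that by blast
  qed
  have two: "circ2 a t = circ2 b t" if "\<Psi> ` ball c0 e \<subseteq> circ2 a t" "norm a = 1" "\<Psi> ` ball c0 e \<subseteq> circ2 b t" "norm b = 1" for a b
    by (rule sw[OF patch.circ1_unique[OF swap_patch e t swap_circ(1)[THEN iffD2, OF that(1)] that(2) swap_circ(1)[THEN iffD2, OF that(3)] that(4)]])
  from K(2) K'(2) consider
      (a) a b where "K = circ1 a t" "norm a = 1" "K' = circ1 b t" "norm b = 1"
    | (b) a b where "K = circ1 a t" "norm a = 1" "K' = circ2 b t" "norm b = 1"
    | (c) a b where "K = circ2 a t" "norm a = 1" "K' = circ1 b t" "norm b = 1"
    | (d) a b where "K = circ2 a t" "norm a = 1" "K' = circ2 b t" "norm b = 1"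
    unfolding circ_class_def by blast
  then show ?thesis
  proof cases
    case a
    then show ?thesis using circ1_unique[OF e t, of a b] K(1) K'(1) by simp
  next
    case b
    then show ?thesis using mixed[of a b] K(1) K'(1) by simp
  next
    case c
    then show ?thesis using mixed[of b a] K(1) K'(1) by simp
  next
    case d
    then show ?thesis using two[of a b] K(1) K'(1) by simp
  qed
qed

text \<open>The zero sets of n1 and n2 are closed and disjoint. Their union contains a dense set,
  since one normal component vanishes on each model, so one of them is the whole ball. The circle
  then lies in the same factor throughout, and \<open>circ1_rigid\<close> applies to the patch or to
  its swap.\<close>

lemma circ_rigid:
  assumes t: "\<bar>t\<bar> < 1"
    and dense: "\<And>c0 e. e > 0 \<Longrightarrow> ball c0 e \<subseteq> ball z r \<Longrightarrow> \<exists>K\<in>circ_class t. \<exists>c' e'. e' > 0 \<and> ball c' e' \<subseteq> ball c0 e \<and> \<Psi> ` ball c' e' \<subseteq> K"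
  shows "\<exists>K\<in>circ_class t. \<Psi> ` ball z r \<subseteq> K"
proof -
  define Q1 where "Q1 = ball z r \<inter> n1 -` {0}"
  define Q2 where "Q2 = ball z r \<inter> n2 -` {0}"
  have cl: "closedin (top_of_set (ball z r)) Q1" "closedin (top_of_set (ball z r)) Q2"
    unfolding Q1_def Q2_def
    by (intro continuous_closedin_preimage continuous_on_subset[OF C1_on_imp_continuous[OF C1_n1] ball_sub]
        continuous_on_subset[OF C1_on_imp_continuous[OF C1_n2] ball_sub]; simp)+
  have disj: "Q1 \<inter> Q2 = {}" using normal_nz ball_sub by (auto simp: Q1_def Q2_def)
  have sub: "Q1 \<subseteq> ball z r" "Q2 \<subseteq> ball z r" by (auto simp: Q1_def Q2_def)
  have cov: "Q1 \<union> Q2 = ball z r"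
  proof (rule ccontr)
    assume ne: "Q1 \<union> Q2 \<noteq> ball z r"
    have "openin (top_of_set (ball z r)) (ball z r - (Q1 \<union> Q2))" using cl by (simp add: openin_diff closedin_Un)
    then have "open (ball z r - (Q1 \<union> Q2))" using openin_open_trans open_ball by blast
    moreover obtain u where "u \<in> ball z r - (Q1 \<union> Q2)" using ne sub by blast
    ultimately obtain e where e: "e > 0" "ball u e \<subseteq> ball z r - (Q1 \<union> Q2)" using open_contains_ball by metis
    then have eb: "ball u e \<subseteq> ball z r" by blast
    obtain K c' e' where K: "K \<in> circ_class t" "e' > 0" "ball c' e' \<subseteq> ball u e" "\<Psi> ` ball c' e' \<subseteq> K"
      using dense[OF e(1) eb] by blast
    have c': "c' \<in> ball c' e'" using K(2) by simp
    have cS: "ball c' e' \<subseteq> S" using K e eb ball_sub by blast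
    have "n1 c' = 0 \<or> n2 c' = 0"
      using K(1) circ1_point(1)[OF open_ball cS c' _ _ t] circ2_point(1)[OF open_ball cS c' _ _ t] K(4)
      unfolding circ_class_def by blast
    moreover have "c' \<in> ball z r - (Q1 \<union> Q2)" using c' K e by blast
    ultimately show False by (auto simp: Q1_def Q2_def)
  qed
  have "openin (top_of_set (ball z r)) Q1"
  proof -
    have "Q1 = ball z r - Q2" using cov disj sub by blast
    then show ?thesis using cl(2) by (metis openin_diff openin_subtopology_self)
  qed
  then have "Q1 = {} \<or> Q1 = ball z r" using connected_clopen[of "ball z r"] cl(1) by auto
  then show ?thesis
  proof
    assume "Q1 = {}"
    then have "Q2 = ball z r" using cov by simp
    then have n2: "\<And>u. u \<in> ball z r \<Longrightarrow> n2 u = 0" unfolding Q2_def by blast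
    have "\<exists>a. norm a = 1 \<and> \<Psi> ` ball z r \<subseteq> circ1 a t"
    proof (rule circ1_rigid[OF t n2])
      fix c0 e assume e: "(0::real) < e" "ball c0 e \<subseteq> ball z r"
      obtain K c' e' where K: "K \<in> circ_class t" "e' > 0" "ball c' e' \<subseteq> ball c0 e" "\<Psi> ` ball c' e' \<subseteq> K"
        using dense[OF e] by blast
      have c': "c' \<in> ball c' e'" using K(2) by simp
      have cS: "ball c' e' \<subseteq> S" "c' \<in> ball z r" using K e c' ball_sub by blast+
      have "\<nexists>a. K = circ2 a t \<and> norm a = 1"
        using circ2_point(2)[OF open_ball cS(1) c' _ _ t] n2[OF cS(2)] K(4) by blast
      then obtain a where "K = circ1 a t" "norm a = 1" using K(1) unfolding circ_class_def by blast
      then show "\<exists>a c' e'. norm a = 1 \<and> e' > 0 \<and> ball c' e' \<subseteq> ball c0 e \<and> \<Psi> ` ball c' e' \<subseteq> circ1 a t"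
        using K by blast
    qed
    then show ?thesis unfolding circ_class_def by blast
  next
    assume "Q1 = ball z r"
    then have n1: "\<And>u. u \<in> ball z r \<Longrightarrow> n1 u = 0" unfolding Q1_def by blast
    have "\<exists>a. norm a = 1 \<and> (prod.swap \<circ> \<Psi>) ` ball z r \<subseteq> circ1 a t"
    proof (rule patch.circ1_rigid[OF swap_patch t])
      show "patch.n2 (prod.swap \<circ> \<Psi>) u = 0" if "u \<in> ball z r" for u
      proof -
        have "u \<in> S" using that ball_sub by blast
        then show ?thesis using swap_normal(2)[of u] n1[OF that] by simp
      qed
      fix c0 e assume e: "(0::real) < e" "ball c0 e \<subseteq> ball z r"
      obtain K c' e' where K: "K \<in> circ_class t" "e' > 0" "ball c' e' \<subseteq> ball c0 e" "\<Psi> ` ball c' e' \<subseteq> K"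
        using dense[OF e] by blast
      have c': "c' \<in> ball c' e'" using K(2) by simp
      have cS: "ball c' e' \<subseteq> S" "c' \<in> ball z r" using K e c' ball_sub by blast+
      have "\<nexists>a. K = circ1 a t \<and> norm a = 1"
        using circ1_point(2)[OF open_ball cS(1) c' _ _ t] n1[OF cS(2)] K(4) by blast
      then obtain a where a: "K = circ2 a t" "norm a = 1" using K(1) unfolding circ_class_def by blast
      then have "(prod.swap \<circ> \<Psi>) ` ball c' e' \<subseteq> circ1 a t" using swap_circ(1) K(4) by blast
      then show "\<exists>a c' e'. norm a = 1 \<and> e' > 0 \<and> ball c' e' \<subseteq> ball c0 e \<and> (prod.swap \<circ> \<Psi>) ` ball c' e' \<subseteq> circ1 a t"
        using K a by blast
    qed
    then show ?thesis unfolding swap_circ circ_class_def by blast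
  qed
qed

end

section \<open>Properties shared by both families of models\<close>

lemma transpose_adjoint: "x \<bullet> (R *v y) = (transpose R *v x) \<bullet> y" for R :: "real^3^3"
  by (simp add: dot_lmul_matrix)

lemma act_rotK:
  assumes T: "T \<in> orth_pairs"
  shows "act T x \<in> rotK (fst T ** R ** transpose (snd T)) t \<longleftrightarrow> x \<in> rotK R t"
proof -
  have o: "orthogonal_matrix (fst T)" "orthogonal_matrix (snd T)" using T by (auto simp: orth_pairs_def)
  have 1: "(fst T ** R ** transpose (snd T)) *v (snd T *v y) = fst T *v (R *v y)" for y
    using o(2) by (simp add: matrix_vector_mul_assoc matrix_mul_assoc[symmetric] orthogonal_matrix_def)
  have S: "act T x \<in> S2xS2 \<longleftrightarrow> x \<in> S2xS2"
    using act_S2xS2[OF T, of x] act_S2xS2[OF inv_pair_orth[OF T], of "act T x"] act_inv_pair[OF T, of x] by auto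
  have "fst (act T x) \<bullet> ((fst T ** R ** transpose (snd T)) *v snd (act T x)) = fst x \<bullet> (R *v snd x)"
    unfolding act_def fst_conv snd_conv 1 by (rule orthogonal_matrix_inner[OF o(1)])
  then show ?thesis unfolding rotK_def using S by simp
qed

lemma act_circ:
  assumes T: "T \<in> orth_pairs"
  shows "act T x \<in> circ1 (fst T *v a) t \<longleftrightarrow> x \<in> circ1 a t" "act T x \<in> circ2 (snd T *v a) t \<longleftrightarrow> x \<in> circ2 a t"
proof -
  have o: "orthogonal_matrix (fst T)" "orthogonal_matrix (snd T)" using T by (auto simp: orth_pairs_def)
  have S: "act T x \<in> S2xS2 \<longleftrightarrow> x \<in> S2xS2"
    using act_S2xS2[OF T, of x] act_S2xS2[OF inv_pair_orth[OF T], of "act T x"] act_inv_pair[OF T, of x] by auto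
  show "act T x \<in> circ1 (fst T *v a) t \<longleftrightarrow> x \<in> circ1 a t" "act T x \<in> circ2 (snd T *v a) t \<longleftrightarrow> x \<in> circ2 a t"
    unfolding circ1_def circ2_def using S by (simp_all add: act_def orthogonal_matrix_inner[OF o(1)] orthogonal_matrix_inner[OF o(2)])
qed

lemma orthogonal_norm: "orthogonal_matrix A \<Longrightarrow> norm (A *v x) = norm x" for A :: "real^3^3"
  by (simp add: norm_eq_sqrt_inner orthogonal_matrix_inner)

text \<open>From here on the two kinds of models are treated together, through invariance
  (\<open>model_act\<close>, \<open>model_swap\<close>), closedness (\<open>model_closed\<close>),
  uniqueness (\<open>model_unique\<close>) and rigidity (\<open>model_rigid\<close>).\<close>

definition model_class :: "R3xR3 set set \<Rightarrow> bool" where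
  "model_class \<K> \<longleftrightarrow> (\<exists>t. \<bar>t\<bar> < 1 \<and> (\<K> = rot_class t \<or> \<K> = circ_class t))"

lemma model_class_cases:
  assumes "model_class \<K>"
  obtains t where "\<bar>t\<bar> < 1" "\<K> = rot_class t" | t where "\<bar>t\<bar> < 1" "\<K> = circ_class t"
  using assms unfolding model_class_def by blast

lemma model_act:
  assumes "model_class \<K>" "K \<in> \<K>" "T \<in> orth_pairs"
  obtains K' where "K' \<in> \<K>" "\<And>x. act T x \<in> K' \<longleftrightarrow> x \<in> K"
proof -
  have o: "orthogonal_matrix (fst T)" "orthogonal_matrix (snd T)" using assms(3) by (auto simp: orth_pairs_def)
  from assms(1) have "\<exists>K'\<in>\<K>. \<forall>x. act T x \<in> K' \<longleftrightarrow> x \<in> K"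
  proof (cases rule: model_class_cases)
    case (1 t)
    then obtain R where R: "K = rotK R t" "orthogonal_matrix R" using assms(2) by (auto simp: rot_class_def)
    have "orthogonal_matrix (fst T ** R ** transpose (snd T))" using o R by (intro orthogonal_matrix_mul) auto
    then show ?thesis using act_rotK[OF assms(3), of _ R t] R 1 unfolding rot_class_def by blast
  next
    case (2 t)
    then consider a where "K = circ1 a t" "norm a = 1" | a where "K = circ2 a t" "norm a = 1"
      using assms(2) by (auto simp: circ_class_def)
    then show ?thesis
    proof cases
      case (1 a)
      have "norm (fst T *v a) = 1" using 1 orthogonal_norm[OF o(1)] by simp
      then show ?thesis using act_circ(1)[OF assms(3), of _ a t] 1 2 unfolding circ_class_def by blast
    next
      case (2 a)
      have "norm (snd T *v a) = 1" using 2 orthogonal_norm[OF o(2)] by simp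
      then show ?thesis using act_circ(2)[OF assms(3), of _ a t] 2 \<open>\<K> = circ_class t\<close> unfolding circ_class_def by blast
    qed
  qed
  then show ?thesis using that by blast
qed

lemma model_swap:
  assumes "model_class \<K>" "K \<in> \<K>"
  obtains K' where "K' \<in> \<K>" "\<And>x. prod.swap x \<in> K' \<longleftrightarrow> x \<in> K"
proof -
  have S: "prod.swap x \<in> S2xS2 \<longleftrightarrow> x \<in> S2xS2" for x by (auto simp: S2xS2_def mem_Times_iff)
  from assms(1) have "\<exists>K'\<in>\<K>. \<forall>x. prod.swap x \<in> K' \<longleftrightarrow> x \<in> K"
  proof (cases rule: model_class_cases)
    case (1 t)
    then obtain R where R: "K = rotK R t" "orthogonal_matrix R" using assms(2) by (auto simp: rot_class_def)
    have "prod.swap x \<in> rotK (transpose R) t \<longleftrightarrow> x \<in> rotK R t" for x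
      unfolding rotK_def mem_Collect_eq S transpose_adjoint[of "fst x"] by (simp add: inner_commute)
    moreover have "orthogonal_matrix (transpose R)" using R by simp
    ultimately show ?thesis using R 1 unfolding rot_class_def by blast
  next
    case (2 t)
    have "prod.swap x \<in> circ2 a t \<longleftrightarrow> x \<in> circ1 a t" "prod.swap x \<in> circ1 a t \<longleftrightarrow> x \<in> circ2 a t" for x a
      unfolding circ1_def circ2_def mem_Collect_eq S by simp_all
    then show ?thesis using assms(2) 2 unfolding circ_class_def by blast
  qed
  then show ?thesis using that by blast
qed

lemma closed_S2xS2: "closed S2xS2"
  unfolding S2xS2_def S2_def by (intro closed_Times) auto

lemma model_closed:
  assumes "model_class \<K>" "K \<in> \<K>" shows "closed K"
proof -
  have *: "closed {x \<in> S2xS2. f x = t}" if "continuous_on UNIV f" for f :: "R3xR3 \<Rightarrow> real" and t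
  proof -
    have "closed (S2xS2 \<inter> f -` {t})"
      by (rule continuous_closed_preimage[OF continuous_on_subset[OF that] closed_S2xS2]) auto
    moreover have "{x \<in> S2xS2. f x = t} = S2xS2 \<inter> f -` {t}" by auto
    ultimately show ?thesis by simp
  qed
  have c: "continuous_on UNIV (\<lambda>x::R3xR3. fst x \<bullet> (R *v snd x))" for R :: "real^3^3"
    by (intro continuous_intros bounded_linear.continuous_on[OF matrix_vector_mul_bounded_linear])
  have c2: "continuous_on UNIV (\<lambda>x::R3xR3. fst x \<bullet> a)" "continuous_on UNIV (\<lambda>x::R3xR3. snd x \<bullet> a)" for a
    by (intro continuous_intros)+
  from assms show ?thesis
    by (cases rule: model_class_cases)
       (auto simp: rot_class_def circ_class_def rotK_def circ1_def circ2_def intro!: *[OF c] *[OF c2(1)] *[OF c2(2)])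
qed

lemma (in patch) model_unique:
  assumes "model_class \<K>" "e > 0" "ball c0 e \<subseteq> S" "\<Psi> ` ball c0 e \<subseteq> K" "K \<in> \<K>" "\<Psi> ` ball c0 e \<subseteq> K'" "K' \<in> \<K>"
  shows "K = K'"
  using assms(1)
proof (cases rule: model_class_cases)
  case (1 t)
  obtain R R' where R: "K = rotK R t" "orthogonal_matrix R" "K' = rotK R' t" "orthogonal_matrix R'"
    using assms 1 unfolding rot_class_def by blast
  then show ?thesis using rotK_unique[OF assms(2,3) 1(1), of R R'] assms(4,6) by simp
next
  case (2 t)
  then show ?thesis using circ_unique[OF assms(2,3) 2(1) assms(4) _ assms(6)] assms(5,7) by simp
qed

lemma (in patch) model_rigid:
  assumes "model_class \<K>"
    and dense: "\<And>c0 e. e > 0 \<Longrightarrow> ball c0 e \<subseteq> ball z r \<Longrightarrow> \<exists>K\<in>\<K>. \<exists>c' e'. e' > 0 \<and> ball c' e' \<subseteq> ball c0 e \<and> \<Psi> ` ball c' e' \<subseteq> K"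
  shows "\<exists>K\<in>\<K>. \<Psi> ` ball z r \<subseteq> K"
  using assms(1)
proof (cases rule: model_class_cases)
  case (1 t)
  then show ?thesis using rotK_rigid[OF 1(1)] dense by blast
next
  case (2 t)
  then show ?thesis using circ_rigid[OF 2(1)] dense by blast
qed

section \<open>Countable families of patches with a homogeneous union\<close>

text \<open>Local homogeneity in terms of patches. Closing the family under swaps absorbs exchanges
  of factors, so \<open>hom\<close> speaks of pairs of orthogonal matrices only; the price is that
  the target point is reached up to a swap.\<close>

locale homogeneous_family =
  fixes \<P> :: "((real^3 \<Rightarrow> R3xR3) \<times> (real^3) \<times> real) set"
  assumes cP: "countable \<P>" and patchP: "\<And>\<Psi> z r. (\<Psi>, z, r) \<in> \<P> \<Longrightarrow> \<exists>S c. patch \<Psi> z r S c"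
    and swapP: "\<And>\<Psi> z r. (\<Psi>, z, r) \<in> \<P> \<Longrightarrow> (prod.swap \<circ> \<Psi>, z, r) \<in> \<P>"
    and hom: "\<And>\<Psi> z r u \<Psi>' z' r' v. (\<Psi>, z, r) \<in> \<P> \<Longrightarrow> u \<in> ball z r \<Longrightarrow> (\<Psi>', z', r') \<in> \<P> \<Longrightarrow> v \<in> ball z' r' \<Longrightarrow>
      \<exists>T\<in>orth_pairs. \<exists>e>0. (act T (\<Psi> u) = \<Psi>' v \<or> act T (\<Psi> u) = prod.swap (\<Psi>' v)) \<and>
        act T ` \<Psi> ` ball u e \<subseteq> (\<Union>(\<Psi>, z, r)\<in>\<P>. \<Psi> ` ball z r)"
begin

text \<open>The moved ball is covered by countably many compact patch images, so one of them
  contains the image of a subball. This subball need not contain u.\<close>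

lemma moved_piece:
  assumes P: "patch \<Psi> z r S c" and T: "T \<in> orth_pairs" and e: "e > 0" "ball u e \<subseteq> ball z r"
    and im: "act T ` \<Psi> ` ball u e \<subseteq> (\<Union>(\<Psi>, z, r)\<in>\<P>. \<Psi> ` ball z r)"
  obtains \<Psi>' z' r' c0 e0 where "(\<Psi>', z', r') \<in> \<P>" "e0 > 0" "ball c0 e0 \<subseteq> ball u e" "\<And>w. w \<in> ball c0 e0 \<Longrightarrow> act T (\<Psi> w) \<in> \<Psi>' ` cball z' r'"
proof -
  interpret patch \<Psi> z r S c by fact
  have sub: "cball u (e/2) \<subseteq> ball u e" using e by auto
  define C where "C P = cball u (e/2) \<inter> (\<lambda>w. act T (\<Psi> w)) -` (fst P ` cball (fst (snd P)) (snd (snd P)))" for P :: "(real^3 \<Rightarrow> R3xR3) \<times> (real^3) \<times> real"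
  have ca: "continuous_on (cball u (e/2)) (\<lambda>w. act T (\<Psi> w))"
  proof -
    have "cball u (e/2) \<subseteq> cball z r" using sub e(2) ball_subset_cball by blast
    then show ?thesis
      by (intro bounded_linear.continuous_on[OF linear_conv_bounded_linear[THEN iffD1, OF act_linear]] continuous_on_subset[OF cont])
  qed
  have cl: "closed (C P)" if PP: "P \<in> \<P>" for P
  proof -
    obtain \<Psi>' z' r' where P: "P = (\<Psi>', z', r')" by (cases P)
    obtain S' c' where "patch \<Psi>' z' r' S' c'" using patchP[of \<Psi>' z' r'] PP P by blast
    then have "closed (\<Psi>' ` cball z' r')" using patch.compact_image compact_imp_closed by blast
    then show ?thesis unfolding C_def P by (intro continuous_closed_preimage[OF ca closed_cball]) simp
  qed
  have cov: "ball u (e/2) \<subseteq> (\<Union>P\<in>\<P>. C P)"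
  proof
    fix w assume "w \<in> ball u (e/2)"
    then have w: "w \<in> cball u (e/2)" "w \<in> ball u e" using e by auto
    then have "act T (\<Psi> w) \<in> (\<Union>(\<Psi>, z, r)\<in>\<P>. \<Psi> ` ball z r)" using im by blast
    then obtain \<Psi>' z' r' where P: "(\<Psi>', z', r') \<in> \<P>" "act T (\<Psi> w) \<in> \<Psi>' ` ball z' r'" by blast
    then have "act T (\<Psi> w) \<in> \<Psi>' ` cball z' r'" using ball_subset_cball by blast
    then have "w \<in> C (\<Psi>', z', r')" using w by (simp add: C_def)
    then show "w \<in> (\<Union>P\<in>\<P>. C P)" using P by blast
  qed
  have ne: "ball u (e/2) \<noteq> {}" using e by simp
  obtain P c0 e0 where P: "P \<in> \<P>" "e0 > 0" "ball c0 e0 \<subseteq> ball u (e/2)" "ball c0 e0 \<subseteq> C P"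
    by (rule Baire_union[OF open_ball ne cP cl cov]) (assumption | rule that, assumption+)+
  obtain \<Psi>' z' r' where PP: "P = (\<Psi>', z', r')" by (cases P)
  show ?thesis
  proof (rule that)
    show "(\<Psi>', z', r') \<in> \<P>" using P PP by simp
    show "ball c0 e0 \<subseteq> ball u e" using P(3) sub ball_subset_cball by blast
    show "act T (\<Psi> w) \<in> \<Psi>' ` cball z' r'" if "w \<in> ball c0 e0" for w
    proof -
      have "w \<in> C P" using P(4) that by blast
      then show ?thesis by (simp add: C_def PP)
    qed
  qed (rule P)
qed

text \<open>One open piece in a model propagates to all patches: translates of the piece cover everything,
  and only countably many translates occur because each of them contains an open piece of some patch.\<close>

lemma propagate:
  assumes \<K>: "model_class \<K>" and P0: "(\<Psi>0, z0, r0) \<in> \<P>" and piece: "ball u0 e0 \<subseteq> ball z0 r0" "e0 > 0" "\<Psi>0 ` ball u0 e0 \<subseteq> K0" "K0 \<in> \<K>"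
    and P1: "(\<Psi>1, z1, r1) \<in> \<P>"
  shows "\<exists>K\<in>\<K>. \<Psi>1 ` ball z1 r1 \<subseteq> K"
proof -
  obtain \<B> :: "(real^3) set set" where \<B>: "countable \<B>" "\<And>B. B \<in> \<B> \<Longrightarrow> open B" "\<And>U. open U \<Longrightarrow> \<exists>\<B>'\<subseteq>\<B>. U = \<Union>\<B>'"
    using ex_countable_basis unfolding topological_basis_def by metis
  \<comment> \<open>By \<open>model_unique\<close> a patch and a basic open set determine the model
    that contains this piece, so \<R> is countable.\<close>
  define \<R> where "\<R> = {K \<in> \<K>. \<exists>\<Psi> z r B. (\<Psi>, z, r) \<in> \<P> \<and> B \<in> \<B> \<and> B \<noteq> {} \<and> B \<subseteq> ball z r \<and> \<Psi> ` B \<subseteq> K}"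
  define good where "good K P B \<longleftrightarrow> K \<in> \<K> \<and> P \<in> \<P> \<and> B \<in> \<B> \<and> B \<noteq> {} \<and> B \<subseteq> ball (fst (snd P)) (snd (snd P)) \<and> fst P ` B \<subseteq> K"
    for K :: "R3xR3 set" and P :: "(real^3 \<Rightarrow> R3xR3) \<times> (real^3) \<times> real" and B
  have goodU: "K = K'" if "good K P B" "good K' P B" for K K' P B
  proof -
    obtain \<Psi> z r where P: "P = (\<Psi>, z, r)" by (cases P)
    have g: "K \<in> \<K>" "K' \<in> \<K>" "(\<Psi>, z, r) \<in> \<P>" "B \<in> \<B>" "B \<noteq> {}" "B \<subseteq> ball z r" "\<Psi> ` B \<subseteq> K" "\<Psi> ` B \<subseteq> K'"
      using that unfolding good_def P by auto
    obtain S c where pt: "patch \<Psi> z r S c" using patchP[OF g(3)] by blast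
    obtain w where "w \<in> B" using g by blast
    then obtain e where e: "e > 0" "ball w e \<subseteq> B" using \<B>(2)[OF g(4)] open_contains_ball by metis
    have "ball w e \<subseteq> S" using e g(6) patch.ball_sub[OF pt] by blast
    moreover have "\<Psi> ` ball w e \<subseteq> K" "\<Psi> ` ball w e \<subseteq> K'" using e g by blast+
    ultimately show ?thesis using patch.model_unique[OF pt \<K> e(1)] g(1,2) by blast
  qed
  have "countable \<R>"
  proof -
    have "\<R> \<subseteq> (\<lambda>(P, B). THE K. good K P B) ` (\<P> \<times> \<B>)"
    proof
      fix K assume "K \<in> \<R>"
      then obtain \<Psi> z r B where g: "good K (\<Psi>, z, r) B" unfolding \<R>_def good_def by auto
      have th: "(THE K. good K (\<Psi>, z, r) B) = K"
        by (rule the_equality[where P="\<lambda>K. good K (\<Psi>, z, r) B", OF g]) (rule goodU[OF _ g])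
      show "K \<in> (\<lambda>(P, B). THE K. good K P B) ` (\<P> \<times> \<B>)"
        by (rule image_eqI[of _ _ "((\<Psi>, z, r), B)"]) (use g in \<open>simp_all add: th, simp_all add: good_def\<close>)
    qed
    then show ?thesis by (rule countable_subset) (intro countable_image countable_SIGMA cP \<B>(1))
  qed
  have inR: "\<exists>K\<in>\<R>. \<Psi>' v \<in> K" if P': "(\<Psi>', z', r') \<in> \<P>" and v: "v \<in> ball z' r'" for \<Psi>' z' r' v
  proof -
    obtain S0 c0 where pt0: "patch \<Psi>0 z0 r0 S0 c0" using patchP[OF P0] by blast
    have u0b: "u0 \<in> ball u0 e0" using piece(2) by simp
    then have u0: "u0 \<in> ball z0 r0" using piece(1) by blast
    obtain T e where T: "T \<in> orth_pairs" "e > 0" "act T (\<Psi>0 u0) = \<Psi>' v \<or> act T (\<Psi>0 u0) = prod.swap (\<Psi>' v)"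
      "act T ` \<Psi>0 ` ball u0 e \<subseteq> (\<Union>(\<Psi>, z, r)\<in>\<P>. \<Psi> ` ball z r)" using hom[OF P0 u0 P' v] by blast
    define e1 where "e1 = min e e0"
    have e1: "e1 > 0" "ball u0 e1 \<subseteq> ball u0 e" "ball u0 e1 \<subseteq> ball u0 e0" using T(2) piece(2) by (auto simp: e1_def)
    have e1z: "ball u0 e1 \<subseteq> ball z0 r0" using e1(3) piece(1) by blast
    have im1: "act T ` \<Psi>0 ` ball u0 e1 \<subseteq> (\<Union>(\<Psi>, z, r)\<in>\<P>. \<Psi> ` ball z r)"
      by (rule order_trans[OF image_mono[OF image_mono[OF e1(2)]] T(4)])
    obtain \<Psi>2 z2 r2 c2 e2 where P2: "(\<Psi>2, z2, r2) \<in> \<P>" "e2 > 0" "ball c2 e2 \<subseteq> ball u0 e1" "\<And>w. w \<in> ball c2 e2 \<Longrightarrow> act T (\<Psi>0 w) \<in> \<Psi>2 ` cball z2 r2"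
      by (rule moved_piece[OF pt0 T(1) e1(1) e1z im1]) (assumption | rule that, assumption+)+
    obtain S2 d2 where pt2: "patch \<Psi>2 z2 r2 S2 d2" using patchP[OF P2(1)] by blast
    have sub2: "ball c2 e2 \<subseteq> cball z0 r0" using P2(3) e1z ball_subset_cball by blast
    obtain g where g: "open (g ` ball c2 e2)" "g ` ball c2 e2 \<subseteq> ball z2 r2" "\<And>w. w \<in> ball c2 e2 \<Longrightarrow> \<Psi>2 (g w) = act T (\<Psi>0 w)"
      by (rule patch.transfer_open[OF pt0 pt2 act_linear act_inj[OF T(1)] open_ball sub2 P2(4)]) (assumption | rule that, assumption+)+
    obtain K' where K': "K' \<in> \<K>" "\<And>x. act T x \<in> K' \<longleftrightarrow> x \<in> K0" using model_act[OF \<K> piece(4) T(1)] by blast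
    have gK: "\<Psi>2 ` g ` ball c2 e2 \<subseteq> K'"
    proof -
      have "\<Psi>2 (g w) \<in> K'" if w: "w \<in> ball c2 e2" for w
      proof -
        have "\<Psi>0 w \<in> K0" using piece(3) w P2(3) e1(3) by blast
        then show ?thesis using g(3)[OF w] K'(2) by simp
      qed
      then show ?thesis by blast
    qed
    obtain \<B>' where B': "\<B>' \<subseteq> \<B>" "g ` ball c2 e2 = \<Union>\<B>'" using \<B>(3)[OF g(1)] by blast
    have "g c2 \<in> \<Union>\<B>'" unfolding B'(2)[symmetric] using P2(2) by simp
    then obtain B where B: "B \<in> \<B>" "B \<noteq> {}" "B \<subseteq> g ` ball c2 e2" using B' by blast
    have "B \<subseteq> ball z2 r2" "\<Psi>2 ` B \<subseteq> K'" using B g(2) gK by blast+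
    then have KR: "K' \<in> \<R>" unfolding \<R>_def using K'(1) P2(1) B by blast
    \<comment> \<open>The subball carried into a single patch may miss u0, but K' is the translate
      of the whole model K0, which contains \<Psi>0 u0. So the moved base point lies on K'.\<close>
    have "\<Psi>0 u0 \<in> K0" using piece(3) u0b by blast
    then have yK: "act T (\<Psi>0 u0) \<in> K'" using K'(2) by blast
    show ?thesis
    proof (cases "act T (\<Psi>0 u0) = \<Psi>' v")
      case True
      then show ?thesis using yK KR by (intro bexI[of _ K']) simp_all
    next
      case False
      then have sv: "prod.swap (\<Psi>' v) \<in> K'" using T(3) yK by simp
      \<comment> \<open>The target was reached only after a swap; the swapped model contains it and
        belongs to \<R> by means of the swapped patch.\<close>
      obtain K'' where K'': "K'' \<in> \<K>" "\<And>x. prod.swap x \<in> K'' \<longleftrightarrow> x \<in> K'" using model_swap[OF \<K> K'(1)] by blast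
      have "prod.swap (prod.swap (\<Psi>' v)) \<in> K''" using K''(2) sv by blast
      then have "\<Psi>' v \<in> K''" by simp
      moreover have "(prod.swap \<circ> \<Psi>2) ` B \<subseteq> K''"
        unfolding image_subset_iff o_def using K''(2) \<open>\<Psi>2 ` B \<subseteq> K'\<close> by blast
      then have "K'' \<in> \<R>" unfolding \<R>_def using K''(1) swapP[OF P2(1)] B \<open>B \<subseteq> ball z2 r2\<close> by blast
      ultimately show ?thesis by blast
    qed
  qed
  obtain S1 d1 where pt1: "patch \<Psi>1 z1 r1 S1 d1" using patchP[OF P1] by blast
  show ?thesis
  proof (rule patch.model_rigid[OF pt1 \<K>])
    fix c e assume e: "(0::real) < e" "ball c e \<subseteq> ball z1 r1"
    have sub: "cball c (e/2) \<subseteq> ball c e" using e by auto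
    have cl: "closed (cball c (e/2) \<inter> \<Psi>1 -` K)" if "K \<in> \<R>" for K
    proof (rule continuous_closed_preimage[OF _ closed_cball])
      show "continuous_on (cball c (e/2)) \<Psi>1"
        using continuous_on_subset[OF patch.cont[OF pt1]] sub e(2) ball_subset_cball by blast
      show "closed K" using model_closed[OF \<K>] that unfolding \<R>_def by blast
    qed
    have cov: "ball c (e/2) \<subseteq> (\<Union>K\<in>\<R>. cball c (e/2) \<inter> \<Psi>1 -` K)"
    proof
      fix w assume "w \<in> ball c (e/2)"
      then have w: "w \<in> cball c (e/2)" "w \<in> ball c e" using e by auto
      then have "w \<in> ball z1 r1" using e by blast
      then obtain K where "K \<in> \<R>" "\<Psi>1 w \<in> K" using inR[OF P1] by blast
      then show "w \<in> (\<Union>K\<in>\<R>. cball c (e/2) \<inter> \<Psi>1 -` K)" using w by blast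
    qed
    have ne: "ball c (e/2) \<noteq> {}" using e by simp
    obtain K c' e' where K: "K \<in> \<R>" "e' > 0" "ball c' e' \<subseteq> ball c (e/2)" "ball c' e' \<subseteq> cball c (e/2) \<inter> \<Psi>1 -` K"
      by (rule Baire_union[OF open_ball ne \<open>countable \<R>\<close> cl cov]) (assumption | rule that, assumption+)+
    have "ball c' e' \<subseteq> ball c e" using K(3) sub ball_subset_cball by blast
    moreover have "\<Psi>1 ` ball c' e' \<subseteq> K" using K(4) by blast
    moreover have "K \<in> \<K>" using K(1) unfolding \<R>_def by blast
    ultimately show "\<exists>K\<in>\<K>. \<exists>c' e'. e' > 0 \<and> ball c' e' \<subseteq> ball c e \<and> \<Psi>1 ` ball c' e' \<subseteq> K"
      using K(2) by blast
  qed
qed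

text \<open>The Baire category theorem selects one compact set of pairs of orthogonal matrices that carry a
  fixed open piece of the patch into one other patch and move the base point over an open piece.\<close>

lemma transitive_movers:
  assumes P: "(\<Psi>, z0, r0) \<in> \<P>" and pt: "patch \<Psi> z r S c" and zr: "ball z r \<subseteq> ball z0 r0"
  obtains B \<Psi>' z' r' U L where "open B" "B \<noteq> {}" "B \<subseteq> ball z r" "(\<Psi>', z', r') \<in> \<P>" "open U" "U \<noteq> {}" "U \<subseteq> ball z r"
    "L = (\<lambda>x. x) \<or> L = prod.swap" "\<And>u. u \<in> U \<Longrightarrow> \<exists>T\<in>movers \<Psi> B (\<Psi>' ` cball z' r'). \<Psi> u = L (act T (\<Psi> z))"
proof -
  interpret patch \<Psi> z r S c by fact
  obtain \<B> :: "(real^3) set set" where \<B>: "countable \<B>" "\<And>B. B \<in> \<B> \<Longrightarrow> open B" "\<And>U. open U \<Longrightarrow> \<exists>\<B>'\<subseteq>\<B>. U = \<Union>\<B>'"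
    using ex_countable_basis unfolding topological_basis_def by metis
  \<comment> \<open>An index records a basic open piece, the patch into which it is moved, and
    whether the target point is reached directly or through the exchange of factors.\<close>
  define I where "I = {B \<in> \<B>. B \<noteq> {} \<and> B \<subseteq> ball z r} \<times> \<P> \<times> {(\<lambda>x. x), prod.swap :: R3xR3 \<Rightarrow> R3xR3}"
  \<comment> \<open>The parameters u for which some mover of index i brings the base point \<Psi> z
    to \<Psi> u, up to that exchange. Such a set is closed because the set of movers is
    compact.\<close>
  define C where "C i = cball z (r/2) \<inter> \<Psi> -` ((\<lambda>T. snd (snd i) (act T (\<Psi> z))) ` movers \<Psi> (fst i) (fst (fst (snd i)) ` cball (fst (snd (fst (snd i)))) (snd (snd (fst (snd i))))))"
    for i :: "(real^3) set \<times> ((real^3 \<Rightarrow> R3xR3) \<times> (real^3) \<times> real) \<times> (R3xR3 \<Rightarrow> R3xR3)"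
  have cI: "countable I" unfolding I_def
    using \<B>(1) cP by (intro countable_SIGMA countable_subset[OF _ \<B>(1)]) auto
  have sub: "cball z (r/2) \<subseteq> cball z r" "cball z (r/2) \<subseteq> ball z r" using r by auto
  have cl: "closed (C i)" if i: "i \<in> I" for i
  proof -
    obtain B \<Psi>' z' r' L where ii: "i = (B, (\<Psi>', z', r'), L)" by (cases i) auto
    have L: "L = (\<lambda>x. x) \<or> L = prod.swap" and P': "(\<Psi>', z', r') \<in> \<P>" using i by (auto simp: I_def ii)
    obtain S' c' where "patch \<Psi>' z' r' S' c'" using patchP[OF P'] by blast
    then have "compact (movers \<Psi> B (\<Psi>' ` cball z' r'))"
      by (intro compact_movers compact_imp_closed patch.compact_image)
    moreover have "continuous_on X (\<lambda>T. L (act T (\<Psi> z)))" for X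
    proof -
      have "continuous_on X (\<lambda>T. act T (\<Psi> z))"
        unfolding continuous_on_def by (intro ballI tendsto_act tendsto_const tendsto_ident_at)
      then show ?thesis using L by (auto simp: prod.swap_def intro!: continuous_intros)
    qed
    ultimately have "compact ((\<lambda>T. L (act T (\<Psi> z))) ` movers \<Psi> B (\<Psi>' ` cball z' r'))"
      by (intro compact_continuous_image)
    then show ?thesis unfolding C_def ii
      by (intro continuous_closed_preimage[OF continuous_on_subset[OF cont sub(1)] closed_cball] compact_imp_closed) simp
  qed
  have "z \<in> ball z r" using r by simp
  then have zb: "z \<in> ball z0 r0" using zr by blast
  have cov: "ball z (r/2) \<subseteq> (\<Union>i\<in>I. C i)"
  proof
    fix u assume "u \<in> ball z (r/2)"
    then have u: "u \<in> cball z (r/2)" "u \<in> ball z r" using r by auto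
    obtain T e where T: "T \<in> orth_pairs" "e > 0" "act T (\<Psi> z) = \<Psi> u \<or> act T (\<Psi> z) = prod.swap (\<Psi> u)"
      "act T ` \<Psi> ` ball z e \<subseteq> (\<Union>(\<Psi>, z, r)\<in>\<P>. \<Psi> ` ball z r)" using hom[OF P zb P subsetD[OF zr u(2)]] by blast
    define e1 where "e1 = min e r"
    have e1: "e1 > 0" "ball z e1 \<subseteq> ball z e" "ball z e1 \<subseteq> ball z r" using T(2) r by (auto simp: e1_def)
    have im1: "act T ` \<Psi> ` ball z e1 \<subseteq> (\<Union>(\<Psi>, z, r)\<in>\<P>. \<Psi> ` ball z r)"
      by (rule order_trans[OF image_mono[OF image_mono[OF e1(2)]] T(4)])
    obtain \<Psi>2 z2 r2 c2 e2 where P2: "(\<Psi>2, z2, r2) \<in> \<P>" "e2 > 0" "ball c2 e2 \<subseteq> ball z e1" "\<And>w. w \<in> ball c2 e2 \<Longrightarrow> act T (\<Psi> w) \<in> \<Psi>2 ` cball z2 r2"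
      by (rule moved_piece[OF pt T(1) e1(1) e1(3) im1]) (assumption | rule that, assumption+)+
    obtain \<B>' where B': "\<B>' \<subseteq> \<B>" "ball c2 e2 = \<Union>\<B>'" using \<B>(3)[OF open_ball[of c2 e2]] by blast
    have "c2 \<in> \<Union>\<B>'" unfolding B'(2)[symmetric] using P2(2) by simp
    then obtain B where B: "B \<in> \<B>" "B \<noteq> {}" "B \<subseteq> ball c2 e2" using B' by blast
    have Bz: "B \<subseteq> ball z r" using B(3) P2(3) e1(3) by blast
    have m: "T \<in> movers \<Psi> B (\<Psi>2 ` cball z2 r2)" unfolding movers_def using T(1) P2(4) B(3) by blast
    obtain L :: "R3xR3 \<Rightarrow> R3xR3" where L: "L \<in> {(\<lambda>x. x), prod.swap}" "\<Psi> u = L (act T (\<Psi> z))"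
    proof (cases "act T (\<Psi> z) = \<Psi> u")
      case True
      then show ?thesis using that[of "\<lambda>x. x"] by simp
    next
      case False
      then have "\<Psi> u = prod.swap (act T (\<Psi> z))" using T(3) by simp
      then show ?thesis using that[of "prod.swap"] by simp
    qed
    have "(B, (\<Psi>2, z2, r2), L) \<in> I" unfolding I_def using B Bz P2(1) L(1) by blast
    moreover have "u \<in> C (B, (\<Psi>2, z2, r2), L)"
      unfolding C_def fst_conv snd_conv using u(1) image_eqI[where f="\<lambda>T. L (act T (\<Psi> z))", OF L(2) m] by (intro IntI vimageI2)
    ultimately show "u \<in> (\<Union>i\<in>I. C i)" by blast
  qed
  have ne: "ball z (r/2) \<noteq> {}" using r by simp
  obtain i c' e' where i: "i \<in> I" "e' > 0" "ball c' e' \<subseteq> ball z (r/2)" "ball c' e' \<subseteq> C i"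
    by (rule Baire_union[OF open_ball ne cI cl cov]) (assumption | rule that, assumption+)+
  obtain B \<Psi>' z' r' L where ii: "i = (B, (\<Psi>', z', r'), L)" by (cases i) auto
  show ?thesis
  proof (rule that[of B \<Psi>' z' r' "ball c' e'" L])
    show "open B" "B \<noteq> {}" "B \<subseteq> ball z r" "(\<Psi>', z', r') \<in> \<P>" "L = (\<lambda>x. x) \<or> L = prod.swap"
      using i(1) \<B>(2) by (auto simp: I_def ii)
    show "ball c' e' \<noteq> {}" using i(2) by simp
    show "ball c' e' \<subseteq> ball z r" using i(3) sub ball_subset_cball by blast
    show "\<exists>T\<in>movers \<Psi> B (\<Psi>' ` cball z' r'). \<Psi> u = L (act T (\<Psi> z))" if "u \<in> ball c' e'" for u
    proof -
      have "u \<in> C i" using i(4) that by blast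
      then show ?thesis unfolding C_def ii by auto
    qed
  qed simp
qed

end

lemma (in patch) open_n_nz: "open {u \<in> ball z r. n1 u \<noteq> 0}" "open {u \<in> ball z r. n2 u \<noteq> 0}"
proof -
  have "open (ball z r \<inter> n1 -` (- {0}))" "open (ball z r \<inter> n2 -` (- {0}))"
    using continuous_open_preimage[OF continuous_on_subset[OF C1_on_imp_continuous[OF C1_n1] ball_sub] open_ball, of "- {0}"]
      continuous_open_preimage[OF continuous_on_subset[OF C1_on_imp_continuous[OF C1_n2] ball_sub] open_ball, of "- {0}"]
    by auto
  moreover have "{u \<in> ball z r. n1 u \<noteq> 0} = ball z r \<inter> n1 -` (- {0})" "{u \<in> ball z r. n2 u \<noteq> 0} = ball z r \<inter> n2 -` (- {0})"
    by auto
  ultimately show "open {u \<in> ball z r. n1 u \<noteq> 0}" "open {u \<in> ball z r. n2 u \<noteq> 0}" by simp_all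
qed

context homogeneous_family begin

text \<open>Near u1 both normal components stay nonzero. \<open>transitive_movers\<close> and
  \<open>movers_not_small\<close> force at least three independent tangent Killing fields on some
  open piece, and \<open>killing_graph_level\<close> makes a ball in it a level set.\<close>

lemma rotation_piece:
  assumes P: "(\<Psi>, z0, r0) \<in> \<P>" and u1: "u1 \<in> ball z0 r0" and n: "patch.n1 \<Psi> u1 \<noteq> 0" "patch.n2 \<Psi> u1 \<noteq> 0"
  obtains t R c0 \<rho> where "\<bar>t\<bar> < 1" "orthogonal_matrix R" "\<rho> > 0" "ball c0 \<rho> \<subseteq> ball z0 r0" "\<Psi> ` ball c0 \<rho> \<subseteq> rotK R t"
proof -
  obtain S c where pt0: "patch \<Psi> z0 r0 S c" using patchP[OF P] by blast
  define V where "V = {u \<in> ball z0 r0. patch.n1 \<Psi> u \<noteq> 0} \<inter> {u \<in> ball z0 r0. patch.n2 \<Psi> u \<noteq> 0}"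
  have Vz: "V \<subseteq> ball z0 r0" and Vn: "\<And>u. u \<in> V \<Longrightarrow> patch.n1 \<Psi> u \<noteq> 0" "\<And>u. u \<in> V \<Longrightarrow> patch.n2 \<Psi> u \<noteq> 0"
    by (auto simp: V_def)
  have oV: "open V" unfolding V_def by (intro open_Int patch.open_n_nz[OF pt0])
  have uV: "u1 \<in> V" using u1 n by (simp add: V_def)
  obtain r1 where r1: "r1 > 0" "cball u1 r1 \<subseteq> V"
    using oV[unfolded open_contains_cball, rule_format, OF uV] by (elim exE conjE) (rule that)
  have sub: "cball u1 r1 \<subseteq> cball z0 r0" using r1(2) Vz ball_subset_cball by blast
  interpret patch \<Psi> u1 r1 S c by (rule patch.subpatch[OF pt0 r1(1) sub])
  have pt: "patch \<Psi> u1 r1 S c" by unfold_locales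
  have zr: "ball u1 r1 \<subseteq> ball z0 r0" using r1(2) Vz ball_subset_cball by blast
  obtain B \<Psi>' z' r' U L where B: "open B" "B \<noteq> {}" "B \<subseteq> ball u1 r1" "(\<Psi>', z', r') \<in> \<P>" "open U" "U \<noteq> {}" "U \<subseteq> ball u1 r1"
    "L = (\<lambda>x. x) \<or> L = prod.swap" "\<And>u. u \<in> U \<Longrightarrow> \<exists>T\<in>movers \<Psi> B (\<Psi>' ` cball z' r'). \<Psi> u = L (act T (\<Psi> u1))"
    by (rule transitive_movers[OF P pt zr]) (assumption | rule that, assumption+)+
  have BS: "B \<subseteq> S" using B(3) ball_sub by blast
  have nB: "n1 u \<noteq> 0" "n2 u \<noteq> 0" if "u \<in> B" for u
  proof -
    have "u \<in> V" using that B(3) r1(2) ball_subset_cball by blast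
    then show "n1 u \<noteq> 0" "n2 u \<noteq> 0" by (rule Vn)+
  qed
  obtain S' c' where pt': "patch \<Psi>' z' r' S' c'" using patchP[OF B(4)] by blast
  have Ln: "norm (L x - L y) = norm (x - y)" for x y :: R3xR3
    using B(8) by (cases x; cases y) (auto simp: norm_Pair add.commute)
  have big: "dim (killing B) \<ge> 3"
  proof (rule ccontr)
    assume "\<not> dim (killing B) \<ge> 3"
    then have "dim (killing B) \<le> 2" by simp
    then obtain b1 b2 where "killing B \<subseteq> span {b1, b2}" using small_span[OF subspace_killing] by blast
    then show False by (rule movers_not_small[OF pt' B(1) BS B(2) _ B(5,6,7) Ln B(9)])
  qed
  obtain c0 where "c0 \<in> B" using B(2) by blast
  then obtain \<rho> where \<rho>: "\<rho> > 0" "ball c0 \<rho> \<subseteq> B" using B(1) open_contains_ball by metis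
  obtain R t where Rt: "orthogonal_matrix R" "\<bar>t\<bar> < 1" "\<And>u. u \<in> ball c0 \<rho> \<Longrightarrow> p u \<bullet> (R *v q u) = t"
    by (rule killing_graph_level[OF B(1) BS \<rho>(2,1) nB big]) (assumption | rule that, assumption+)+
  have "\<Psi> u \<in> rotK R t" if u: "u \<in> ball c0 \<rho>" for u
  proof -
    have "u \<in> S" using u \<rho> BS by blast
    then have "\<Psi> u \<in> S2xS2" using sph by blast
    then show ?thesis using Rt(3)[OF u] by (simp add: rotK_def p_def q_def)
  qed
  then have "\<Psi> ` ball c0 \<rho> \<subseteq> rotK R t" by blast
  moreover have "ball c0 \<rho> \<subseteq> ball z0 r0" using \<rho>(2) B(3) zr by blast
  ultimately show ?thesis using that Rt(1,2) \<rho>(1) by blast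
qed

text \<open>n1 is nonzero at z0, hence near z0, and there \<open>dich\<close> makes n2 vanish
  identically. Then \<open>circle_direction\<close> and \<open>circle_level\<close> apply to the
  piece found by \<open>transitive_movers\<close>.\<close>

lemma circle_piece:
  assumes P: "(\<Psi>, z0, r0) \<in> \<P>" and n: "patch.n2 \<Psi> z0 = 0"
    and dich: "\<And>\<Psi> z r u. (\<Psi>, z, r) \<in> \<P> \<Longrightarrow> u \<in> ball z r \<Longrightarrow> patch.n1 \<Psi> u = 0 \<or> patch.n2 \<Psi> u = 0"
  obtains t a c0 \<rho> where "\<bar>t\<bar> < 1" "norm a = 1" "\<rho> > 0" "ball c0 \<rho> \<subseteq> ball z0 r0" "\<Psi> ` ball c0 \<rho> \<subseteq> circ1 a t"
proof -
  obtain S c where pt0: "patch \<Psi> z0 r0 S c" using patchP[OF P] by blast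
  define V where "V = {u \<in> ball z0 r0. patch.n1 \<Psi> u \<noteq> 0}"
  have Vz: "V \<subseteq> ball z0 r0" and Vn: "\<And>u. u \<in> V \<Longrightarrow> patch.n1 \<Psi> u \<noteq> 0"
    by (auto simp: V_def)
  have oV: "open V" unfolding V_def by (rule patch.open_n_nz(1)[OF pt0])
  have z0: "z0 \<in> ball z0 r0" using patch.r[OF pt0] by simp
  then have "z0 \<in> S" using patch.ball_sub[OF pt0] by blast
  then have uV: "z0 \<in> V" using patch.normal_nz[OF pt0, of z0] n z0 by (simp add: V_def)
  obtain r1 where r1: "r1 > 0" "cball z0 r1 \<subseteq> V"
    using oV[unfolded open_contains_cball, rule_format, OF uV] by (elim exE conjE) (rule that)
  have sub: "cball z0 r1 \<subseteq> cball z0 r0" using r1(2) Vz ball_subset_cball by blast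
  interpret patch \<Psi> z0 r1 S c by (rule patch.subpatch[OF pt0 r1(1) sub])
  have pt: "patch \<Psi> z0 r1 S c" by unfold_locales
  have zr: "ball z0 r1 \<subseteq> ball z0 r0" using r1(2) Vz ball_subset_cball by blast
  have n2: "n2 u = 0" if "u \<in> ball z0 r1" for u
  proof -
    have "u \<in> V" using that r1(2) ball_subset_cball by blast
    then show ?thesis using dich[OF P subsetD[OF Vz]] Vn by blast
  qed
  obtain B \<Psi>' z' r' U L where B: "open B" "B \<noteq> {}" "B \<subseteq> ball z0 r1" "(\<Psi>', z', r') \<in> \<P>" "open U" "U \<noteq> {}" "U \<subseteq> ball z0 r1"
    "L = (\<lambda>x. x) \<or> L = prod.swap" "\<And>u. u \<in> U \<Longrightarrow> \<exists>T\<in>movers \<Psi> B (\<Psi>' ` cball z' r'). \<Psi> u = L (act T (\<Psi> z0))"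
    by (rule transitive_movers[OF P pt zr]) (assumption | rule that, assumption+)+
  obtain S' c' where pt': "patch \<Psi>' z' r' S' c'" using patchP[OF B(4)] by blast
  obtain a where a: "a \<noteq> 0" "\<And>u. u \<in> B \<Longrightarrow> a \<bullet> \<alpha> u = 0"
    by (rule circle_direction[OF pt' B(1,3) n2 dich[OF B(4)] B(5,6,7,8,9)]) (assumption | rule that, assumption+)+
  obtain c0 where "c0 \<in> B" using B(2) by blast
  then obtain \<rho> where \<rho>: "\<rho> > 0" "ball c0 \<rho> \<subseteq> B" using B(1) open_contains_ball by metis
  have \<rho>z: "ball c0 \<rho> \<subseteq> ball z0 r1" using \<rho> B by blast
  obtain b t where bt: "norm b = 1" "\<bar>t\<bar> < 1" "\<And>u. u \<in> ball c0 \<rho> \<Longrightarrow> p u \<bullet> b = t"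
    by (rule circle_level[OF \<rho>z \<rho>(1) n2 a(1) a(2)[OF subsetD[OF \<rho>(2)]]]) (assumption | rule that, assumption+)+
  have "\<Psi> u \<in> circ1 b t" if u: "u \<in> ball c0 \<rho>" for u
  proof -
    have "u \<in> S" using u \<rho>z ball_sub by blast
    then have "\<Psi> u \<in> S2xS2" using sph by blast
    then show ?thesis using bt(3)[OF u] by (simp add: circ1_def p_def)
  qed
  then have "\<Psi> ` ball c0 \<rho> \<subseteq> circ1 b t" by blast
  moreover have "ball c0 \<rho> \<subseteq> ball z0 r0" using \<rho>z zr by blast
  ultimately show ?thesis using that bt(1,2) \<rho>(1) by blast
qed

text \<open>Either both normal components are nonzero somewhere, or at every point one of them
  vanishes and, after a swap, n2 = 0 at the centre of some patch. Each case provides one open piece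
  of a model, which fixes the kind and the parameter t for all patches by
  \<open>propagate\<close>.\<close>

lemma patches_in_model:
  shows "\<exists>\<K>. model_class \<K> \<and> (\<forall>\<Psi> z r. (\<Psi>, z, r) \<in> \<P> \<longrightarrow> (\<exists>K\<in>\<K>. \<Psi> ` ball z r \<subseteq> K))"
proof (cases "\<P> = {}")
  case True
  have "model_class (rot_class 0)" unfolding model_class_def by force
  then show ?thesis using True by blast
next
  case False
  have "\<exists>\<K> \<Psi> z r u e K. model_class \<K> \<and> (\<Psi>, z, r) \<in> \<P> \<and> ball u e \<subseteq> ball z r \<and> e > 0 \<and> \<Psi> ` ball u e \<subseteq> K \<and> K \<in> \<K>"
  proof (cases "\<exists>\<Psi> z r u. (\<Psi>, z, r) \<in> \<P> \<and> u \<in> ball z r \<and> patch.n1 \<Psi> u \<noteq> 0 \<and> patch.n2 \<Psi> u \<noteq> 0")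
    case True
    then obtain \<Psi> z r u where P: "(\<Psi>, z, r) \<in> \<P>" "u \<in> ball z r" "patch.n1 \<Psi> u \<noteq> 0" "patch.n2 \<Psi> u \<noteq> 0" by blast
    obtain t R c0 \<rho> where K: "\<bar>t\<bar> < 1" "orthogonal_matrix R" "\<rho> > 0" "ball c0 \<rho> \<subseteq> ball z r" "\<Psi> ` ball c0 \<rho> \<subseteq> rotK R t"
      by (rule rotation_piece[OF P]) (assumption | rule that, assumption+)+
    have "model_class (rot_class t)" "rotK R t \<in> rot_class t" using K(1,2) unfolding model_class_def rot_class_def by blast+
    then show ?thesis using P(1) K(3,4,5) by blast
  next
    case F: False
    then have dich: "\<And>\<Psi> z r u. (\<Psi>, z, r) \<in> \<P> \<Longrightarrow> u \<in> ball z r \<Longrightarrow> patch.n1 \<Psi> u = 0 \<or> patch.n2 \<Psi> u = 0" by blast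
    obtain \<Psi>0 z r where P0: "(\<Psi>0, z, r) \<in> \<P>" using False by auto
    obtain S c where pt0: "patch \<Psi>0 z r S c" using patchP[OF P0] by blast
    have z: "z \<in> ball z r" "z \<in> S" using patch.r[OF pt0] patch.S(2)[OF pt0] by auto
    have "\<exists>\<Psi>. (\<Psi>, z, r) \<in> \<P> \<and> patch.n2 \<Psi> z = 0"
    proof (cases "patch.n2 \<Psi>0 z = 0")
      case True
      then show ?thesis using P0 by blast
    next
      case False
      then have "patch.n1 \<Psi>0 z = 0" using dich[OF P0 z(1)] by blast
      then have "patch.n2 (prod.swap \<circ> \<Psi>0) z = 0" using patch.swap_normal(2)[OF pt0 z(2)] by simp
      then show ?thesis using swapP[OF P0] by blast
    qed
    then obtain \<Psi> where P: "(\<Psi>, z, r) \<in> \<P>" "patch.n2 \<Psi> z = 0" by blast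
    obtain t a c0 \<rho> where K: "\<bar>t\<bar> < 1" "norm a = 1" "\<rho> > 0" "ball c0 \<rho> \<subseteq> ball z r" "\<Psi> ` ball c0 \<rho> \<subseteq> circ1 a t"
      by (rule circle_piece[OF P dich]) (assumption | rule that, assumption+)+
    have "model_class (circ_class t)" "circ1 a t \<in> circ_class t" using K(1,2) unfolding model_class_def circ_class_def by blast+
    then show ?thesis using P(1) K(3,4,5) by blast
  qed
  then obtain \<K> \<Psi> z r u e K where X: "model_class \<K>" "(\<Psi>, z, r) \<in> \<P>" "ball u e \<subseteq> ball z r" "e > 0" "\<Psi> ` ball u e \<subseteq> K" "K \<in> \<K>"
    by (elim exE conjE) (rule that)
  show ?thesis
  proof (intro exI[of _ \<K>] conjI allI impI)
    show "\<exists>K\<in>\<K>. \<Psi>' ` ball z' r' \<subseteq> K" if "(\<Psi>', z', r') \<in> \<P>" for \<Psi>' z' r'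
      by (rule propagate[OF X(1,2,3,4,5,6) that])
  qed (rule X)
qed

end

section \<open>Isometries of S2 x S2\<close>

definition sph_angle :: "real^3 \<Rightarrow> real^3 \<Rightarrow> real" where
  "sph_angle p q = arccos (p \<bullet> q)"

lemma S2_inner_bounds:
  assumes "p \<in> S2" "q \<in> S2" shows "-1 \<le> p \<bullet> q" "p \<bullet> q \<le> 1"
  using Cauchy_Schwarz_ineq2[of p q] assms by (auto simp: S2_def)

lemma cos_sph_angle: "p \<in> S2 \<Longrightarrow> q \<in> S2 \<Longrightarrow> cos (sph_angle p q) = p \<bullet> q"
  unfolding sph_angle_def using S2_inner_bounds by (simp add: cos_arccos)

lemma sph_angle_bounds: "p \<in> S2 \<Longrightarrow> q \<in> S2 \<Longrightarrow> 0 \<le> sph_angle p q \<and> sph_angle p q \<le> pi"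
  unfolding sph_angle_def using S2_inner_bounds by (simp add: arccos_lbound arccos_ubound)

text \<open>Removing the components along q leaves vectors whose lengths are the sines of the two
  angles. Cauchy-Schwarz for them together with the addition formula gives cos (a + b) at most p .
  w, and cos is decreasing on [0, pi].\<close>

lemma sph_angle_triangle:
  assumes "p \<in> S2" "q \<in> S2" "w \<in> S2"
  shows "sph_angle p w \<le> sph_angle p q + sph_angle q w"
proof (cases "sph_angle p q + sph_angle q w \<le> pi")
  case False
  then show ?thesis using sph_angle_bounds[OF assms(1,3)] by linarith
next
  case True
  let ?a = "sph_angle p q" and ?b = "sph_angle q w"
  have ab: "0 \<le> ?a" "?a \<le> pi" "0 \<le> ?b" "?b \<le> pi" using sph_angle_bounds assms by blast+
  have n: "norm p = 1" "norm q = 1" "norm w = 1" using assms by (auto simp: S2_def)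
  have u: "p \<bullet> p = 1" "q \<bullet> q = 1" "w \<bullet> w = 1" using n by (simp_all add: norm_eq_1)
  define p' w' where "p' = p - (p \<bullet> q) *\<^sub>R q" and "w' = w - (w \<bullet> q) *\<^sub>R q"
  have sin: "sin ?a = norm p'" "sin ?b = norm w'"
  proof -
    have "(norm p')\<^sup>2 = 1 - (p \<bullet> q)\<^sup>2" unfolding power2_norm_eq_inner p'_def using u
      by (simp add: inner_diff_left inner_diff_right inner_commute power2_eq_square)
    also have "\<dots> = (sin ?a)\<^sup>2" by (simp add: sin_squared_eq cos_sph_angle assms)
    finally show "sin ?a = norm p'" using sin_ge_zero[OF ab(1,2)] by (simp add: power2_eq_iff_nonneg)
    have "(norm w')\<^sup>2 = 1 - (q \<bullet> w)\<^sup>2" unfolding power2_norm_eq_inner w'_def using u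
      by (simp add: inner_diff_left inner_diff_right inner_commute power2_eq_square)
    also have "\<dots> = (sin ?b)\<^sup>2" by (simp add: sin_squared_eq cos_sph_angle assms)
    finally show "sin ?b = norm w'" using sin_ge_zero[OF ab(3,4)] by (simp add: power2_eq_iff_nonneg)
  qed
  have "p' \<bullet> w' = p \<bullet> w - (p \<bullet> q) * (q \<bullet> w)" unfolding p'_def w'_def using u
    by (simp add: inner_diff_left inner_diff_right inner_commute)
  moreover have "\<bar>p' \<bullet> w'\<bar> \<le> norm p' * norm w'" by (rule Cauchy_Schwarz_ineq2)
  ultimately have "cos (?a + ?b) \<le> cos (sph_angle p w)"
    by (simp add: cos_add sin cos_sph_angle assms)
  moreover have "0 \<le> ?a + ?b" using ab by simp
  ultimately show ?thesis using sph_angle_bounds[OF assms(1,3)] True cos_mono_le_eq by blast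
qed

lemma chord_sph_angle:
  assumes "p \<in> S2" "q \<in> S2" shows "norm (p - q) = 2 * sin (sph_angle p q / 2)"
proof -
  have u: "p \<bullet> p = 1" "q \<bullet> q = 1" using assms by (auto simp: S2_def norm_eq_1)
  let ?a = "sph_angle p q"
  have ab: "0 \<le> ?a" "?a \<le> pi" using sph_angle_bounds assms by blast+
  have "(norm (p - q))\<^sup>2 = 2 - 2 * cos (2 * (?a / 2))" unfolding power2_norm_eq_inner
    using u by (simp add: inner_diff_left inner_diff_right inner_commute cos_sph_angle assms)
  also have "\<dots> = (2 * sin (?a / 2))\<^sup>2" unfolding cos_double_sin by (simp add: power2_eq_square)
  finally have e: "(norm (p - q))\<^sup>2 = (2 * sin (?a / 2))\<^sup>2" .
  have "0 \<le> sin (?a / 2)" by (rule sin_ge_zero) (use ab in linarith)+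
  then have "0 \<le> 2 * sin (?a / 2)" by simp
  then show ?thesis by (rule power2_eq_imp_eq[OF e norm_ge_zero])
qed

text \<open>The Riemannian distance of the product, written explicitly so that no infimum over
  curves is needed.\<close>

definition angle_dist :: "R3xR3 \<Rightarrow> R3xR3 \<Rightarrow> real" where
  "angle_dist x y = norm (sph_angle (fst x) (fst y), sph_angle (snd x) (snd y))"

lemma S2xS2_iff: "x \<in> S2xS2 \<longleftrightarrow> fst x \<in> S2 \<and> snd x \<in> S2"
  by (auto simp: S2xS2_def mem_Times_iff)

lemma angle_dist_triangle:
  assumes "x \<in> S2xS2" "y \<in> S2xS2" "w \<in> S2xS2"
  shows "angle_dist x w \<le> angle_dist x y + angle_dist y w"
proof -
  have s: "fst x \<in> S2" "fst y \<in> S2" "fst w \<in> S2" "snd x \<in> S2" "snd y \<in> S2" "snd w \<in> S2"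
    using assms by (auto simp: S2xS2_iff)
  let ?a = "sph_angle (fst x) (fst y)" and ?b = "sph_angle (fst y) (fst w)" and ?c = "sph_angle (fst x) (fst w)"
  let ?a' = "sph_angle (snd x) (snd y)" and ?b' = "sph_angle (snd y) (snd w)" and ?c' = "sph_angle (snd x) (snd w)"
  have m: "norm (?c, ?c') \<le> norm (?a + ?b, ?a' + ?b')"
    unfolding norm_Pair using s sph_angle_triangle sph_angle_bounds
    by (intro real_sqrt_le_mono add_mono power_mono) auto
  also have "(?a + ?b, ?a' + ?b') = (?a, ?a') + (?b, ?b')" by simp
  also have "norm \<dots> \<le> norm (?a, ?a') + norm (?b, ?b')" by (rule norm_triangle_ineq)
  finally show ?thesis by (simp add: angle_dist_def)
qed

lemma sin_half_lower:
  assumes "(0::real) < e" obtains d where "d > 0" "\<And>x. 0 \<le> x \<Longrightarrow> x \<le> d \<Longrightarrow> x \<le> (1 + e) * (2 * sin (x / 2))"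
proof -
  have "((\<lambda>x. (1 + e) * (2 * sin (x / 2)) - x) has_real_derivative e) (at 0)"
    by (auto intro!: derivative_eq_intros)
  from DERIV_pos_inc_right[OF this assms] obtain d where d: "d > 0" "\<And>h. 0 < h \<Longrightarrow> h < d \<Longrightarrow> 0 < (1 + e) * (2 * sin (h / 2)) - h"
    by auto
  have "x \<le> (1 + e) * (2 * sin (x / 2))" if "0 \<le> x" "x \<le> d / 2" for x
  proof (cases "x = 0")
    case False
    then show ?thesis using d(2)[of x] that d(1) by simp
  qed simp
  then show ?thesis using that[of "d / 2"] d(1) by simp
qed

lemma sph_angle_small:
  assumes "(0::real) < e" obtains d where "d > 0" "\<And>p q. p \<in> S2 \<Longrightarrow> q \<in> S2 \<Longrightarrow> norm (p - q) < d \<Longrightarrow> sph_angle p q \<le> (1 + e) * norm (p - q)"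
proof -
  obtain d0 where d0: "d0 > 0" "\<And>x. 0 \<le> x \<Longrightarrow> x \<le> d0 \<Longrightarrow> x \<le> (1 + e) * (2 * sin (x / 2))" using sin_half_lower[OF assms] by blast
  define d1 where "d1 = min d0 pi"
  have d1: "0 < d1" "d1 \<le> pi" "d1 \<le> d0" using d0 by (auto simp: d1_def)
  define d where "d = 2 * sin (d1 / 2)"
  have "d > 0" using d1 by (simp add: d_def sin_gt_zero)
  moreover have "sph_angle p q \<le> (1 + e) * norm (p - q)" if "p \<in> S2" "q \<in> S2" "norm (p - q) < d" for p q
  proof -
    let ?a = "sph_angle p q"
    have ab: "0 \<le> ?a" "?a \<le> pi" using sph_angle_bounds that by blast+
    have "sin (?a / 2) < sin (d1 / 2)" using that chord_sph_angle[of p q] by (simp add: d_def)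
    then have "?a \<le> d1" using sin_monotone_2pi_le[of "d1 / 2" "?a / 2"] ab d1 by force
    then show ?thesis using d0(2)[of ?a] ab d1 by (simp add: chord_sph_angle that)
  qed
  ultimately show ?thesis using that by blast
qed

lemma angle_dist_small:
  assumes "(0::real) < e" obtains d where "d > 0" "\<And>x y. x \<in> S2xS2 \<Longrightarrow> y \<in> S2xS2 \<Longrightarrow> norm (x - y) < d \<Longrightarrow> angle_dist x y \<le> (1 + e) * norm (x - y)"
proof -
  obtain d where d: "d > 0" "\<And>p q. p \<in> S2 \<Longrightarrow> q \<in> S2 \<Longrightarrow> norm (p - q) < d \<Longrightarrow> sph_angle p q \<le> (1 + e) * norm (p - q)"
    using sph_angle_small[OF assms] by blast
  have "angle_dist x y \<le> (1 + e) * norm (x - y)" if "x \<in> S2xS2" "y \<in> S2xS2" "norm (x - y) < d" for x y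
  proof -
    have s: "fst x \<in> S2" "fst y \<in> S2" "snd x \<in> S2" "snd y \<in> S2" using that by (auto simp: S2xS2_iff)
    have n: "norm (fst x - fst y) < d" "norm (snd x - snd y) < d"
      using norm_fst_snd_le[of "x - y"] that(3) by simp_all
    have le: "sph_angle (fst x) (fst y) \<le> \<bar>(1 + e) * norm (fst x - fst y)\<bar>" "sph_angle (snd x) (snd y) \<le> \<bar>(1 + e) * norm (snd x - snd y)\<bar>"
      using d(2)[OF s(1,2) n(1)] d(2)[OF s(3,4) n(2)] by linarith+
    have "angle_dist x y \<le> norm ((1 + e) * norm (fst x - fst y), (1 + e) * norm (snd x - snd y))"
      unfolding angle_dist_def norm_Pair using le s sph_angle_bounds
      by (intro real_sqrt_le_mono add_mono power_mono) auto
    also have "\<dots> = norm ((1 + e) *\<^sub>R (norm (fst x - fst y), norm (snd x - snd y)))" by simp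
    also have "\<dots> = (1 + e) * norm (norm (fst x - fst y), norm (snd x - snd y))" using assms by (simp only: norm_scaleR)
    also have "norm (norm (fst x - fst y), norm (snd x - snd y)) = norm (x - y)"
      by (cases x; cases y) (simp add: norm_Pair)
    finally show ?thesis .
  qed
  then show ?thesis using that d(1) by blast
qed

text \<open>A curve of speed at most K satisfies the bound on short intervals up to factors near 1,
  because angle and chord agree to first order. The triangle inequality adds up adjacent intervals,
  and \<open>Bolzano\<close> passes from short intervals to [0, 1] without any integral.\<close>

lemma curve_angle_dist:
  fixes \<sigma> :: "real \<Rightarrow> R3xR3"
  assumes S: "\<And>s. s \<in> {0..1} \<Longrightarrow> \<sigma> s \<in> S2xS2" and K: "K \<ge> 0"
    and D: "\<And>s. s \<in> {0..1} \<Longrightarrow> \<exists>v. (\<sigma> has_vector_derivative v) (at s within {0..1}) \<and> norm v \<le> K"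
  shows "angle_dist (\<sigma> 0) (\<sigma> 1) \<le> K"
proof (rule field_le_epsilon)
  fix e0 :: real assume e0: "e0 > 0"
  \<comment> \<open>(1 + e)(K + e) exceeds K by e (K + 1 + e), which is at most e (K + 2) and so at
    most e0.\<close>
  define e where "e = min 1 (e0 / (K + 2))"
  have e: "0 < e" "e \<le> 1" "e * (K + 2) \<le> e0"
  proof -
    show "0 < e" "e \<le> 1" using e0 K by (auto simp: e_def)
    have "e * (K + 2) \<le> e0 / (K + 2) * (K + 2)" using K by (intro mult_right_mono) (auto simp: e_def)
    then show "e * (K + 2) \<le> e0" using K by simp
  qed
  let ?P = "\<lambda>a b. {a..b} \<subseteq> {0..1} \<longrightarrow> angle_dist (\<sigma> a) (\<sigma> b) \<le> (1 + e) * (K + e) * (b - a)"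
  obtain d where d: "d > 0" "\<And>x y. x \<in> S2xS2 \<Longrightarrow> y \<in> S2xS2 \<Longrightarrow> norm (x - y) < d \<Longrightarrow> angle_dist x y \<le> (1 + e) * norm (x - y)"
    using angle_dist_small[OF e(1)] by blast
  have "?P 0 1"
  proof (rule Bolzano[of 0 1 ?P])
    fix a b c :: real assume "?P a b" "?P b c" and abc: "a \<le> b" "b \<le> c"
    show "?P a c"
    proof
      assume ac: "{a..c} \<subseteq> {0..1}"
      have "{a..b} \<subseteq> {0..1}" "{b..c} \<subseteq> {0..1}" using ac abc by auto
      then have 1: "angle_dist (\<sigma> a) (\<sigma> b) \<le> (1 + e) * (K + e) * (b - a)" "angle_dist (\<sigma> b) (\<sigma> c) \<le> (1 + e) * (K + e) * (c - b)"
        using \<open>?P a b\<close> \<open>?P b c\<close> by blast+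
      have "a \<in> {0..1}" "b \<in> {0..1}" "c \<in> {0..1}" using ac abc by auto
      then have "angle_dist (\<sigma> a) (\<sigma> c) \<le> angle_dist (\<sigma> a) (\<sigma> b) + angle_dist (\<sigma> b) (\<sigma> c)" using angle_dist_triangle S by blast
      also have "\<dots> \<le> (1 + e) * (K + e) * (b - a) + (1 + e) * (K + e) * (c - b)" using 1 by simp
      also have "\<dots> = (1 + e) * (K + e) * (c - a)" by (simp add: algebra_simps)
      finally show "angle_dist (\<sigma> a) (\<sigma> c) \<le> (1 + e) * (K + e) * (c - a)" .
    qed
  next
    fix x :: real assume x: "0 \<le> x" "x \<le> 1"
    obtain v where v: "(\<sigma> has_vector_derivative v) (at x within {0..1})" "norm v \<le> K" using D[of x] x by auto
    have "\<exists>d1>0. \<forall>y\<in>{0..1}. norm (y - x) < d1 \<longrightarrow> norm (\<sigma> y - \<sigma> x - (y - x) *\<^sub>R v) \<le> e * norm (y - x)"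
      using v(1) e(1) unfolding has_vector_derivative_def has_derivative_within_alt by blast
    then obtain d1 where d1: "d1 > 0" "\<And>y. y \<in> {0..1} \<Longrightarrow> \<bar>y - x\<bar> < d1 \<Longrightarrow> norm (\<sigma> y - \<sigma> x - (y - x) *\<^sub>R v) \<le> e * \<bar>y - x\<bar>"
      by auto
    have near: "angle_dist (\<sigma> y) (\<sigma> x) \<le> (1 + e) * (K + e) * \<bar>y - x\<bar> \<and> angle_dist (\<sigma> x) (\<sigma> y) \<le> (1 + e) * (K + e) * \<bar>y - x\<bar>"
      if y: "y \<in> {0..1}" "\<bar>y - x\<bar> < min d1 (d / (K + e + 1))" for y
    proof -
      have "norm (\<sigma> y - \<sigma> x) \<le> norm (\<sigma> y - \<sigma> x - (y - x) *\<^sub>R v) + norm ((y - x) *\<^sub>R v)"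
        by (metis diff_add_cancel norm_triangle_ineq)
      also have "\<dots> \<le> e * \<bar>y - x\<bar> + \<bar>y - x\<bar> * K"
        using d1(2)[of y] y v(2) by (intro add_mono) (auto intro!: mult_left_mono)
      finally have 1: "norm (\<sigma> y - \<sigma> x) \<le> (K + e) * \<bar>y - x\<bar>" by (simp add: algebra_simps)
      also have "\<dots> \<le> (K + e + 1) * \<bar>y - x\<bar>" by (intro mult_right_mono) auto
      also have "\<dots> < d" using y(2) K e(1) by (simp add: pos_less_divide_eq mult.commute)
      finally have 2: "norm (\<sigma> y - \<sigma> x) < d" .
      have SS: "\<sigma> y \<in> S2xS2" "\<sigma> x \<in> S2xS2" using S y x by auto
      have 3: "(1 + e) * norm (\<sigma> y - \<sigma> x) \<le> (1 + e) * (K + e) * \<bar>y - x\<bar>"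
        using 1 e by (simp add: mult.assoc)
      show ?thesis using d(2)[OF SS 2] d(2)[OF SS(2,1)] 2 3 by (simp add: norm_minus_commute)
    qed
    show "\<exists>d>0. \<forall>a b. a \<le> x \<and> x \<le> b \<and> b - a < d \<longrightarrow> ?P a b"
    proof (intro exI[of _ "min d1 (d / (K + e + 1))"] conjI allI impI)
      show "0 < min d1 (d / (K + e + 1))" using d1 d K e by simp
      fix a b assume ab: "a \<le> x \<and> x \<le> b \<and> b - a < min d1 (d / (K + e + 1))" "{a..b} \<subseteq> {0..1}"
      have m: "a \<in> {0..1}" "b \<in> {0..1}" using ab by auto
      have "\<bar>a - x\<bar> < min d1 (d / (K + e + 1))" "\<bar>b - x\<bar> < min d1 (d / (K + e + 1))" using ab(1) by linarith+
      then have 1: "angle_dist (\<sigma> a) (\<sigma> x) \<le> (1 + e) * (K + e) * \<bar>a - x\<bar>" "angle_dist (\<sigma> x) (\<sigma> b) \<le> (1 + e) * (K + e) * \<bar>b - x\<bar>"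
        using near m by blast+
      have "angle_dist (\<sigma> a) (\<sigma> b) \<le> angle_dist (\<sigma> a) (\<sigma> x) + angle_dist (\<sigma> x) (\<sigma> b)"
        using angle_dist_triangle S m x by simp
      also have "\<dots> \<le> (1 + e) * (K + e) * (x - a) + (1 + e) * (K + e) * (b - x)" using 1 ab(1) by simp
      also have "\<dots> = (1 + e) * (K + e) * (b - a)" by (simp add: algebra_simps)
      finally show "angle_dist (\<sigma> a) (\<sigma> b) \<le> (1 + e) * (K + e) * (b - a)" .
    qed
  qed simp
  then have "angle_dist (\<sigma> 0) (\<sigma> 1) \<le> (1 + e) * (K + e)" by simp
  also have "\<dots> = K + e * (K + 1 + e)" by (simp add: algebra_simps)
  also have "\<dots> \<le> K + e * (K + 2)" using e by (intro add_left_mono mult_left_mono) auto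
  also have "\<dots> \<le> K + e0" using e by simp
  finally show "angle_dist (\<sigma> 0) (\<sigma> 1) \<le> K + e0" .
qed

lemma great_circle:
  assumes p: "p \<in> S2" and q: "q \<in> S2"
  obtains \<gamma> \<gamma>' :: "real \<Rightarrow> real^3" where "\<gamma> 0 = p" "\<gamma> 1 = q" "\<And>s. \<gamma> s \<in> S2" "\<And>s. (\<gamma> has_vector_derivative \<gamma>' s) (at s)"
    "\<And>s. norm (\<gamma>' s) = sph_angle p q" "\<And>s. \<gamma> s \<bullet> \<gamma>' s = 0"
proof -
  let ?a = "sph_angle p q"
  have u: "p \<bullet> p = 1" "q \<bullet> q = 1" using p q by (auto simp: S2_def norm_eq_1)
  have ab: "0 \<le> ?a" "?a \<le> pi" using sph_angle_bounds p q by blast+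
  have c: "cos ?a = p \<bullet> q" by (rule cos_sph_angle[OF p q])
  have "\<exists>e. e \<bullet> e = 1 \<and> p \<bullet> e = 0 \<and> q = cos ?a *\<^sub>R p + sin ?a *\<^sub>R e"
  proof (cases "sin ?a = 0")
    case True
    \<comment> \<open>For equal or antipodal points the great circle is not unique, and any
      direction orthogonal to p will do.\<close>
    obtain y where y: "y \<noteq> 0" "orthogonal p y" using orthogonal_to_vector_exists[of p] by auto
    define e where "e = y /\<^sub>R norm y"
    have "norm e = 1" using y by (simp add: e_def)
    then have "e \<bullet> e = 1" by (simp only: norm_eq_1)
    moreover have "p \<bullet> e = 0" using y by (simp add: e_def orthogonal_def)
    ultimately have e: "e \<bullet> e = 1" "p \<bullet> e = 0" by blast+
    have "(q - cos ?a *\<^sub>R p) \<bullet> (q - cos ?a *\<^sub>R p) = 1 - (cos ?a)\<^sup>2"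
      using u c by (simp add: inner_diff_left inner_diff_right inner_commute power2_eq_square)
    also have "\<dots> = 0" using True by (simp add: cos_squared_eq)
    finally have "q = cos ?a *\<^sub>R p" by simp
    then show ?thesis using e True by auto
  next
    case False
    define e where "e = (q - cos ?a *\<^sub>R p) /\<^sub>R sin ?a"
    have "(q - cos ?a *\<^sub>R p) \<bullet> (q - cos ?a *\<^sub>R p) = 1 - (cos ?a)\<^sup>2"
      using u c by (simp add: inner_diff_left inner_diff_right inner_commute power2_eq_square)
    also have "\<dots> = sin ?a * sin ?a" by (simp add: cos_squared_eq) (simp add: power2_eq_square)
    finally have qq: "(q - cos ?a *\<^sub>R p) \<bullet> (q - cos ?a *\<^sub>R p) = sin ?a * sin ?a" .
    have "e \<bullet> e = inverse (sin ?a) * (inverse (sin ?a) * ((q - cos ?a *\<^sub>R p) \<bullet> (q - cos ?a *\<^sub>R p)))"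
      by (simp only: e_def inner_scaleR_left inner_scaleR_right)
    also have "\<dots> = 1" unfolding qq using False by (simp add: field_simps)
    finally have 1: "e \<bullet> e = 1" .
    have "p \<bullet> e = 0" using u c by (simp add: e_def inner_diff_right)
    moreover have "q = cos ?a *\<^sub>R p + sin ?a *\<^sub>R e" using False by (simp add: e_def)
    ultimately show ?thesis using 1 by blast
  qed
  then obtain e where e: "e \<bullet> e = 1" "p \<bullet> e = 0" "q = cos ?a *\<^sub>R p + sin ?a *\<^sub>R e" by blast
  define \<gamma> where "\<gamma> s = cos (s * ?a) *\<^sub>R p + sin (s * ?a) *\<^sub>R e" for s
  define \<gamma>' where "\<gamma>' s = (- ?a * sin (s * ?a)) *\<^sub>R p + (?a * cos (s * ?a)) *\<^sub>R e" for s
  show ?thesis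
  proof (rule that[of \<gamma> \<gamma>'])
    show "\<gamma> 0 = p" by (simp add: \<gamma>_def)
    show "\<gamma> 1 = q" using e(3) by (simp add: \<gamma>_def)
    show "\<gamma> s \<in> S2" for s
    proof -
      have "\<gamma> s \<bullet> \<gamma> s = (cos (s * ?a))\<^sup>2 + (sin (s * ?a))\<^sup>2"
        using u e by (simp add: \<gamma>_def inner_add_left inner_add_right inner_commute power2_eq_square)
      then show ?thesis by (simp add: S2_def norm_eq_1)
    qed
    show "(\<gamma> has_vector_derivative \<gamma>' s) (at s)" for s
      unfolding \<gamma>_def \<gamma>'_def
      by (auto intro!: derivative_eq_intros simp: has_real_derivative_iff_has_vector_derivative[symmetric] mult.commute)
    show "norm (\<gamma>' s) = ?a" for s
    proof -
      have "(norm (\<gamma>' s))\<^sup>2 = ?a\<^sup>2 * (sin (s * ?a))\<^sup>2 + ?a\<^sup>2 * (cos (s * ?a))\<^sup>2"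
        unfolding power2_norm_eq_inner using u e(1,2)
        by (simp add: \<gamma>'_def inner_add_left inner_add_right inner_diff_left inner_diff_right inner_commute power2_eq_square algebra_simps)
      also have "\<dots> = ?a\<^sup>2 * ((sin (s * ?a))\<^sup>2 + (cos (s * ?a))\<^sup>2)" by (simp only: distrib_left)
      finally have "(norm (\<gamma>' s))\<^sup>2 = ?a\<^sup>2" by simp
      then show ?thesis using ab by (simp add: power2_eq_iff_nonneg)
    qed
    show "\<gamma> s \<bullet> \<gamma>' s = 0" for s
      using u e(1,2) by (simp add: \<gamma>_def \<gamma>'_def inner_add_left inner_add_right inner_diff_left inner_diff_right inner_commute)
  qed
qed

lemma geodesic_exists:
  assumes x: "x \<in> S2xS2" and y: "y \<in> S2xS2"
  obtains \<sigma> \<sigma>' where "\<sigma> 0 = x" "\<sigma> 1 = y" "\<And>s. \<sigma> s \<in> S2xS2" "\<And>s. (\<sigma> has_vector_derivative \<sigma>' s) (at s)"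
    "\<And>s. norm (\<sigma>' s) = angle_dist x y" "\<And>s. \<sigma>' s \<in> tangent_space (\<sigma> s)"
proof -
  have s: "fst x \<in> S2" "fst y \<in> S2" "snd x \<in> S2" "snd y \<in> S2" using x y by (auto simp: S2xS2_iff)
  obtain g g' where g: "g 0 = fst x" "g 1 = fst y" "\<And>s. g s \<in> S2" "\<And>s. (g has_vector_derivative g' s) (at s)"
    "\<And>s. norm (g' s) = sph_angle (fst x) (fst y)" "\<And>s. g s \<bullet> g' s = 0" by (rule great_circle[OF s(1,2)]) (assumption | rule that, assumption+)+
  obtain h h' where h: "h 0 = snd x" "h 1 = snd y" "\<And>s. h s \<in> S2" "\<And>s. (h has_vector_derivative h' s) (at s)"
    "\<And>s. norm (h' s) = sph_angle (snd x) (snd y)" "\<And>s. h s \<bullet> h' s = 0" by (rule great_circle[OF s(3,4)]) (assumption | rule that, assumption+)+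
  show ?thesis
  proof (rule that[of "\<lambda>s. (g s, h s)" "\<lambda>s. (g' s, h' s)"])
    show "((\<lambda>s. (g s, h s)) has_vector_derivative (g' s, h' s)) (at s)" for s
      by (intro has_vector_derivative_Pair g h)
    show "norm (g' s, h' s) = angle_dist x y" for s by (simp add: norm_Pair angle_dist_def g(5) h(5))
  qed (use g h in \<open>auto simp: S2xS2_iff tangent_space_def\<close>)
qed

lemma tangent_of_curve:
  assumes S: "\<And>s. s \<in> {0..1} \<Longrightarrow> \<tau> s \<in> S2xS2" and s: "s \<in> {0..1::real}"
    and D: "(\<tau> has_vector_derivative v) (at s within {0..1})"
  shows "v \<in> tangent_space (\<tau> s)"
proof -
  have *: "f \<bullet> w = 0" if f: "f = g s" and g: "(g has_vector_derivative w) (at s within {0..1})" and u: "\<And>s. s \<in> {0..1} \<Longrightarrow> g s \<in> S2"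
    for f w :: "real^3" and g
  proof -
    have "((\<lambda>s. g s \<bullet> g s) has_vector_derivative (g s \<bullet> w + w \<bullet> g s)) (at s within {0..1})"
      by (rule bounded_bilinear.has_vector_derivative[OF bounded_bilinear_inner g g])
    moreover have "((\<lambda>s. g s \<bullet> g s) has_vector_derivative 0) (at s within {0..1})"
      by (rule has_vector_derivative_transform[OF s _ has_vector_derivative_const[of 1]])
         (use u in \<open>simp add: S2_def norm_eq_1\<close>)
    ultimately have "g s \<bullet> w + w \<bullet> g s = 0"
      using vector_derivative_unique_within_closed_interval[of 0 1 s] s by (simp add: cbox_interval)
    then show ?thesis using f by (simp add: inner_commute)
  qed
  have "fst (\<tau> s) \<bullet> fst v = 0" "snd (\<tau> s) \<bullet> snd v = 0"
    by (rule *[OF refl bounded_linear.has_vector_derivative[OF bounded_linear_fst D]], use S in \<open>simp add: S2xS2_iff\<close>)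
       (rule *[OF refl bounded_linear.has_vector_derivative[OF bounded_linear_snd D]], use S in \<open>simp add: S2xS2_iff\<close>)
  then show ?thesis by (simp add: tangent_space_def case_prod_beta mem_Times_iff)
qed

lemma chain_curve:
  assumes "\<And>s. s \<in> {0..1::real} \<Longrightarrow> \<sigma> s \<in> S2xS2" and "(\<sigma> has_vector_derivative v) (at s within {0..1})"
    and "(F has_derivative F') (at (\<sigma> s) within S2xS2)"
  shows "((\<lambda>s. F (\<sigma> s)) has_vector_derivative F' v) (at s within {0..1})"
proof -
  have "\<sigma> ` {0..1} \<subseteq> S2xS2" using assms(1) by blast
  then have F: "(F has_derivative F') (at (\<sigma> s) within \<sigma> ` {0..1})" using assms(3) has_derivative_subset by blast
  have lin: "linear F'" using assms(3) has_derivative_linear by blast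
  from has_derivative_in_compose[OF assms(2)[unfolded has_vector_derivative_def] F]
  show ?thesis unfolding has_vector_derivative_def by (simp add: linear_scale[OF lin])
qed

lemma smooth_on_subset_derivative:
  assumes "smooth_on_subset X G" "x \<in> X"
  obtains G' where "(G has_derivative G') (at x within X)"
proof -
  have "\<exists>U g. open U \<and> x \<in> U \<and> smooth_on U g \<and> (\<forall>y\<in>X \<inter> U. g y = G y)"
    using assms(1)[unfolded smooth_on_subset_def] assms(2) by (rule bspec)
  then obtain U g where U: "open U" "x \<in> U" "smooth_on U g" and U4: "\<forall>y\<in>X \<inter> U. g y = G y"
    by (elim exE conjE) (rule that)
  have "C_k_on (Suc 0) U g" using U(3) unfolding smooth_on_def by blast
  then have "g differentiable (at x)" using U(2) by simp
  then obtain G' where "(g has_derivative G') (at x)" unfolding differentiable_def by blast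
  then have D: "(g has_derivative G') (at x within X)" by (rule has_derivative_at_withinI)
  obtain e where e: "e > 0" "ball x e \<subseteq> U" using openE[OF U(1,2)] by blast
  have "(G has_derivative G') (at x within X)"
    by (rule has_derivative_transform_within[OF D e(1) assms(2)]) (use e(2) U4 in \<open>auto simp: dist_commute subset_iff\<close>)
  then show ?thesis using that by blast
qed

text \<open>The image of a minimal geodesic under F is a curve of the same speed.\<close>

lemma isometry_angle_dist_le:
  assumes F: "isometry_S2xS2 F" and x: "x \<in> S2xS2" and y: "y \<in> S2xS2"
  shows "angle_dist (F x) (F y) \<le> angle_dist x y"
proof -
  have bij: "bij_betw F S2xS2 S2xS2" using F by (simp add: isometry_S2xS2_def)
  obtain \<sigma> \<sigma>' where g: "\<sigma> 0 = x" "\<sigma> 1 = y" "\<And>s. \<sigma> s \<in> S2xS2" "\<And>s. (\<sigma> has_vector_derivative \<sigma>' s) (at s)"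
    "\<And>s. norm (\<sigma>' s) = angle_dist x y" "\<And>s. \<sigma>' s \<in> tangent_space (\<sigma> s)"
    by (rule geodesic_exists[OF x y]) (assumption | rule that, assumption+)+
  have "angle_dist ((\<lambda>s. F (\<sigma> s)) 0) ((\<lambda>s. F (\<sigma> s)) 1) \<le> angle_dist x y"
  proof (rule curve_angle_dist)
    show "F (\<sigma> s) \<in> S2xS2" for s using bij g(3) bij_betwE by blast
    show "0 \<le> angle_dist x y" by (simp add: angle_dist_def)
    fix s :: real assume "s \<in> {0..1}"
    obtain F' where F': "(F has_derivative F') (at (\<sigma> s) within S2xS2)" "\<And>u v. u \<in> tangent_space (\<sigma> s) \<Longrightarrow> v \<in> tangent_space (\<sigma> s) \<Longrightarrow> F' u \<bullet> F' v = u \<bullet> v"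
      using F g(3) unfolding isometry_S2xS2_def by blast
    have "((\<lambda>s. F (\<sigma> s)) has_vector_derivative F' (\<sigma>' s)) (at s within {0..1})"
      by (rule chain_curve[OF g(3) has_vector_derivative_at_within[OF g(4)] F'(1)])
    moreover have "norm (F' (\<sigma>' s)) = norm (\<sigma>' s)" using F'(2)[OF g(6) g(6)] by (simp add: norm_eq_sqrt_inner)
    ultimately show "\<exists>v. ((\<lambda>s. F (\<sigma> s)) has_vector_derivative v) (at s within {0..1}) \<and> norm v \<le> angle_dist x y"
      by (intro exI[of _ "F' (\<sigma>' s)"] conjI) (simp_all add: g(5))
  qed
  then show ?thesis by (simp add: g)
qed

text \<open>A minimal geodesic between the images is pulled back by the inverse.
  \<open>isometry_S2xS2\<close> states the metric condition for F and only smoothness for the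
  inverse, so the speed of the pulled-back curve is found from F: its velocity is tangent, and the
  derivative of F sends it to the velocity of the geodesic.\<close>

lemma isometry_angle_dist_ge:
  assumes F: "isometry_S2xS2 F" and x: "x \<in> S2xS2" and y: "y \<in> S2xS2"
  shows "angle_dist x y \<le> angle_dist (F x) (F y)"
proof -
  have bij: "bij_betw F S2xS2 S2xS2" using F by (simp add: isometry_S2xS2_def)
  define G where "G = inv_into S2xS2 F"
  have GS: "G w \<in> S2xS2" "F (G w) = w" if "w \<in> S2xS2" for w
    using bij that unfolding G_def by (auto simp: bij_betw_def inv_into_into f_inv_into_f)
  have GF: "G (F w) = w" if "w \<in> S2xS2" for w
    using bij that unfolding G_def by (simp add: bij_betw_def)
  have FS: "F x \<in> S2xS2" "F y \<in> S2xS2" using bij x y bij_betwE by blast+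
  obtain \<sigma> \<sigma>' where g: "\<sigma> 0 = F x" "\<sigma> 1 = F y" "\<And>s. \<sigma> s \<in> S2xS2" "\<And>s. (\<sigma> has_vector_derivative \<sigma>' s) (at s)"
    "\<And>s. norm (\<sigma>' s) = angle_dist (F x) (F y)" "\<And>s. \<sigma>' s \<in> tangent_space (\<sigma> s)"
    by (rule geodesic_exists[OF FS]) (assumption | rule that, assumption+)+
  have "angle_dist ((\<lambda>s. G (\<sigma> s)) 0) ((\<lambda>s. G (\<sigma> s)) 1) \<le> angle_dist (F x) (F y)"
  proof (rule curve_angle_dist)
    show GSs: "G (\<sigma> s) \<in> S2xS2" for s using GS g(3) by blast
    show "0 \<le> angle_dist (F x) (F y)" by (simp add: angle_dist_def)
    fix s :: real assume s: "s \<in> {0..1}"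
    have "smooth_on_subset S2xS2 G" using F by (simp add: isometry_S2xS2_def G_def)
    then obtain G' where G': "(G has_derivative G') (at (\<sigma> s) within S2xS2)"
      using smooth_on_subset_derivative g(3) by blast
    define v where "v = G' (\<sigma>' s)"
    have v: "((\<lambda>s. G (\<sigma> s)) has_vector_derivative v) (at s within {0..1})"
      unfolding v_def by (rule chain_curve[OF g(3) has_vector_derivative_at_within[OF g(4)] G'])
    have tv: "v \<in> tangent_space (G (\<sigma> s))" by (rule tangent_of_curve[OF GSs s v])
    obtain F' where F': "(F has_derivative F') (at (G (\<sigma> s)) within S2xS2)" "\<And>u v. u \<in> tangent_space (G (\<sigma> s)) \<Longrightarrow> v \<in> tangent_space (G (\<sigma> s)) \<Longrightarrow> F' u \<bullet> F' v = u \<bullet> v"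
      using F GSs unfolding isometry_S2xS2_def by blast
    have "((\<lambda>s. F (G (\<sigma> s))) has_vector_derivative F' v) (at s within {0..1})"
      by (rule chain_curve[OF GSs v F'(1)])
    then have "(\<sigma> has_vector_derivative F' v) (at s within {0..1})" by (simp add: GS g(3))
    then have A: "(\<sigma> has_vector_derivative F' v) (at s within cbox 0 1)" unfolding cbox_interval .
    have "F' v = \<sigma>' s"
      by (rule vector_derivative_unique_within_closed_interval[OF _ _ A has_vector_derivative_at_within[OF g(4)]]) (use s in auto)
    then have "norm v = norm (\<sigma>' s)" using F'(2)[OF tv tv] by (simp add: norm_eq_sqrt_inner)
    then show "\<exists>v. ((\<lambda>s. G (\<sigma> s)) has_vector_derivative v) (at s within {0..1}) \<and> norm v \<le> angle_dist (F x) (F y)"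
      using v by (intro exI[of _ v] conjI) (simp_all add: g(5))
  qed
  then show ?thesis by (simp add: g GF x y)
qed

lemma isometry_angle_dist:
  "isometry_S2xS2 F \<Longrightarrow> x \<in> S2xS2 \<Longrightarrow> y \<in> S2xS2 \<Longrightarrow> angle_dist (F x) (F y) = angle_dist x y"
  using isometry_angle_dist_le isometry_angle_dist_ge by (simp add: order_antisym)

lemma S2_minus: "p \<in> S2 \<Longrightarrow> - p \<in> S2" and S2xS2_minus: "x \<in> S2xS2 \<Longrightarrow> - x \<in> S2xS2"
  by (auto simp: S2_def S2xS2_iff)

lemma sph_angle_minus: "p \<in> S2 \<Longrightarrow> q \<in> S2 \<Longrightarrow> sph_angle p (- q) = pi - sph_angle p q"
  unfolding sph_angle_def using S2_inner_bounds[of p q] by (simp add: arccos_minus)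

lemma angle_dist_antipode: "x \<in> S2xS2 \<Longrightarrow> angle_dist x (- x) = norm (pi, pi)"
  unfolding angle_dist_def S2xS2_iff
  by (simp add: sph_angle_minus) (simp add: sph_angle_def S2_def norm_eq_1)

text \<open>Each angle is at most pi, so the distance is largest only if both are pi. Thus -x is the
  unique farthest point from x, and isometries commute with the antipodal map.\<close>

lemma angle_dist_max:
  assumes "x \<in> S2xS2" "y \<in> S2xS2" "angle_dist x y = norm (pi, pi)" shows "y = - x"
proof -
  have s: "fst x \<in> S2" "fst y \<in> S2" "snd x \<in> S2" "snd y \<in> S2" using assms by (auto simp: S2xS2_iff)
  let ?a = "sph_angle (fst x) (fst y)" and ?b = "sph_angle (snd x) (snd y)"
  have ab: "0 \<le> ?a" "?a \<le> pi" "0 \<le> ?b" "?b \<le> pi" using sph_angle_bounds s by blast+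
  have "?a\<^sup>2 + ?b\<^sup>2 = pi\<^sup>2 + pi\<^sup>2" using assms(3) by (simp add: angle_dist_def norm_Pair)
  moreover have "?a\<^sup>2 \<le> pi\<^sup>2" "?b\<^sup>2 \<le> pi\<^sup>2" using ab by (auto intro: power_mono)
  ultimately have "?a\<^sup>2 = pi\<^sup>2" "?b\<^sup>2 = pi\<^sup>2" by linarith+
  then have "?a = pi" "?b = pi" using ab by (auto simp: power2_eq_iff_nonneg)
  then have c: "fst x \<bullet> fst y = -1" "snd x \<bullet> snd y = -1" using cos_sph_angle[OF s(1,2)] cos_sph_angle[OF s(3,4)] by simp_all
  have eq: "q = - p" if "p \<in> S2" "q \<in> S2" "p \<bullet> q = -1" for p q
  proof -
    have "(p + q) \<bullet> (p + q) = 0" using that by (simp add: inner_add_left inner_add_right inner_commute S2_def norm_eq_1)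
    then show ?thesis by (simp add: add_eq_0_iff)
  qed
  show ?thesis using eq[OF s(1,2) c(1)] eq[OF s(3,4) c(2)] by (simp add: prod_eq_iff)
qed

lemma two_squares_sum:
  fixes a b a' b' :: real
  assumes "a\<^sup>2 + b\<^sup>2 = a'\<^sup>2 + b'\<^sup>2" "a + b = a' + b'"
  shows "(a = a' \<and> b = b') \<or> (a = b' \<and> b = a')"
proof -
  have b: "b = a' + b' - a" using assms(2) by simp
  have "(a - a') * (a - b') = 0" using assms(1) unfolding b by (simp add: power2_eq_square algebra_simps)
  then show ?thesis using assms(2) by auto
qed

text \<open>The distances from x to y and to -y give the sums of squares of the angles a, b and of
  pi - a, pi - b. Together they determine a + b and then the unordered pair of angles, hence the sum
  of their cosines, which is the inner product of the ambient space.\<close>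

lemma isometry_inner:
  assumes F: "isometry_S2xS2 F" and x: "x \<in> S2xS2" and y: "y \<in> S2xS2"
  shows "F x \<bullet> F y = x \<bullet> y"
proof -
  have bij: "bij_betw F S2xS2 S2xS2" using F by (simp add: isometry_S2xS2_def)
  have FS: "F w \<in> S2xS2" if "w \<in> S2xS2" for w using bij that bij_betwE by blast
  have my: "- y \<in> S2xS2" using S2xS2_minus y by blast
  have anti: "F (- y) = - F y"
    by (rule angle_dist_max[OF FS[OF y] FS[OF my]]) (simp add: isometry_angle_dist[OF F y my] angle_dist_antipode[OF y])
  let ?a = "sph_angle (fst x) (fst y)" and ?b = "sph_angle (snd x) (snd y)"
  let ?a' = "sph_angle (fst (F x)) (fst (F y))" and ?b' = "sph_angle (snd (F x)) (snd (F y))"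
  have s: "fst x \<in> S2" "fst y \<in> S2" "snd x \<in> S2" "snd y \<in> S2" using x y by (auto simp: S2xS2_iff)
  have s': "fst (F x) \<in> S2" "fst (F y) \<in> S2" "snd (F x) \<in> S2" "snd (F y) \<in> S2" using FS x y by (auto simp: S2xS2_iff)
  have 1: "?a'\<^sup>2 + ?b'\<^sup>2 = ?a\<^sup>2 + ?b\<^sup>2"
    using isometry_angle_dist[OF F x y] by (simp add: angle_dist_def norm_Pair)
  have 2: "(pi - ?a')\<^sup>2 + (pi - ?b')\<^sup>2 = (pi - ?a)\<^sup>2 + (pi - ?b)\<^sup>2"
    using isometry_angle_dist[OF F x my] by (simp add: anti angle_dist_def norm_Pair sph_angle_minus s s')
  have "2 * pi * (?a' + ?b') = 2 * pi * (?a + ?b)" using 1 2 by (simp add: power2_eq_square algebra_simps)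
  then have "?a' + ?b' = ?a + ?b" by simp
  from two_squares_sum[OF 1 this] have "cos ?a' + cos ?b' = cos ?a + cos ?b" by auto
  then have "fst (F x) \<bullet> fst (F y) + snd (F x) \<bullet> snd (F y) = fst x \<bullet> fst y + snd x \<bullet> snd y"
    by (simp add: cos_sph_angle s s')
  then show ?thesis by (simp add: inner_prod_def)
qed

text \<open>F is extended linearly from a maximal independent subset of S2 x S2. Preservation of
  inner products carries over to the extension, and expanding the squared norm of the difference of
  F and the extension gives zero.\<close>

lemma isometry_linear:
  assumes F: "isometry_S2xS2 F"
  obtains L where "linear L" "\<And>x. x \<in> S2xS2 \<Longrightarrow> F x = L x" "\<And>x y. x \<in> span S2xS2 \<Longrightarrow> y \<in> span S2xS2 \<Longrightarrow> L x \<bullet> L y = x \<bullet> y"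
proof -
  obtain B where B: "B \<subseteq> S2xS2" "independent B" "S2xS2 \<subseteq> span B" using maximal_independent_subset by metis
  obtain L where L: "linear L" "\<And>b. b \<in> B \<Longrightarrow> L b = F b" using linear_independent_extend[OF B(2), of F] by blast
  have 1: "F y \<bullet> L x = y \<bullet> x" if y: "y \<in> S2xS2" and x: "x \<in> span B" for x y
  proof -
    have "subspace {x. F y \<bullet> L x = y \<bullet> x}"
      by (simp add: subspace_def linear_0[OF L(1)] linear_add[OF L(1)] linear_scale[OF L(1)] inner_add_right)
    moreover have "B \<subseteq> {x. F y \<bullet> L x = y \<bullet> x}" using L(2) isometry_inner[OF F y] B(1) by auto
    ultimately have "span B \<subseteq> {x. F y \<bullet> L x = y \<bullet> x}" by (simp add: span_minimal)
    then show ?thesis using x by blast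
  qed
  have 2: "L y \<bullet> L x = y \<bullet> x" if y: "y \<in> span B" and x: "x \<in> span B" for x y
  proof -
    have "subspace {y. L y \<bullet> L x = y \<bullet> x}"
      by (simp add: subspace_def linear_0[OF L(1)] linear_add[OF L(1)] linear_scale[OF L(1)] inner_add_left)
    moreover have "B \<subseteq> {y. L y \<bullet> L x = y \<bullet> x}" using L(2) 1[OF _ x] B(1) by force
    ultimately have "span B \<subseteq> {y. L y \<bullet> L x = y \<bullet> x}" by (simp add: span_minimal)
    then show ?thesis using y by blast
  qed
  have 3: "F x = L x" if x: "x \<in> S2xS2" for x
  proof -
    have xs: "x \<in> span B" using x B(3) by blast
    have "(F x - L x) \<bullet> (F x - L x) = 0"
      using isometry_inner[OF F x x] 1[OF x xs] 2[OF xs xs] by (simp add: inner_diff_left inner_diff_right inner_commute)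
    then show ?thesis by simp
  qed
  have "span S2xS2 \<subseteq> span B" using B(3) span_minimal subspace_span by blast
  then show ?thesis using that[OF L(1) 3] 2 by blast
qed

lemma unit_norm_orthogonal:
  fixes f :: "real^3 \<Rightarrow> real^3"
  assumes "linear f" "\<And>p. p \<in> S2 \<Longrightarrow> norm (f p) = 1" shows "orthogonal_transformation f"
  unfolding orthogonal_transformation
proof (intro conjI assms allI)
  fix x :: "real^3"
  show "norm (f x) = norm x"
  proof (cases "x = 0")
    case True then show ?thesis by (simp add: linear_0[OF assms(1)])
  next
    case False
    then have "norm (f (x /\<^sub>R norm x)) = 1" by (intro assms) (simp add: S2_def)
    then show ?thesis using False by (simp add: linear_scale[OF assms(1)] field_simps)
  qed
qed

text \<open>Replacing q by -q shows that a p and b q are orthogonal and that their squared norms add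
  up to 1. If b is not zero, a cannot be onto and so kills some unit vector; then b preserves norms
  and a vanishes.\<close>

lemma orthogonal_ranges:
  fixes a b :: "real^3 \<Rightarrow> real^3"
  assumes lin: "linear a" "linear b" and ab: "\<And>p q. p \<in> S2 \<Longrightarrow> q \<in> S2 \<Longrightarrow> norm (a p + b q) = 1"
  shows "((\<forall>x. a x = 0) \<and> orthogonal_transformation b) \<or> ((\<forall>x. b x = 0) \<and> orthogonal_transformation a)"
proof -
  have sq: "a p \<bullet> a p + b q \<bullet> b q = 1" "a p \<bullet> b q = 0" if p: "p \<in> S2" and q: "q \<in> S2" for p q
  proof -
    have "(a p + b q) \<bullet> (a p + b q) = 1" using ab[OF p q] by (simp add: norm_eq_1)
    moreover have "(a p - b q) \<bullet> (a p - b q) = 1" using ab[OF p S2_minus[OF q]] by (simp add: norm_eq_1 linear_neg[OF lin(2)])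
    ultimately show "a p \<bullet> a p + b q \<bullet> b q = 1" "a p \<bullet> b q = 0"
      by (simp_all add: inner_add_left inner_add_right inner_diff_left inner_diff_right inner_commute)
  qed
  have unitS: "x /\<^sub>R norm x \<in> S2" if "x \<noteq> 0" for x :: "real^3" using that by (simp add: S2_def)
  have e: "axis 1 1 \<in> S2" by (simp add: S2_def)
  have zero: "\<forall>x. f x = 0" if f: "linear f" "\<And>p. p \<in> S2 \<Longrightarrow> f p = 0" for f :: "real^3 \<Rightarrow> real^3"
  proof
    fix x
    show "f x = 0"
    proof (cases "x = 0")
      case True then show ?thesis by (simp add: linear_0[OF f(1)])
    next
      case False
      then have "f (x /\<^sub>R norm x) = 0" by (intro f unitS)
      then show ?thesis using False by (simp add: linear_scale[OF f(1)])
    qed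
  qed
  show ?thesis
  proof (cases "\<exists>q\<in>S2. b q \<noteq> 0")
    case False
    then have "\<forall>x. b x = 0" using zero[OF lin(2)] by blast
    moreover have "orthogonal_transformation a"
      by (rule unit_norm_orthogonal[OF lin(1)]) (use sq(1)[OF _ e] False e in \<open>simp add: norm_eq_1\<close>)
    ultimately show ?thesis by blast
  next
    case True
    then obtain q where q: "q \<in> S2" "b q \<noteq> 0" by blast
    \<comment> \<open>An injective a would be onto, so b q would be a value of a and therefore
      orthogonal to itself.\<close>
    have "\<not> inj a"
    proof
      assume "inj a"
      then have "surj a" using lin(1) linear_injective_imp_surjective by blast
      then obtain y where y: "b q = a y" by (metis surjD)
      then have "y \<noteq> 0" using q linear_0[OF lin(1)] by auto
      then have "a (y /\<^sub>R norm y) \<bullet> b q = 0" using sq(2)[OF unitS q(1)] by blast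
      then have "b q \<bullet> b q = 0" using \<open>y \<noteq> 0\<close> by (simp add: linear_scale[OF lin(1)] y)
      then show False using q by simp
    qed
    then obtain x where x: "x \<noteq> 0" "a x = 0" using linear_injective_0[OF lin(1)] by blast
    let ?x = "x /\<^sub>R norm x"
    have ax: "a ?x = 0" using x by (simp add: linear_scale[OF lin(1)])
    have bq: "b w \<bullet> b w = 1" if "w \<in> S2" for w using sq(1)[OF unitS[OF x(1)] that] ax by simp
    have "orthogonal_transformation b"
      by (rule unit_norm_orthogonal[OF lin(2)]) (simp add: norm_eq_1 bq)
    moreover have "a p = 0" if "p \<in> S2" for p using sq(1)[OF that e] bq[OF e] by simp
    ultimately show ?thesis using zero[OF lin(1)] by blast
  qed
qed

lemma matrix_of_orthogonal:
  fixes f :: "real^3 \<Rightarrow> real^3"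
  assumes "orthogonal_transformation f"
  shows "orthogonal_matrix (matrix f)" "matrix f *v x = f x"
  using assms orthogonal_transformation_matrix fun_cong[OF matrix_vector_mul(2)[of f]] by (auto simp: orthogonal_transformation_linear)

text \<open>The antipodal map recovers the sum of the two angles from the product distance, so an isometry
  permutes the two angles and preserves the inner product of the ambient space.\<close>

lemma isometry_form:
  assumes F: "isometry_S2xS2 F"
  obtains T where "T \<in> orth_pairs" "(\<forall>x\<in>S2xS2. F x = act T x) \<or> (\<forall>x\<in>S2xS2. F x = prod.swap (act T x))"
proof -
  obtain L where L: "linear L" "\<And>x. x \<in> S2xS2 \<Longrightarrow> F x = L x" "\<And>x y. x \<in> span S2xS2 \<Longrightarrow> y \<in> span S2xS2 \<Longrightarrow> L x \<bullet> L y = x \<bullet> y"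
    by (rule isometry_linear[OF F]) (assumption | rule that, assumption+)+
  have bij: "bij_betw F S2xS2 S2xS2" using F by (simp add: isometry_S2xS2_def)
  define a b cc d where "a p = fst (L (p, 0))" and "b q = fst (L (0, q))" and "cc p = snd (L (p, 0))" and "d q = snd (L (0, q))" for p q :: "real^3"
  have l1: "linear (\<lambda>p. L (p, 0::real^3))" "linear (\<lambda>q. L (0::real^3, q))"
    using linear_compose[OF linearI[of "\<lambda>p. (p, 0)"] L(1)] linear_compose[OF linearI[of "\<lambda>q. (0, q)"] L(1)] by (simp_all add: o_def)
  have lin: "linear a" "linear b" "linear cc" "linear d"
    unfolding a_def b_def cc_def d_def
    using linear_compose[OF l1(1) linear_fst] linear_compose[OF l1(2) linear_fst] linear_compose[OF l1(1) linear_snd] linear_compose[OF l1(2) linear_snd]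
    by (simp_all add: o_def)
  have split: "L (p, q) = (a p + b q, cc p + d q)" for p q
  proof -
    have "L (p, q) = L (p, 0) + L (0, q)" using linear_add[OF L(1), of "(p, 0)" "(0, q)"] by simp
    then show ?thesis by (simp add: a_def b_def cc_def d_def prod_eq_iff)
  qed
  have mem: "(p, q) \<in> S2xS2" if "p \<in> S2" "q \<in> S2" for p q using that by (simp add: S2xS2_iff)
  have LS: "L (p, q) \<in> S2xS2" if "p \<in> S2" "q \<in> S2" for p q
    using L(2)[OF mem[OF that]] bij_betwE[OF bij] mem[OF that] by metis
  have n1: "norm (a p + b q) = 1" "norm (cc p + d q) = 1" if "p \<in> S2" "q \<in> S2" for p q
    using LS[OF that] by (simp_all add: split S2xS2_iff S2_def)
  have e: "axis 1 1 \<in> S2" by (simp add: S2_def)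
  have n2: "a p \<bullet> a p + cc p \<bullet> cc p = 1" if p: "p \<in> S2" for p
  proof -
    \<comment> \<open>(p, 0) is the midpoint of two points of S2 x S2, so it lies in the span on
      which L preserves inner products.\<close>
    have e2: "(p, 0) = (1/2) *\<^sub>R ((p, axis 1 1) + (p, - axis 1 1)) " by (simp add: scaleR_add_left[symmetric])
    have "(p, axis 1 1) \<in> S2xS2" "(p, - axis 1 1) \<in> S2xS2" using mem[OF p e] mem[OF p S2_minus[OF e]] by auto
    then have "(p, 0) \<in> span S2xS2" by (subst e2) (intro span_mul span_add span_base)
    then have "L (p, 0) \<bullet> L (p, 0) = (p, 0::real^3) \<bullet> (p, 0)" using L(3) by blast
    then show ?thesis using p by (simp add: a_def cc_def inner_prod_def S2_def norm_eq_1)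
  qed
  have oo: "False" if "orthogonal_transformation f" "\<forall>x. f x = 0" for f :: "real^3 \<Rightarrow> real^3"
  proof -
    have "norm (f (axis 1 1)) = norm (axis 1 1 :: real^3)" using that(1) by (simp add: orthogonal_transformation)
    then show False using that(2) by simp
  qed
  have nn: "f p \<bullet> f p = 1" if "orthogonal_transformation f" "p \<in> S2" for f :: "real^3 \<Rightarrow> real^3" and p
    using that by (simp add: orthogonal_transformation_def S2_def norm_eq_1)
  from orthogonal_ranges[OF lin(1,2) n1(1)] show ?thesis
  proof
    assume ab: "(\<forall>x. a x = 0) \<and> orthogonal_transformation b"
    then have "orthogonal_transformation cc" using unit_norm_orthogonal[OF lin(3)] n2 by (simp add: norm_eq_1)
    moreover from this have "\<forall>x. d x = 0" using orthogonal_ranges[OF lin(3,4) n1(2)] oo by blast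
    ultimately have c: "orthogonal_transformation cc" "\<And>x. d x = 0" by blast+
    show ?thesis
    proof (rule that[of "(matrix cc, matrix b)"])
      show "(matrix cc, matrix b) \<in> orth_pairs" using matrix_of_orthogonal(1) c ab by (simp add: orth_pairs_def)
      show "(\<forall>x\<in>S2xS2. F x = act (matrix cc, matrix b) x) \<or> (\<forall>x\<in>S2xS2. F x = prod.swap (act (matrix cc, matrix b) x))"
        using L(2) split ab c by (auto simp: act_def matrix_of_orthogonal(2) prod_eq_iff)
    qed
  next
    assume ab: "(\<forall>x. b x = 0) \<and> orthogonal_transformation a"
    have cz: "cc p = 0" if "p \<in> S2" for p using n2[OF that] nn[of a p] ab that by simp
    have "orthogonal_transformation d"
      using unit_norm_orthogonal[OF lin(4)] n1(2)[OF e] cz[OF e] by simp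
    moreover from this have "\<forall>x. cc x = 0" using orthogonal_ranges[OF lin(3,4) n1(2)] oo by blast
    ultimately have c: "orthogonal_transformation d" "\<And>x. cc x = 0" by blast+
    show ?thesis
    proof (rule that[of "(matrix a, matrix d)"])
      show "(matrix a, matrix d) \<in> orth_pairs" using matrix_of_orthogonal(1) c ab by (simp add: orth_pairs_def)
      show "(\<forall>x\<in>S2xS2. F x = act (matrix a, matrix d) x) \<or> (\<forall>x\<in>S2xS2. F x = prod.swap (act (matrix a, matrix d) x))"
        using L(2) split ab c by (auto simp: act_def matrix_of_orthogonal(2) prod_eq_iff)
    qed
  qed
qed

section \<open>Congruence with the standard models\<close>

lemma C_k_on_const: "C_k_on k S (\<lambda>x. c)"
proof (induction k arbitrary: c)
  case (Suc k)
  have "frechet_derivative (\<lambda>x. c) (at x) = (\<lambda>v. 0)" for x by (simp add: Dv_eqI)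
  then show ?case using Suc by simp
qed simp

lemma smooth_on_linear:
  fixes f :: "'a::euclidean_space \<Rightarrow> 'b::euclidean_space"
  assumes "linear f" shows "smooth_on UNIV f"
proof -
  have D: "(f has_derivative f) (at x)" for x
    by (rule linear_imp_has_derivative[OF assms])
  have "C_k_on k UNIV f" for k
  proof (cases k)
    case 0
    then show ?thesis using linear_continuous_on[OF linear_conv_bounded_linear[THEN iffD1, OF assms]] by simp
  next
    case (Suc j)
    have "f differentiable (at x)" for x using D differentiable_def by blast
    moreover have "frechet_derivative f (at x) = f" for x by (rule Dv_eqI[OF D])
    ultimately show ?thesis using Suc by (simp add: C_k_on_const)
  qed
  then show ?thesis by (simp add: smooth_on_def)
qed

lemma linear_isometry:
  assumes F: "linear F" "linear G" and S: "\<And>x. x \<in> S2xS2 \<Longrightarrow> F x \<in> S2xS2" "\<And>x. x \<in> S2xS2 \<Longrightarrow> G x \<in> S2xS2"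
    and inv: "\<And>x. G (F x) = x" "\<And>x. F (G x) = x" and ip: "\<And>x y. F x \<bullet> F y = x \<bullet> y"
  shows "isometry_S2xS2 F"
  unfolding isometry_S2xS2_def
proof (intro conjI ballI)
  show bij: "bij_betw F S2xS2 S2xS2"
    by (rule bij_betw_byWitness[of _ G]) (use S inv in auto)
  have sm: "smooth_on_subset S2xS2 H'" if "linear H" "\<And>x. x \<in> S2xS2 \<Longrightarrow> H x = H' x" for H H' :: "R3xR3 \<Rightarrow> R3xR3"
    unfolding smooth_on_subset_def
  proof
    fix x :: R3xR3 assume "x \<in> S2xS2"
    show "\<exists>U g. open U \<and> x \<in> U \<and> smooth_on U g \<and> (\<forall>y\<in>S2xS2 \<inter> U. g y = H' y)"
      by (intro exI[of _ UNIV] exI[of _ H] conjI) (use smooth_on_linear[OF that(1)] that(2) in simp_all)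
  qed
  show "smooth_on_subset S2xS2 F" by (rule sm[OF F(1)]) simp
  show "smooth_on_subset S2xS2 (inv_into S2xS2 F)"
  proof (rule sm[OF F(2)])
    fix x assume x: "x \<in> S2xS2"
    have "inv_into S2xS2 F (F (G x)) = G x" by (rule inv_into_f_f) (use bij S(2)[OF x] in \<open>auto simp: bij_betw_def\<close>)
    then show "G x = inv_into S2xS2 F x" by (simp add: inv)
  qed
  fix x :: R3xR3 assume "x \<in> S2xS2"
  have "(F has_derivative F) (at x within S2xS2)" by (rule linear_imp_has_derivative[OF F(1)])
  then show "\<exists>F'. (F has_derivative F') (at x within S2xS2) \<and> (\<forall>u\<in>tangent_space x. \<forall>v\<in>tangent_space x. F' u \<bullet> F' v = u \<bullet> v)"
    using ip by blast
qed

lemma linear_swap: "linear (prod.swap :: R3xR3 \<Rightarrow> R3xR3)"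
  by (rule linearI) auto

lemma inner_swap: "prod.swap x \<bullet> prod.swap y = x \<bullet> y" for x y :: R3xR3
  by (simp add: inner_prod_def)

lemma isometry_act: "T \<in> orth_pairs \<Longrightarrow> isometry_S2xS2 (act T)"
  by (rule linear_isometry[OF act_linear act_linear, of _ "inv_pair T"])
     (simp_all add: act_S2xS2 inv_pair_orth act_inv_pair act_inner)

lemma isometry_act_swap:
  assumes "T \<in> orth_pairs" shows "isometry_S2xS2 (\<lambda>x. act T (prod.swap x))"
proof (rule linear_isometry[of _ "\<lambda>x. prod.swap (act (inv_pair T) x)"])
  show "linear (\<lambda>x. act T (prod.swap x))" using linear_compose[OF linear_swap act_linear] by (simp add: o_def)
  show "linear (\<lambda>x. prod.swap (act (inv_pair T) x))" using linear_compose[OF act_linear linear_swap] by (simp add: o_def)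
  have sw: "prod.swap x \<in> S2xS2 \<longleftrightarrow> x \<in> S2xS2" for x by (auto simp: S2xS2_iff)
  show "x \<in> S2xS2 \<Longrightarrow> act T (prod.swap x) \<in> S2xS2" "x \<in> S2xS2 \<Longrightarrow> prod.swap (act (inv_pair T) x) \<in> S2xS2" for x
    using act_S2xS2 assms inv_pair_orth sw by auto
qed (simp_all add: act_inv_pair assms act_inner inner_swap)

lemma openin_linear_image:
  fixes F G :: "R3xR3 \<Rightarrow> R3xR3"
  assumes "linear G" "\<And>x. G (F x) = x" "\<And>x. F (G x) = x" "openin (top_of_set K) X"
  shows "openin (top_of_set (F ` K)) (F ` X)"
proof -
  obtain U where U: "open U" "X = K \<inter> U" using assms(4) by (auto simp: openin_open)
  have "open (G -` U)"
    by (rule open_vimage[OF U(1) linear_continuous_on[OF linear_conv_bounded_linear[THEN iffD1, OF assms(1)]]])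
  moreover have "F ` X = F ` K \<inter> G -` U"
  proof
    show "F ` X \<subseteq> F ` K \<inter> G -` U" using U(2) assms(2) by auto
    show "F ` K \<inter> G -` U \<subseteq> F ` X" using U(2) assms(2) by force
  qed
  ultimately show ?thesis by (auto simp: openin_open)
qed

lemma congruent_circ1:
  assumes a: "norm a = 1" and t: "\<bar>t\<bar> < 1"
  obtains T where "T \<in> orth_pairs" "act T ` circ1 a t = S1 (sqrt (1 - t\<^sup>2)) \<times> S2"
proof -
  \<comment> \<open>\<open>S1\<close> consists of points at nonnegative height, so for negative t
    the axis a is sent to the negative third axis, and the height becomes -t.\<close>
  define e :: "real^3" where "e = (if t \<ge> 0 then axis 3 1 else - axis 3 1)"
  have ne: "norm a = norm e" using a by (simp add: e_def)
  obtain f where f: "orthogonal_transformation f" "f a = e" using orthogonal_transformation_exists[OF ne] by blast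
  let ?T = "(matrix f, mat 1 :: real^3^3)"
  have T: "?T \<in> orth_pairs" using matrix_of_orthogonal(1)[OF f(1)] by (simp add: orth_pairs_def orthogonal_matrix_id)
  have me: "matrix f *v a = e" using matrix_of_orthogonal(2)[OF f(1)] f(2) by simp
  have t2: "t\<^sup>2 \<le> 1" using t by (simp add: abs_square_le_1)
  have tgt: "y \<in> circ1 e t \<longleftrightarrow> y \<in> S1 (sqrt (1 - t\<^sup>2)) \<times> S2" for y
    using t2 by (auto simp: circ1_def S1_def S2xS2_iff mem_Times_iff e_def inner_axis)
  have "act ?T ` circ1 a t = circ1 e t"
  proof
    show "act ?T ` circ1 a t \<subseteq> circ1 e t" using act_circ(1)[OF T, of _ a t] me by auto
    show "circ1 e t \<subseteq> act ?T ` circ1 a t"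
    proof
      fix y assume y: "y \<in> circ1 e t"
      then have "act ?T (act (inv_pair ?T) y) \<in> circ1 (fst ?T *v a) t" using act_inv_pair[OF T] me by simp
      then have "act (inv_pair ?T) y \<in> circ1 a t" using act_circ(1)[OF T] by blast
      then show "y \<in> act ?T ` circ1 a t" using act_inv_pair(2)[OF T, of y] by (intro image_eqI[of _ _ "act (inv_pair ?T) y"]) simp_all
    qed
  qed
  then have "act ?T ` circ1 a t = S1 (sqrt (1 - t\<^sup>2)) \<times> S2" using tgt by auto
  then show ?thesis using that T by blast
qed

text \<open>Applying R to the second factor turns p . R q into the plain inner product.\<close>

lemma congruent_rotK:
  assumes R: "orthogonal_matrix R"
  obtains T where "T \<in> orth_pairs" "act T ` rotK R t = M_hyp t"
proof -
  let ?T = "(mat 1 :: real^3^3, R)"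
  have T: "?T \<in> orth_pairs" using R by (simp add: orth_pairs_def orthogonal_matrix_id)
  have id: "fst ?T ** R ** transpose (snd ?T) = mat 1" using R by (simp add: orthogonal_matrix_def)
  have tgt: "rotK (mat 1) t = M_hyp t" by (auto simp: rotK_def M_hyp_def)
  have ar: "act ?T x \<in> rotK (mat 1) t \<longleftrightarrow> x \<in> rotK R t" for x using act_rotK[OF T, of x R t] unfolding id .
  have "act ?T ` rotK R t = rotK (mat 1) t"
  proof
    show "act ?T ` rotK R t \<subseteq> rotK (mat 1) t" using ar by auto
    show "rotK (mat 1) t \<subseteq> act ?T ` rotK R t"
    proof
      fix y assume y: "y \<in> rotK (mat 1) t"
      then have "act (inv_pair ?T) y \<in> rotK R t" using ar[of "act (inv_pair ?T) y"] act_inv_pair(2)[OF T, of y] by simp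
      then show "y \<in> act ?T ` rotK R t" using act_inv_pair(2)[OF T, of y] by (intro image_eqI[of _ _ "act (inv_pair ?T) y"]) simp_all
    qed
  qed
  then show ?thesis using that T tgt by simp
qed

lemma congruent_open_subset:
  assumes T: "T \<in> orth_pairs" and X: "openin (top_of_set K) X" and K: "act T ` K = K0"
  shows "\<exists>Y. openin (top_of_set K0) Y \<and> congruent_S2xS2 X Y"
proof (intro exI[of _ "act T ` X"] conjI)
  show "openin (top_of_set K0) (act T ` X)"
    using openin_linear_image[OF act_linear act_inv_pair[OF T] X] by (simp add: K)
  show "congruent_S2xS2 X (act T ` X)" unfolding congruent_S2xS2_def using isometry_act[OF T] by blast
qed

lemma congruent_open_subset_swap:
  assumes T: "T \<in> orth_pairs" and X: "openin (top_of_set K) X" and K: "act T ` prod.swap ` K = K0"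
  shows "\<exists>Y. openin (top_of_set K0) Y \<and> congruent_S2xS2 X Y"
proof (intro exI[of _ "(\<lambda>x. act T (prod.swap x)) ` X"] conjI)
  have lin: "linear (\<lambda>x. prod.swap (act (inv_pair T) x))" using linear_compose[OF act_linear linear_swap] by (simp add: o_def)
  have "openin (top_of_set ((\<lambda>x. act T (prod.swap x)) ` K)) ((\<lambda>x. act T (prod.swap x)) ` X)"
    by (rule openin_linear_image[OF lin _ _ X]) (simp_all add: act_inv_pair[OF T])
  then show "openin (top_of_set K0) ((\<lambda>x. act T (prod.swap x)) ` X)" using K by (simp add: image_image)
  show "congruent_S2xS2 X ((\<lambda>x. act T (prod.swap x)) ` X)"
    unfolding congruent_S2xS2_def using isometry_act_swap[OF T] by blast
qed

lemma model_congruent: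
  assumes "model_class \<K>" "K \<in> \<K>" and X: "openin (top_of_set K) X"
  shows "(\<exists>r Y. 0 < r \<and> r \<le> 1 \<and> openin (top_of_set (S1 r \<times> S2)) Y \<and> congruent_S2xS2 X Y) \<or>
         (\<exists>t Y. -1 < t \<and> t < 1 \<and> openin (top_of_set (M_hyp t)) Y \<and> congruent_S2xS2 X Y)"
  using assms(1)
proof (cases rule: model_class_cases)
  case (1 t)
  then obtain R where R: "K = rotK R t" "orthogonal_matrix R" using assms(2) by (auto simp: rot_class_def)
  obtain T where T: "T \<in> orth_pairs" "act T ` K = M_hyp t" using congruent_rotK[OF R(2), of t] R(1) by blast
  have "-1 < t" "t < 1" using 1(1) by auto
  then show ?thesis using congruent_open_subset[OF T(1) X T(2)] by blast
next
  case (2 t)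
  define r where "r = sqrt (1 - t\<^sup>2)"
  have "t\<^sup>2 < 1" using 2(1) by (simp add: abs_square_less_1)
  then have r: "0 < r" "r \<le> 1" by (simp_all add: r_def)
  have "\<exists>Y. openin (top_of_set (S1 r \<times> S2)) Y \<and> congruent_S2xS2 X Y"
  proof -
    from 2(2) assms(2) consider (a) a where "K = circ1 a t" "norm a = 1" | (b) a where "K = circ2 a t" "norm a = 1"
      by (auto simp: circ_class_def)
    then show ?thesis
    proof cases
      case a
      obtain T where T: "T \<in> orth_pairs" "act T ` K = S1 r \<times> S2" using congruent_circ1[OF a(2) 2(1)] a(1) unfolding r_def by blast
      show ?thesis by (rule congruent_open_subset[OF T(1) X T(2)])
    next
      case b
      have sw: "prod.swap ` K = circ1 a t"
      proof -
        have m: "y \<in> circ1 a t \<longleftrightarrow> prod.swap y \<in> circ2 a t" for y by (auto simp: circ1_def circ2_def S2xS2_iff)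
        show ?thesis unfolding b(1) using m by (force simp: image_iff)
      qed
      obtain T where T: "T \<in> orth_pairs" "act T ` circ1 a t = S1 r \<times> S2" using congruent_circ1[OF b(2) 2(1)] unfolding r_def by blast
      show ?thesis by (rule congruent_open_subset_swap[OF T(1) X]) (simp add: sw T(2))
    qed
  qed
  then show ?thesis using r by blast
qed

section \<open>Openness of the image in the model\<close>

lemma limit_of_zeros:
  fixes X :: "nat \<Rightarrow> 'a::real_normed_vector"
  assumes "X \<longlonglongrightarrow> L" "\<And>k. X k = 0" shows "L = 0"
proof -
  have "X = (\<lambda>k. 0)" using assms(2) by auto
  then show ?thesis using assms(1) by (simp add: LIMSEQ_const_iff)
qed

context patch begin

text \<open>A limit of rescaled secants of K is annihilated by the differentials of all equations
  defining K. These are the sphere equations and the level equation, whose tangential gradient is a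
  nonzero multiple of the normal of the patch. So the limit is tangent by
  \<open>in_rangeI\<close>.\<close>

lemma model_paratangent:
  assumes \<K>: "model_class \<K>" "K \<in> \<K>" and W: "open W" "W \<subseteq> S" "u \<in> W" "\<Psi> ` W \<subseteq> K"
    and y: "\<And>k. y k \<in> K" "\<And>k. y' k \<in> K" and l: "y \<longlonglongrightarrow> \<Psi> u" "y' \<longlonglongrightarrow> \<Psi> u"
    and D: "(\<lambda>k. s k *\<^sub>R (y k - y' k)) \<longlonglongrightarrow> d"
  obtains \<xi> where "d = Dv \<Psi> u \<xi>"
proof -
  have uS: "u \<in> S" using W by blast
  have KS: "K \<subseteq> S2xS2" using \<K> by (cases rule: model_class_cases) (auto simp: rot_class_def circ_class_def rotK_def circ1_def circ2_def)
  have Df: "(\<lambda>k. s k *\<^sub>R (fst (y k) - fst (y' k))) \<longlonglongrightarrow> fst d" and Ds: "(\<lambda>k. s k *\<^sub>R (snd (y k) - snd (y' k))) \<longlonglongrightarrow> snd d"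
    using tendsto_fst[OF D] tendsto_snd[OF D] by simp_all
  have lf: "(\<lambda>k. fst (y k)) \<longlonglongrightarrow> p u" "(\<lambda>k. fst (y' k)) \<longlonglongrightarrow> p u" "(\<lambda>k. snd (y k)) \<longlonglongrightarrow> q u" "(\<lambda>k. snd (y' k)) \<longlonglongrightarrow> q u"
    using tendsto_fst[OF l(1)] tendsto_fst[OF l(2)] tendsto_snd[OF l(1)] tendsto_snd[OF l(2)] by (simp_all add: p_def q_def)
  have u1: "fst (y k) \<bullet> fst (y k) = 1" "snd (y k) \<bullet> snd (y k) = 1" "fst (y' k) \<bullet> fst (y' k) = 1" "snd (y' k) \<bullet> snd (y' k) = 1" for k
    using subsetD[OF KS y(1)[of k]] subsetD[OF KS y(2)[of k]] by (simp_all add: S2xS2_iff S2_def norm_eq_1)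
  have sphere: "a \<bullet> w = 0" if "(\<lambda>k. s k *\<^sub>R (f k - f' k)) \<longlonglongrightarrow> w" "f \<longlonglongrightarrow> a" "f' \<longlonglongrightarrow> a" "\<And>k. f k \<bullet> f k = 1" "\<And>k. f' k \<bullet> f' k = 1"
    for f f' :: "nat \<Rightarrow> real^3" and a w
  proof -
    have "(\<lambda>k. (f k + f' k) \<bullet> (s k *\<^sub>R (f k - f' k))) \<longlonglongrightarrow> (a + a) \<bullet> w" by (intro tendsto_inner tendsto_add that)
    moreover have "(f k + f' k) \<bullet> (s k *\<^sub>R (f k - f' k)) = 0" for k
    proof -
      have "(f k + f' k) \<bullet> (f k - f' k) = 0"
        using that(4)[of k] that(5)[of k] by (simp add: inner_diff_right inner_add_left inner_commute[of "f' k" "f k"])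
      then show ?thesis by simp
    qed
    ultimately have "(a + a) \<bullet> w = 0" by (rule limit_of_zeros)
    then have "a \<bullet> w + a \<bullet> w = 0" by (simp only: inner_add_left)
    then show ?thesis by simp
  qed
  have t1: "p u \<bullet> fst d = 0" by (rule sphere[OF Df lf(1,2) u1(1,3)])
  have t2: "q u \<bullet> snd d = 0" by (rule sphere[OF Ds lf(3,4) u1(2,4)])
  have np: "norm (p u) = 1" "norm (q u) = 1" using unit[OF uS] by (simp_all add: norm_eq_1)
  have "n1 u \<bullet> fst d + n2 u \<bullet> snd d = 0"
    using \<K>(1)
  proof (cases rule: model_class_cases)
    case (1 t)
    then obtain R where R: "K = rotK R t" "orthogonal_matrix R" using \<K>(2) by (auto simp: rot_class_def)
    have lev: "fst x \<bullet> (R *v snd x) = t" if "x \<in> K" for x using that R by (simp add: rotK_def)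
    have "(\<lambda>k. (s k *\<^sub>R (fst (y k) - fst (y' k))) \<bullet> (R *v snd (y k)) + fst (y' k) \<bullet> (R *v (s k *\<^sub>R (snd (y k) - snd (y' k)))))
       \<longlonglongrightarrow> fst d \<bullet> (R *v q u) + p u \<bullet> (R *v snd d)"
      by (intro tendsto_add tendsto_inner Df lf bounded_linear.tendsto[OF matrix_vector_mul_bounded_linear] Ds)
    moreover have "(s k *\<^sub>R (fst (y k) - fst (y' k))) \<bullet> (R *v snd (y k)) + fst (y' k) \<bullet> (R *v (s k *\<^sub>R (snd (y k) - snd (y' k)))) = 0" for k
      using lev[OF y(1)[of k]] lev[OF y(2)[of k]]
      by (simp add: matrix_vector_mult_scaleR matrix_vector_mult_diff_distrib inner_diff_left inner_diff_right algebra_simps)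
    ultimately have e: "fst d \<bullet> (R *v q u) + p u \<bullet> (R *v snd d) = 0" by (rule limit_of_zeros)
    obtain m where m: "R *v q u - t *\<^sub>R p u = m *\<^sub>R n1 u" "transpose R *v p u - t *\<^sub>R q u = m *\<^sub>R n2 u"
      by (rule rotK_normal[OF W(1,2,3) W(4)[unfolded R(1)] R(2)])
    \<comment> \<open>If m vanished, R q would equal t p, whose length |t| is less than 1.\<close>
    have "m \<noteq> 0"
    proof
      assume "m = 0"
      then have "R *v q u = t *\<^sub>R p u" using m by simp
      then have "norm (R *v q u) = \<bar>t\<bar>" using np by simp
      then show False using orthogonal_norm[OF R(2), of "q u"] np 1(1) by simp
    qed
    have "m * (n1 u \<bullet> fst d + n2 u \<bullet> snd d) = (R *v q u - t *\<^sub>R p u) \<bullet> fst d + (transpose R *v p u - t *\<^sub>R q u) \<bullet> snd d"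
      unfolding m by (simp add: algebra_simps)
    also have "\<dots> = (R *v q u) \<bullet> fst d + (transpose R *v p u) \<bullet> snd d"
      using t1 t2 by (simp add: inner_diff_left)
    also have "\<dots> = 0" using e transpose_adjoint[of "p u" R "snd d"] by (simp add: inner_commute)
    finally show ?thesis using \<open>m \<noteq> 0\<close> by simp
  next
    case (2 t)
    have lim0: "w \<bullet> a = 0" if "(\<lambda>k. s k *\<^sub>R (f k - f' k)) \<longlonglongrightarrow> w" "\<And>k. f k \<bullet> a = t" "\<And>k. f' k \<bullet> a = t" for f f' :: "nat \<Rightarrow> real^3" and a w
    proof -
      have "(\<lambda>k. (s k *\<^sub>R (f k - f' k)) \<bullet> a) \<longlonglongrightarrow> w \<bullet> a" by (intro tendsto_inner tendsto_const that)
      moreover have "(s k *\<^sub>R (f k - f' k)) \<bullet> a = 0" for k using that(2,3)[of k] by (simp add: inner_diff_left)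
      ultimately show ?thesis by (rule limit_of_zeros)
    qed
    from 2(2) \<K>(2) consider (a) a where "K = circ1 a t" "norm a = 1" | (b) a where "K = circ2 a t" "norm a = 1"
      by (auto simp: circ_class_def)
    then show ?thesis
    proof cases
      case a
      have e: "fst d \<bullet> a = 0" by (rule lim0[OF Df]) (use y a(1) in \<open>auto simp: circ1_def\<close>)
      obtain m where m: "a - t *\<^sub>R p u = m *\<^sub>R n1 u" "0 = m *\<^sub>R n2 u" by (rule circ1_normal[OF W(1,2,3) W(4)[unfolded a(1)]])
      have n2: "n2 u = 0" by (rule circ1_point(1)[OF W(1,2,3) W(4)[unfolded a(1)] a(2) 2(1)])
      have "m \<noteq> 0"
      proof
        assume "m = 0"
        then have "a = t *\<^sub>R p u" using m by simp
        then show False using a(2) np 2(1) by simp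
      qed
      have "m * (n1 u \<bullet> fst d) = (a - t *\<^sub>R p u) \<bullet> fst d" unfolding m by simp
      also have "\<dots> = 0" using e t1 by (simp add: inner_diff_left inner_commute[of a "fst d"])
      finally show ?thesis using \<open>m \<noteq> 0\<close> n2 by simp
    next
      case b
      have e: "snd d \<bullet> a = 0" by (rule lim0[OF Ds]) (use y b(1) in \<open>auto simp: circ2_def\<close>)
      have sK: "(prod.swap \<circ> \<Psi>) ` W \<subseteq> circ1 a t" unfolding swap_circ using W(4) b(1) by simp
      interpret Q: patch "prod.swap \<circ> \<Psi>" z r S c by (rule swap_patch)
      obtain m where m: "a - t *\<^sub>R Q.p u = m *\<^sub>R Q.n1 u" by (rule Q.circ1_normal[OF W(1,2,3) sK])
      have Qp: "Q.p u = q u" "Q.n1 u = n2 u" using swap_normal(1)[OF uS] by (simp_all add: Q.p_def q_def)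
      have n1: "n1 u = 0" by (rule circ2_point(1)[OF W(1,2,3) W(4)[unfolded b(1)] b(2) 2(1)])
      have "m \<noteq> 0"
      proof
        assume "m = 0"
        then have "a = t *\<^sub>R q u" using m Qp by simp
        then show False using b(2) np 2(1) by simp
      qed
      have "m * (n2 u \<bullet> snd d) = (a - t *\<^sub>R q u) \<bullet> snd d" using m unfolding Qp by simp
      also have "\<dots> = 0" using e t2 by (simp add: inner_diff_left inner_commute[of a "snd d"])
      finally show ?thesis using \<open>m \<noteq> 0\<close> n1 by simp
    qed
  qed
  then obtain \<xi> where "dp u \<xi> = fst d" "dq u \<xi> = snd d" by (rule in_rangeI[OF uS t1 t2])
  then have "d = Dv \<Psi> u \<xi>" by (simp add: D_eq)
  then show ?thesis using that by blast
qed

text \<open>Projection to the tangent space at z is injective on K near \<Psi> z: a limit of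
  normalized secants in its kernel would be a tangent vector orthogonal to the tangent space, hence
  zero. The projected patch is open by invariance of domain, so every point of K near \<Psi> z has
  the same projection as a point of the patch and therefore coincides with it.\<close>

lemma image_open_in_model:
  assumes \<K>: "model_class \<K>" "K \<in> \<K>" and im: "\<Psi> ` ball z r \<subseteq> K"
  obtains W where "open W" "\<Psi> z \<in> W" "K \<inter> W \<subseteq> \<Psi> ` ball z r"
proof -
  have zb: "z \<in> ball z r" using r by simp
  then have zS: "z \<in> S" using ball_sub by blast
  \<comment> \<open>Inner products with the three basic tangent vectors at z; the kernel is the
    orthogonal complement of the tangent space.\<close>
  define \<pi> :: "R3xR3 \<Rightarrow> real^3" where "\<pi> w = (\<chi> i. w \<bullet> Dv \<Psi> z (axis i 1))" for w
  have lin: "linear \<pi>" unfolding \<pi>_def by (rule linearI) (simp_all add: vec_eq_iff inner_add_left)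
  have bl: "bounded_linear \<pi>" using lin linear_conv_bounded_linear by blast
  have ker: "w \<bullet> Dv \<Psi> z \<xi> = 0" if "\<pi> w = 0" for w \<xi>
  proof -
    have "w \<bullet> Dv \<Psi> z (axis i 1) = 0" for i using that by (simp add: \<pi>_def vec_eq_iff)
    then show ?thesis by (subst linear_axis_expand[OF lin_D[OF zS]]) (simp add: inner_add_right)
  qed
  have "\<exists>\<delta>>0. \<forall>y\<in>K \<inter> ball (\<Psi> z) \<delta>. \<forall>y'\<in>K \<inter> ball (\<Psi> z) \<delta>. \<pi> y = \<pi> y' \<longrightarrow> y = y'"
  proof (rule ccontr)
    assume neg: "\<not> ?thesis"
    have "\<forall>n. \<exists>yy. fst yy \<in> K \<inter> ball (\<Psi> z) (1 / Suc n) \<and> snd yy \<in> K \<inter> ball (\<Psi> z) (1 / Suc n) \<and> \<pi> (fst yy) = \<pi> (snd yy) \<and> fst yy \<noteq> snd yy"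
    proof
      fix n
      have "(1::real) / Suc n > 0" by simp
      then obtain y y' where "y \<in> K \<inter> ball (\<Psi> z) (1 / Suc n)" "y' \<in> K \<inter> ball (\<Psi> z) (1 / Suc n)" "\<pi> y = \<pi> y'" "y \<noteq> y'"
        using neg by blast
      then show "\<exists>yy. fst yy \<in> K \<inter> ball (\<Psi> z) (1 / Suc n) \<and> snd yy \<in> K \<inter> ball (\<Psi> z) (1 / Suc n) \<and> \<pi> (fst yy) = \<pi> (snd yy) \<and> fst yy \<noteq> snd yy"
        by (intro exI[of _ "(y, y')"]) simp
    qed
    then obtain yy where yy: "\<forall>n. fst (yy n) \<in> K \<inter> ball (\<Psi> z) (1 / Suc n) \<and> snd (yy n) \<in> K \<inter> ball (\<Psi> z) (1 / Suc n) \<and> \<pi> (fst (yy n)) = \<pi> (snd (yy n)) \<and> fst (yy n) \<noteq> snd (yy n)"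
      by (rule choice[THEN exE])
    define y y' where "y n = fst (yy n)" and "y' n = snd (yy n)" for n
    have Y: "y n \<in> K" "y' n \<in> K" "y n \<in> ball (\<Psi> z) (1 / Suc n)" "y' n \<in> ball (\<Psi> z) (1 / Suc n)" "\<pi> (y n) = \<pi> (y' n)" "y n \<noteq> y' n" for n
      using yy unfolding y_def y'_def by blast+
    have conv: "v \<longlonglongrightarrow> \<Psi> z" if "\<And>n. v n \<in> ball (\<Psi> z) (1 / Suc n)" for v
    proof -
      have "(\<lambda>n. dist (v n) (\<Psi> z)) \<longlonglongrightarrow> 0"
      proof (rule Lim_null_comparison[OF _ LIMSEQ_Suc[OF lim_const_over_n[of 1]]])
        show "\<forall>\<^sub>F n in sequentially. norm (dist (v n) (\<Psi> z)) \<le> 1 / real (Suc n)"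
          using that by (intro always_eventually) (auto simp: dist_commute less_imp_le)
      qed
      then show ?thesis using tendsto_dist_iff by blast
    qed
    define dd where "dd n = (1 / norm (y n - y' n)) *\<^sub>R (y n - y' n)" for n
    have "\<And>n. dd n \<in> sphere 0 1" using Y(6) by (simp add: dd_def)
    then obtain d s where d: "d \<in> sphere 0 1" "strict_mono s" "(dd \<circ> s) \<longlonglongrightarrow> d"
      using compact_sphere[of 0 1] unfolding compact_def by metis
    have lim: "(\<lambda>k. (1 / norm (y (s k) - y' (s k))) *\<^sub>R (y (s k) - y' (s k))) \<longlonglongrightarrow> d" using d(3) by (simp add: dd_def o_def)
    have ys: "(\<lambda>k. y (s k)) \<longlonglongrightarrow> \<Psi> z" "(\<lambda>k. y' (s k)) \<longlonglongrightarrow> \<Psi> z"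
      using LIMSEQ_subseq_LIMSEQ[OF conv[OF Y(3)] d(2)] LIMSEQ_subseq_LIMSEQ[OF conv[OF Y(4)] d(2)] by (simp_all add: o_def)
    obtain \<xi> where \<xi>: "d = Dv \<Psi> z \<xi>" by (rule model_paratangent[OF \<K> open_ball ball_sub zb im Y(1,2) ys lim])
    have "\<pi> (dd n) = 0" for n using Y(5) by (simp add: dd_def linear_scale[OF lin] linear_diff[OF lin])
    moreover have "(\<lambda>k. \<pi> ((dd \<circ> s) k)) \<longlonglongrightarrow> \<pi> d" by (rule bounded_linear.tendsto[OF bl d(3)])
    ultimately have "\<pi> d = 0" by (intro limit_of_zeros[where X = "\<lambda>k. \<pi> ((dd \<circ> s) k)" and L = "\<pi> d"]) simp_all
    then have "d \<bullet> d = 0" using ker[of d \<xi>] \<xi> by simp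
    then show False using d(1) by simp
  qed
  then obtain \<delta> where \<delta>: "\<delta> > 0" "\<And>y y'. y \<in> K \<inter> ball (\<Psi> z) \<delta> \<Longrightarrow> y' \<in> K \<inter> ball (\<Psi> z) \<delta> \<Longrightarrow> \<pi> y = \<pi> y' \<Longrightarrow> y = y'" by blast
  define V where "V = ball z r \<inter> \<Psi> -` ball (\<Psi> z) \<delta>"
  have cb: "continuous_on (ball z r) \<Psi>" by (rule continuous_on_subset[OF cont ball_subset_cball])
  have oV: "open V" unfolding V_def by (rule continuous_open_preimage[OF cb open_ball open_ball])
  have zV: "z \<in> V" using zb \<delta>(1) by (simp add: V_def)
  have VK: "\<Psi> w \<in> K \<inter> ball (\<Psi> z) \<delta>" if "w \<in> V" for w using that im by (auto simp: V_def)
  have inj: "inj_on (\<lambda>w. \<pi> (\<Psi> w)) V"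
  proof (rule inj_onI)
    fix v w assume vw: "v \<in> V" "w \<in> V" "\<pi> (\<Psi> v) = \<pi> (\<Psi> w)"
    have eq: "\<Psi> v = \<Psi> w" by (rule \<delta>(2)[OF VK[OF vw(1)] VK[OF vw(2)] vw(3)])
    have "v \<in> cball z r" "w \<in> cball z r" using vw ball_subset_cball by (auto simp: V_def)
    then have "c * norm (v - w) \<le> 0" using low[of v w] eq by simp
    then show "v = w" using c by (simp add: mult_le_0_iff)
  qed
  have contV: "continuous_on V (\<lambda>w. \<pi> (\<Psi> w))"
    by (rule bounded_linear.continuous_on[OF bl continuous_on_subset[OF cb]]) (simp add: V_def)
  have oI: "open ((\<lambda>w. \<pi> (\<Psi> w)) ` V)" by (rule invariance_of_domain[OF contV oV inj])
  have "open (\<pi> -` ((\<lambda>w. \<pi> (\<Psi> w)) ` V))"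
    by (rule open_vimage[OF oI linear_continuous_on[OF bl]])
  then have "open (ball (\<Psi> z) \<delta> \<inter> \<pi> -` ((\<lambda>w. \<pi> (\<Psi> w)) ` V))" by (intro open_Int open_ball)
  moreover have "\<Psi> z \<in> ball (\<Psi> z) \<delta> \<inter> \<pi> -` ((\<lambda>w. \<pi> (\<Psi> w)) ` V)" using zV \<delta>(1) by simp
  moreover have "K \<inter> (ball (\<Psi> z) \<delta> \<inter> \<pi> -` ((\<lambda>w. \<pi> (\<Psi> w)) ` V)) \<subseteq> \<Psi> ` ball z r"
  proof
    fix y assume y: "y \<in> K \<inter> (ball (\<Psi> z) \<delta> \<inter> \<pi> -` ((\<lambda>w. \<pi> (\<Psi> w)) ` V))"
    then obtain w where w: "w \<in> V" "\<pi> y = \<pi> (\<Psi> w)" by auto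
    have "y = \<Psi> w" by (rule \<delta>(2)[OF _ VK[OF w(1)] w(2)]) (use y in blast)
    then show "y \<in> \<Psi> ` ball z r" using w(1) by (auto simp: V_def)
  qed
  ultimately show ?thesis by (rule that)
qed

end

section \<open>From the manifold to countably many patches\<close>

lemma smooth_on_C1:
  assumes "smooth_on S f"
  shows "C1_on S f" and "C1_on S (\<lambda>u. Dv f u v)"
proof -
  have C2: "C_k_on (Suc (Suc 0)) S f" using assms unfolding smooth_on_def by blast
  have C1: "C_k_on (Suc 0) S f" using assms unfolding smooth_on_def by blast
  have *: "C1_on S g" if "C_k_on (Suc 0) S g" for g :: "'a \<Rightarrow> 'b"
    using that frechet_derivative_works by (auto simp: C1_on_def)
  show "C1_on S f" by (rule *[OF C1])
  show "C1_on S (\<lambda>u. Dv f u v)" by (rule *) (use C2 in simp)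
qed

text \<open>The coordinate map \<phi> remains hidden behind an existential quantifier. Its openness
  is what converts neighbourhoods in M into balls of parameters
  (\<open>local_param_neighbourhood\<close>).\<close>

definition local_param ::
  "'m topology \<Rightarrow> ('m \<Rightarrow> R3xR3) \<Rightarrow> (real^3 \<Rightarrow> R3xR3) \<Rightarrow> real^3 \<Rightarrow> real \<Rightarrow> 'm set \<Rightarrow> bool" where
  "local_param M \<Phi> \<Psi> z r V \<longleftrightarrow> (\<exists>S c. patch \<Psi> z r S c) \<and> openin M V \<and>
     (\<exists>\<phi>. \<phi> ` V = ball z r \<and> (\<forall>y\<in>V. \<Phi> y = \<Psi> (\<phi> y)) \<and> (\<forall>W. openin M W \<longrightarrow> open (\<phi> ` (V \<inter> W))))"

lemma local_param_patch:
  assumes "local_param M \<Phi> \<Psi> z r V"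
  obtains S c where "patch \<Psi> z r S c"
  using assms unfolding local_param_def by blast

lemma local_param_image: "local_param M \<Phi> \<Psi> z r V \<Longrightarrow> \<Phi> ` V = \<Psi> ` ball z r"
  unfolding local_param_def by (metis image_cong image_image)

lemma local_param_open: "local_param M \<Phi> \<Psi> z r V \<Longrightarrow> openin M V"
  unfolding local_param_def by blast

lemma local_param_neighbourhood:
  assumes L: "local_param M \<Phi> \<Psi> z r V"
  obtains \<phi> where "\<phi> ` V = ball z r" "\<And>y. y \<in> V \<Longrightarrow> \<Phi> y = \<Psi> (\<phi> y)"
    "\<And>y W. y \<in> V \<Longrightarrow> openin M W \<Longrightarrow> y \<in> W \<Longrightarrow> \<exists>e>0. ball (\<phi> y) e \<subseteq> ball z r \<and> \<Psi> ` ball (\<phi> y) e \<subseteq> \<Phi> ` W"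
proof -
  obtain \<phi> where \<phi>: "\<phi> ` V = ball z r" "\<And>y. y \<in> V \<Longrightarrow> \<Phi> y = \<Psi> (\<phi> y)" "\<And>W. openin M W \<Longrightarrow> open (\<phi> ` (V \<inter> W))"
    using L unfolding local_param_def by blast
  have loc: "\<exists>e>0. ball (\<phi> x) e \<subseteq> ball z r \<and> \<Psi> ` ball (\<phi> x) e \<subseteq> \<Phi> ` W" if x: "x \<in> V" "openin M W" "x \<in> W" for x W
  proof -
    have "\<phi> x \<in> \<phi> ` (V \<inter> W)" using x by blast
    then obtain e where e: "e > 0" "ball (\<phi> x) e \<subseteq> \<phi> ` (V \<inter> W)"
      using \<phi>(3)[OF x(2)] unfolding open_contains_ball by blast
    have "\<Psi> ` ball (\<phi> x) e \<subseteq> \<Phi> ` W"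
    proof
      fix w assume "w \<in> \<Psi> ` ball (\<phi> x) e"
      then obtain y where "y \<in> V" "y \<in> W" "w = \<Psi> (\<phi> y)" using e(2) by blast
      then show "w \<in> \<Phi> ` W" using \<phi>(2)[of y] by (intro image_eqI[of _ _ y]) simp_all
    qed
    moreover have "ball (\<phi> x) e \<subseteq> ball z r" using e(2) \<phi>(1) by blast
    ultimately show ?thesis using e(1) by blast
  qed
  show ?thesis by (rule that[OF \<phi>(1,2) loc])
qed

text \<open>A chart around x is restricted to the ball on which \<open>patch_exists\<close> gives a
  Lipschitz inverse; homeomorphy of the chart makes the restricted coordinate map open.\<close>

lemma local_param_exists:
  assumes H: "hypersurface M A \<Phi>" and x: "x \<in> topspace M"
  shows "\<exists>\<Psi> z r V. local_param M \<Phi> \<Psi> z r V \<and> x \<in> V"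
proof -
  have at: "smooth_atlas M A" and im: "\<Phi> ` topspace M \<subseteq> S2xS2" and sm: "smooth_immersion A \<Phi>"
    using H unfolding hypersurface_def smooth_manifold_def by simp_all
  have "x \<in> (\<Union>c\<in>A. fst c)" using at x unfolding smooth_atlas_def by simp
  then obtain ch where ch: "ch \<in> A" "x \<in> fst ch" by blast
  obtain U \<phi> where "ch = (U, \<phi>)" by (cases ch)
  then have U: "(U, \<phi>) \<in> A" "x \<in> U" using ch by simp_all
  have "is_chart M (U, \<phi>)" using at U(1) unfolding smooth_atlas_def by blast
  then have oU: "openin M U" and oS: "open (\<phi> ` U)" and h: "homeomorphic_map (subtopology M U) (top_of_set (\<phi> ` U)) \<phi>"
    by (simp_all add: is_chart_def)
  have UM: "U \<subseteq> topspace M" by (rule openin_subset[OF oU])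
  have tU: "topspace (subtopology M U) = U" using UM by auto
  have inj: "inj_on \<phi> U" using homeomorphic_imp_injective_map[OF h] tU by simp
  define \<Psi> where "\<Psi> = \<Phi> \<circ> inv_into U \<phi>"
  have sP: "smooth_on (\<phi> ` U) \<Psi>" and iP: "\<And>u. u \<in> \<phi> ` U \<Longrightarrow> inj (Dv \<Psi> u)"
    using bspec[OF sm[unfolded smooth_immersion_def] U(1)] unfolding \<Psi>_def by auto
  have \<Psi>: "\<Psi> (\<phi> y) = \<Phi> y" if "y \<in> U" for y using inv_into_f_f[OF inj that] by (simp add: \<Psi>_def)
  have imP: "\<Psi> ` \<phi> ` U \<subseteq> S2xS2" using im UM \<Psi> by (auto simp: image_subset_iff)
  have xS: "\<phi> x \<in> \<phi> ` U" using U(2) by blast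
  obtain r c where P: "patch \<Psi> (\<phi> x) r (\<phi> ` U) c"
    by (rule patch_exists[OF oS xS smooth_on_C1(1)[OF sP] smooth_on_C1(2)[OF sP] imP iP])
  interpret patch \<Psi> "\<phi> x" r "\<phi> ` U" c by fact
  define V where "V = {y \<in> U. \<phi> y \<in> ball (\<phi> x) r}"
  have "openin (top_of_set (\<phi> ` U)) (ball (\<phi> x) r)" by (rule open_subset[OF ball_sub open_ball])
  then have "openin (subtopology M U) {y \<in> topspace (subtopology M U). \<phi> y \<in> ball (\<phi> x) r}"
    by (rule openin_continuous_map_preimage[OF homeomorphic_imp_continuous_map[OF h]])
  then have "openin (subtopology M U) V" unfolding tU V_def .
  then have oV: "openin M V" by (rule openin_trans_full[OF _ oU])
  have "open (\<phi> ` (V \<inter> W))" if "openin M W" for W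
  proof -
    have "openin M (V \<inter> W)" by (rule openin_Int[OF oV that])
    then have "openin (subtopology M U) (V \<inter> W)" using openin_open_subtopology[OF oU] by (auto simp: V_def)
    then have "openin (top_of_set (\<phi> ` U)) (\<phi> ` (V \<inter> W))"
      using homeomorphic_imp_open_map[OF h] unfolding open_map_def by blast
    then show ?thesis using openin_open_eq[OF oS] by blast
  qed
  moreover have "\<phi> ` V = ball (\<phi> x) r" using ball_sub by (auto simp: V_def)
  moreover have "\<forall>y\<in>V. \<Phi> y = \<Psi> (\<phi> y)" using \<Psi> by (simp add: V_def)
  ultimately have "local_param M \<Phi> \<Psi> (\<phi> x) r V"
    unfolding local_param_def using P oV by blast
  moreover have "x \<in> V" using U(2) r by (simp add: V_def)
  ultimately show ?thesis by blast
qed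

text \<open>Second countability makes M a Lindelof space, and countability is indispensable for the
  Baire arguments.\<close>

lemma local_param_countable_cover:
  fixes M :: "'m topology"
  assumes H: "hypersurface M A \<Phi>"
  obtains C :: "'m set" and \<Psi> z r V where "countable C" "\<And>x. x \<in> C \<Longrightarrow> local_param M \<Phi> (\<Psi> x) (z x) (r x) (V x)" "(\<Union>x\<in>C. V x) = topspace M"
proof -
  have "\<forall>x\<in>topspace M. \<exists>\<Psi> z r V. local_param M \<Phi> \<Psi> z r V \<and> x \<in> V"
    using local_param_exists[OF H] by blast
  then obtain \<Psi> z r V where L: "\<forall>x\<in>topspace M. local_param M \<Phi> (\<Psi> x) (z x) (r x) (V x) \<and> x \<in> V x" by metis
  have oV: "openin M (V x)" if "x \<in> topspace M" for x using L that local_param_open by blast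
  have cov: "\<Union> (V ` topspace M) = topspace M" using L openin_subset[OF oV] by blast
  have Lin: "Lindelof_space M"
    using H second_countable_imp_Lindelof_space unfolding hypersurface_def smooth_manifold_def by blast
  have "\<exists>\<V>. countable \<V> \<and> \<V> \<subseteq> V ` topspace M \<and> \<Union>\<V> = topspace M"
    by (rule Lin[unfolded Lindelof_space_def, THEN spec, THEN mp]) (use oV cov in simp)
  then obtain \<V> where V: "countable \<V> \<and> \<V> \<subseteq> V ` topspace M" "\<Union>\<V> = topspace M" by (elim exE conjE) (rule that, simp_all)
  have "\<exists>C. countable C \<and> C \<subseteq> topspace M \<and> \<V> = V ` C" by (rule countable_subset_image[THEN iffD1, OF V(1)])
  then obtain C where C: "countable C" "C \<subseteq> topspace M" "\<V> = V ` C" by (elim exE conjE) (rule that)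
  show ?thesis by (rule that[OF C(1), of \<Psi> z r V]) (use L C V(2) in auto)
qed

lemma act_swap: "act (prod.swap T) (prod.swap x) = prod.swap (act T x)"
  by (simp add: act_def)

text \<open>Local homogeneity of M becomes the hypothesis \<open>hom\<close> of
  \<open>homogeneous_family\<close>: by \<open>isometry_form\<close> the given isometry is a pair of
  orthogonal matrices up to a swap, and swaps stay inside the union N of the image with its swapped
  copy.\<close>

lemma local_params_in_models:
  fixes M :: "'m topology"
  assumes H: "hypersurface M A \<Phi>" and hom: "locally_homogeneous M \<Phi>"
  obtains \<K> where "model_class \<K>" "\<And>x. x \<in> topspace M \<Longrightarrow> \<exists>V. \<exists>K\<in>\<K>. openin M V \<and> x \<in> V \<and> \<Phi> ` V \<subseteq> K"
proof -
  obtain C :: "'m set" and \<Psi> z r V where C: "countable C" and L: "\<And>x. x \<in> C \<Longrightarrow> local_param M \<Phi> (\<Psi> x) (z x) (r x) (V x)"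
    and cover: "(\<Union>x\<in>C. V x) = topspace M"
    by (rule local_param_countable_cover[OF H]) (assumption | rule that, assumption+)+
  define \<P> where "\<P> = (\<lambda>(\<sigma>, x). (\<sigma> \<circ> \<Psi> x, z x, r x)) ` ({id, prod.swap} \<times> C)"
  have PE: "\<exists>\<sigma> x. x \<in> C \<and> (\<sigma> = id \<or> \<sigma> = prod.swap) \<and> \<Psi>' = \<sigma> \<circ> \<Psi> x \<and> z' = z x \<and> r' = r x" if "(\<Psi>', z', r') \<in> \<P>" for \<Psi>' z' r'
    using that unfolding \<P>_def by auto
  have PI: "(\<sigma> \<circ> \<Psi> x, z x, r x) \<in> \<P>" if "x \<in> C" "\<sigma> = id \<or> \<sigma> = prod.swap" for \<sigma> x
    unfolding \<P>_def by (rule image_eqI[of _ _ "(\<sigma>, x)"]) (use that in auto)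
  define N where "N = \<Phi> ` topspace M \<union> prod.swap ` \<Phi> ` topspace M"
  have N: "N \<subseteq> (\<Union>(\<Psi>, z, r)\<in>\<P>. \<Psi> ` ball z r)"
  proof -
    have *: "\<sigma> (\<Phi> y) \<in> (\<Union>(\<Psi>, z, r)\<in>\<P>. \<Psi> ` ball z r)" if y: "y \<in> topspace M" and s: "\<sigma> = id \<or> \<sigma> = prod.swap" for \<sigma> y
    proof -
      obtain x where x: "x \<in> C" "y \<in> V x" using y cover by blast
      then have "\<Phi> y \<in> \<Psi> x ` ball (z x) (r x)" using local_param_image[OF L[OF x(1)]] by blast
      then have "\<sigma> (\<Phi> y) \<in> (\<sigma> \<circ> \<Psi> x) ` ball (z x) (r x)" by auto
      then show ?thesis using PI[OF x(1) s] by (intro UN_I[of "(\<sigma> \<circ> \<Psi> x, z x, r x)"]) simp_all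
    qed
    show ?thesis using *[of _ id] *[of _ prod.swap] unfolding N_def by fastforce
  qed
  have Nsw: "prod.swap w \<in> N" if "w \<in> N" for w using that unfolding N_def by force
  have imS: "\<Phi> ` topspace M \<subseteq> S2xS2" using H by (simp add: hypersurface_def)
  have F: "homogeneous_family \<P>"
  proof
    show "countable \<P>" unfolding \<P>_def using C by (intro countable_image countable_SIGMA) auto
    show "\<exists>S c. patch \<Psi>' z' r' S c" if m: "(\<Psi>', z', r') \<in> \<P>" for \<Psi>' z' r'
    proof -
      obtain \<sigma> x where x: "x \<in> C" "\<sigma> = id \<or> \<sigma> = prod.swap" "\<Psi>' = \<sigma> \<circ> \<Psi> x" "z' = z x" "r' = r x"
        using PE[OF m] by (elim exE conjE) (rule that)
      obtain S c where P: "patch (\<Psi> x) (z x) (r x) S c" by (rule local_param_patch[OF L[OF x(1)]])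
      then show ?thesis using patch.swap_patch[OF P] x(2) unfolding x(3,4,5) by (elim disjE) auto
    qed
    show "(prod.swap \<circ> \<Psi>', z', r') \<in> \<P>" if m: "(\<Psi>', z', r') \<in> \<P>" for \<Psi>' z' r'
    proof -
      obtain \<sigma> x where x: "x \<in> C" "\<sigma> = id \<or> \<sigma> = prod.swap" "\<Psi>' = \<sigma> \<circ> \<Psi> x" "z' = z x" "r' = r x"
        using PE[OF m] by (elim exE conjE) (rule that)
      have "prod.swap \<circ> \<sigma> = id \<or> prod.swap \<circ> \<sigma> = prod.swap" using x(2) by (auto simp: fun_eq_iff)
      from PI[OF x(1) this] show ?thesis unfolding x(3,4,5) by (simp only: o_assoc)
    qed
    fix \<Psi>1 z1 r1 u \<Psi>2 z2 r2 v
    assume P1: "(\<Psi>1, z1, r1) \<in> \<P>" "u \<in> ball z1 r1" and P2: "(\<Psi>2, z2, r2) \<in> \<P>" "v \<in> ball z2 r2"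
    obtain \<sigma> x where x: "x \<in> C" "\<sigma> = id \<or> \<sigma> = prod.swap" "\<Psi>1 = \<sigma> \<circ> \<Psi> x" "z1 = z x" "r1 = r x"
      using PE[OF P1(1)] by (elim exE conjE) (rule that)
    obtain \<sigma>' x' where x': "x' \<in> C" "\<sigma>' = id \<or> \<sigma>' = prod.swap" "\<Psi>2 = \<sigma>' \<circ> \<Psi> x'" "z2 = z x'" "r2 = r x'"
      using PE[OF P2(1)] by (elim exE conjE) (rule that)
    have u: "u \<in> ball (z x) (r x)" and v: "v \<in> ball (z x') (r x')" using P1 P2 x x' by simp_all
    obtain \<phi> where \<phi>: "\<phi> ` V x = ball (z x) (r x)" "\<And>y. y \<in> V x \<Longrightarrow> \<Phi> y = \<Psi> x (\<phi> y)"
      "\<And>y W. y \<in> V x \<Longrightarrow> openin M W \<Longrightarrow> y \<in> W \<Longrightarrow> \<exists>e>0. ball (\<phi> y) e \<subseteq> ball (z x) (r x) \<and> \<Psi> x ` ball (\<phi> y) e \<subseteq> \<Phi> ` W"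
      by (rule local_param_neighbourhood[OF L[OF x(1)]]) (assumption | rule that, assumption+)+
    obtain y where y: "y \<in> V x" "u = \<phi> y" using u \<phi>(1) by blast
    obtain y' where y': "y' \<in> V x'" "\<Phi> y' = \<Psi> x' v" using v local_param_image[OF L[OF x'(1)]] by (metis imageE imageI)
    have yM: "y \<in> topspace M" "y' \<in> topspace M" using y(1) y'(1) cover x(1) x'(1) by blast+
    obtain V1 W1 F where F: "openin M V1" "y \<in> V1" "openin M W1" "isometry_S2xS2 F" "F ` \<Phi> ` V1 = \<Phi> ` W1" "F (\<Phi> y) = \<Phi> y'"
      using hom yM unfolding locally_homogeneous_def by meson
    obtain T where T: "T \<in> orth_pairs" "(\<forall>x\<in>S2xS2. F x = act T x) \<or> (\<forall>x\<in>S2xS2. F x = prod.swap (act T x))"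
      by (rule isometry_form[OF F(4)])
    obtain e where e: "e > 0" "\<Psi> x ` ball u e \<subseteq> \<Phi> ` V1" using \<phi>(3)[OF y(1) F(1,2)] unfolding y(2) by blast
    have S1: "w \<in> S2xS2" if "w \<in> \<Phi> ` V1" for w using that imS openin_subset[OF F(1)] by blast
    have aF: "act T w = F w \<or> act T w = prod.swap (F w)" if "w \<in> \<Phi> ` V1" for w
      using T(2) S1[OF that] by auto
    have aN: "act T w \<in> N" if "w \<in> \<Phi> ` V1" for w
    proof -
      have "F w \<in> \<Phi> ` W1" using that F(5) by blast
      then have "F w \<in> N" using openin_subset[OF F(3)] unfolding N_def by blast
      then show ?thesis using aF[OF that] Nsw[of "F w"] by metis
    qed
    have "\<Phi> y = \<Psi> x u" using \<phi>(2)[OF y(1)] y(2) by simp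
    then have ay: "act T (\<Psi> x u) = \<Psi> x' v \<or> act T (\<Psi> x u) = prod.swap (\<Psi> x' v)"
      using aF[OF imageI[OF F(2)]] F(6) y'(2) by simp
    \<comment> \<open>If the starting patch is a swapped one, T is conjugated with the exchange of
      factors, which interchanges its two matrices (\<open>act_swap\<close>).\<close>
    define T' where "T' = (if \<sigma> = id then T else prod.swap T)"
    have T': "T' \<in> orth_pairs" using T(1) by (simp add: T'_def orth_pairs_def)
    have ns: "prod.swap \<noteq> (id :: R3xR3 \<Rightarrow> R3xR3)"
    proof
      assume "prod.swap = (id :: R3xR3 \<Rightarrow> R3xR3)"
      then have "prod.swap (0 :: real^3, axis 1 1 :: real^3) = (0, axis 1 1)" by simp
      then show False by (simp add: axis_eq_0_iff)
    qed
    have aT': "act T' (\<sigma> w) = \<sigma> (act T w)" for w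
      using x(2) by (elim disjE) (simp_all add: T'_def ns act_swap)
    have "act T' (\<Psi>1 u) = \<sigma> (act T (\<Psi> x u))" by (simp add: x(3) aT')
    then have "act T' (\<Psi>1 u) = \<Psi>2 v \<or> act T' (\<Psi>1 u) = prod.swap (\<Psi>2 v)"
      using ay x(2) x'(2) by (elim disjE) (simp_all add: x'(3))
    moreover have "act T' ` \<Psi>1 ` ball u e \<subseteq> (\<Union>(\<Psi>, z, r)\<in>\<P>. \<Psi> ` ball z r)"
    proof (rule subset_trans[OF _ N], rule subsetI)
      fix w assume "w \<in> act T' ` \<Psi>1 ` ball u e"
      then obtain s where s: "s \<in> ball u e" "w = \<sigma> (act T (\<Psi> x s))" unfolding x(3) by (auto simp: aT')
      have "act T (\<Psi> x s) \<in> N" using aN e(2) s(1) by blast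
      with x(2) show "w \<in> N" by (elim disjE) (simp_all add: s(2) Nsw)
    qed
    ultimately show "\<exists>T\<in>orth_pairs. \<exists>e>0. (act T (\<Psi>1 u) = \<Psi>2 v \<or> act T (\<Psi>1 u) = prod.swap (\<Psi>2 v)) \<and>
        act T ` \<Psi>1 ` ball u e \<subseteq> (\<Union>(\<Psi>, z, r)\<in>\<P>. \<Psi> ` ball z r)"
      using T' e(1) by (intro bexI[of _ T'] exI[of _ e] conjI)
  qed
  obtain \<K> where \<K>: "model_class \<K>" "\<And>\<Psi> z r. (\<Psi>, z, r) \<in> \<P> \<Longrightarrow> \<exists>K\<in>\<K>. \<Psi> ` ball z r \<subseteq> K"
    using homogeneous_family.patches_in_model[OF F] by blast
  show ?thesis
  proof (rule that[OF \<K>(1)])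
    fix y assume "y \<in> topspace M"
    then obtain x where x: "x \<in> C" "y \<in> V x" using cover by blast
    obtain K where K: "K \<in> \<K>" "(id \<circ> \<Psi> x) ` ball (z x) (r x) \<subseteq> K"
      using \<K>(2)[OF PI[OF x(1), of id]] by blast
    then have "\<Phi> ` V x \<subseteq> K" using local_param_image[OF L[OF x(1)]] by simp
    then show "\<exists>V. \<exists>K\<in>\<K>. openin M V \<and> y \<in> V \<and> \<Phi> ` V \<subseteq> K"
      using K(1) x(2) local_param_open[OF L[OF x(1)]] by blast
  qed
qed

section \<open>One model for the whole hypersurface\<close>

text \<open>The union of the open sets mapped into K0 and the union of those mapped into other
  models of the family cover M. They are disjoint, since at a common point a ball of parameters
  would lie in two models, against \<open>model_unique\<close>. Connectedness leaves only
  K0.\<close>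

lemma image_in_model:
  assumes H: "hypersurface M A \<Phi>" and con: "connected_space M" and hom: "locally_homogeneous M \<Phi>" and ne: "topspace M \<noteq> {}"
  obtains \<K> K where "model_class \<K>" "K \<in> \<K>" "\<Phi> ` topspace M \<subseteq> K"
proof -
  obtain \<K> where \<K>: "model_class \<K>" and loc: "\<And>x. x \<in> topspace M \<Longrightarrow> \<exists>V. \<exists>K\<in>\<K>. openin M V \<and> x \<in> V \<and> \<Phi> ` V \<subseteq> K"
    by (rule local_params_in_models[OF H hom]) (assumption | rule that, assumption+)+
  obtain x0 V0 K0 where K0: "K0 \<in> \<K>" "openin M V0" "x0 \<in> V0" "\<Phi> ` V0 \<subseteq> K0" using ne loc by blast
  define E1 where "E1 = \<Union>{V. openin M V \<and> \<Phi> ` V \<subseteq> K0}"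
  define E2 where "E2 = \<Union>{V. openin M V \<and> (\<exists>K\<in>\<K>. K \<noteq> K0 \<and> \<Phi> ` V \<subseteq> K)}"
  have o: "openin M E1" "openin M E2" unfolding E1_def E2_def by auto
  have cov: "topspace M \<subseteq> E1 \<union> E2"
  proof
    fix x assume x: "x \<in> topspace M"
    obtain V K where V: "K \<in> \<K>" "openin M V" "x \<in> V" "\<Phi> ` V \<subseteq> K" using loc[OF x] by (elim exE bexE conjE) (rule that)
    show "x \<in> E1 \<union> E2"
    proof (cases "K = K0")
      case True
      then have "x \<in> E1" unfolding E1_def using V by (intro UnionI[OF _ V(3)]) simp
      then show ?thesis ..
    next
      case False
      then have "x \<in> E2" unfolding E2_def using V by (intro UnionI[OF _ V(3)]) blast
      then show ?thesis ..
    qed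
  qed
  have disj: "E1 \<inter> E2 = {}"
  proof (rule ccontr)
    assume "E1 \<inter> E2 \<noteq> {}"
    then obtain x where "x \<in> E1" "x \<in> E2" by blast
    obtain V where V1: "openin M V" "\<Phi> ` V \<subseteq> K0" "x \<in> V" using \<open>x \<in> E1\<close> unfolding E1_def by (elim UnionE CollectE conjE) (rule that)
    obtain V' K where V2: "openin M V'" "K \<in> \<K>" "K \<noteq> K0" "\<Phi> ` V' \<subseteq> K" "x \<in> V'"
      using \<open>x \<in> E2\<close> unfolding E2_def by (elim UnionE CollectE conjE bexE) (rule that)
    have V: "openin M V" "\<Phi> ` V \<subseteq> K0" "openin M V'" "x \<in> V" "x \<in> V'" "K \<in> \<K>" "K \<noteq> K0" "\<Phi> ` V' \<subseteq> K"
      using V1 V2 by simp_all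
    have oi: "openin M (V \<inter> V')" "x \<in> V \<inter> V'" using V by auto
    have xM: "x \<in> topspace M" using V(1,4) openin_subset by blast
    obtain \<Psi> z r U where L: "local_param M \<Phi> \<Psi> z r U" "x \<in> U" using local_param_exists[OF H xM] by (elim exE conjE) (rule that)
    obtain S c where P: "patch \<Psi> z r S c" by (rule local_param_patch[OF L(1)])
    obtain u e where e: "e > 0" "ball u e \<subseteq> ball z r" "\<Psi> ` ball u e \<subseteq> \<Phi> ` (V \<inter> V')"
    proof -
      obtain \<phi> where "\<phi> ` U = ball z r" "\<And>y. y \<in> U \<Longrightarrow> \<Phi> y = \<Psi> (\<phi> y)" and nb: "\<And>y W. y \<in> U \<Longrightarrow> openin M W \<Longrightarrow> y \<in> W \<Longrightarrow> \<exists>e>0. ball (\<phi> y) e \<subseteq> ball z r \<and> \<Psi> ` ball (\<phi> y) e \<subseteq> \<Phi> ` W"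
        by (rule local_param_neighbourhood[OF L(1)]) (assumption | rule that, assumption+)+
      from nb[OF L(2) oi] show thesis by (elim exE conjE) (rule that)
    qed
    have "ball u e \<subseteq> S" using e(2) patch.ball_sub[OF P] by blast
    moreover have "\<Psi> ` ball u e \<subseteq> K0" "\<Psi> ` ball u e \<subseteq> K" using e(3) V(2,8) by blast+
    ultimately have "K = K0" using patch.model_unique[OF P \<K> e(1)] K0(1) V(6) by metis
    then show False using V(7) by blast
  qed
  have "x0 \<in> E1" unfolding E1_def using K0 by (intro UnionI[OF _ K0(3)]) simp
  then have "E1 \<noteq> {}" by auto
  then have "E2 = {}" using con o cov disj unfolding connected_space_def by metis
  then have "topspace M \<subseteq> E1" using cov by simp
  moreover have "\<Phi> ` E1 \<subseteq> K0" unfolding E1_def by auto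
  ultimately have "\<Phi> ` topspace M \<subseteq> K0" by blast
  then show ?thesis by (rule that[OF \<K> K0(1)])
qed

text \<open>Every point of the image is the centre of a smaller patch with image in K, and
  \<open>image_open_in_model\<close> gives a neighbourhood in K filled by that patch.\<close>

lemma image_openin_model:
  assumes H: "hypersurface M A \<Phi>" and \<K>: "model_class \<K>" "K \<in> \<K>" and im: "\<Phi> ` topspace M \<subseteq> K"
  shows "openin (top_of_set K) (\<Phi> ` topspace M)"
proof (subst openin_subopen, rule ballI)
  fix y assume "y \<in> \<Phi> ` topspace M"
  then obtain x where x: "x \<in> topspace M" "y = \<Phi> x" by blast
  obtain \<Psi> z r V where L: "local_param M \<Phi> \<Psi> z r V" "x \<in> V" using local_param_exists[OF H x(1)] by (elim exE conjE) (rule that)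
  obtain S c where P: "patch \<Psi> z r S c" by (rule local_param_patch[OF L(1)])
  have "\<Phi> x \<in> \<Psi> ` ball z r" using imageI[OF L(2), of \<Phi>] unfolding local_param_image[OF L(1)] .
  then obtain u where u: "u \<in> ball z r" "\<Phi> x = \<Psi> u" by (elim imageE) (rule that)
  obtain r' where r': "r' > 0" "r' < 1" "cball u r' \<subseteq> ball z r" "patch \<Psi> u r' S c" by (rule patch_small[OF P u(1) zero_less_one])
  have sub: "\<Psi> ` ball u r' \<subseteq> \<Phi> ` topspace M"
    using r'(3) ball_subset_cball[of u r'] local_param_image[OF L(1)] openin_subset[OF local_param_open[OF L(1)]] by blast
  obtain W where W: "open W" "\<Psi> u \<in> W" "K \<inter> W \<subseteq> \<Psi> ` ball u r'"
    by (rule patch.image_open_in_model[OF r'(4) \<K> subset_trans[OF sub im]])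
  show "\<exists>T. openin (top_of_set K) T \<and> y \<in> T \<and> T \<subseteq> \<Phi> ` topspace M"
    using W sub im x u(2) by (intro exI[of _ "K \<inter> W"]) (auto simp: openin_open_Int)
qed

theorem corollary2:
  fixes M :: "'m topology"
    and A :: "('m, 3) chart set"
    and \<Phi> :: "'m \<Rightarrow> R3xR3"
  assumes "hypersurface M A \<Phi>"
    and "connected_space M"
    and "orientable M A"
    and "locally_homogeneous M \<Phi>"
  shows "(\<exists>r Y. 0 < r \<and> r \<le> 1 \<and> openin (top_of_set (S1 r \<times> S2)) Y \<and>
            congruent_S2xS2 (\<Phi> ` topspace M) Y) \<or>
         (\<exists>t Y. -1 < t \<and> t < 1 \<and> openin (top_of_set (M_hyp t)) Y \<and>
            congruent_S2xS2 (\<Phi> ` topspace M) Y)"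
proof (cases "topspace M = {}")
  case True
  \<comment> \<open>For empty M the image is the empty open subset of an arbitrary model.\<close>
  have "norm (axis 1 1 :: real^3) = 1" by simp
  then have 1: "circ1 (axis 1 1) 0 \<in> circ_class 0" unfolding circ_class_def by blast
  have 2: "model_class (circ_class 0)" unfolding model_class_def by (intro exI[of _ 0]) simp
  show ?thesis by (rule model_congruent[OF 2 1]) (simp add: True)
next
  case False
  obtain \<K> K where K: "model_class \<K>" "K \<in> \<K>" "\<Phi> ` topspace M \<subseteq> K"
    by (rule image_in_model[OF assms(1,2,4) False])
  show ?thesis by (rule model_congruent[OF K(1,2) image_openin_model[OF assms(1) K]])
qed

end
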